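(* Let $(X_n)_{n=0}^\infty$ be a sequence of pairwise disjoint compact sets in $\mathbb{C}$ with $\inf\{|z| : z\in X_n\}\to\infty$ as $n\to\infty$, and let $(C_n)_{n=0}^{\infty}$ be a sequence of finite sets $C_n\subseteq X_n$. Let $\varphi$ be a holomorphic function defined on a neighbourhood of $X:=\bigcup_{n=0}^\infty X_n$ such that $\varphi(X_{n-1})\subseteq X_n$ and $\varphi(\partial X_{n-1})\subseteq \partial X_n$ for all $n\geq 1$. Let $(\varepsilon_n)_{n=0}^\infty$ be a sequence of positive numbers. Suppose additionally that $\varphi$ is univalent on a neighbourhood of $X$ and that $\varphi(X_n)=X_{n+1}$ for all $n\geq 0$. Then the following hold. (I) (Escaping case.) There exist a transcendental meromorphic function $f$ and a $\mathcal{C}^{\infty}$ diffeomorphism $\theta\colon\mathbb{C}\to\mathbb{C}$ with $\theta=\operatorname{id}$ on $X_0$ such that (a) $f\circ\theta=\theta\circ\varphi$ on $X$; (b) $|\theta(z)-z|\leq\varepsilon_n$ on $X_n$ for all $n\geq 0$; (c) $\partial\theta(X)\subseteq J(f)$; (d) $\theta$ satisfies the Cauchy--Riemann equations on $X$; in particular, it is conformal on $\operatorname{int}(X)$; (e) $\theta(c)=c$ for $c\in\bigcup_{n=0}^\infty C_n$. In particular, $\theta(X)\subseteq I(f)$ and each $\theta(X_n)$ is a wandering compact set of $f$. (II) (Oscillating case.) There exist a transcendental meromorphic function $f$, a $\mathcal{C}^{\infty}$ diffeomorphism $\theta\colon\mathbb{C}\to\mathbb{C}$ with $\theta=\operatorname{id}$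 on $X_0$, and a sequence $(k_n)_{n=0}^\infty$ of positive integers such that $f^{k_n}\circ\theta=\theta\circ\varphi$ on $X_n$ for all $n\geq 0$, such that (b), (c), (d) and (e) of part (I) hold for these $f$ and $\theta$, and such that the set $f(\theta(X))$ is bounded. In particular, $\theta(X)\subseteq BU(f)$ and each $\theta(X_n)$ is a wandering compact set of $f$. (III) (Entire case.) If $\mathbb{C}\setminus X$ is connected, then in each of (I) and (II) the function $f$ can be chosen to be a transcendental entire function (still with $\theta=\operatorname{id}$ on $X_0$).
   Context: Boundaries and closures are taken in $\mathbb{C}$. Univalent means holomorphic and injective. A transcendental meromorphic (resp. entire) function is a meromorphic function $f\colon\mathbb{C}\to\widehat{\mathbb{C}}$ (resp. a holomorphic function $f\colon\mathbb{C}\to\mathbb{C}$) for which $\infty$ is an essential singularity. The Fatou set $F(f)$ is the set of points having a neighbourhood on which all iterates $f^n$ are defined and form a normal family; the Julia set is $J(f)=\mathbb{C}\setminus F(f)$. The escaping set is $I(f)=\{z\in\mathbb{C}: f^n(z)\to\infty\text{ as }n\to\infty\}$ and the bungee set is $BU(f)=\{z\in\mathbb{C}: \liminf_{n\to\infty}|f^n(z)|<\infty=\limsup_{n\to\infty}|f^n(z)|\}$. A compact set $K\subseteq\mathbb{C}$ is a wandering compact set of $f$ if $\partial K\subseteq J(f)$ and $f^n(K)\cap f^m(K)=\emptyset$ for all $n\neq m$. *)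

theory Defs
  imports "HOL-Complex_Analysis.Complex_Analysis"
begin

section \<open>Meromorphic functions and their iterates\<close>

text \<open>
  A meromorphic function \<open>\<complex> \<rightarrow> \<complex> \<union> {\<infinity>}\<close> is represented by \<open>f :: complex \<Rightarrow> complex\<close> with
  \<open>f nicely_meromorphic_on UNIV\<close>: the poles of \<open>f\<close> are the points with \<open>is_pole f z\<close> (where
  \<open>f z = 0\<close> is a dummy value), and \<open>f\<close> is analytic everywhere else.  The Riemann sphere is
  \<^typ>\<open>complex option\<close>, with \<^term>\<open>None\<close> for \<open>\<infinity>\<close>.
\<close>

definition to_sphere :: "(complex \<Rightarrow> complex) \<Rightarrow> complex \<Rightarrow> complex option" where
  "to_sphere f z = (if is_pole f z then None else Some (f z))"

text \<open>
  \<open>iterate f n z = Some w\<close> means that \<open>f\<^sup>n(z)\<close> is defined and equal to the finite value \<open>w\<close>;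
  \<^term>\<open>None\<close> stands both for the value \<open>\<infinity>\<close> and for undefinedness.  Since \<open>f\<close> is not defined
  at \<open>\<infinity>\<close>, all iterates are defined at \<open>z\<close> iff none of the \<open>iterate f n z\<close> is \<^term>\<open>None\<close>.
\<close>

primrec iterate :: "(complex \<Rightarrow> complex) \<Rightarrow> nat \<Rightarrow> complex \<Rightarrow> complex option" where
  "iterate f 0 z = Some z"
| "iterate f (Suc n) z = Option.bind (iterate f n z) (to_sphere f)"

definition iterates_defined :: "(complex \<Rightarrow> complex) \<Rightarrow> complex \<Rightarrow> bool" where
  "iterates_defined f z \<longleftrightarrow> (\<forall>n. iterate f n z \<noteq> None)"

text \<open>
  The essential singularity at \<open>\<infinity>\<close> is expressed in the coordinate \<open>1 / z\<close>.  It need not be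
  isolated: \<open>\<not> not_essential\<close> says that there is neither a finite limit nor a pole, and this
  is also the case if the poles of \<open>f\<close> accumulate at \<open>\<infinity>\<close>.
\<close>

definition essential_at_infinity :: "(complex \<Rightarrow> complex) \<Rightarrow> bool" where
  "essential_at_infinity f \<longleftrightarrow> \<not> not_essential (\<lambda>z. f (1 / z)) 0"

definition transcendental_meromorphic :: "(complex \<Rightarrow> complex) \<Rightarrow> bool" where
  "transcendental_meromorphic f \<longleftrightarrow> f nicely_meromorphic_on UNIV \<and> essential_at_infinity f"

definition transcendental_entire :: "(complex \<Rightarrow> complex) \<Rightarrow> bool" where
  "transcendental_entire f \<longleftrightarrow> f holomorphic_on UNIV \<and> essential_at_infinity f"


section \<open>Fatou, Julia, escaping and bungee sets\<close>

text \<open>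
  Stereographic projection onto the unit sphere of \<open>\<complex> \<times> \<real>\<close>.  The distance of the images of two
  points is their chordal distance, so that uniform convergence with respect to the spherical
  metric becomes \<^term>\<open>uniform_limit\<close>.
\<close>

fun stereographic :: "complex option \<Rightarrow> complex \<times> real" where
  "stereographic None = (0, 1)"
| "stereographic (Some z) =
     ((2 / ((norm z)\<^sup>2 + 1)) *\<^sub>R z, ((norm z)\<^sup>2 - 1) / ((norm z)\<^sup>2 + 1))"

definition normal_family :: "complex set \<Rightarrow> (complex \<Rightarrow> complex option) set \<Rightarrow> bool" where
  "normal_family U \<F> \<longleftrightarrow>
     (\<forall>s :: nat \<Rightarrow> complex \<Rightarrow> complex option. range s \<subseteq> \<F> \<longrightarrow>
        (\<exists>(r :: nat \<Rightarrow> nat) (g :: complex \<Rightarrow> complex option). strict_mono r \<and>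
           (\<forall>K. compact K \<and> K \<subseteq> U \<longrightarrow>
              uniform_limit K (\<lambda>n z. stereographic (s (r n) z)) (\<lambda>z. stereographic (g z))
                sequentially)))"

definition Fatou_set :: "(complex \<Rightarrow> complex) \<Rightarrow> complex set" where
  "Fatou_set f = {z. \<exists>U. open U \<and> z \<in> U \<and> (\<forall>w\<in>U. iterates_defined f w) \<and>
                         normal_family U (range (iterate f))}"

definition Julia_set :: "(complex \<Rightarrow> complex) \<Rightarrow> complex set" where
  "Julia_set f = - Fatou_set f"

definition escaping_set :: "(complex \<Rightarrow> complex) \<Rightarrow> complex set" where
  "escaping_set f =
     {z. iterates_defined f z \<and> filterlim (\<lambda>n. the (iterate f n z)) at_infinity sequentially}"

definition bungee_set :: "(complex \<Rightarrow> complex) \<Rightarrow> complex set" where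
  "bungee_set f =
     {z. iterates_defined f z \<and>
         liminf (\<lambda>n. ereal (norm (the (iterate f n z)))) < \<infinity> \<and>
         limsup (\<lambda>n. ereal (norm (the (iterate f n z)))) = \<infinity>}"

definition wandering_compact_set :: "(complex \<Rightarrow> complex) \<Rightarrow> complex set \<Rightarrow> bool" where
  "wandering_compact_set f K \<longleftrightarrow>
     compact K \<and> frontier K \<subseteq> Julia_set f \<and>
     (\<forall>z\<in>K. iterates_defined f z) \<and>
     (\<forall>m n. m \<noteq> n \<longrightarrow> iterate f n ` K \<inter> iterate f m ` K = {})"


section \<open>Smooth diffeomorphisms of the plane\<close>

text \<open>
  Smoothness is meant in the real sense: \<^term>\<open>(differentiable)\<close> is real (Frechet)
  differentiability, and \<open>C\<^sup>k\<^sup>+\<^sup>1\<close> means that all directional derivatives exist and are \<open>C\<^sup>k\<close>.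
\<close>

primrec C_k :: "nat \<Rightarrow> (complex \<Rightarrow> complex) \<Rightarrow> bool" where
  "C_k 0 f \<longleftrightarrow> continuous_on UNIV f"
| "C_k (Suc k) f \<longleftrightarrow>
     (\<forall>z. f differentiable (at z)) \<and> (\<forall>v. C_k k (\<lambda>z. frechet_derivative f (at z) v))"

definition C_infinity :: "(complex \<Rightarrow> complex) \<Rightarrow> bool" where
  "C_infinity f \<longleftrightarrow> (\<forall>k. C_k k f)"

definition smooth_diffeomorphism :: "(complex \<Rightarrow> complex) \<Rightarrow> bool" where
  "smooth_diffeomorphism \<theta> \<longleftrightarrow> bij \<theta> \<and> C_infinity \<theta> \<and> C_infinity (inv \<theta>)"

text \<open>With \<open>\<theta> = u + iv\<close>: \<open>u\<^sub>x = v\<^sub>y\<close> and \<open>u\<^sub>y = - v\<^sub>x\<close>.\<close>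

definition Cauchy_Riemann_at :: "(complex \<Rightarrow> complex) \<Rightarrow> complex \<Rightarrow> bool" where
  "Cauchy_Riemann_at \<theta> z \<longleftrightarrow>
     \<theta> differentiable (at z) \<and>
     Re (frechet_derivative \<theta> (at z) 1) = Im (frechet_derivative \<theta> (at z) \<i>) \<and>
     Re (frechet_derivative \<theta> (at z) \<i>) = - Im (frechet_derivative \<theta> (at z) 1)"

definition conformal_on :: "(complex \<Rightarrow> complex) \<Rightarrow> complex set \<Rightarrow> bool" where
  "conformal_on \<theta> S \<longleftrightarrow> \<theta> holomorphic_on S \<and> (\<forall>z\<in>S. deriv \<theta> z \<noteq> 0)"


section \<open>Realising orbits of compact sets\<close>

definition admissible_conjugacy ::
  "(nat \<Rightarrow> complex set) \<Rightarrow> (nat \<Rightarrow> complex set) \<Rightarrow> (nat \<Rightarrow> real) \<Rightarrow>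
   (complex \<Rightarrow> complex) \<Rightarrow> (complex \<Rightarrow> complex) \<Rightarrow> bool" where
  "admissible_conjugacy X C \<epsilon> f \<theta> \<longleftrightarrow>
     smooth_diffeomorphism \<theta> \<and>
     (\<forall>z\<in>X 0. \<theta> z = z) \<and>
     (\<forall>n. \<forall>z\<in>X n. norm (\<theta> z - z) \<le> \<epsilon> n) \<and>
     frontier (\<theta> ` (\<Union>n. X n)) \<subseteq> Julia_set f \<and>
     (\<forall>z\<in>(\<Union>n. X n). Cauchy_Riemann_at \<theta> z) \<and>
     conformal_on \<theta> (interior (\<Union>n. X n)) \<and>
     (\<forall>c\<in>(\<Union>n. C n). \<theta> c = c)"

definition escaping_realization ::
  "(nat \<Rightarrow> complex set) \<Rightarrow> (nat \<Rightarrow> complex set) \<Rightarrow> (complex \<Rightarrow> complex) \<Rightarrow> (nat \<Rightarrow> real) \<Rightarrow>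
   (complex \<Rightarrow> complex) \<Rightarrow> (complex \<Rightarrow> complex) \<Rightarrow> bool" where
  "escaping_realization X C \<phi> \<epsilon> f \<theta> \<longleftrightarrow>
     admissible_conjugacy X C \<epsilon> f \<theta> \<and>
     (\<forall>z\<in>(\<Union>n. X n). to_sphere f (\<theta> z) = Some (\<theta> (\<phi> z))) \<and>
     \<theta> ` (\<Union>n. X n) \<subseteq> escaping_set f \<and>
     (\<forall>n. wandering_compact_set f (\<theta> ` X n))"

definition oscillating_realization ::
  "(nat \<Rightarrow> complex set) \<Rightarrow> (nat \<Rightarrow> complex set) \<Rightarrow> (complex \<Rightarrow> complex) \<Rightarrow> (nat \<Rightarrow> real) \<Rightarrow>
   (complex \<Rightarrow> complex) \<Rightarrow> (complex \<Rightarrow> complex) \<Rightarrow> (nat \<Rightarrow> nat) \<Rightarrow> bool" where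
  "oscillating_realization X C \<phi> \<epsilon> f \<theta> k \<longleftrightarrow>
     admissible_conjugacy X C \<epsilon> f \<theta> \<and>
     (\<forall>n. k n > 0) \<and>
     (\<forall>n. \<forall>z\<in>X n. iterate f (k n) (\<theta> z) = Some (\<theta> (\<phi> z))) \<and>
     (\<exists>B. bounded B \<and> to_sphere f ` \<theta> ` (\<Union>n. X n) \<subseteq> Some ` B) \<and>
     \<theta> ` (\<Union>n. X n) \<subseteq> bungee_set f \<and>
     (\<forall>n. wandering_compact_set f (\<theta> ` X n))"

end

theory Submission
  imports Defs
begin

text \<open>
  By Runge's theorem one builds rational functions \<open>f\<^sub>0, f\<^sub>1, \<dots>\<close> (polynomials, if \<open>\<complex> - X\<close> is
  connected) such that \<open>f\<^sub>s\<^sub>+\<^sub>1\<close> is close to \<open>f\<^sub>s\<close> on a large compact set and agrees with it on a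
  growing finite set, while on a small neighbourhood of the current image of \<open>X\<^sub>0\<close> it is close to the
  map that carries this image to the next one.  In the limit \<open>f\<close>, the orbit of \<open>X\<^sub>0\<close> visits a
  small univalent perturbation of every \<open>X\<^sub>n\<close>; as the perturbations are holomorphic and tiny, they
  are restrictions of one diffeomorphism \<open>\<theta>\<close> near the identity.  At the same time, finite sets of points
  accumulating at \<open>\<partial>X\<^sub>0\<close> are sent into a disc that \<open>f\<close> maps into itself.  Every point of \<open>\<partial>X\<^sub>0\<close>
  is then a limit of points with bounded orbits, although its own orbit is unbounded, so it lies in
  the Julia set.

  In the oscillating case a visit to \<open>X\<^sub>n\<close> is followed by a passage through fixed discs around points
  \<open>b\<^sub>0, \<dots>, b\<^sub>n\<close>, on each of which \<open>f\<close> is nearly the translation by \<open>b\<^sub>j\<^sub>+\<^sub>1 - b\<^sub>j\<close>.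
\<close>

section \<open>Runge's theorem\<close>

text \<open>Errors do not accumulate along the orbit. Stage s does not imitate a single step of
  \<phi>: it approximates \<open>\<Psi> s\<close> composed with the inverse of the univalent map
  \<open>f ^^ t s\<close>, so the orbit is steered anew from its actual position towards a
  prescribed function of the starting point. Accordingly \<theta> is read off at the end: near
  \<open>X n\<close> it is \<open>f ^^ T n\<close> after the inverse of \<open>\<phi> ^^ n\<close>,
  and the conjugacy is exact by construction.

  Each stage uses up three neighbourhoods of \<open>X 0\<close>: on \<open>N (3 * s)\<close> the
  orbit so far is univalent, \<open>N (3 * s + 1)\<close> carries the new target, and
  \<open>N (3 * s + 2)\<close> leaves room for later perturbations.

  The obstacle is Runge's theorem. In the entire case the old and the new sets must together have
  connected complement, although the sets \<open>X n\<close> need not be connected; hence the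
  exhaustion consists of sets that swallow or miss each prescribed neighbourhood. In the meromorphic
  case, poles must be kept where the function is already fixed, but must disappear from the place
  that the orbit visits next.\<close>

inductive ratfun :: "complex set \<Rightarrow> (complex \<Rightarrow> complex) \<Rightarrow> bool" for A where
  monom: "ratfun A (\<lambda>z. c * z ^ k)"
| pole: "a \<in> A \<Longrightarrow> ratfun A (\<lambda>z. c / (z - a))"
| add: "ratfun A f \<Longrightarrow> ratfun A g \<Longrightarrow> ratfun A (\<lambda>z. f z + g z)"

lemma ratfun_const: "ratfun A (\<lambda>z. c)"
  using ratfun.monom[of A c 0] by simp

lemma ratfun_mono: "ratfun A f \<Longrightarrow> A \<subseteq> B \<Longrightarrow> ratfun B f"
  by (induction rule: ratfun.induct) (auto intro: ratfun.intros)

lemma ratfun_cmult: "ratfun A f \<Longrightarrow> ratfun A (\<lambda>z. c * f z)"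
proof (induction rule: ratfun.induct)
  case (monom d k) then show ?case using ratfun.monom[of A "c*d" k] by (simp add: mult.assoc)
next
  case (pole a d) then show ?case using ratfun.pole[of a A "c*d"] by simp
next
  case (add f g) then show ?case using ratfun.add by (fastforce simp: distrib_left)
qed

lemma ratfun_sum:
  assumes "\<And>i. i \<in> I \<Longrightarrow> ratfun A (f i)"
  shows "ratfun A (\<lambda>z. \<Sum>i\<in>I. f i z)"
proof (cases "finite I")
  case True
  then show ?thesis using assms
    by (induction I rule: finite_induct) (auto intro: ratfun.add ratfun_const)
qed (simp add: ratfun_const)

lemma ratfun_diff: "ratfun A f \<Longrightarrow> ratfun A g \<Longrightarrow> ratfun A (\<lambda>z. f z - g z)"
  using ratfun.add[of A f "\<lambda>z. (-1) * g z"] ratfun_cmult[of A g "-1"] by simp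

lemma ratfun_monom_mult: "ratfun {} f \<Longrightarrow> ratfun {} (\<lambda>z. c * z ^ k * f z)"
proof (induction rule: ratfun.induct)
  case (monom d j)
  then show ?case using ratfun.monom[of "{}" "c*d" "k+j"] by (simp add: power_add mult_ac)
next
  case (add f g) then show ?case using ratfun.add by (fastforce simp: distrib_left)
qed auto

text \<open>Restricted to polynomials: the square of \<open>c / (z - a)\<close> has a double pole
  and leaves the class.\<close>

lemma ratfun_mult: "ratfun {} f \<Longrightarrow> ratfun {} g \<Longrightarrow> ratfun {} (\<lambda>z. f z * g z)"
proof (induction rule: ratfun.induct)
  case (monom c k) then show ?case using ratfun_monom_mult by blast
next
  case (add f h) then show ?case using ratfun.add by (fastforce simp: distrib_right)
qed auto

lemma ratfun_prod:
  assumes "\<And>i. i \<in> I \<Longrightarrow> ratfun {} (f i)"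
  shows "ratfun {} (\<lambda>z. \<Prod>i\<in>I. f i z)"
proof (cases "finite I")
  case True
  then show ?thesis using assms
    by (induction I rule: finite_induct) (auto intro: ratfun_mult ratfun_const)
qed (simp add: ratfun_const)

lemma ratfun_linear: "ratfun A (\<lambda>z. z - a)"
  using ratfun_diff[OF ratfun.monom[of A 1 1] ratfun_const[of A a]] by simp

lemma ratfun_analytic: "ratfun A f \<Longrightarrow> S \<inter> A = {} \<Longrightarrow> f analytic_on S"
proof (induction rule: ratfun.induct)
  case (monom c k) show ?case by (intro analytic_intros)
next
  case (pole a c) then show ?case by (intro analytic_intros) auto
next
  case (add f g) then show ?case by (auto intro!: analytic_intros)
qed

lemma ratfun_meromorphic: "ratfun A f \<Longrightarrow> f meromorphic_on S"
  by (induction rule: ratfun.induct) (auto intro!: meromorphic_intros)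

text \<open>The class is generated additively, so the partial fractions can be sorted by the
  location of their poles. Only simple poles occur because Riemann sums of Cauchy integrals have no
  others.\<close>

lemma ratfun_split:
  "ratfun UNIV f \<Longrightarrow> \<exists>u v. ratfun (-W) u \<and> ratfun W v \<and> f = (\<lambda>z. u z + v z)"
proof (induction rule: ratfun.induct)
  case (monom c k)
  show ?case
    by (rule exI[of _ "\<lambda>z. c*z^k"], rule exI[of _ "\<lambda>z. 0"]) (auto intro: ratfun.monom ratfun_const)
next
  case (pole a c)
  show ?case
  proof (cases "a \<in> W")
    case True then show ?thesis
      by (intro exI[of _ "\<lambda>z. c/(z-a)"] exI[of _ "\<lambda>z. 0"]) (auto intro: ratfun.pole ratfun_const)
  next
    case False then show ?thesis
      by (intro exI[of _ "\<lambda>z. c/(z-a)"] exI[of _ "\<lambda>z. 0"]) (auto intro: ratfun.pole ratfun_const)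
  qed
next
  case (add f g)
  then obtain u v u' v' where "ratfun (-W) u" "ratfun W v" "f = (\<lambda>z. u z + v z)"
      "ratfun (-W) u'" "ratfun W v'" "g = (\<lambda>z. u' z + v' z)" by blast
  then show ?case
    by (intro exI[of _ "\<lambda>z. u z + u' z"] exI[of _ "\<lambda>z. v z + v' z"]) (auto intro: ratfun.add)
qed

text \<open>On a piece of the segment that is short compared with the modulus of uniform continuity,
  the integrand may be frozen at the initial point \<open>p\<close>. What remains is
  \<open>g p / (p - z)\<close> times \<open>q - p\<close>, a simple pole term with its pole on the
  segment.\<close>

lemma Cauchy_segment_approx:
  assumes "compact K" "closed_segment a b \<inter> K = {}" "continuous_on (closed_segment a b) g" "e > 0"
  shows "\<exists>f. ratfun (closed_segment a b) f \<and>
    (\<forall>z\<in>K. norm (contour_integral (linepath a b) (\<lambda>w. g w / (w - z)) - f z) \<le> e * norm (b - a))"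
proof -
  let ?S = "closed_segment a b"
  have "continuous_on (?S \<times> K) (\<lambda>(w,z). g w / (w - z))"
    unfolding case_prod_unfold
    by (intro continuous_intros continuous_on_compose2[OF assms(3)]) (use assms(2) in auto)
  then have "uniformly_continuous_on (?S \<times> K) (\<lambda>(w,z). g w / (w - z))"
    by (rule compact_uniformly_continuous) (simp add: assms compact_Times)
  then obtain d where d: "d > 0" "\<forall>p\<in>?S \<times> K. \<forall>q\<in>?S \<times> K. dist q p < d \<longrightarrow>
      dist ((\<lambda>(w,z). g w / (w - z)) q) ((\<lambda>(w,z). g w / (w - z)) p) < e"
    using assms(4) unfolding uniformly_continuous_on_def by blast
  have uc: "norm (g w / (w - z) - g v / (v - z)) \<le> e"
    if "w \<in> ?S" "v \<in> ?S" "z \<in> K" "dist w v < d" for w v z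
  proof -
    have "dist (w,z) (v,z) < d" using that by (simp add: dist_Pair_Pair)
    moreover have "(w,z) \<in> ?S \<times> K" "(v,z) \<in> ?S \<times> K" using that by auto
    ultimately have "dist (g w / (w - z)) (g v / (v - z)) < e"
      using d(2)[rule_format, of "(v,z)" "(w,z)"] by (simp only: prod.case)
    then show ?thesis by (simp add: dist_norm)
  qed
  have cont: "continuous_on ?S (\<lambda>w. g w / (w - z))" if "z \<in> K" for z
    by (intro continuous_intros assms(3)) (use that assms(2) in auto)
  \<comment> \<open>Induction on the number n of bisections that bring the pieces below length
    \<open>d\<close>. The errors are proportional to length, so they add up correctly.\<close>
  have *: "\<exists>f. ratfun ?S f \<and>
      (\<forall>z\<in>K. norm (contour_integral (linepath p q) (\<lambda>w. g w / (w - z)) - f z) \<le> e * norm (q - p))"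
    if "closed_segment p q \<subseteq> ?S" "norm (q - p) < 2 ^ n * d" for p q and n :: nat
    using that
  proof (induction n arbitrary: p q)
    case 0
    have p: "p \<in> ?S" using 0 by auto
    show ?case
    proof (intro exI conjI ballI)
      show "ratfun ?S (\<lambda>z. (- (q - p) * g p) / (z - p))" by (rule ratfun.pole) fact
      fix z assume z: "z \<in> K"
      then have zp: "z \<noteq> p" using p assms(2) by auto
      have i1: "(\<lambda>w. g w / (w - z)) contour_integrable_on linepath p q"
        by (rule contour_integrable_continuous_linepath, rule continuous_on_subset[OF cont[OF z] 0(1)])
      have "((\<lambda>w. g w / (w - z) - g p / (p - z)) has_contour_integral
         (contour_integral (linepath p q) (\<lambda>w. g w / (w - z)) - g p / (p - z) * (q - p))) (linepath p q)"
        by (intro has_contour_integral_diff has_contour_integral_integral i1 has_contour_integral_const_linepath)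
      then have "norm (contour_integral (linepath p q) (\<lambda>w. g w / (w - z)) - g p / (p - z) * (q - p))
        \<le> e * norm (q - p)"
      proof (rule has_contour_integral_bound_linepath)
        show "0 \<le> e" using assms by simp
        fix x assume x: "x \<in> closed_segment p q"
        then have "dist x p \<le> norm (q - p)"
          using segment_bound(1) by (metis dist_commute dist_norm norm_minus_commute)
        then show "norm (g x / (x - z) - g p / (p - z)) \<le> e"
          using uc[of x p z] 0 x p z by auto
      qed
      also have "g p / (p - z) * (q - p) = (- (q - p) * g p) / (z - p)"
        using zp by (simp add: divide_simps) (simp add: algebra_simps)
      finally show "norm (contour_integral (linepath p q) (\<lambda>w. g w / (w - z)) - - (q - p) * g p / (z - p))
        \<le> e * norm (q - p)" .
    qed
  next
    case (Suc n)
    define c where "c = midpoint p q"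
    have c: "c \<in> closed_segment p q" unfolding c_def by simp
    have sub: "closed_segment p c \<subseteq> closed_segment p q" "closed_segment c q \<subseteq> closed_segment p q"
      using c by (auto simp: subset_closed_segment)
    have nn: "norm (c - p) = norm (q - p) / 2" "norm (q - c) = norm (q - p) / 2"
      using dist_midpoint(1)[of p q] dist_midpoint(4)[of p q]
      by (simp_all add: c_def dist_norm norm_minus_commute)
    obtain f1 where f1: "ratfun ?S f1" "\<forall>z\<in>K. norm (contour_integral (linepath p c) (\<lambda>w. g w / (w - z)) - f1 z) \<le> e * norm (c - p)"
      using Suc.IH[of p c] sub Suc.prems nn by auto
    obtain f2 where f2: "ratfun ?S f2" "\<forall>z\<in>K. norm (contour_integral (linepath c q) (\<lambda>w. g w / (w - z)) - f2 z) \<le> e * norm (q - c)"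
      using Suc.IH[of c q] sub Suc.prems nn by auto
    show ?case
    proof (intro exI conjI ballI)
      show "ratfun ?S (\<lambda>z. f1 z + f2 z)" using f1 f2 by (intro ratfun.add)
      fix z assume z: "z \<in> K"
      have "contour_integral (linepath p q) (\<lambda>w. g w / (w - z)) =
        contour_integral (linepath p c) (\<lambda>w. g w / (w - z)) + contour_integral (linepath c q) (\<lambda>w. g w / (w - z))"
        by (rule contour_integral_split_linepath[OF continuous_on_subset[OF cont[OF z] Suc.prems(1)] c])
      then have "contour_integral (linepath p q) (\<lambda>w. g w / (w - z)) - (f1 z + f2 z) =
        (contour_integral (linepath p c) (\<lambda>w. g w / (w - z)) - f1 z) + (contour_integral (linepath c q) (\<lambda>w. g w / (w - z)) - f2 z)"
        by simp
      also have "norm \<dots> \<le> e * norm (c - p) + e * norm (q - c)"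
        by (rule norm_triangle_mono[OF f1(2)[rule_format,OF z] f2(2)[rule_format,OF z]])
      finally have "norm (contour_integral (linepath p q) (\<lambda>w. g w / (w - z)) - (f1 z + f2 z)) \<le> e * norm (c - p) + e * norm (q - c)" .
      then show "norm (contour_integral (linepath p q) (\<lambda>w. g w / (w - z)) - (f1 z + f2 z)) \<le> e * norm (q - p)"
        using nn by (simp add: field_simps)
    qed
  qed
  obtain n where "norm (b - a) / d < 2 ^ n" using real_arch_pow[of 2] by fastforce
  then show ?thesis using *[of a b n] d(1) by (auto simp: field_simps)
qed

section \<open>Cauchy's integral formula on a square grid\<close>

definition grid_pt :: "real \<Rightarrow> int \<times> int \<Rightarrow> complex" where
  "grid_pt h p = Complex (h * fst p) (h * snd p)"

definition grid_sq :: "real \<Rightarrow> int \<times> int \<Rightarrow> complex set" where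
  "grid_sq h p = cbox (grid_pt h p) (grid_pt h (fst p + 1, snd p + 1))"

lemma mem_grid_sq: "z \<in> grid_sq h (i,j) \<longleftrightarrow>
   h * i \<le> Re z \<and> Re z \<le> h * (i+1) \<and> h * j \<le> Im z \<and> Im z \<le> h * (j+1)"
  by (auto simp: grid_sq_def grid_pt_def in_cbox_complex_iff)

lemma grid_segments:
  assumes "h > 0"
  shows "closed_segment (grid_pt h (i,j)) (grid_pt h (i+1,j)) \<subseteq> grid_sq h (i,j)"
    "closed_segment (grid_pt h (i,j)) (grid_pt h (i,j+1)) \<subseteq> grid_sq h (i,j)"
    "closed_segment (grid_pt h (i,j+1)) (grid_pt h (i+1,j+1)) \<subseteq> grid_sq h (i,j)"
    "closed_segment (grid_pt h (i+1,j)) (grid_pt h (i+1,j+1)) \<subseteq> grid_sq h (i,j)"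
proof -
  have "convex (grid_sq h (i,j))" unfolding grid_sq_def by (rule convex_box)
  moreover have "grid_pt h (i,j) \<in> grid_sq h (i,j)" "grid_pt h (i+1,j) \<in> grid_sq h (i,j)"
    "grid_pt h (i,j+1) \<in> grid_sq h (i,j)" "grid_pt h (i+1,j+1) \<in> grid_sq h (i,j)"
    unfolding mem_grid_sq grid_pt_def using assms by (auto intro: mult_left_mono)
  ultimately show "closed_segment (grid_pt h (i,j)) (grid_pt h (i+1,j)) \<subseteq> grid_sq h (i,j)"
    "closed_segment (grid_pt h (i,j)) (grid_pt h (i,j+1)) \<subseteq> grid_sq h (i,j)"
    "closed_segment (grid_pt h (i,j+1)) (grid_pt h (i+1,j+1)) \<subseteq> grid_sq h (i,j)"
    "closed_segment (grid_pt h (i+1,j)) (grid_pt h (i+1,j+1)) \<subseteq> grid_sq h (i,j)"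
    by (simp_all add: closed_segment_subset)
qed

definition grid_path :: "real \<Rightarrow> int \<times> int \<Rightarrow> real \<Rightarrow> complex" where
  "grid_path h p = rectpath (grid_pt h p) (grid_pt h (fst p + 1, snd p + 1))"

lemma path_image_grid_path:
  assumes "h > 0"
  shows "path_image (grid_path h p) = grid_sq h p - box (grid_pt h p) (grid_pt h (fst p + 1, snd p + 1))"
  unfolding grid_path_def grid_sq_def
  by (rule path_image_rectpath_cbox_minus_box) (use assms in \<open>auto simp: grid_pt_def intro: mult_left_mono\<close>)

text \<open>Top and left edge are rewritten with reversed orientation, so that every edge runs to
  the right or upwards and can be compared with the same edge of the neighbouring square.\<close>

lemma grid_path_integral:
  assumes "h > 0" "continuous_on (path_image (grid_path h (i,j))) f"
  shows "contour_integral (grid_path h (i,j)) f =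
      contour_integral (linepath (grid_pt h (i,j)) (grid_pt h (i+1,j))) f
    + contour_integral (linepath (grid_pt h (i+1,j)) (grid_pt h (i+1,j+1))) f
    - contour_integral (linepath (grid_pt h (i,j+1)) (grid_pt h (i+1,j+1))) f
    - contour_integral (linepath (grid_pt h (i,j)) (grid_pt h (i,j+1))) f"
proof -
  define a where "a = grid_pt h (i,j)"
  define b where "b = grid_pt h (i+1,j)"
  define c where "c = grid_pt h (i+1,j+1)"
  define d where "d = grid_pt h (i,j+1)"
  have gp: "grid_path h (i,j) = linepath a b +++ linepath b c +++ linepath c d +++ linepath d a"
    by (simp add: grid_path_def rectpath_def Let_def a_def b_def c_def d_def grid_pt_def)
  have pim: "path_image (grid_path h (i,j)) = closed_segment a b \<union> closed_segment b c \<union> closed_segment c d \<union> closed_segment d a"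
    unfolding gp by (simp add: path_image_join Un_assoc)
  have int: "f contour_integrable_on linepath a b" "f contour_integrable_on linepath b c"
    "f contour_integrable_on linepath c d" "f contour_integrable_on linepath d a"
    by (intro contour_integrable_continuous_linepath continuous_on_subset[OF assms(2)]; simp add: pim; blast)+
  have "contour_integral (grid_path h (i,j)) f = contour_integral (linepath a b) f +
    contour_integral (linepath b c) f + contour_integral (linepath c d) f + contour_integral (linepath d a) f"
    unfolding gp by (simp add: contour_integral_join contour_integrable_joinI int valid_path_join)
  moreover have "contour_integral (linepath c d) f = - contour_integral (linepath d c) f"
    by (metis contour_integral_reversepath reversepath_linepath valid_path_linepath)
  moreover have "contour_integral (linepath d a) f = - contour_integral (linepath a d) f"
    by (metis contour_integral_reversepath reversepath_linepath valid_path_linepath)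
  ultimately show ?thesis by (simp add: a_def b_def c_def d_def)
qed

lemma finite_grid_sq_meeting:
  assumes "h > 0" "bounded K"
  shows "finite {p. grid_sq h p \<inter> K \<noteq> {}}"
proof -
  obtain B where B: "\<And>z. z \<in> K \<Longrightarrow> norm z \<le> B" using assms(2) bounded_iff by blast
  define N where "N = \<lceil>B / h\<rceil> + 1"
  have "{p. grid_sq h p \<inter> K \<noteq> {}} \<subseteq> {-N..N} \<times> {-N..N}"
  proof
    fix p assume "p \<in> {p. grid_sq h p \<inter> K \<noteq> {}}"
    then obtain i j z where p: "p = (i,j)" and z: "z \<in> grid_sq h (i,j)" "z \<in> K"
      by (cases p) blast
    have 1: "\<bar>Re z\<bar> \<le> B" "\<bar>Im z\<bar> \<le> B" using B[OF z(2)] abs_Re_le_cmod abs_Im_le_cmod order_trans by blast+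
    have k: "k \<in> {-N..N}" if "h * k \<le> x" "x \<le> h * (k + 1)" "\<bar>x\<bar> \<le> B" for k :: int and x
    proof -
      have "h * k \<le> B" "- B \<le> h * (k+1)" using that by auto
      then have "k \<le> B/h" "-B/h \<le> k+1" using assms(1) by (auto simp: field_simps)
      then show ?thesis unfolding N_def by auto linarith+
    qed
    show "p \<in> {- N..N} \<times> {- N..N}"
      using p z(1) 1 k[of i "Re z"] k[of j "Im z"] unfolding mem_grid_sq by auto
  qed
  then show ?thesis using finite_subset by blast
qed

lemma dist_grid_sq:
  assumes "h > 0" "z \<in> grid_sq h p" "w \<in> grid_sq h p"
  shows "dist z w \<le> 2 * h"
proof -
  obtain i j where p: "p = (i,j)" by (cases p)
  have "dist z w \<le> \<bar>Re (z-w)\<bar> + \<bar>Im (z-w)\<bar>" unfolding dist_norm by (rule cmod_le)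
  also have "\<bar>Re (z-w)\<bar> \<le> h" using assms unfolding p mem_grid_sq by (auto simp: abs_le_iff algebra_simps)
  also have "\<bar>Im (z-w)\<bar> \<le> h" using assms unfolding p mem_grid_sq by (auto simp: abs_le_iff algebra_simps)
  finally show ?thesis by simp
qed

text \<open>An open square of the grid is disjoint from all other closed squares: \<open>z\<close>
  sees Cauchy's formula in its own square and Cauchy's theorem in the others.\<close>

lemma grid_Cauchy:
  assumes h: "h > 0" and fin: "finite S" and holo: "g holomorphic_on (\<Union>p\<in>S. grid_sq h p)"
    and p0: "p0 \<in> S" and z: "z \<in> box (grid_pt h p0) (grid_pt h (fst p0 + 1, snd p0 + 1))"
  shows "(\<Sum>p\<in>S. contour_integral (grid_path h p) (\<lambda>w. g w / (w - z))) = 2 * pi * \<i> * g z"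
    "\<And>p. p \<in> S \<Longrightarrow> z \<notin> path_image (grid_path h p)"
proof -
  obtain i j where ij: "p0 = (i,j)" by (cases p0)
  have zz: "h * i < Re z" "Re z < h * (i+1)" "h * j < Im z" "Im z < h * (j+1)"
    using z unfolding ij by (auto simp: grid_pt_def in_box_complex_iff)
  have other: "z \<notin> grid_sq h p" if "p \<noteq> p0" for p
  proof
    assume zp: "z \<in> grid_sq h p"
    obtain k l where kl: "p = (k,l)" by (cases p)
    have *: "a = b" if "h * a < x" "x < h * (a+1)" "h * b \<le> x" "x \<le> h * (b+1)" for a b :: int and x
    proof -
      have "h * a < h * (b+1)" "h * b < h * (a+1)" using that by auto
      then have "a < b + 1" "b < a + 1" using h by (auto simp: mult_less_cancel_left_pos) 
      then show ?thesis by simp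
    qed
    have "i = k" "j = l" using zz zp *[of i "Re z" k] *[of j "Im z" l] unfolding kl mem_grid_sq by auto
    then show False using that ij kl by simp
  qed
  show *: "z \<notin> path_image (grid_path h p)" for p
    using other[of p] z by (cases "p = p0") (auto simp: path_image_grid_path[OF h])
  have vp: "valid_path (grid_path h p)" "pathfinish (grid_path h p) = pathstart (grid_path h p)" for p
    unfolding grid_path_def by auto
  have pim: "path_image (grid_path h p) \<subseteq> grid_sq h p" for p
    using path_image_grid_path[OF h] by auto
  have "contour_integral (grid_path h p0) (\<lambda>w. g w / (w - z)) = 2 * pi * \<i> * winding_number (grid_path h p0) z * g z"
  proof (rule contour_integral_unique, rule Cauchy_integral_formula_convex_simple[where S="grid_sq h p0"])
    show "convex (grid_sq h p0)" unfolding grid_sq_def by (rule convex_box)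
    show "g holomorphic_on grid_sq h p0" by (rule holomorphic_on_subset[OF holo]) (use p0 in auto)
    show "z \<in> interior (grid_sq h p0)" using z unfolding grid_sq_def by simp
    show "path_image (grid_path h p0) \<subseteq> grid_sq h p0 - {z}" using pim[of p0] *[of p0] by blast
  qed (use vp in auto)
  also have "winding_number (grid_path h p0) z = 1"
    unfolding grid_path_def by (rule winding_number_rectpath) (fact z)
  finally have 1: "contour_integral (grid_path h p0) (\<lambda>w. g w / (w - z)) = 2 * pi * \<i> * g z" by simp
  have 2: "contour_integral (grid_path h p) (\<lambda>w. g w / (w - z)) = 0" if "p \<in> S - {p0}" for p
  proof (rule contour_integral_unique, rule Cauchy_theorem_convex_simple[where S="grid_sq h p"])
    show "(\<lambda>w. g w / (w - z)) holomorphic_on grid_sq h p"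
      by (intro holomorphic_intros holomorphic_on_subset[OF holo]) (use that other[of p] in auto)
    show "convex (grid_sq h p)" unfolding grid_sq_def by (rule convex_box)
  qed (use vp pim in auto)
  show "(\<Sum>p\<in>S. contour_integral (grid_path h p) (\<lambda>w. g w / (w - z))) = 2 * pi * \<i> * g z"
    using 1 2 by (simp add: sum.remove[OF fin p0])
qed

lemma sum_diff_sets:
  fixes f :: "'a \<Rightarrow> 'b :: ab_group_add"
  assumes "finite A" "finite B"
  shows "sum f A - sum f B = sum f (A - B) - sum f (B - A)"
proof -
  have "sum f A = sum f (A - B) + sum f (A \<inter> B)"
    using sum.Int_Diff[OF assms(1), of f B] by (simp add: add.commute)
  moreover have "sum f B = sum f (B - A) + sum f (A \<inter> B)"
    using sum.Int_Diff[OF assms(2), of f A] by (simp add: add.commute Int_commute)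
  ultimately show ?thesis by simp
qed

text \<open>
  An edge shared by two squares meeting \<open>K\<close> is run through twice, in opposite directions.  The
  remaining edges bound a square that misses \<open>K\<close>, hence are disjoint from \<open>K\<close> themselves.
\<close>

lemma Cauchy_grid_formula:
  assumes "compact K" "open U" "K \<subseteq> U" "g holomorphic_on U"
  shows "\<exists>(I :: (bool \<times> int \<times> int) set) a b s. finite I \<and>
    (\<forall>e\<in>I. closed_segment (a e) (b e) \<subseteq> U - K) \<and>
    (\<forall>z\<in>K. \<exists>t0>0. \<forall>t::real. 0 < t \<and> t < t0 \<longrightarrow> z + t * (1 + \<i>) \<in> U \<and>
        (\<Sum>e\<in>I. s e * contour_integral (linepath (a e) (b e)) (\<lambda>w. g w / (w - (z + t * (1 + \<i>)))))
          = 2 * pi * \<i> * g (z + t * (1 + \<i>)))"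
proof -
  obtain d where d: "d > 0" "(\<Union>z\<in>K. ball z d) \<subseteq> U"
    using compact_subset_open_imp_ball_epsilon_subset[OF assms(1-3)] by blast
  \<comment> \<open>Two points of a square of side \<open>h\<close> are at most
    \<open>2 * h < d\<close> apart, so the squares meeting \<open>K\<close> stay in
    \<open>U\<close>.\<close>
  define h where "h = d / 4"
  have h: "h > 0" using d h_def by simp
  define S where "S = {p. grid_sq h p \<inter> K \<noteq> {}}"
  have finS: "finite S" unfolding S_def by (rule finite_grid_sq_meeting[OF h]) (use assms(1) compact_imp_bounded in auto)
  have SU: "grid_sq h p \<subseteq> U" if pS: "p \<in> S" for p
  proof
    fix w assume w: "w \<in> grid_sq h p"
    obtain z where z: "z \<in> K" "z \<in> grid_sq h p" using pS unfolding S_def by blast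
    then have "dist z w \<le> 2 * h" using dist_grid_sq[OF h] w by auto
    then have "w \<in> ball z d" using d h_def by auto
    then show "w \<in> U" using d(2) z(1) by blast
  qed
  define up where "up = (\<lambda>p::int\<times>int. (fst p, snd p + 1))"
  define ri where "ri = (\<lambda>p::int\<times>int. (fst p + 1, snd p))"
  have inju: "inj up" "inj ri" unfolding up_def ri_def by (auto simp: inj_on_def prod_eq_iff)
  then have inj: "inj_on up S" "inj_on ri S" by (auto intro: inj_on_subset)
  \<comment> \<open>Edges are indexed by the square of which they are the bottom
    (\<open>False\<close>) or left (\<open>True\<close>) edge; \<open>up\<close> and
    \<open>ri\<close> turn the top and right edge of a square into such edges of its neighbour.
    After cancellation \<open>A\<close> and \<open>B\<close> keep the sign +1, \<open>A'\<close> and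
    \<open>B'\<close> the sign -1.\<close>
  define A where "A = S - up ` S" define A' where "A' = up ` S - S"
  define B where "B = ri ` S - S" define B' where "B' = S - ri ` S"
  have fin: "finite A" "finite A'" "finite B" "finite B'"
    using finS unfolding A_def A'_def B_def B'_def by auto
  define I where "I = {False} \<times> (A \<union> A') \<union> {True} \<times> (B \<union> B')"
  define s :: "bool \<times> int \<times> int \<Rightarrow> complex" where
    "s = (\<lambda>(v,p). if v then (if p \<in> B then 1 else -1) else (if p \<in> A then 1 else -1))"
  define a where "a = (\<lambda>(v::bool,p). grid_pt h p)"
  define b where "b = (\<lambda>(v,p). if v then grid_pt h (up p) else grid_pt h (ri p))"
  have segH: "closed_segment (grid_pt h p) (grid_pt h (ri p)) \<subseteq> grid_sq h p"
    "closed_segment (grid_pt h (up p)) (grid_pt h (ri (up p))) \<subseteq> grid_sq h p" for p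
    using grid_segments(1,3)[OF h, of "fst p" "snd p"] by (auto simp: ri_def up_def)
  have segV: "closed_segment (grid_pt h p) (grid_pt h (up p)) \<subseteq> grid_sq h p"
    "closed_segment (grid_pt h (ri p)) (grid_pt h (up (ri p))) \<subseteq> grid_sq h p" for p
    using grid_segments(2,4)[OF h, of "fst p" "snd p"] by (auto simp: ri_def up_def)
  have notS: "grid_sq h p \<inter> K = {}" if "p \<notin> S" for p using that S_def by auto
  have up': "\<exists>q. p = up q" for p by (rule exI[of _ "(fst p, snd p - 1)"]) (simp add: up_def)
  have ri': "\<exists>q. p = ri q" for p by (rule exI[of _ "(fst p - 1, snd p)"]) (simp add: ri_def)
  have edgeA: "closed_segment (grid_pt h p) (grid_pt h (ri p)) \<subseteq> U - K" if "p \<in> A \<union> A'" for p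
  proof -
    obtain q where q: "p = up q" using up' by blast
    have "(p \<in> S \<and> q \<notin> S) \<or> (p \<notin> S \<and> q \<in> S)"
      using that inj_image_mem_iff[OF inju(1), of q S] unfolding A_def A'_def q Un_iff Diff_iff by argo
    then show ?thesis using segH(1)[of p] segH(2)[of q] notS SU unfolding q by fast
  qed
  have edgeB: "closed_segment (grid_pt h p) (grid_pt h (up p)) \<subseteq> U - K" if "p \<in> B \<union> B'" for p
  proof -
    obtain q where q: "p = ri q" using ri' by blast
    have "(p \<in> S \<and> q \<notin> S) \<or> (p \<notin> S \<and> q \<in> S)"
      using that inj_image_mem_iff[OF inju(2), of q S] unfolding B_def B'_def q Un_iff Diff_iff by argo
    then show ?thesis using segV(1)[of p] segV(2)[of q] notS SU unfolding q by fast
  qed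
  show ?thesis
  proof (rule exI[of _ I], rule exI[of _ a], rule exI[of _ b], rule exI[of _ s], intro conjI ballI)
    show "finite I" unfolding I_def using fin by auto
    show "closed_segment (a e) (b e) \<subseteq> U - K" if eI: "e \<in> I" for e
    proof (cases e rule: prod.exhaust)
      case (Pair v p)
      show ?thesis
      proof (cases v)
        case True
        then have "p \<in> B \<union> B'" using eI Pair unfolding I_def by auto
        from edgeB[OF this] show ?thesis using True Pair by (simp only: a_def b_def prod.case if_True)
      next
        case False
        then have "p \<in> A \<union> A'" using eI Pair unfolding I_def by auto
        from edgeA[OF this] show ?thesis using False Pair by (simp only: a_def b_def prod.case if_False)
      qed
    qed
  next
    fix z assume z: "z \<in> K"
    \<comment> \<open>\<open>z\<close> may lie on a grid line. Rounding down picks the square that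
      is entered on moving from \<open>z\<close> in the direction \<open>1 + \<i>\<close>, and
      \<open>t0\<close> is the room available in it.\<close>
    define p0 where "p0 = (\<lfloor>Re z / h\<rfloor>, \<lfloor>Im z / h\<rfloor>)"
    define t0 where "t0 = min (h * (fst p0 + 1) - Re z) (h * (snd p0 + 1) - Im z)"
    have fl: "h * \<lfloor>x / h\<rfloor> \<le> x" "x < h * (\<lfloor>x / h\<rfloor> + 1)" for x
    proof -
      define k where "k = \<lfloor>x / h\<rfloor>"
      have "of_int k \<le> x / h" "x / h < of_int k + 1" unfolding k_def by linarith+
      then have "h * k \<le> x" "x < h * (k + 1)" using h by (auto simp: field_simps)
      then show "h * \<lfloor>x / h\<rfloor> \<le> x" "x < h * (\<lfloor>x / h\<rfloor> + 1)" unfolding k_def by auto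
    qed
    have "z \<in> grid_sq h p0" unfolding p0_def mem_grid_sq using fl[of "Re z"] fl[of "Im z"] by auto
    then have p0S: "p0 \<in> S" using z unfolding S_def by auto
    show "\<exists>t0>0. \<forall>t::real. 0 < t \<and> t < t0 \<longrightarrow> z + t * (1 + \<i>) \<in> U \<and>
        (\<Sum>e\<in>I. s e * contour_integral (linepath (a e) (b e)) (\<lambda>w. g w / (w - (z + t * (1 + \<i>)))))
          = 2 * pi * \<i> * g (z + t * (1 + \<i>))"
    proof (intro exI conjI allI impI)
      show "t0 > 0" unfolding t0_def p0_def using fl[of "Re z"] fl[of "Im z"] by auto
      fix t :: real assume t: "0 < t \<and> t < t0"
      define y where "y = z + t * (1 + \<i>)"
      have y: "y \<in> box (grid_pt h p0) (grid_pt h (fst p0 + 1, snd p0 + 1))"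
        unfolding y_def using t fl[of "Re z"] fl[of "Im z"]
        by (auto simp: grid_pt_def in_box_complex_iff t0_def p0_def)
      then have "y \<in> grid_sq h p0" unfolding grid_sq_def using box_subset_cbox by blast
      then show yU: "z + t * (1 + \<i>) \<in> U" using SU[OF p0S] y_def by auto
      define G where "G = (\<lambda>w. g w / (w - y))"
      define H where "H = (\<lambda>p. contour_integral (linepath (grid_pt h p) (grid_pt h (ri p))) G)"
      define V where "V = (\<lambda>p. contour_integral (linepath (grid_pt h p) (grid_pt h (up p))) G)"
      have holo: "g holomorphic_on (\<Union>p\<in>S. grid_sq h p)"
        by (rule holomorphic_on_subset[OF assms(4)]) (use SU in auto)
      note gc = grid_Cauchy[OF h finS holo p0S y]
      have "2 * pi * \<i> * g y = (\<Sum>p\<in>S. contour_integral (grid_path h p) G)"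
        using gc(1) by (simp add: G_def)
      also have "\<dots> = (\<Sum>p\<in>S. H p + V (ri p) - H (up p) - V p)"
      proof (rule sum.cong[OF refl])
        fix p assume p: "p \<in> S"
        have "continuous_on (path_image (grid_path h p)) G" unfolding G_def
        proof (intro continuous_intros)
          have "path_image (grid_path h p) \<subseteq> U" using path_image_grid_path[OF h, of p] SU[OF p] by auto
          then show "continuous_on (path_image (grid_path h p)) g"
            using holomorphic_on_imp_continuous_on[OF assms(4)] continuous_on_subset by blast
        qed (use gc(2)[OF p] in auto)
        then show "contour_integral (grid_path h p) G = H p + V (ri p) - H (up p) - V p"
          using grid_path_integral[OF h, of "fst p" "snd p" G]
          by (simp add: H_def V_def ri_def up_def)
      qed
      also have "\<dots> = (sum H S - sum H (up ` S)) + (sum V (ri ` S) - sum V S)"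
        by (simp add: sum.reindex[OF inj(1)] sum.reindex[OF inj(2)] sum.distrib sum_subtractf)
      also have "\<dots> = (sum H A - sum H A') + (sum V B - sum V B')"
        unfolding A_def A'_def B_def B'_def using finS by (simp add: sum_diff_sets[symmetric])
      also have "sum H A - sum H A' = (\<Sum>p\<in>A \<union> A'. s (False,p) * H p)"
      proof -
        have "A \<inter> A' = {}" unfolding A_def A'_def by auto
        moreover have "(\<Sum>p\<in>A. s (False,p) * H p) = sum H A" by (rule sum.cong) (auto simp: s_def)
        moreover have "(\<Sum>p\<in>A'. s (False,p) * H p) = - sum H A'"
          unfolding sum_negf[symmetric] by (rule sum.cong) (auto simp: s_def A_def A'_def)
        ultimately show ?thesis using fin by (simp add: sum.union_disjoint)
      qed
      also have "sum V B - sum V B' = (\<Sum>p\<in>B \<union> B'. s (True,p) * V p)"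
      proof -
        have "B \<inter> B' = {}" unfolding B_def B'_def by auto
        moreover have "(\<Sum>p\<in>B. s (True,p) * V p) = sum V B" by (rule sum.cong) (auto simp: s_def)
        moreover have "(\<Sum>p\<in>B'. s (True,p) * V p) = - sum V B'"
          unfolding sum_negf[symmetric] by (rule sum.cong) (auto simp: s_def B_def B'_def)
        ultimately show ?thesis using fin by (simp add: sum.union_disjoint)
      qed
      also have "(\<Sum>p\<in>A \<union> A'. s (False,p) * H p) + (\<Sum>p\<in>B \<union> B'. s (True,p) * V p) =
          (\<Sum>e\<in>I. s e * contour_integral (linepath (a e) (b e)) G)"
      proof -
        have slice: "sum F ({v} \<times> C) = (\<Sum>p\<in>C. F (v,p))" for v C and F :: "bool \<times> int \<times> int \<Rightarrow> complex"
          by (rule sum.reindex_bij_witness[of _ "Pair v" snd]) auto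
        have "(\<Sum>e\<in>I. s e * contour_integral (linepath (a e) (b e)) G) =
          (\<Sum>e\<in>{False} \<times> (A \<union> A'). s e * contour_integral (linepath (a e) (b e)) G) +
          (\<Sum>e\<in>{True} \<times> (B \<union> B'). s e * contour_integral (linepath (a e) (b e)) G)"
          unfolding I_def by (rule sum.union_disjoint) (use fin in auto)
        moreover have "(\<Sum>e\<in>{False} \<times> (A \<union> A'). s e * contour_integral (linepath (a e) (b e)) G) =
            (\<Sum>p\<in>A \<union> A'. s (False,p) * H p)"
          unfolding H_def a_def b_def
          by (simp add: slice)
        moreover have "(\<Sum>e\<in>{True} \<times> (B \<union> B'). s e * contour_integral (linepath (a e) (b e)) G) =
            (\<Sum>p\<in>B \<union> B'. s (True,p) * V p)"
          unfolding V_def a_def b_def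
          by (simp add: slice)
        ultimately show ?thesis by simp
      qed
      finally show "(\<Sum>e\<in>I. s e * contour_integral (linepath (a e) (b e)) (\<lambda>w. g w / (w - (z + t * (1 + \<i>)))))
          = 2 * pi * \<i> * g (z + t * (1 + \<i>))" unfolding G_def y_def by simp
    qed
  qed
qed

lemma Runge_rational:
  assumes "compact K" "open U" "K \<subseteq> U" "g holomorphic_on U" "\<epsilon> > 0"
  shows "\<exists>f. ratfun (-K) f \<and> (\<forall>z\<in>K. norm (g z - f z) \<le> \<epsilon>)"
proof -
  from Cauchy_grid_formula[OF assms(1-4)]
  obtain I :: "(bool \<times> int \<times> int) set" and a b s where I_ex: "finite I \<and>
    (\<forall>e\<in>I. closed_segment (a e) (b e) \<subseteq> U - K) \<and>
    (\<forall>z\<in>K. \<exists>t0>0. \<forall>t::real. 0 < t \<and> t < t0 \<longrightarrow> z + t * (1 + \<i>) \<in> U \<and>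
        (\<Sum>e\<in>I. s e * contour_integral (linepath (a e) (b e)) (\<lambda>w. g w / (w - (z + t * (1 + \<i>)))))
          = 2 * pi * \<i> * g (z + t * (1 + \<i>)))"
    by (elim exE) (rule that)
  have I: "finite I" "\<And>e. e \<in> I \<Longrightarrow> closed_segment (a e) (b e) \<subseteq> U - K"
    using I_ex by simp_all
  note lim = I_ex[THEN conjunct2, THEN conjunct2, THEN bspec]
  define E where "E = (\<Union>e\<in>I. closed_segment (a e) (b e))"
  have EK: "E \<subseteq> U - K" unfolding E_def using I(2) by blast
  have clE: "closed E" unfolding E_def using I(1) by auto
  define \<Phi> where "\<Phi> = (\<lambda>z. (\<Sum>e\<in>I. s e / (2*pi*\<i>) * contour_integral (linepath (a e) (b e)) (\<lambda>w. g w / (w - z))))"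
  have approx: "\<exists>f. ratfun E f \<and> (\<forall>z\<in>L. norm (\<Phi> z - f z) \<le> \<epsilon>)"
    if L: "compact L" "L \<inter> E = {}" and "\<epsilon> > 0" for L \<epsilon>
  proof -
    define N where "N = (\<Sum>e\<in>I. norm (s e / (2*pi*\<i>)) * norm (b e - a e))"
    have N: "N \<ge> 0" unfolding N_def by (intro sum_nonneg mult_nonneg_nonneg) auto
    define d where "d = \<epsilon> / (N + 1)"
    have d: "d > 0" unfolding d_def using N that by auto
    have "\<exists>f. ratfun (closed_segment (a e) (b e)) f \<and>
       (\<forall>z\<in>L. norm (contour_integral (linepath (a e) (b e)) (\<lambda>w. g w / (w - z)) - f z) \<le> d * norm (b e - a e))"
      if eI: "e \<in> I" for e
    proof (rule Cauchy_segment_approx[OF L(1) _ _ d])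
      show "closed_segment (a e) (b e) \<inter> L = {}" using L(2) eI unfolding E_def by blast
      show "continuous_on (closed_segment (a e) (b e)) g"
        using continuous_on_subset[OF holomorphic_on_imp_continuous_on[OF assms(4)]] I(2)[OF eI] by blast
    qed
    then have "\<forall>e\<in>I. \<exists>f. ratfun (closed_segment (a e) (b e)) f \<and>
       (\<forall>z\<in>L. norm (contour_integral (linepath (a e) (b e)) (\<lambda>w. g w / (w - z)) - f z) \<le> d * norm (b e - a e))"
      by blast
    from bchoice[OF this] obtain f where f: "\<And>e. e \<in> I \<Longrightarrow> ratfun (closed_segment (a e) (b e)) (f e)"
       "\<And>e z. e \<in> I \<Longrightarrow> z \<in> L \<Longrightarrow> norm (contour_integral (linepath (a e) (b e)) (\<lambda>w. g w / (w - z)) - f e z) \<le> d * norm (b e - a e)"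
      by blast
    show ?thesis
    proof (intro exI conjI ballI)
      show "ratfun E (\<lambda>z. \<Sum>e\<in>I. s e / (2*pi*\<i>) * f e z)"
        by (intro ratfun_sum ratfun_cmult ratfun_mono[OF f(1)]) (auto simp: E_def)
      fix z assume z: "z \<in> L"
      have "norm (\<Phi> z - (\<Sum>e\<in>I. s e / (2*pi*\<i>) * f e z)) =
         norm (\<Sum>e\<in>I. s e / (2*pi*\<i>) * (contour_integral (linepath (a e) (b e)) (\<lambda>w. g w / (w - z)) - f e z))"
        unfolding \<Phi>_def by (simp only: sum_subtractf right_diff_distrib)
      also have "\<dots> \<le> (\<Sum>e\<in>I. norm (s e / (2*pi*\<i>)) * (d * norm (b e - a e)))"
        unfolding norm_mult[symmetric]
        by (rule sum_norm_le, subst norm_mult, rule mult_left_mono[OF f(2)[OF _ z]]) auto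
      also have "\<dots> = d * N" unfolding N_def by (simp add: sum_distrib_left mult_ac)
      also have "\<dots> \<le> \<epsilon>" unfolding d_def using N that(3) by (simp add: field_simps)
      finally show "norm (\<Phi> z - (\<Sum>e\<in>I. s e / (2*pi*\<i>) * f e z)) \<le> \<epsilon>" .
    qed
  qed
  \<comment> \<open>Cauchy's formula is available only at \<open>z + t * (1 + \<i>)\<close>. The
    approximants of \<Phi> on a closed disc around \<open>z\<close> are continuous there and carry
    the equation to the limit t -> 0, up to an arbitrarily small error.\<close>
  have eq: "\<Phi> z = g z" if z: "z \<in> K" for z
  proof -
    have small: "norm (\<Phi> z - g z) \<le> 2 * \<delta>" if "\<delta> > 0" for \<delta>
    proof -
      obtain r where r: "r > 0" "cball z r \<subseteq> - E"
        using open_contains_cball[of "-E"] clE EK z by blast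
      obtain f where f: "ratfun E f" "\<forall>w\<in>cball z r. norm (\<Phi> w - f w) \<le> \<delta>"
        using approx[OF compact_cball _ \<open>\<delta> > 0\<close>, of z r] r(2) by blast
      from lim[OF z] obtain t0 where t0c: "t0 > 0 \<and> (\<forall>t::real. 0 < t \<and> t < t0 \<longrightarrow> z + t * (1 + \<i>) \<in> U \<and>
        (\<Sum>e\<in>I. s e * contour_integral (linepath (a e) (b e)) (\<lambda>w. g w / (w - (z + t * (1 + \<i>)))))
          = 2 * pi * \<i> * g (z + t * (1 + \<i>)))"
        by (elim exE) (rule that)
      note t0 = t0c[THEN conjunct1] t0c[THEN conjunct2]
      have path: "((\<lambda>t::real. z + t * (1 + \<i>)) \<longlongrightarrow> z) (at_right 0)"
      proof -
        have "((\<lambda>t::real. z + complex_of_real t * (1 + \<i>)) \<longlongrightarrow> z + complex_of_real 0 * (1 + \<i>)) (at_right 0)"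
          by (intro tendsto_intros)
        then show ?thesis by simp
      qed
      have "isCont f z" using ratfun_analytic[OF f(1), of "{z}"] EK z analytic_at_imp_isCont by blast
      moreover have "isCont g z" using assms z holomorphic_on_imp_continuous_on continuous_on_eq_continuous_at by blast
      ultimately have "((\<lambda>t::real. f (z + t * (1 + \<i>)) - g (z + t * (1 + \<i>))) \<longlongrightarrow> f z - g z) (at_right 0)"
        by (intro tendsto_diff isCont_tendsto_compose[OF _ path])
      then have "((\<lambda>t::real. norm (f (z + t * (1 + \<i>)) - g (z + t * (1 + \<i>)))) \<longlongrightarrow> norm (f z - g z)) (at_right 0)"
        by (rule tendsto_norm)
      then have "norm (f z - g z) \<le> \<delta>"
      proof (rule tendsto_upperbound)
        have "\<forall>\<^sub>F t::real in at_right 0. z + t * (1 + \<i>) \<in> ball z r"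
          using path r(1) by (intro topological_tendstoD) auto
        moreover have "\<forall>\<^sub>F t::real in at_right 0. 0 < t \<and> t < t0"
          using t0(1) by (auto simp: eventually_at_right_field)
        ultimately show "\<forall>\<^sub>F t::real in at_right 0. norm (f (z + t * (1 + \<i>)) - g (z + t * (1 + \<i>))) \<le> \<delta>"
        proof eventually_elim
          case (elim t)
          define y where "y = z + t * (1 + \<i>)"
          have "\<Phi> y = (\<Sum>e\<in>I. s e * contour_integral (linepath (a e) (b e)) (\<lambda>w. g w / (w - y))) / (2*pi*\<i>)"
            unfolding \<Phi>_def by (simp add: sum_divide_distrib)
          also have "\<dots> = g y" using t0(2)[rule_format, of t] elim by (simp add: y_def)
          finally have "\<Phi> y = g y" .
          moreover have "y \<in> cball z r" using elim unfolding y_def by auto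
          ultimately show ?case using f(2) unfolding y_def[symmetric] by (metis norm_minus_commute)
        qed
      qed auto
      moreover have "norm (\<Phi> z - f z) \<le> \<delta>" using f(2) r(1) by auto
      ultimately show ?thesis using norm_triangle_ineq[of "\<Phi> z - f z" "f z - g z"] by simp
    qed
    have "norm (\<Phi> z - g z) \<le> 0"
    proof (rule field_le_epsilon)
      fix e :: real assume "e > 0"
      then show "norm (\<Phi> z - g z) \<le> 0 + e" using small[of "e/2"] by simp
    qed
    then show ?thesis by simp
  qed
  obtain f where f: "ratfun E f" "\<forall>z\<in>K. norm (\<Phi> z - f z) \<le> \<epsilon>"
    using approx[OF assms(1) _ assms(5)] EK by blast
  show ?thesis using f eq ratfun_mono[OF f(1), of "-K"] EK by (intro exI[of _ f]) auto
qed

section \<open>Polynomial approximation and pole pushing\<close>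

definition poly_approximable :: "complex set \<Rightarrow> (complex \<Rightarrow> complex) \<Rightarrow> bool" where
  "poly_approximable K h \<longleftrightarrow> (\<forall>e>0. \<exists>f. ratfun {} f \<and> (\<forall>z\<in>K. norm (h z - f z) \<le> e))"

lemma poly_approximable_ratfun: "ratfun {} f \<Longrightarrow> poly_approximable K f"
  unfolding poly_approximable_def by (metis diff_self less_imp_le norm_zero)

lemma poly_approximable_add:
  assumes "poly_approximable K f" "poly_approximable K g"
  shows "poly_approximable K (\<lambda>z. f z + g z)"
  unfolding poly_approximable_def
proof (intro allI impI)
  fix e :: real assume "e > 0"
  then have "e/2 > 0" by simp
  then obtain p q where pq: "ratfun {} p" "\<forall>z\<in>K. norm (f z - p z) \<le> e/2" "ratfun {} q" "\<forall>z\<in>K. norm (g z - q z) \<le> e/2"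
    using assms unfolding poly_approximable_def by meson
  have "norm (f z + g z - (p z + q z)) \<le> e" if "z \<in> K" for z
    using norm_triangle_mono[OF pq(2)[rule_format, OF that] pq(4)[rule_format, OF that]]
    by (simp add: algebra_simps)
  then show "\<exists>h. ratfun {} h \<and> (\<forall>z\<in>K. norm (f z + g z - h z) \<le> e)"
    using ratfun.add[OF pq(1,3)] by blast
qed

lemma poly_approximable_mult:
  assumes "poly_approximable K f" "poly_approximable K g" "bounded (f ` K)" "bounded (g ` K)"
  shows "poly_approximable K (\<lambda>z. f z * g z)"
  unfolding poly_approximable_def
proof (intro allI impI)
  fix e :: real assume e: "e > 0"
  obtain A B where A: "A > 0" "\<And>z. z \<in> K \<Longrightarrow> norm (f z) \<le> A" and B: "B > 0" "\<And>z. z \<in> K \<Longrightarrow> norm (g z) \<le> B"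
    using assms(3,4) unfolding bounded_pos by (metis imageI)
  define d where "d = min 1 (e / (A + B + 1))"
  have N: "A + B + 1 > 0" using A(1) B(1) by simp
  have d: "d > 0" "d \<le> 1" unfolding d_def using e N by auto
  have "d * (A + B + 1) \<le> (e / (A + B + 1)) * (A + B + 1)"
    by (rule mult_right_mono) (use N in \<open>auto simp: d_def\<close>)
  then have d3: "d * (A + B + 1) \<le> e" using N by simp
  obtain p q where pq: "ratfun {} p" "\<And>z. z\<in>K \<Longrightarrow> norm (f z - p z) \<le> d" "ratfun {} q" "\<And>z. z\<in>K \<Longrightarrow> norm (g z - q z) \<le> d"
    using assms(1,2) d(1) unfolding poly_approximable_def by meson
  have "norm (f z * g z - p z * q z) \<le> e" if z: "z \<in> K" for z
  proof -
    have "norm (q z) \<le> norm (g z) + norm (g z - q z)" by (metis norm_minus_commute norm_triangle_sub)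
    then have q: "norm (q z) \<le> B + 1" using B(2)[OF z] pq(4)[OF z] d(2) by linarith
    have "f z * g z - p z * q z = f z * (g z - q z) + (f z - p z) * q z" by (simp add: algebra_simps)
    also have "norm \<dots> \<le> A * d + d * (B + 1)"
      by (rule norm_triangle_mono; subst norm_mult; rule mult_mono) (use A B pq z q d in auto)
    also have "\<dots> \<le> e" using d3 by (simp add: algebra_simps)
    finally show ?thesis .
  qed
  then show "\<exists>h. ratfun {} h \<and> (\<forall>z\<in>K. norm (f z * g z - h z) \<le> e)"
    using ratfun_mult[OF pq(1,3)] by blast
qed

lemma poly_approximable_power:
  assumes "poly_approximable K f" "bounded (f ` K)"
  shows "poly_approximable K (\<lambda>z. f z ^ n)"
proof -
  obtain A where A: "\<And>z. z \<in> K \<Longrightarrow> norm (f z) \<le> A" using assms(2) unfolding bounded_iff by auto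
  show ?thesis
  proof (induction n)
    case 0 then show ?case using poly_approximable_ratfun[OF ratfun_const[of "{}" 1]] by simp
  next
    case (Suc n)
    have "bounded ((\<lambda>z. f z ^ n) ` K)"
      unfolding bounded_iff using A by (intro exI[of _ "A^n"]) (auto simp: norm_power power_mono)
    then show ?case using poly_approximable_mult[OF assms(1) Suc assms(2)] by simp
  qed
qed

lemma poly_approximable_sum:
  assumes "\<And>i. i \<in> I \<Longrightarrow> poly_approximable K (f i)"
  shows "poly_approximable K (\<lambda>z. \<Sum>i\<in>I. f i z)"
proof (cases "finite I")
  case True
  then show ?thesis using assms
    by (induction I rule: finite_induct) (auto intro: poly_approximable_add poly_approximable_ratfun ratfun_const)
qed (auto intro: poly_approximable_ratfun ratfun_const)

lemma poly_approximable_limit: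
  assumes "\<And>e. e > 0 \<Longrightarrow> \<exists>g. poly_approximable K g \<and> (\<forall>z\<in>K. norm (f z - g z) \<le> e)"
  shows "poly_approximable K f"
  unfolding poly_approximable_def
proof (intro allI impI)
  fix e :: real assume "e > 0"
  then have e: "e/2 > 0" by simp
  obtain g where g: "poly_approximable K g" "\<forall>z\<in>K. norm (f z - g z) \<le> e/2" using assms[OF e] by blast
  obtain h where h: "ratfun {} h" "\<forall>z\<in>K. norm (g z - h z) \<le> e/2"
    using g(1) e unfolding poly_approximable_def by blast
  have "norm (f z - h z) \<le> e" if "z \<in> K" for z
    using norm_triangle_mono[OF g(2)[rule_format, OF that] h(2)[rule_format, OF that]] by simp
  then show "\<exists>h. ratfun {} h \<and> (\<forall>z\<in>K. norm (f z - h z) \<le> e)" using h(1) by blast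
qed

text \<open>Partial sums of the geometric series converge uniformly because
  \<open>norm (q z)\<close> is at most 1/2, and they are polynomials in \<open>q\<close>.\<close>

lemma poly_approximable_geometric:
  assumes "poly_approximable K u" "poly_approximable K q" "\<And>z. z \<in> K \<Longrightarrow> norm (q z) \<le> 1/2" "bounded (u ` K)"
  shows "poly_approximable K (\<lambda>z. u z / (1 - q z))"
proof (rule poly_approximable_limit)
  fix e :: real assume e: "e > 0"
  obtain B where B: "B > 0" "\<And>z. z \<in> K \<Longrightarrow> norm (u z) \<le> B" using assms(4) unfolding bounded_pos by auto
  obtain n where n: "(1/2::real) ^ n < e / (2 * B)" using e B(1) real_arch_pow_inv[of "e/(2*B)" "1/2"] by auto
  define s where "s = (\<lambda>z. \<Sum>k<n. q z ^ k)"
  have bq: "bounded (q ` K)" unfolding bounded_iff using assms(3) by blast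
  have "norm (s z) \<le> real n" if "z \<in> K" for z
  proof -
    have "norm (s z) \<le> (\<Sum>k<n. 1)" unfolding s_def
      by (rule sum_norm_le) (use assms(3)[OF that] in \<open>auto simp: norm_power power_le_one\<close>)
    then show ?thesis by simp
  qed
  then have bs: "bounded (s ` K)" unfolding bounded_iff by blast
  have "poly_approximable K s" unfolding s_def
    by (intro poly_approximable_sum poly_approximable_power assms(2) bq)
  then have "poly_approximable K (\<lambda>z. u z * s z)" by (intro poly_approximable_mult assms bs)
  moreover have "norm (u z / (1 - q z) - u z * s z) \<le> e" if z: "z \<in> K" for z
  proof -
    have q1: "q z \<noteq> 1" using assms(3)[OF z] by auto
    have "1/2 \<le> norm (1 - q z)" using norm_triangle_ineq2[of 1 "q z"] assms(3)[OF z] by simp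
    have e: "(1 - q z) * s z = 1 - q z ^ n" unfolding s_def using q1 by (simp add: sum_gp_strict)
    have "u z - u z * ((1 - q z) * s z) = u z * q z ^ n" by (simp only: e) (simp add: algebra_simps)
    moreover have "u z / (1 - q z) - u z * s z = (u z - u z * ((1 - q z) * s z)) / (1 - q z)"
      using q1 by (simp add: diff_divide_distrib)
    ultimately have "u z / (1 - q z) - u z * s z = u z * q z ^ n / (1 - q z)" by simp
    also have "norm \<dots> \<le> B * (1/2)^n / (1/2)"
      unfolding norm_divide norm_mult norm_power
      by (intro frac_le mult_mono power_mono) (use assms(3)[OF z] B(2)[OF z] B(1) \<open>1/2 \<le> norm (1 - q z)\<close> in auto)
    also have "\<dots> \<le> e" using n B(1) by (simp add: field_simps)
    finally show ?thesis .
  qed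
  ultimately show "\<exists>g. poly_approximable K g \<and> (\<forall>z\<in>K. norm (u z / (1 - q z) - g z) \<le> e)" by blast
qed

text \<open>A pole at \<open>w\<close> can be moved to \<open>w'\<close> if \<open>K\<close> is at
  least twice as far from \<open>w\<close> as \<open>w'\<close> is, by expanding in powers of
  \<open>(w' - w) / (z - w)\<close>. A pole far from \<open>K\<close> is handled by a power series
  in z, and connectedness of the complement links it to all others.\<close>

lemma pole_pushing:
  assumes "compact K" "connected (-K)" "w \<notin> K"
  shows "poly_approximable K (\<lambda>z. c / (z - w))"
proof -
  define P where "P = (\<lambda>w. poly_approximable K (\<lambda>z. 1 / (z - w)))"
  have step: "P w'" if "P w" "w \<in> -K" "w' \<in> -K" "\<And>z. z \<in> K \<Longrightarrow> norm (w' - w) \<le> norm (z - w) / 2" for w w'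
  proof -
    have u: "poly_approximable K (\<lambda>z. 1 / (z - w))" using that(1) P_def by simp
    have bu: "bounded ((\<lambda>z. 1 / (z - w)) ` K)"
      by (intro compact_imp_bounded compact_continuous_image continuous_intros assms) (use that in auto)
    have q: "poly_approximable K (\<lambda>z. (w' - w) * (1 / (z - w)))"
      by (rule poly_approximable_mult[OF poly_approximable_ratfun[OF ratfun_const] u _ bu]) (auto simp: image_constant_conv)
    have "poly_approximable K (\<lambda>z. (1 / (z - w)) / (1 - (w' - w) * (1 / (z - w))))"
    proof (rule poly_approximable_geometric[OF u q _ bu])
      fix z assume z: "z \<in> K"
      then have "norm (z - w) > 0" using that(2) by auto
      then show "norm ((w' - w) * (1 / (z - w))) \<le> 1/2"
        using that(4)[OF z] by (simp add: norm_mult norm_divide field_simps)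
    qed
    moreover have "(1 / (z - w)) / (1 - (w' - w) * (1 / (z - w))) = 1 / (z - w')" if "z \<in> K" for z
    proof -
      have "z \<noteq> w" "z \<noteq> w'" using that \<open>w \<in> -K\<close> \<open>w' \<in> -K\<close> by auto
      then have "(1 / (z - w)) / (1 - (w' - w) * (1 / (z - w))) = 1 / ((z - w) * (1 - (w' - w) * (1 / (z - w))))"
        by simp
      also have "(z - w) * (1 - (w' - w) * (1 / (z - w))) = z - w'"
      proof -
        have "(z - w) * ((w' - w) * (1 / (z - w))) = w' - w" using \<open>z \<noteq> w\<close> by simp
        then show ?thesis by (simp only: right_diff_distrib[of "z - w" 1] mult_1_right) (simp add: algebra_simps)
      qed
      finally show ?thesis .
    qed
    ultimately show ?thesis unfolding P_def poly_approximable_def by simp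
  qed
  obtain B where B: "B > 0" "\<And>z. z \<in> K \<Longrightarrow> norm z \<le> B" using compact_imp_bounded[OF assms(1)] unfolding bounded_pos by auto
  define w0 where "w0 = complex_of_real (2 * B)"
  have w0: "norm w0 = 2 * B" unfolding w0_def using B(1) by (simp only: norm_of_real abs_of_pos)
  have w0K: "w0 \<in> -K" using B w0 by fastforce
  have "P w0"
  proof -
    have q: "poly_approximable K (\<lambda>z. z / w0)"
      using poly_approximable_ratfun[OF ratfun.monom[of "{}" "1/w0" 1]] by simp
    have "poly_approximable K (\<lambda>z. (-1 / w0) / (1 - z / w0))"
    proof (rule poly_approximable_geometric[OF poly_approximable_ratfun[OF ratfun_const] q])
      show "bounded ((\<lambda>z. -1 / w0) ` K)" by (simp add: image_constant_conv)
    next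
      fix z assume "z \<in> K"
      then show "norm (z / w0) \<le> 1/2" using B w0 by (simp add: norm_divide field_simps)
    qed
    moreover have "(-1 / w0) / (1 - z / w0) = 1 / (z - w0)" if "z \<in> K" for z
    proof -
      have "w0 \<noteq> 0" "z \<noteq> w0" using w0 B(1) that w0K by auto
      then show ?thesis by (simp add: divide_simps)
    qed
    ultimately show ?thesis unfolding P_def poly_approximable_def by simp
  qed
  have "P w"
  proof (rule connected_induction_simple[OF assms(2), of w0 w P])
    fix v assume v: "v \<in> -K"
    obtain r where r: "r > 0" "ball v r \<subseteq> -K"
      using v compact_imp_closed[OF assms(1)] open_contains_ball[of "-K"] by blast
    show "\<exists>T. openin (top_of_set (- K)) T \<and> v \<in> T \<and> (\<forall>x\<in>T. \<forall>y\<in>T. P x \<longrightarrow> P y)"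
    proof (intro exI conjI ballI impI)
      \<comment> \<open>For x and y in this ball and z in \<open>K\<close>, the distance from x to y
        is below 2r/5 and that from x to z above 4r/5: the factor 2 demanded by
        \<open>step\<close>.\<close>
      show "openin (top_of_set (- K)) (ball v (r/5))"
      proof (rule open_openin_trans)
        show "open (-K)" using assms(1) by (simp add: compact_imp_closed open_Compl)
        show "ball v (r/5) \<subseteq> -K" using r subset_ball[of "r/5" r v] by auto
      qed auto
      show "v \<in> ball v (r/5)" using r by auto
      fix x y assume xy: "x \<in> ball v (r/5)" "y \<in> ball v (r/5)" "P x"
      show "P y"
      proof (rule step[OF xy(3)])
        show "x \<in> -K" "y \<in> -K" using xy(1,2) r subset_ball[of "r/5" r v] by fastforce+
        fix z assume "z \<in> K"
        then have "dist v z \<ge> r" using r(2) by (meson ComplD mem_ball not_le subsetD)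
        moreover have "dist v x < r/5" "dist v y < r/5" using xy by auto
        moreover have "dist v z \<le> dist v x + dist x z" by (rule dist_triangle)
        moreover have "dist x y \<le> dist v x + dist v y" by (metis dist_commute dist_triangle)
        ultimately show "norm (y - x) \<le> norm (z - x) / 2"
          by (simp add: dist_norm norm_minus_commute)
      qed
    qed
  qed (use w0K assms \<open>P w0\<close> in auto)
  then have "poly_approximable K (\<lambda>z. c * (1 / (z - w)))" unfolding P_def
    by (intro poly_approximable_mult[OF poly_approximable_ratfun[OF ratfun_const]] compact_imp_bounded
        compact_continuous_image continuous_intros assms) (use assms in auto)
  then show ?thesis by simp
qed

text \<open>Both cases of the construction run through this one statement, with \<open>ent\<close>
  selecting approximation by polynomials.\<close>

theorem Runge:
  assumes "compact K" "open U" "K \<subseteq> U" "g holomorphic_on U" "\<epsilon> > 0" "ent \<Longrightarrow> connected (-K)"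
  shows "\<exists>f. ratfun (if ent then {} else -K) f \<and> (\<forall>z\<in>K. norm (g z - f z) \<le> \<epsilon>)"
proof (cases ent)
  case True
  have "poly_approximable K f" if "ratfun (-K) f" for f
    using that
  proof (induction rule: ratfun.induct)
    case (pole a c)
    then show ?case using pole_pushing[OF assms(1) assms(6)[OF True]] by blast
  qed (auto intro: poly_approximable_add poly_approximable_ratfun ratfun.monom)
  then have "poly_approximable K g"
    using Runge_rational[OF assms(1-4)] by (intro poly_approximable_limit) blast
  then show ?thesis using True assms(5) unfolding poly_approximable_def by simp
qed (use Runge_rational[OF assms(1-5)] in auto)

text \<open>Lagrange's polynomials \<open>l a\<close> correct the finitely many values afterwards.
  As they are bounded on \<open>K\<close>, the correction costs a fixed factor, paid for in advance
  by approximating with the smaller error \<open>d\<close>.\<close>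

lemma Runge_interpolating:
  assumes "compact K" "open U" "K \<subseteq> U" "g holomorphic_on U" "\<epsilon> > 0" "ent \<Longrightarrow> connected (-K)"
    "finite E" "E \<subseteq> K"
  shows "\<exists>f. ratfun (if ent then {} else -K) f \<and> (\<forall>z\<in>K. norm (g z - f z) \<le> \<epsilon>) \<and> (\<forall>z\<in>E. f z = g z)"
proof -
  define l where "l = (\<lambda>a z. \<Prod>b\<in>E - {a}. (1 / (a - b)) * (z - b))"
  have l_rat: "ratfun {} (l a)" for a
    unfolding l_def by (intro ratfun_prod ratfun_cmult ratfun_linear)
  have l: "l a b = (if b = a then 1 else 0)" if "a \<in> E" "b \<in> E" for a b
    using that assms(7) unfolding l_def by (auto intro!: prod.neutral)
  have "\<exists>B. \<forall>z\<in>K. norm (l a z) \<le> B" for a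
  proof -
    have "bounded (l a ` K)"
      by (intro compact_imp_bounded compact_continuous_image assms(1)
          holomorphic_on_imp_continuous_on analytic_imp_holomorphic ratfun_analytic[OF l_rat]) auto
    then show ?thesis unfolding bounded_iff by auto
  qed
  then obtain B where B: "\<And>a z. z \<in> K \<Longrightarrow> norm (l a z) \<le> B a" by metis
  define N where "N = (\<Sum>a\<in>E. \<bar>B a\<bar>)"
  have N: "N \<ge> 0" unfolding N_def by (rule sum_nonneg) auto
  define d where "d = \<epsilon> / (N + 1)"
  have d: "d > 0" "d * (N + 1) = \<epsilon>" using assms(5) N unfolding d_def by auto
  obtain f where f: "ratfun (if ent then {} else -K) f" "\<forall>z\<in>K. norm (g z - f z) \<le> d"
    using Runge[OF assms(1-4) d(1) assms(6)] by blast
  show ?thesis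
  proof (intro exI conjI ballI)
    show "ratfun (if ent then {} else -K) (\<lambda>z. f z + (\<Sum>a\<in>E. (g a - f a) * l a z))"
      by (intro ratfun.add f(1) ratfun_sum ratfun_cmult ratfun_mono[OF l_rat]) auto
    fix z assume z: "z \<in> K"
    have "norm (\<Sum>a\<in>E. (g a - f a) * l a z) \<le> (\<Sum>a\<in>E. d * \<bar>B a\<bar>)"
    proof (rule sum_norm_le)
      fix a assume "a \<in> E"
      then have "norm (g a - f a) \<le> d" using f(2) assms(8) by auto
      moreover have "norm (l a z) \<le> \<bar>B a\<bar>" using B[OF z, of a] by linarith
      ultimately show "norm ((g a - f a) * l a z) \<le> d * \<bar>B a\<bar>"
        unfolding norm_mult by (intro mult_mono) (use d in auto)
    qed
    also have "\<dots> = d * N" unfolding N_def by (simp add: sum_distrib_left)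
    finally have "norm (g z - f z) + norm (\<Sum>a\<in>E. (g a - f a) * l a z) \<le> d + d * N"
      using f(2) z by (intro add_mono) auto
    then show "norm (g z - (f z + (\<Sum>a\<in>E. (g a - f a) * l a z))) \<le> \<epsilon>"
      using norm_triangle_ineq4[of "g z - f z" "\<Sum>a\<in>E. (g a - f a) * l a z"] d(2)
      by (simp add: algebra_simps)
  next
    fix z assume z: "z \<in> E"
    have "(\<Sum>a\<in>E. (g a - f a) * l a z) = (\<Sum>a\<in>E. if a = z then g a - f a else 0)"
      by (rule sum.cong) (use l z in auto)
    also have "\<dots> = g z - f z" using assms(7) z by simp
    finally show "f z + (\<Sum>a\<in>E. (g a - f a) * l a z) = g z" by simp
  qed
qed

text \<open>The poles of \<open>f\<close> are sorted by \<open>W\<close>: those outside sit in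
  \<open>u\<close> and are kept, those inside sit in \<open>v\<close>, which is merely approximated.
  The new function is \<open>u + r\<close> with \<open>r\<close> close to \<open>v\<close> on
  \<open>K\<close> and to \<open>g - u\<close> on \<open>M\<close>. Its difference to
  \<open>f\<close> is \<open>r - v\<close>, which is analytic on \<open>K\<close> even where
  \<open>f\<close> has poles, while nothing singular is left on \<open>M\<close>.\<close>

lemma ratfun_extend:
  assumes f: "ratfun (if ent then {} else UNIV) f"
    and "compact K" "compact M" "open W" "M \<subseteq> W" "K \<inter> W = {}"
    and "ent \<Longrightarrow> connected (- (K \<union> M))" and g: "g analytic_on M" and "finite E" "\<epsilon> > 0"
  shows "\<exists>f'. ratfun (if ent then {} else UNIV) f' \<and> (\<lambda>z. f' z - f z) analytic_on K \<and>
     (\<forall>z\<in>K. norm (f' z - f z) \<le> \<epsilon>) \<and> (\<forall>z\<in>K \<inter> E. f' z = f z) \<and> f' analytic_on M \<and>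
     (\<forall>z\<in>M. norm (f' z - g z) \<le> \<epsilon>) \<and> (\<forall>z\<in>M \<inter> E. f' z = g z)"
proof -
  obtain u v where uv: "ratfun (if ent then {} else -W) u" "ratfun (if ent then {} else W) v" "f = (\<lambda>z. u z + v z)"
  proof (cases ent)
    case True
    then show ?thesis using that[of f "\<lambda>z. 0"] f ratfun_const[of "{}" 0] by auto
  next
    case False
    then show ?thesis using that ratfun_split[of f W] f by auto
  qed
  have KM: "K \<inter> M = {}" using assms(5,6) by auto
  have u: "u analytic_on M" by (rule ratfun_analytic[OF uv(1)]) (use assms(5) in auto)
  have v: "v analytic_on K" by (rule ratfun_analytic[OF uv(2)]) (use assms(6) in auto)
  have "(\<lambda>z. g z - u z) analytic_on M" by (intro analytic_intros g u)
  then obtain O1 where O1: "open O1" "M \<subseteq> O1" "(\<lambda>z. g z - u z) holomorphic_on O1"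
    unfolding analytic_on_holomorphic by blast
  obtain O2 where O2: "open O2" "K \<subseteq> O2" "v holomorphic_on O2"
    using v unfolding analytic_on_holomorphic by blast
  obtain S T where ST: "open S" "open T" "M \<subseteq> S" "K \<subseteq> T" "S \<inter> T = {}"
    using separation_normal[OF compact_imp_closed[OF assms(3)] compact_imp_closed[OF assms(2)]] KM by (metis Int_commute)
  define h where "h = (\<lambda>z. if z \<in> S then g z - u z else v z)"
  have holo: "h holomorphic_on (O1 \<inter> S) \<union> (O2 \<inter> T)"
  proof (rule holomorphic_on_Un)
    show "h holomorphic_on O1 \<inter> S"
      by (rule holomorphic_transform[OF holomorphic_on_subset[OF O1(3)]]) (auto simp: h_def)
    show "h holomorphic_on O2 \<inter> T"
      by (rule holomorphic_transform[OF holomorphic_on_subset[OF O2(3)]]) (use ST in \<open>auto simp: h_def\<close>)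
  qed (use O1 O2 ST in auto)
  have op: "open ((O1 \<inter> S) \<union> (O2 \<inter> T))" using O1 O2 ST by auto
  have sub: "K \<union> M \<subseteq> (O1 \<inter> S) \<union> (O2 \<inter> T)" using O1 O2 ST by auto
  have fin: "finite ((K \<union> M) \<inter> E)" using assms(9) by simp
  have "\<exists>r. ratfun (if ent then {} else -(K \<union> M)) r \<and>
      (\<forall>z\<in>K \<union> M. norm (h z - r z) \<le> \<epsilon>) \<and> (\<forall>z\<in>(K \<union> M) \<inter> E. r z = h z)"
    by (rule Runge_interpolating[OF compact_Un[OF assms(2,3)] op sub holo assms(10) _ fin Int_lower1])
      (rule assms(7))
  then obtain r where r: "ratfun (if ent then {} else -(K \<union> M)) r"
      "\<forall>z\<in>K \<union> M. norm (h z - r z) \<le> \<epsilon>" "\<forall>z\<in>(K \<union> M) \<inter> E. r z = h z"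
    by (elim exE conjE) (rule that)
  have r_an: "r analytic_on K \<union> M" by (rule ratfun_analytic[OF r(1)]) auto
  have hK: "h z = v z" if "z \<in> K" for z using that ST unfolding h_def by auto
  have hM: "h z = g z - u z" if "z \<in> M" for z using that ST unfolding h_def by auto
  show ?thesis
  proof (intro exI conjI ballI)
    show "ratfun (if ent then {} else UNIV) (\<lambda>z. u z + r z)"
      by (intro ratfun.add ratfun_mono[OF uv(1)] ratfun_mono[OF r(1)]) auto
    have "(\<lambda>z. r z - v z) analytic_on K"
      by (intro analytic_intros v analytic_on_subset[OF r_an]) auto
    then show "(\<lambda>z. u z + r z - f z) analytic_on K" by (simp add: uv(3))
    show "(\<lambda>z. u z + r z) analytic_on M"
      by (intro analytic_intros u analytic_on_subset[OF r_an]) auto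
    show "norm (u z + r z - f z) \<le> \<epsilon>" if "z \<in> K" for z
    proof -
      have "norm (h z - r z) \<le> \<epsilon>" using r(2) that by auto
      moreover have "h z - r z = - (u z + r z - f z)" using hK[OF that] by (simp add: uv(3))
      ultimately show ?thesis by (metis norm_minus_cancel)
    qed
    show "u z + r z = f z" if "z \<in> K \<inter> E" for z
      using r(3) hK[of z] that by (auto simp: uv(3))
    show "norm (u z + r z - g z) \<le> \<epsilon>" if "z \<in> M" for z
    proof -
      have "norm (h z - r z) \<le> \<epsilon>" using r(2) that by auto
      moreover have "h z - r z = - (u z + r z - g z)" using hM[OF that] by simp
      ultimately show ?thesis by (metis norm_minus_cancel)
    qed
    show "u z + r z = g z" if "z \<in> M \<inter> E" for z
      using r(3) hM[of z] that by auto
  qed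
qed

section \<open>Compact sets with connected complement\<close>

abbreviation (input) full :: "complex set \<Rightarrow> bool" where "full K \<equiv> connected (- K)"

text \<open>A separation of \<open>- A\<close> leaves the connected set
  \<open>- (A \<union> B)\<close> on one side. The other side is then contained in \<open>B\<close>,
  hence away from \<open>A\<close>, and would be both open and closed in the plane.\<close>

lemma full_clopen_part:
  assumes "closed A" "closed B" "A \<inter> B = {}" "full (A \<union> B)"
  shows "full A"
proof (rule ccontr)
  assume "\<not> full A"
  then obtain T1 T2 where T: "open T1" "open T2" "- A \<subseteq> T1 \<union> T2" "T1 \<inter> T2 \<inter> - A = {}"
      "T1 \<inter> - A \<noteq> {}" "T2 \<inter> - A \<noteq> {}"
    unfolding connected_def by blast
  define U1 where "U1 = T1 \<inter> -A"
  define U2 where "U2 = T2 \<inter> -A"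
  have U: "open U1" "open U2" "U1 \<union> U2 = - A" "U1 \<inter> U2 = {}" "U1 \<noteq> {}" "U2 \<noteq> {}"
    unfolding U1_def U2_def using T assms(1) by (auto simp: open_Compl)
  have *: False if V: "open V1" "open V2" "V1 \<union> V2 = - A" "V1 \<inter> V2 = {}" "V1 \<noteq> {}" "V2 \<noteq> {}"
    "- (A \<union> B) \<subseteq> V1" for V1 V2
  proof -
    have VB: "V2 \<subseteq> B" using V by auto
    then have "closure V2 \<subseteq> B" using assms(2) by (simp add: closure_minimal)
    moreover have "closure V2 \<inter> V1 = {}"
      using V(1,4) by (metis Int_commute open_Int_closure_eq_empty)
    ultimately have "closure V2 \<subseteq> V2" using V(3) assms(3) by blast
    then have "closed V2" by (metis closure_subset closure_eq subset_antisym)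
    then have "V2 = UNIV" using clopen[of V2] V by blast
    then show False using V by blast
  qed
  have "- (A \<union> B) \<subseteq> U1 \<or> - (A \<union> B) \<subseteq> U2"
  proof -
    have "U1 \<inter> -(A \<union> B) = {} \<or> U2 \<inter> -(A \<union> B) = {}"
      using connectedD[OF assms(4) U(1,2)] U by blast
    then show ?thesis using U by blast
  qed
  then show False using *[of U1 U2] *[of U2 U1] U by (metis Int_commute Un_commute)
qed

text \<open>Janiszewski's theorem; the intersection of the two sets is connected because it is
  empty.\<close>

lemma full_Un:
  assumes "compact S" "closed T" "S \<inter> T = {}" "full S" "full T"
  shows "full (S \<union> T)"
  unfolding connected_iff_connected_component
proof (intro ballI)
  fix a b assume "a \<in> - (S \<union> T)" "b \<in> - (S \<union> T)"
  then show "connected_component (- (S \<union> T)) a b"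
    using assms by (intro Janiszewski) (auto simp: connected_iff_connected_component)
qed

lemma full_UN:
  assumes "finite I" "\<And>i. i \<in> I \<Longrightarrow> compact (K i)" "\<And>i. i \<in> I \<Longrightarrow> full (K i)"
    "\<And>i j. i \<in> I \<Longrightarrow> j \<in> I \<Longrightarrow> i \<noteq> j \<Longrightarrow> K i \<inter> K j = {}"
  shows "full (\<Union>i\<in>I. K i)"
  using assms
proof (induction I rule: finite_induct)
  case empty then show ?case by (simp add: connected_UNIV)
next
  case (insert i I)
  have "full (K i \<union> (\<Union>i\<in>I. K i))"
  proof (rule full_Un)
    show "closed (\<Union>i\<in>I. K i)" using insert by (intro closed_UN) (auto simp: compact_imp_closed)
    show "K i \<inter> (\<Union>i\<in>I. K i) = {}" using insert.prems(3)[of i] insert.hyps by blast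
  qed (use insert in auto)
  then show ?case by simp
qed

text \<open>A homeomorphism between compact subsets of the plane need not extend to the plane, but
  by Borsuk's criterion it is a topological property of a compact set whether it separates the
  plane.\<close>

lemma full_image:
  assumes "compact K" "full K" "continuous_on K f" "inj_on f K"
  shows "full (f ` K)"
proof -
  have "K homeomorphic f ` K" using homeomorphic_compact[OF assms(1,3) refl assms(4)] .
  then show ?thesis
    using homeomorphic_Borsukian_eq Borsukian_separation_compact assms compact_continuous_image by blast
qed

lemma full_cball: "full (cball z r)"
  by (rule connected_complement_bounded_convex[OF bounded_cball convex_cball]) (simp add: DIM_complex)

lemma full_fill:
  assumes "compact K"
  shows "full (K \<union> inside K)" "compact (K \<union> inside K)"
proof -
  show "full (K \<union> inside K)"
    unfolding union_with_inside using connected_outside[OF compact_imp_bounded[OF assms]] by simp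
  have "closed (K \<union> inside K)" unfolding union_with_inside
    using open_outside[OF compact_imp_closed[OF assms]] by (simp add: closed_Compl)
  moreover have "bounded (K \<union> inside K)"
    using bounded_inside[OF compact_imp_bounded[OF assms]] compact_imp_bounded[OF assms] by simp
  ultimately show "compact (K \<union> inside K)" using compact_eq_bounded_closed by blast
qed

text \<open>A closed \<delta>-neighbourhood of \<open>K\<close> may have holes, and these are
  filled. The filled set stays in \<open>U\<close> if every point of the compact set
  \<open>C\<close> can be joined to a far point off the \<delta>-neighbourhood: a path in
  \<open>- K\<close> achieves this for one point and a small disc around it, and compactness gives
  one \<delta> for all.\<close>

lemma full_compact_nbhd:
  assumes K: "compact K" "full K" and U: "open U" "K \<subseteq> U"
  obtains K' where "compact K'" "full K'" "K \<subseteq> interior K'" "K' \<subseteq> U"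
proof (cases "K = {}")
  case True
  then show ?thesis using that[of "{}"] by (simp add: connected_UNIV)
next
  case False
  obtain R where R: "R > 0" "K \<subseteq> ball 0 R"
    using bounded_subset_ballD[OF compact_imp_bounded[OF K(1)]] by blast
  define N where "N = (\<lambda>\<delta>. {w. infdist w K \<le> \<delta>})"
  have N_mono: "N a \<subseteq> N b" if "a \<le> b" for a b using that unfolding N_def by auto
  have N_ball: "N \<delta> \<subseteq> ball 0 (R + 1)" if "\<delta> \<le> 1" for \<delta>
  proof
    fix w assume "w \<in> N \<delta>"
    then have "infdist w K \<le> 1" using that N_def by auto
    obtain k where k: "k \<in> K" "infdist w K = dist w k"
      using infdist_attains_inf[OF compact_imp_closed[OF K(1)] False, of w] by auto
    have "norm w \<le> norm k + dist w k" by (metis dist_norm norm_triangle_sub)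
    then show "w \<in> ball 0 (R + 1)" using k R \<open>infdist w K \<le> 1\<close> by auto
  qed
  define C where "C = cball 0 (R + 1) - (U \<inter> ball 0 R)"
  have C: "compact C" unfolding C_def using U(1) by (intro compact_diff) auto
  have CK: "C \<subseteq> -K" unfolding C_def using U R by auto
  define w where "w = complex_of_real (R + 2)"
  have w: "norm w = R + 2" unfolding w_def using R by (simp only: norm_of_real abs_of_pos)
  have wK: "w \<in> -K" using w R by auto
  have pc: "path_connected (-K)"
    using K connected_open_path_connected[of "-K"] by (simp add: compact_imp_closed open_Compl)
  have wout: "w \<in> outside (N \<delta>)" if "\<delta> \<le> 1" for \<delta>
  proof -
    have "outside (cball (0::complex) (R+1)) \<subseteq> outside (N \<delta>)"
      using N_ball[OF that] by (intro outside_mono) auto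
    moreover have "w \<in> - cball 0 (R+1)" using w by auto
    ultimately show ?thesis using outside_convex[of "cball 0 (R+1)"] by auto
  qed
  have loc: "\<exists>d. 0 < d \<and> d \<le> 1 \<and> ball z d \<subseteq> outside (N d)" if z: "z \<in> C" for z
  proof -
    obtain g where g: "path g" "path_image g \<subseteq> -K" "pathstart g = z" "pathfinish g = w"
      using pc z CK wK unfolding path_connected_def by blast
    have cg: "compact (path_image g)" using g(1) by (rule compact_path_image)
    obtain e where e: "e > 0" "\<And>x y. x \<in> path_image g \<Longrightarrow> y \<in> K \<Longrightarrow> e \<le> dist x y"
      using separate_compact_closed[OF cg compact_imp_closed[OF K(1)]] g(2) by blast
    define d where "d = min 1 (e/3)"
    have d: "d > 0" "d \<le> 1" "3 * d \<le> e" unfolding d_def using e(1) by auto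
    have far: "x \<notin> N d" if "p \<in> path_image g" "dist p x < d" for p x
    proof
      assume "x \<in> N d"
      then obtain k where k: "k \<in> K" "dist x k \<le> d"
        using infdist_attains_inf[OF compact_imp_closed[OF K(1)] False, of x]
        unfolding N_def by (metis mem_Collect_eq)
      have "e \<le> dist p k" using e(2) that(1) k by auto
      also have "\<dots> \<le> dist p x + dist x k" by (rule dist_triangle)
      finally show False using that k d by linarith
    qed
    have zi: "z \<in> path_image g" using g(3) pathstart_in_path_image by blast
    have "connected (ball z d \<union> path_image g)"
    proof (rule connected_Un)
      have "z \<in> ball z d" using d by simp
      then show "ball z d \<inter> path_image g \<noteq> {}" using zi by blast
    qed (use connected_path_image[OF g(1)] in auto)
    moreover have "ball z d \<union> path_image g \<subseteq> - N d"
      using far[OF zi] far[of _ _] d(1) by force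
    moreover have "w \<in> path_image g" using g(4) pathfinish_in_path_image by blast
    ultimately have "connected_component (- N d) w y" if "y \<in> ball z d" for y
      unfolding connected_component_def using that by (intro exI[of _ "ball z d \<union> path_image g"]) auto
    then have "ball z d \<subseteq> outside (N d)" using outside_same_component wout[OF d(2)] by blast
    then show ?thesis using d by blast
  qed
  have "\<exists>\<delta>. 0 < \<delta> \<and> \<delta> \<le> 1 \<and> C \<subseteq> outside (N \<delta>)"
  proof -
    from loc have "\<forall>z\<in>C. \<exists>d. 0 < d \<and> d \<le> 1 \<and> ball z d \<subseteq> outside (N d)" by blast
    from bchoice[OF this] obtain d where d: "\<forall>z\<in>C. 0 < d z \<and> d z \<le> 1 \<and> ball z (d z) \<subseteq> outside (N (d z))" by blast
    have "C \<subseteq> (\<Union>z\<in>C. ball z (d z))" using d by auto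
    from compactE_image[OF C _ this] obtain C' where C': "C' \<subseteq> C" "finite C'" "C \<subseteq> (\<Union>z\<in>C'. ball z (d z))" by auto
    define \<delta> where "\<delta> = Min (insert 1 (d ` C'))"
    have "\<delta> \<le> 1" "\<delta> > 0" "\<And>z. z \<in> C' \<Longrightarrow> \<delta> \<le> d z" unfolding \<delta>_def using C' d by auto
    moreover have "C \<subseteq> outside (N \<delta>)"
    proof
      fix x assume "x \<in> C"
      then obtain z where z: "z \<in> C'" "x \<in> ball z (d z)" using C'(3) by blast
      then have "x \<in> outside (N (d z))" using d C' by blast
      then show "x \<in> outside (N \<delta>)" using outside_mono[OF N_mono] \<open>\<And>z. z \<in> C' \<Longrightarrow> \<delta> \<le> d z\<close> z by blast
    qed
    ultimately show ?thesis by blast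
  qed
  then obtain \<delta> where \<delta>: "0 < \<delta>" "\<delta> \<le> 1" "C \<subseteq> outside (N \<delta>)" by blast
  have "closed (N \<delta>)" unfolding N_def
    by (intro closed_Collect_le continuous_intros)
  moreover have "bounded (N \<delta>)" using N_ball[OF \<delta>(2)] bounded_ball bounded_subset by blast
  ultimately have cN: "compact (N \<delta>)" using compact_eq_bounded_closed by blast
  show ?thesis
  proof
    show "compact (N \<delta> \<union> inside (N \<delta>))" "full (N \<delta> \<union> inside (N \<delta>))" using full_fill[OF cN] by auto
    have "K \<subseteq> (\<Union>k\<in>K. ball k \<delta>)" using \<delta> by auto
    moreover have "(\<Union>k\<in>K. ball k \<delta>) \<subseteq> N \<delta>"
      unfolding N_def by (auto intro: order_trans[OF infdist_le] simp: dist_commute less_imp_le)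
    ultimately show "K \<subseteq> interior (N \<delta> \<union> inside (N \<delta>))"
      by (meson interior_maximal open_UN open_ball order_trans sup_ge1)
    have "outside (N \<delta>) \<supseteq> - cball 0 (R+1)"
      using outside_mono[OF order_trans[OF N_ball[OF \<delta>(2)] ball_subset_cball]] outside_convex[OF convex_cball, of "0::complex" "R+1"] by simp
    then show "N \<delta> \<union> inside (N \<delta>) \<subseteq> U"
      unfolding union_with_inside using \<delta>(3) unfolding C_def by blast
  qed
qed

section \<open>Locally finite families of compact sets and adapted exhaustions\<close>

lemma closed_UN_locally_finite:
  fixes Z :: "nat \<Rightarrow> 'a::real_normed_vector set"
  assumes "\<And>n. closed (Z n)" "\<And>R. finite {n. Z n \<inter> cball 0 R \<noteq> {}}"
  shows "closed (\<Union>n\<in>I. Z n)"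
  unfolding closed_def open_contains_ball
proof
  fix x assume x: "x \<in> - (\<Union>n\<in>I. Z n)"
  define J where "J = I \<inter> {n. Z n \<inter> cball 0 (norm x + 1) \<noteq> {}}"
  have "finite J" unfolding J_def using assms(2) by blast
  then have op: "open (ball x 1 - (\<Union>n\<in>J. Z n))" using assms(1) by (intro open_Diff open_ball closed_UN) auto
  have "x \<in> ball x 1 - (\<Union>n\<in>J. Z n)" using x J_def by auto
  then obtain e where e: "e > 0" "ball x e \<subseteq> ball x 1 - (\<Union>n\<in>J. Z n)"
    by (rule openE[OF op])
  have "ball x e \<subseteq> - (\<Union>n\<in>I. Z n)"
  proof
    fix y assume "y \<in> ball x e"
    then have y: "dist x y < 1" "y \<notin> (\<Union>n\<in>J. Z n)" using e(2) by auto
    have "norm y \<le> norm x + dist x y" by (metis dist_commute dist_norm norm_triangle_sub)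
    then have "y \<in> cball 0 (norm x + 1)" using y by auto
    then show "y \<in> - (\<Union>n\<in>I. Z n)" using y(2) unfolding J_def by blast
  qed
  then show "\<exists>e>0. ball x e \<subseteq> - (\<Union>n\<in>I. Z n)" using e by blast
qed

lemma closed_UN_compact_locally_finite:
  fixes Z :: "nat \<Rightarrow> complex set"
  assumes "\<And>n. compact (Z n)" "\<And>R. finite {n. Z n \<inter> cball 0 R \<noteq> {}}"
  shows "closed (\<Union>n\<in>I. Z n)"
  using closed_UN_locally_finite[OF compact_imp_closed[OF assms(1)] assms(2)] .

text \<open>Otherwise the exterior of a disc, being connected, would lie in a single member, because
  each member and the union of the others are disjoint closed sets; but members are bounded.\<close>

lemma locally_finite_compl_unbounded:
  fixes Z :: "nat \<Rightarrow> complex set"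
  assumes "\<And>n. compact (Z n)" "disjoint_family Z" "\<And>R. finite {n. Z n \<inter> cball 0 R \<noteq> {}}"
  shows "\<exists>z. norm z > R \<and> z \<notin> (\<Union>n. Z n)"
proof (rule ccontr)
  assume "\<not> ?thesis"
  then have sub: "- cball 0 R \<subseteq> (\<Union>n. Z n)" by auto
  define S where "S = - cball (0::complex) R"
  have S: "connected S" unfolding S_def by (rule full_cball)
  define z where "z = complex_of_real (\<bar>R\<bar> + 1)"
  have nz: "norm (complex_of_real (\<bar>R\<bar> + t)) = \<bar>R\<bar> + t" if "t > 0" for t
    using that by (simp only: norm_of_real)
  have "z \<in> S" unfolding S_def z_def using nz[of 1] by simp
  then obtain n where n: "z \<in> Z n" using sub S_def by blast
  have "closed (Z n)" "closed (\<Union>m\<in>-{n}. Z m)"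
    using compact_imp_closed[OF assms(1)] closed_UN_compact_locally_finite[OF assms(1,3)] by auto
  moreover have un: "(\<Union>n. Z n) = Z n \<union> (\<Union>m\<in>-{n}. Z m)" by auto
  moreover have sub': "S \<subseteq> Z n \<union> (\<Union>m\<in>-{n}. Z m)" using sub unfolding S_def un .
  moreover have "Z n \<inter> (\<Union>m\<in>-{n}. Z m) \<inter> S = {}" using assms(2) unfolding disjoint_family_on_def by blast
  moreover have "Z n \<inter> S \<noteq> {}" using n \<open>z \<in> S\<close> by blast
  ultimately have "(\<Union>m\<in>-{n}. Z m) \<inter> S = {}" using connected_closedD[OF S, of "Z n" "\<Union>m\<in>-{n}. Z m"] by blast
  then have "S \<subseteq> Z n" using sub' by blast
  moreover obtain B where B: "\<forall>x\<in>Z n. norm x \<le> B" using compact_imp_bounded[OF assms(1)] bounded_iff by blast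
  moreover have "complex_of_real (\<bar>R\<bar> + (\<bar>B\<bar> + 1)) \<in> S" unfolding S_def using nz[of "\<bar>B\<bar> + 1"] by simp
  ultimately show False using nz[of "\<bar>B\<bar> + 1"] by fastforce
qed

lemma full_member:
  fixes Z :: "nat \<Rightarrow> complex set"
  assumes "\<And>n. compact (Z n)" "disjoint_family Z" "\<And>R. finite {n. Z n \<inter> cball 0 R \<noteq> {}}"
    "full (\<Union>n. Z n)"
  shows "full (Z n)"
proof (rule full_clopen_part)
  show "closed (Z n)" "closed (\<Union>m\<in>-{n}. Z m)"
    using compact_imp_closed[OF assms(1)] closed_UN_compact_locally_finite[OF assms(1,3)] by auto
  show "Z n \<inter> (\<Union>m\<in>-{n}. Z m) = {}" using assms(2) unfolding disjoint_family_on_def by blast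
  have "Z n \<union> (\<Union>m\<in>-{n}. Z m) = (\<Union>n. Z n)" by auto
  then show "full (Z n \<union> (\<Union>m\<in>-{n}. Z m))" using assms(4) by simp
qed

text \<open>Filling the holes may cut through a member: \<open>Z n\<close> can have parts inside and
  outside the filled set. The outer parts are added, and a slight thickening puts every member met
  so far into the interior without touching the others.\<close>

lemma full_hull_of_ball:
  fixes Z :: "nat \<Rightarrow> complex set"
  assumes Z: "\<And>n. compact (Z n)" "disjoint_family Z" "\<And>R. finite {n. Z n \<inter> cball 0 R \<noteq> {}}"
    "\<And>n. full (Z n)"
  obtains E where "compact E" "full E" "cball 0 R \<subseteq> E" "\<And>n. Z n \<subseteq> interior E \<or> Z n \<inter> E = {}"
proof -
  have disj: "Z m \<inter> Z n = {}" if "m \<noteq> n" for m n using Z(2) that unfolding disjoint_family_on_def by blast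
  define I1 where "I1 = {n. Z n \<inter> cball 0 R \<noteq> {}}"
  define H1 where "H1 = cball 0 R \<union> (\<Union>n\<in>I1. Z n)"
  have cH1: "compact H1" unfolding H1_def I1_def using Z by (intro compact_Un compact_UN) auto
  define H2 where "H2 = H1 \<union> inside H1"
  have H2: "compact H2" "full H2" unfolding H2_def using full_fill[OF cH1] by auto
  define I2 where "I2 = {n. Z n \<inter> H2 \<noteq> {}}"
  have finI2: "finite I2"
  proof -
    obtain B where "H2 \<subseteq> ball 0 B" using bounded_subset_ballD[OF compact_imp_bounded[OF H2(1)], of 0] by blast
    then have "H2 \<subseteq> cball 0 B" using ball_subset_cball by blast
    then have "I2 \<subseteq> {n. Z n \<inter> cball 0 B \<noteq> {}}" unfolding I2_def by blast
    then show ?thesis using Z(3) finite_subset by blast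
  qed
  have part: "compact (Z n - H2)" "full (Z n - H2)" for n
  proof -
    have "closed (Z n - H2) \<and> full (Z n - H2)"
    proof (cases "n \<in> I1")
      case True
      then have "Z n - H2 = {}" unfolding H2_def H1_def by blast
      then show ?thesis by (simp only: closed_empty) (simp add: connected_UNIV)
    next
      case False
      then have "Z n \<inter> cball 0 R = {}" unfolding I1_def by auto
      moreover have "Z n \<inter> Z m = {}" if "m \<in> I1" for m using disj[of n m] False that by blast
      ultimately have "Z n \<inter> H1 = {}" unfolding H1_def by blast
      \<comment> \<open>The filled set is bounded by points of \<open>H1\<close>, which
        \<open>Z n\<close> misses. So \<open>Z n\<close> falls into two closed parts, and the outer
        one inherits the connected complement.\<close>
      then have eq: "Z n - H2 = Z n - inside H1" "Z n - outside H1 = Z n \<inter> inside H1"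
        using inside_Un_outside[of H1] inside_Int_outside[of H1] unfolding H2_def by blast+
      have c: "closed (Z n - inside H1)" "closed (Z n - outside H1)"
        using Z(1) cH1 by (simp_all add: closed_Diff compact_imp_closed open_inside open_outside)
      moreover have "(Z n - inside H1) \<union> (Z n - outside H1) = Z n" using eq by blast
      moreover have "(Z n - inside H1) \<inter> (Z n - outside H1) = {}" using eq by blast
      ultimately show ?thesis using full_clopen_part[of "Z n - inside H1" "Z n - outside H1"] Z(4) eq(1) by simp
    qed
    then show "compact (Z n - H2)" "full (Z n - H2)" using compact_Int_closed[OF Z(1), of "Z n - H2" n]
      by (auto simp: Int_absorb1)
  qed
  define H3 where "H3 = H2 \<union> (\<Union>n\<in>I2. Z n - H2)"
  have H3: "compact H3" "full H3"
  proof -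
    have c: "compact (\<Union>n\<in>I2. Z n - H2)" using finI2 part by (intro compact_UN) auto
    have f: "full (\<Union>n\<in>I2. Z n - H2)" using finI2 part disj by (intro full_UN) blast+
    show "compact H3" unfolding H3_def by (rule compact_Un[OF H2(1) c])
    show "full H3" unfolding H3_def
      by (rule full_Un[OF H2(1) compact_imp_closed[OF c] _ H2(2) f]) blast
  qed
  have "open (- (\<Union>n\<in>-I2. Z n))"
    using closed_UN_compact_locally_finite[OF Z(1,3)] by (rule open_Compl)
  moreover have "H3 \<subseteq> - (\<Union>n\<in>-I2. Z n)"
  proof -
    have "H2 \<inter> Z m = {}" if "m \<in> -I2" for m using that unfolding I2_def by auto
    moreover have "(Z n - H2) \<inter> Z m = {}" if "n \<in> I2" "m \<in> -I2" for m n using disj[of n m] that by auto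
    ultimately show ?thesis unfolding H3_def by blast
  qed
  ultimately obtain E where E: "compact E" "full E" "H3 \<subseteq> interior E" "E \<subseteq> - (\<Union>n\<in>-I2. Z n)"
    using full_compact_nbhd[OF H3] by blast
  show ?thesis
  proof
    show "cball 0 R \<subseteq> E" using E(3) interior_subset unfolding H3_def H2_def H1_def by blast
    show "Z n \<subseteq> interior E \<or> Z n \<inter> E = {}" for n
    proof (cases "n \<in> I2")
      case True then have "Z n \<subseteq> H3" unfolding H3_def by blast
      then show ?thesis using E by blast
    qed (use E in blast)
  qed (use E in auto)
qed

text \<open>The radii are halved: if the half-size neighbourhoods of \<open>Z m\<close> and
  \<open>Z n\<close> met, the larger of the two full radii would reach from one set to the other.
  \<open>B n\<close> is a further obstacle, prescribed for each n separately.\<close>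

lemma separating_nbhds:
  fixes Z B :: "nat \<Rightarrow> complex set"
  assumes Z: "\<And>n. compact (Z n)" "disjoint_family Z" "\<And>R. finite {n. Z n \<inter> cball 0 R \<noteq> {}}"
    and B: "\<And>n. closed (B n)" "\<And>n. Z n \<inter> B n = {}"
  shows "\<exists>W. (\<forall>n. open (W n) \<and> Z n \<subseteq> W n \<and> W n \<inter> B n = {}) \<and> disjoint_family W"
proof -
  define F where "F = (\<lambda>n. B n \<union> (\<Union>m\<in>-{n}. Z m))"
  have "\<exists>e>0. (\<Union>z\<in>Z n. ball z e) \<subseteq> - F n" for n
  proof -
    have "closed (F n)" unfolding F_def
      using closed_Un[OF B(1) closed_UN_compact_locally_finite[OF Z(1,3)]] .
    moreover have "Z n \<subseteq> - F n" using B Z(2) unfolding F_def disjoint_family_on_def by blast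
    ultimately show ?thesis
      using compact_subset_open_imp_ball_epsilon_subset[OF Z(1), of "- F n" n] by (metis open_Compl)
  qed
  then obtain e where e: "\<And>n. e n > 0" "\<And>n. (\<Union>z\<in>Z n. ball z (e n)) \<subseteq> - F n" by metis
  define W where "W = (\<lambda>n. \<Union>z\<in>Z n. ball z (e n / 2))"
  show ?thesis
  proof (rule exI[of _ W], intro conjI allI)
    show "open (W n)" for n unfolding W_def by auto
    show "Z n \<subseteq> W n" for n unfolding W_def using e(1)[of n] by force
    show "W n \<inter> B n = {}" for n
    proof -
      have "W n \<subseteq> (\<Union>z\<in>Z n. ball z (e n))" unfolding W_def using e(1)[of n] by force
      then show ?thesis using e(2)[of n] unfolding F_def by blast
    qed
    show "disjoint_family W"
      unfolding disjoint_family_on_def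
    proof (intro ballI impI)
      fix m n :: nat assume "m \<noteq> n"
      show "W m \<inter> W n = {}"
      proof (rule ccontr)
        assume "W m \<inter> W n \<noteq> {}"
        then obtain y a b where y: "a \<in> Z m" "b \<in> Z n" "dist a y < e m / 2" "dist b y < e n / 2"
          unfolding W_def by auto
        have "dist a b \<le> dist a y + dist b y" by (metis dist_commute dist_triangle)
        then have "dist a b < e m \<or> dist b a < e n" using y by (auto simp: dist_commute)
        then have "b \<in> ball a (e m) \<or> a \<in> ball b (e n)" by simp
        then have "b \<in> - F m \<or> a \<in> - F n" using e(2)[of m] e(2)[of n] y(1,2) by blast
        then show False using y \<open>m \<noteq> n\<close> unfolding F_def by blast
      qed
    qed
  qed
qed

text \<open>In the entire case the hulls \<open>E' m\<close> swallow or miss each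
  \<open>Z n\<close>, but nothing links m to n. The sequence is slowed down until \<open>E s\<close>
  misses \<open>Z s\<close>, since stage s must act near \<open>Z s\<close> without touching
  \<open>E s\<close>. Squeezing \<open>W n\<close> between consecutive hulls lets it inherit the
  alternative.\<close>

lemma locally_finite_exhaustion:
  fixes Z :: "nat \<Rightarrow> complex set"
  assumes Z: "\<And>n. compact (Z n)" "disjoint_family Z" "\<And>R. finite {n. Z n \<inter> cball 0 R \<noteq> {}}"
    and Zfull: "\<And>n. ent \<Longrightarrow> full (Z n)" and D: "compact D" "\<And>n. Z n \<inter> D = {}"
  obtains E W where "\<And>s::nat. compact (E s)" "\<And>s. ent \<Longrightarrow> full (E s)" "\<And>s. E s \<subseteq> E (Suc s)"
    "\<And>R. \<exists>s. cball 0 R \<subseteq> E s" "\<And>s::nat. open (W s)" "\<And>s. Z s \<subseteq> W s" "disjoint_family W"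
    "\<And>s. W s \<inter> E s = {}" "\<And>s. W s \<inter> D = {}" "\<And>r s. ent \<Longrightarrow> W r \<subseteq> E s \<or> W r \<inter> E s = {}"
proof -
  define P where "P = (\<lambda>(m::nat) E. compact E \<and> cball 0 (real m) \<subseteq> E \<and>
     (ent \<longrightarrow> full E \<and> (\<forall>n. Z n \<subseteq> interior E \<or> Z n \<inter> E = {})))"
  have ex: "\<exists>E. P m E \<and> cball 0 R \<subseteq> E" for m R
  proof (cases ent)
    case True
    obtain E where E: "compact E" "full E" "cball 0 (max R (real m)) \<subseteq> E" "\<And>n. Z n \<subseteq> interior E \<or> Z n \<inter> E = {}"
      using full_hull_of_ball[OF Z Zfull[OF True], of "max R (real m)"] by blast
    have "cball (0::complex) R \<subseteq> cball 0 (max R (real m))" "cball (0::complex) (real m) \<subseteq> cball 0 (max R (real m))"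
      by auto
    then show ?thesis unfolding P_def using E by blast
  next
    case False
    have "P m (cball 0 (max R (real m)))" unfolding P_def using False by auto
    then show ?thesis by (intro exI[of _ "cball 0 (max R (real m))"]) auto
  qed
  have "\<exists>E'. \<forall>m. P m (E' m) \<and> E' m \<subseteq> E' (Suc m)"
  proof (rule dependent_nat_choice)
    show "\<exists>E. P 0 E" using ex by blast
    fix E and m assume "P m E"
    then obtain B where "E \<subseteq> ball 0 B"
      using bounded_subset_ballD[OF compact_imp_bounded, of E 0] unfolding P_def by blast
    then show "\<exists>F. P (Suc m) F \<and> E \<subseteq> F" using ex[of "Suc m" B] ball_subset_cball by blast
  qed
  then obtain E' where E': "\<And>m. P m (E' m)" "\<And>m. E' m \<subseteq> E' (Suc m)" by blast
  have mono: "E' a \<subseteq> E' b" if "a \<le> b" for a b using lift_Suc_mono_le[of E', OF E'(2) that] .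
  have E'c: "compact (E' m)" "cball 0 (real m) \<subseteq> E' m" "ent \<Longrightarrow> full (E' m)"
    "ent \<Longrightarrow> Z n \<subseteq> interior (E' m) \<or> Z n \<inter> E' m = {}" for m n
    using E'(1)[of m] unfolding P_def by auto
  define A where "A = (\<lambda>s m. m \<le> s \<and> (\<forall>n\<ge>s. Z n \<inter> E' m = {}))"
  define E where "E = (\<lambda>s. \<Union>m\<in>{m. A s m}. E' m)"
  have finA: "finite {m. A s m}" for s
    by (rule finite_subset[of _ "{..s}"]) (auto simp: A_def)
  have E_cases: "E s = {} \<or> (\<exists>m. A s m \<and> E s = E' m)" for s
  proof (cases "{m. A s m} = {}")
    case False
    define M where "M = Max {m. A s m}"
    have M: "A s M" "\<And>m. A s m \<Longrightarrow> m \<le> M" using Max_in[OF finA False] Max_ge[OF finA] unfolding M_def by auto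
    have "E' m \<subseteq> E' M" if "A s m" for m using mono[OF M(2)[OF that]] .
    then have "E s = E' M" unfolding E_def using M(1) by blast
    then show ?thesis using M by blast
  qed (auto simp: E_def)
  \<comment> \<open>The first hull that swallows \<open>Z n\<close>; in the entire case all earlier
    hulls miss \<open>Z n\<close>.\<close>
  define m0 where "m0 = (\<lambda>n. LEAST m. Z n \<subseteq> interior (E' m))"
  have m0: "Z n \<subseteq> interior (E' (m0 n))" for n
  proof -
    obtain B where B: "Z n \<subseteq> ball 0 B" using bounded_subset_ballD[OF compact_imp_bounded[OF Z(1)], of n 0] by blast
    obtain m :: nat where "B \<le> real m" using real_arch_simple by blast
    then have "Z n \<subseteq> ball 0 (real m)" using B subset_ball by blast
    then have "Z n \<subseteq> interior (E' m)" using E'c(2)[of m] ball_subset_cball[of 0 "real m"]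
      by (meson interior_maximal open_ball order_trans)
    then show ?thesis unfolding m0_def by (rule LeastI)
  qed
  have m0_less: "Z n \<inter> E' m = {}" if "m < m0 n" ent for m n
    using not_less_Least[of m "\<lambda>m. Z n \<subseteq> interior (E' m)"] that E'c(4)[of n m] unfolding m0_def by blast
  \<comment> \<open>Avoiding \<open>B n\<close> puts \<open>W n\<close> inside the hull with index
    \<open>m0 n\<close> and outside the preceding one, if there is one. Hence every other hull
    contains or misses \<open>W n\<close> as well.\<close>
  define B where "B = (\<lambda>n. D \<union> E n \<union> (if ent then - interior (E' (m0 n)) \<union>
      (if m0 n = 0 then {} else E' (m0 n - 1)) else {}))"
  have ZE: "Z n \<inter> E n = {}" for n using E_cases[of n] unfolding A_def by blast
  have cE: "compact (E s)" for s using E_cases[of s] E'c(1) by auto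
  have "closed (B n)" for n unfolding B_def
    using compact_imp_closed[OF D(1)] compact_imp_closed[OF cE] compact_imp_closed[OF E'c(1)]
    by (auto intro!: closed_Un closed_Compl)
  moreover have "Z n \<inter> B n = {}" for n
  proof -
    have "Z n \<inter> E' (m0 n - 1) = {}" if ent "m0 n \<noteq> 0" using m0_less[of "m0 n - 1" n] that by auto
    then show ?thesis unfolding B_def using D(2)[of n] ZE[of n] m0[of n] by auto
  qed
  ultimately have "\<exists>W. (\<forall>n. open (W n) \<and> Z n \<subseteq> W n \<and> W n \<inter> B n = {}) \<and> disjoint_family W"
    by (rule separating_nbhds[OF Z])
  then obtain W where W': "(\<forall>n. open (W n) \<and> Z n \<subseteq> W n \<and> W n \<inter> B n = {}) \<and> disjoint_family W"
    by (elim exE) (rule that)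
  then have W: "open (W n)" "Z n \<subseteq> W n" "disjoint_family W" "W n \<inter> B n = {}" for n by simp_all
  show ?thesis
  proof
    show "compact (E s)" for s by (rule cE)
    show "full (E s)" if ent for s
      using E_cases[of s] E'c(3)[OF that] by (auto simp: connected_UNIV)
    show "E s \<subseteq> E (Suc s)" for s
    proof -
      have "A (Suc s) m" if "A s m" for m using that unfolding A_def by (meson Suc_leD le_SucI)
      then show ?thesis unfolding E_def by blast
    qed
    show "\<exists>s. cball 0 R \<subseteq> E s" for R
    proof -
      obtain m :: nat where m: "R \<le> real m" using real_arch_simple by blast
      obtain Q where "E' m \<subseteq> ball 0 Q" using bounded_subset_ballD[OF compact_imp_bounded[OF E'c(1)], of m 0] by blast
      then have "{n. Z n \<inter> E' m \<noteq> {}} \<subseteq> {n. Z n \<inter> cball 0 Q \<noteq> {}}" using ball_subset_cball by blast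
      then have "finite {n. Z n \<inter> E' m \<noteq> {}}" using Z(3) finite_subset by blast
      then obtain N where N: "\<forall>n\<in>{n. Z n \<inter> E' m \<noteq> {}}. n < N" using finite_nat_set_iff_bounded by blast
      have "A (max m N) m" unfolding A_def using N by (metis (mono_tags, lifting) leD max.bounded_iff max.cobounded1 mem_Collect_eq)
      then have "E' m \<subseteq> E (max m N)" unfolding E_def by blast
      moreover have "cball (0::complex) R \<subseteq> cball 0 (real m)" using m by auto
      ultimately show ?thesis using E'c(2)[of m] by blast
    qed
    show "open (W s)" "Z s \<subseteq> W s" "disjoint_family W" for s using W by auto
    show "W s \<inter> E s = {}" "W s \<inter> D = {}" for s using W(4)[of s] unfolding B_def by auto
    show "W r \<subseteq> E s \<or> W r \<inter> E s = {}" if ent for r s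
    proof (cases "E s = {}")
      case False
      then obtain m where m: "E s = E' m" using E_cases by blast
      show ?thesis
      proof (cases "m0 r \<le> m")
        case True
        have "W r \<subseteq> interior (E' (m0 r))" using W(4)[of r] that unfolding B_def by auto
        then show ?thesis using mono[OF True] interior_subset m by blast
      next
        case False
        then have "m0 r \<noteq> 0" "m \<le> m0 r - 1" by auto
        moreover have "W r \<inter> E' (m0 r - 1) = {}" using W(4)[of r] that \<open>m0 r \<noteq> 0\<close> unfolding B_def by auto
        ultimately show ?thesis using mono m by blast
      qed
    qed auto
  qed
qed

section \<open>Smooth functions on open sets\<close>

text \<open>Derivatives are taken at the points of \<open>S\<close>, not within \<open>S\<close>, so
  the notion is meant for open sets, where it is local.\<close>

primrec C_k_on :: "nat \<Rightarrow> complex set \<Rightarrow> (complex \<Rightarrow> complex) \<Rightarrow> bool" where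
  "C_k_on 0 S f \<longleftrightarrow> continuous_on S f"
| "C_k_on (Suc k) S f \<longleftrightarrow>
     (\<forall>z\<in>S. f differentiable (at z)) \<and> (\<forall>v. C_k_on k S (\<lambda>z. frechet_derivative f (at z) v))"

lemma C_k_eq_C_k_on_UNIV: "C_k k f \<longleftrightarrow> C_k_on k UNIV f"
proof (induction k arbitrary: f)
  case (Suc k)
  show ?case unfolding C_k.simps C_k_on.simps Suc by simp
qed simp

lemma C_k_on_cong:
  assumes "open S" "\<And>z. z \<in> S \<Longrightarrow> f z = g z" "C_k_on k S f"
  shows "C_k_on k S g"
  using assms(2,3)
proof (induction k arbitrary: f g)
  case 0
  then show ?case using continuous_on_cong[of S S f g] by simp
next
  case (Suc k)
  have d: "(g has_derivative frechet_derivative f (at z)) (at z)" if "z \<in> S" for z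
    using Suc.prems that assms(1) by (auto intro!: has_derivative_transform_within_open[of f _ z UNIV S g]
        simp: frechet_derivative_works[symmetric])
  have "C_k_on k S (\<lambda>z. frechet_derivative g (at z) v)" for v
  proof (rule Suc.IH)
    show "C_k_on k S (\<lambda>z. frechet_derivative f (at z) v)" using Suc.prems by simp
  qed (metis d frechet_derivative_at)
  then show ?case using d unfolding C_k_on.simps differentiable_def by blast
qed

lemma C_k_on_subset: "C_k_on k S f \<Longrightarrow> T \<subseteq> S \<Longrightarrow> C_k_on k T f"
proof (induction k arbitrary: f)
  case 0 then show ?case using continuous_on_subset by simp blast
next
  case (Suc k)
  then show ?case unfolding C_k_on.simps by blast
qed

lemma C_k_on_SucD: "C_k_on (Suc k) S f \<Longrightarrow> C_k_on k S f"
proof (induction k arbitrary: f)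
  case 0
  then have "f differentiable (at z)" if "z \<in> S" for z using that by simp
  then have "isCont f z" if "z \<in> S" for z using that differentiable_imp_continuous_within by blast
  then show ?case by (auto intro!: continuous_at_imp_continuous_on)
next
  case (Suc k)
  have "C_k_on k S (\<lambda>z. frechet_derivative f (at z) v)" for v
    using Suc.prems unfolding C_k_on.simps(2)[of "Suc k"] by (blast intro: Suc.IH)
  then show ?case using Suc.prems unfolding C_k_on.simps(2) by blast
qed

lemma C_k_on_local:
  assumes "open S" "\<And>z. z \<in> S \<Longrightarrow> \<exists>T. open T \<and> z \<in> T \<and> C_k_on k T f"
  shows "C_k_on k S f"
  using assms(2)
proof (induction k arbitrary: f)
  case 0
  have "isCont f z" if "z \<in> S" for z
    using 0[OF that] by (auto simp: continuous_on_eq_continuous_at)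
  then show ?case using assms(1) by (simp add: continuous_on_eq_continuous_at)
next
  case (Suc k)
  show ?case unfolding C_k_on.simps
  proof (intro conjI allI ballI)
    show "f differentiable (at z)" if "z \<in> S" for z using Suc.prems[OF that] by auto
    show "C_k_on k S (\<lambda>z. frechet_derivative f (at z) v)" for v
    proof (rule Suc.IH)
      fix z assume "z \<in> S"
      then obtain T where "open T" "z \<in> T" "C_k_on (Suc k) T f" using Suc.prems by blast
      then show "\<exists>T. open T \<and> z \<in> T \<and> C_k_on k T (\<lambda>z. frechet_derivative f (at z) v)" by auto
    qed
  qed
qed

text \<open>\<open>frechet_derivative\<close> is a choice term; by uniqueness of derivatives any
  explicit \<open>f'\<close> may stand in for it.\<close>

lemma C_k_on_SucI:
  assumes "open S" "\<And>z. z \<in> S \<Longrightarrow> (f has_derivative f' z) (at z)" "\<And>v. C_k_on k S (\<lambda>z. f' z v)"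
  shows "C_k_on (Suc k) S f"
  unfolding C_k_on.simps
proof (intro conjI allI ballI)
  show "f differentiable (at z)" if "z \<in> S" for z using assms(2)[OF that] unfolding differentiable_def by blast
  show "C_k_on k S (\<lambda>z. frechet_derivative f (at z) v)" for v
  proof (rule C_k_on_cong[OF assms(1) _ assms(3)[of v]])
    fix z assume "z \<in> S"
    then show "f' z v = frechet_derivative f (at z) v" using frechet_derivative_at[OF assms(2)] by metis
  qed
qed

lemma C_k_on_has_derivative:
  "C_k_on (Suc k) S f \<Longrightarrow> z \<in> S \<Longrightarrow> (f has_derivative frechet_derivative f (at z)) (at z)"
  using frechet_derivative_works[of f "at z"] by simp

lemma C_k_on_const: "open S \<Longrightarrow> C_k_on k S (\<lambda>z. c)"
proof (induction k arbitrary: c)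
  case (Suc k)
  show ?case by (rule C_k_on_SucI[OF Suc(2) has_derivative_const]) (use Suc in simp)
qed simp

lemma C_k_on_linear:
  assumes "open S" "bounded_linear L" "C_k_on k S f"
  shows "C_k_on k S (\<lambda>z. L (f z))"
  using assms(3)
proof (induction k arbitrary: f)
  case 0 then show ?case using bounded_linear.continuous_on[OF assms(2)] by simp
next
  case (Suc k)
  show ?case
  proof (rule C_k_on_SucI[OF assms(1)])
    show "((\<lambda>z. L (f z)) has_derivative (\<lambda>v. L (frechet_derivative f (at z) v))) (at z)" if "z \<in> S" for z
      by (rule bounded_linear.has_derivative[OF assms(2) C_k_on_has_derivative[OF Suc.prems that]])
    show "C_k_on k S (\<lambda>z. L (frechet_derivative f (at z) v))" for v
      by (rule Suc.IH) (use Suc.prems in simp)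
  qed
qed

lemma C_k_on_id: "open S \<Longrightarrow> C_k_on k S (\<lambda>z. z)"
proof (cases k)
  case (Suc j)
  assume "open S"
  then show ?thesis unfolding Suc
    by (intro C_k_on_SucI[where f'="\<lambda>z v. v"] has_derivative_ident C_k_on_const)
qed simp

lemma C_k_on_add:
  assumes "open S" "C_k_on k S f" "C_k_on k S g"
  shows "C_k_on k S (\<lambda>z. f z + g z)"
  using assms(2,3)
proof (induction k arbitrary: f g)
  case 0 then show ?case by (auto intro: continuous_intros)
next
  case (Suc k)
  show ?case
  proof (rule C_k_on_SucI[OF assms(1)])
    show "((\<lambda>z. f z + g z) has_derivative (\<lambda>v. frechet_derivative f (at z) v + frechet_derivative g (at z) v)) (at z)" if "z \<in> S" for z
      by (intro has_derivative_add C_k_on_has_derivative[OF Suc.prems(1) that] C_k_on_has_derivative[OF Suc.prems(2) that])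
    show "C_k_on k S (\<lambda>z. frechet_derivative f (at z) v + frechet_derivative g (at z) v)" for v
      by (rule Suc.IH) (use Suc.prems in simp_all)
  qed
qed

lemma C_k_on_mult:
  assumes "open S" "C_k_on k S f" "C_k_on k S g"
  shows "C_k_on k S (\<lambda>z. f z * g z)"
  using assms(2,3)
proof (induction k arbitrary: f g)
  case 0 then show ?case by (auto intro: continuous_intros)
next
  case (Suc k)
  show ?case
  proof (rule C_k_on_SucI[OF assms(1)])
    show "((\<lambda>z. f z * g z) has_derivative (\<lambda>v. f z * frechet_derivative g (at z) v + frechet_derivative f (at z) v * g z)) (at z)" if "z \<in> S" for z
      by (intro has_derivative_mult C_k_on_has_derivative[OF Suc.prems(1) that] C_k_on_has_derivative[OF Suc.prems(2) that])
    show "C_k_on k S (\<lambda>z. f z * frechet_derivative g (at z) v + frechet_derivative f (at z) v * g z)" for v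
      by (intro C_k_on_add[OF assms(1)] Suc.IH C_k_on_SucD[OF Suc.prems(1)] C_k_on_SucD[OF Suc.prems(2)])
         (use Suc.prems in simp_all)
  qed
qed

lemma C_k_on_sum:
  assumes "open S" "\<And>i. i \<in> I \<Longrightarrow> C_k_on k S (f i)"
  shows "C_k_on k S (\<lambda>z. \<Sum>i\<in>I. f i z)"
proof (cases "finite I")
  case True
  then show ?thesis using assms(2)
    by (induction I rule: finite_induct) (auto intro: C_k_on_add C_k_on_const assms(1))
qed (simp add: C_k_on_const assms(1))

lemma C_k_on_inverse:
  assumes "open S" "C_k_on k S f" "\<And>z. z \<in> S \<Longrightarrow> f z \<noteq> 0"
  shows "C_k_on k S (\<lambda>z. inverse (f z))"
  using assms(2)
proof (induction k)
  case 0 then show ?case using assms(3) by (auto intro: continuous_intros)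
next
  case (Suc k)
  have i: "C_k_on k S (\<lambda>z. inverse (f z))" by (rule Suc.IH[OF C_k_on_SucD[OF Suc.prems]])
  show ?case
  proof (rule C_k_on_SucI[OF assms(1)])
    show "((\<lambda>z. inverse (f z)) has_derivative (\<lambda>v. - (inverse (f z) * frechet_derivative f (at z) v * inverse (f z)))) (at z)" if "z \<in> S" for z
      by (rule Deriv.has_derivative_inverse[OF assms(3)[OF that] C_k_on_has_derivative[OF Suc.prems that]])
    show "C_k_on k S (\<lambda>z. - (inverse (f z) * frechet_derivative f (at z) v * inverse (f z)))" for v
      by (intro C_k_on_linear[OF assms(1) bounded_linear_minus[OF bounded_linear_ident]] C_k_on_mult[OF assms(1)] i)
        (use Suc.prems in simp)
  qed
qed

lemma bounded_linear_Re: "bounded_linear (\<lambda>z. complex_of_real (Re z))"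
  using bounded_linear_compose[OF bounded_linear_of_real bounded_linear_Re] .

lemma bounded_linear_Im: "bounded_linear (\<lambda>z. complex_of_real (Im z))"
  using bounded_linear_compose[OF bounded_linear_of_real bounded_linear_Im] .

text \<open>A real-linear map of the plane is determined by its values at 1 and \<open>\<i>\<close>.
  In this form a derivative applied to a varying vector, as in the chain rule, becomes a sum of
  products, to which induction on the order of smoothness applies.\<close>

lemma linear_complex_decomp:
  fixes L :: "complex \<Rightarrow> complex"
  assumes "bounded_linear L"
  shows "L v = Re v * L 1 + Im v * L \<i>"
proof -
  have l: "linear L" using assms by (rule bounded_linear.linear)
  have "v = Re v *\<^sub>R 1 + Im v *\<^sub>R \<i>" by (simp add: complex_eq_iff)
  then have "L v = L (Re v *\<^sub>R 1 + Im v *\<^sub>R \<i>)" by (rule arg_cong)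
  also have "\<dots> = Re v *\<^sub>R L 1 + Im v *\<^sub>R L \<i>" by (simp only: linear_add[OF l] linear_scale[OF l])
  finally show ?thesis by (simp add: scaleR_conv_of_real)
qed

lemma C_k_on_compose:
  assumes "open S" "open T" "C_k_on k S g" "C_k_on k T f" "g ` S \<subseteq> T"
  shows "C_k_on k S (\<lambda>z. f (g z))"
  using assms(3,4)
proof (induction k arbitrary: f)
  case 0 then show ?case using assms(5) by (auto intro: continuous_on_compose2)
next
  case (Suc k)
  show ?case
  proof (rule C_k_on_SucI[OF assms(1)])
    fix z assume z: "z \<in> S"
    have gz: "g z \<in> T" using z assms(5) by auto
    have df: "(f has_derivative frechet_derivative f (at (g z))) (at (g z))"
      by (rule C_k_on_has_derivative[OF Suc.prems(2) gz])
    have "((\<lambda>z. f (g z)) has_derivative (\<lambda>v. frechet_derivative f (at (g z)) (frechet_derivative g (at z) v))) (at z)"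
      by (rule has_derivative_compose[OF C_k_on_has_derivative[OF Suc.prems(1) z] df])
    also have "(\<lambda>v. frechet_derivative f (at (g z)) (frechet_derivative g (at z) v)) =
      (\<lambda>v. Re (frechet_derivative g (at z) v) * frechet_derivative f (at (g z)) 1 +
           Im (frechet_derivative g (at z) v) * frechet_derivative f (at (g z)) \<i>)"
      by (rule ext, rule linear_complex_decomp[OF has_derivative_bounded_linear[OF df]])
    finally show "((\<lambda>z. f (g z)) has_derivative (\<lambda>v. Re (frechet_derivative g (at z) v) * frechet_derivative f (at (g z)) 1 +
           Im (frechet_derivative g (at z) v) * frechet_derivative f (at (g z)) \<i>)) (at z)" .
  next
    fix v
    have g: "C_k_on k S (\<lambda>z. frechet_derivative g (at z) v)" using Suc.prems by simp
    have f: "C_k_on k S (\<lambda>z. frechet_derivative f (at (g z)) w)" for w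
      by (rule Suc.IH[OF C_k_on_SucD[OF Suc.prems(1)], of "\<lambda>z. frechet_derivative f (at z) w"])
        (use Suc.prems(2) in simp)
    show "C_k_on k S (\<lambda>z. Re (frechet_derivative g (at z) v) * frechet_derivative f (at (g z)) 1 +
           Im (frechet_derivative g (at z) v) * frechet_derivative f (at (g z)) \<i>)"
      by (intro C_k_on_add[OF assms(1)] C_k_on_mult[OF assms(1)] f
          C_k_on_linear[OF assms(1) bounded_linear_Re g] C_k_on_linear[OF assms(1) bounded_linear_Im g])
  qed
qed

lemma C_k_on_holomorphic:
  assumes "open S" "f holomorphic_on S"
  shows "C_k_on k S f"
  using assms(2)
proof (induction k arbitrary: f)
  case 0 then show ?case by (simp add: holomorphic_on_imp_continuous_on)
next
  case (Suc k)
  show ?case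
  proof (rule C_k_on_SucI[OF assms(1)])
    show "(f has_derivative (\<lambda>v. deriv f z * v)) (at z)" if "z \<in> S" for z
      using holomorphic_derivI[OF Suc.prems assms(1) that] by (simp add: has_field_derivative_def)
    show "C_k_on k S (\<lambda>z. deriv f z * v)" for v
      by (intro C_k_on_mult C_k_on_const assms(1) Suc.IH holomorphic_deriv Suc.prems)
  qed
qed

section \<open>Flat functions and smooth cutoffs\<close>

definition flat_exp :: "nat \<Rightarrow> real \<Rightarrow> real" where
  "flat_exp m x = (if x > 0 then inverse x ^ m * exp (- inverse x) else 0)"

lemma flat_exp_over_x: "((\<lambda>x. flat_exp m x / x) \<longlongrightarrow> 0) (at 0)"
proof -
  have "((\<lambda>t::real. t ^ Suc m / exp t) \<longlongrightarrow> 0) at_top" by (rule tendsto_power_div_exp_0)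
  from filterlim_compose[OF this filterlim_inverse_at_top_right]
  have "((\<lambda>x::real. inverse x ^ Suc m / exp (inverse x)) \<longlongrightarrow> 0) (at_right 0)" .
  moreover have "\<forall>\<^sub>F x in at_right 0. inverse x ^ Suc m / exp (inverse x) = flat_exp m x / x"
    unfolding eventually_at_right_field
    by (intro exI[of _ 1]) (auto simp: flat_exp_def exp_minus divide_simps)
  ultimately have r: "((\<lambda>x. flat_exp m x / x) \<longlongrightarrow> 0) (at_right 0)" using tendsto_cong by fast
  have "((\<lambda>x. flat_exp m x / x) \<longlongrightarrow> 0) (at_left 0)"
    by (rule tendsto_eventually) (auto simp: flat_exp_def eventually_at_left_field intro: exI[of _ "-1"])
  then show ?thesis using r filterlim_split_at by blast
qed

text \<open>The powers of \<open>inverse x\<close> are part of \<open>flat_exp\<close> so that the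
  linear span of the family is closed under differentiation; the exponential factor beats them all
  at 0.\<close>

lemma DERIV_flat_exp:
  "(flat_exp m has_real_derivative (- real m * flat_exp (Suc m) x + flat_exp (Suc (Suc m)) x)) (at x)"
proof (cases x "0::real" rule: linorder_cases)
  case less
  have "(flat_exp m has_real_derivative 0) (at x)"
    by (rule has_field_derivative_transform_within_open[where f="\<lambda>_. 0" and S="{..<0}"]) (use less in \<open>auto simp: flat_exp_def\<close>)
  then show ?thesis using less by (simp add: flat_exp_def)
next
  case equal
  have "(flat_exp m has_real_derivative 0) (at 0)"
    unfolding DERIV_def using flat_exp_over_x[of m] by (simp add: flat_exp_def[of m 0])
  then show ?thesis using equal by (simp add: flat_exp_def)
next
  case greater
  have d1: "((\<lambda>x. inverse x ^ m) has_real_derivative real m * (- (inverse x ^ Suc (Suc 0)) * inverse x ^ (m - Suc 0))) (at x)"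
    using DERIV_power[OF DERIV_inverse[of x], of m] greater by simp
  have e: "real m * (- (inverse x ^ Suc (Suc 0)) * inverse x ^ (m - Suc 0)) = - real m * inverse x ^ Suc m"
    by (cases m) (auto simp: algebra_simps)
  have d2: "((\<lambda>x. exp (- inverse x)) has_real_derivative exp (- inverse x) * inverse x ^ Suc (Suc 0)) (at x)"
    using greater by (auto intro!: derivative_eq_intros simp: power2_eq_square)
  have "((\<lambda>x. inverse x ^ m * exp (- inverse x)) has_real_derivative
     (- real m * inverse x ^ Suc m) * exp (- inverse x) + exp (- inverse x) * inverse x ^ Suc (Suc 0) * inverse x ^ m) (at x)"
    by (rule DERIV_mult[OF d1[unfolded e] d2])
  then have "((\<lambda>x. inverse x ^ m * exp (- inverse x)) has_real_derivative
     (- real m * (inverse x ^ Suc m * exp (- inverse x)) + inverse x ^ Suc (Suc m) * exp (- inverse x))) (at x)"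
    by (simp add: mult_ac)
  then have "(flat_exp m has_real_derivative
     (- real m * (inverse x ^ Suc m * exp (- inverse x)) + inverse x ^ Suc (Suc m) * exp (- inverse x))) (at x)"
    by (rule has_field_derivative_transform_within_open[where S="{0<..}"]) (use greater in \<open>auto simp: flat_exp_def\<close>)
  then show ?thesis using greater by (simp add: flat_exp_def)
qed

lemma C_k_on_flat_exp: "C_k_on k UNIV (\<lambda>z. complex_of_real (flat_exp m (Re z)))"
proof (induction k arbitrary: m)
  case 0
  have "continuous_on UNIV (flat_exp m)"
    using DERIV_flat_exp DERIV_isCont by (simp add: continuous_on_eq_continuous_at) blast
  then have "continuous_on UNIV (\<lambda>z. flat_exp m (Re z))"
    by (rule continuous_on_compose2) (auto intro: continuous_intros)
  then show ?case by (auto intro: continuous_intros)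
next
  case (Suc k)
  show ?case
  proof (rule C_k_on_SucI[OF open_UNIV])
    fix z :: complex
    have "((\<lambda>z. flat_exp m (Re z)) has_derivative (\<lambda>v. (- real m * flat_exp (Suc m) (Re z) + flat_exp (Suc (Suc m)) (Re z)) * Re v)) (at z)"
      using has_derivative_compose[OF _ DERIV_flat_exp[unfolded has_field_derivative_def], of Re Re z UNIV m]
        bounded_linear_imp_has_derivative[OF Complex.bounded_linear_Re] by simp
    then show "((\<lambda>z. complex_of_real (flat_exp m (Re z))) has_derivative
      (\<lambda>v. (- of_nat m * complex_of_real (flat_exp (Suc m) (Re z)) + complex_of_real (flat_exp (Suc (Suc m)) (Re z))) * complex_of_real (Re v))) (at z)"
      using bounded_linear.has_derivative[OF bounded_linear_of_real] by fastforce
  next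
    fix v :: complex
    show "C_k_on k UNIV (\<lambda>z. (- of_nat m * complex_of_real (flat_exp (Suc m) (Re z)) + complex_of_real (flat_exp (Suc (Suc m)) (Re z))) * complex_of_real (Re v))"
      by (intro C_k_on_mult C_k_on_add C_k_on_const open_UNIV Suc.IH)
  qed
qed

lemma open_UN_ball_cover:
  fixes K :: "complex set"
  assumes "compact K" "open U" "K \<subseteq> U"
  obtains P r where "finite P" "P \<subseteq> K" "r > 0" "K \<subseteq> (\<Union>p\<in>P. ball p r)" "\<And>p. p \<in> P \<Longrightarrow> cball p (2 * r) \<subseteq> U"
proof -
  obtain d where d: "d > 0" "(\<Union>z\<in>K. ball z d) \<subseteq> U"
    using compact_subset_open_imp_ball_epsilon_subset[OF assms] by blast
  have "K \<subseteq> (\<Union>p\<in>K. ball p (d/3))" using d by auto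
  from compactE_image[OF assms(1) _ this] obtain P where P: "P \<subseteq> K" "finite P" "K \<subseteq> (\<Union>p\<in>P. ball p (d/3))" by auto
  show ?thesis
  proof
    show "cball p (2 * (d/3)) \<subseteq> U" if "p \<in> P" for p
    proof -
      have "cball p (2 * (d/3)) \<subseteq> ball p d" using d by auto
      also have "\<dots> \<subseteq> U" using d P that by blast
      finally show ?thesis .
    qed
  qed (use P d in auto)
qed

text \<open>A sum \<open>S\<close> of flat bumps on finitely many discs has a positive minimum
  \<open>m\<close> near \<open>K\<close>. With h the flat exponential, the smooth step h(x) / (h(x)
  + h(1 - x)) at x = S / m equals 1 as soon as \<open>S\<close> is at least \<open>m\<close>. Being
  1 on an open set \<open>N\<close>, not only on \<open>K\<close>, is what later leaves a
  holomorphic function unchanged near \<open>K\<close>.\<close>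

lemma smooth_cutoff:
  assumes "compact K" "open U" "K \<subseteq> U"
  shows "\<exists>bump L N. (\<forall>k. C_k_on k UNIV bump) \<and> compact L \<and> L \<subseteq> U \<and> open N \<and> K \<subseteq> N \<and> N \<subseteq> L \<and>
    (\<forall>z\<in>N. bump z = 1) \<and> (\<forall>z. z \<notin> L \<longrightarrow> bump z = 0) \<and> (\<forall>z. norm (bump z) \<le> 1)"
proof (cases "K = {}")
  case True
  then show ?thesis
    by (intro exI[of _ "\<lambda>z. 0"] exI[of _ "{}"]) (simp add: C_k_on_const)
next
  case False
  obtain P r where P: "finite P" "P \<subseteq> K" "r > 0" "K \<subseteq> (\<Union>p\<in>P. ball p r)" "\<And>p. p \<in> P \<Longrightarrow> cball p (2 * r) \<subseteq> U"
    using open_UN_ball_cover[OF assms] by blast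
  define N where "N = (\<Union>p\<in>P. ball p r)"
  define N' where "N' = (\<Union>p\<in>P. cball p r)"
  define L where "L = (\<Union>p\<in>P. cball p (2*r))"
  \<comment> \<open>The squared distance is smooth also at \<open>p\<close>; \<open>q p\<close> is
    positive exactly on the open disc of radius \<open>2 * r\<close>.\<close>
  define q where "q = (\<lambda>(p::complex) z. (2*r)\<^sup>2 - (norm (z - p))\<^sup>2)"
  define S where "S = (\<lambda>z. \<Sum>p\<in>P. flat_exp 0 (q p z))"
  have h_pos: "flat_exp 0 x > 0 \<longleftrightarrow> x > 0" for x by (simp add: flat_exp_def)
  have h_nn: "flat_exp 0 x \<ge> 0" for x by (simp add: flat_exp_def)
  have cq: "C_k_on k UNIV (\<lambda>z. complex_of_real (flat_exp 0 (q p z)))" for k p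
  proof -
    have "C_k_on k UNIV (\<lambda>z. complex_of_real ((2*r)\<^sup>2) + (-1) * ((z + - p) * cnj (z + - p)))"
      by (intro C_k_on_add C_k_on_mult C_k_on_const C_k_on_id open_UNIV
          C_k_on_linear[OF open_UNIV bounded_linear_cnj])
    moreover have "complex_of_real ((2*r)\<^sup>2) + (-1) * ((z + - p) * cnj (z + - p)) = complex_of_real (q p z)" for z
      unfolding complex_norm_square[symmetric] q_def by simp
    ultimately have "C_k_on k UNIV (\<lambda>z. complex_of_real (q p z))" by simp
    from C_k_on_compose[OF open_UNIV open_UNIV this C_k_on_flat_exp[of k 0]] show ?thesis by simp
  qed
  have cS: "C_k_on k UNIV (\<lambda>z. complex_of_real (S z))" for k
    unfolding S_def of_real_sum by (intro C_k_on_sum open_UNIV cq)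
  have S_nn: "S z \<ge> 0" for z unfolding S_def by (intro sum_nonneg h_nn)
  have S_pos: "S z > 0" if z: "z \<in> N'" for z
  proof -
    obtain p where p: "p \<in> P" "dist p z \<le> r" using z unfolding N'_def by auto
    then have "norm (z - p) < 2 * r" using P(3) by (simp add: dist_norm norm_minus_commute)
    then have "(norm (z - p))\<^sup>2 < (2*r)\<^sup>2" by (intro power_strict_mono) auto
    then have "q p z > 0" unfolding q_def by simp
    then have "flat_exp 0 (q p z) > 0" using h_pos by simp
    moreover have "flat_exp 0 (q p z) \<le> S z" unfolding S_def
      by (rule member_le_sum) (use p P h_nn in auto)
    ultimately show ?thesis by simp
  qed
  have S_zero: "S z = 0" if "z \<notin> L" for z
    unfolding S_def
  proof (rule sum.neutral, rule ballI)
    fix p assume "p \<in> P"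
    then have "norm (z - p) > 2 * r" using that unfolding L_def by (auto simp: dist_norm norm_minus_commute)
    then have "(norm (z - p))\<^sup>2 \<ge> (2*r)\<^sup>2" using P(3) by (intro power_mono) auto
    then show "flat_exp 0 (q p z) = 0" unfolding q_def flat_exp_def by simp
  qed
  have "continuous_on N' (\<lambda>z. complex_of_real (S z))"
    using cS[of 0] continuous_on_subset by fastforce
  then have "continuous_on N' (\<lambda>z. Re (complex_of_real (S z)))" by (rule continuous_on_Re)
  then have contS: "continuous_on N' S" by (simp only: Re_complex_of_real)
  have cN': "compact N'" unfolding N'_def using P(1) by (intro compact_UN) auto
  have "N' \<noteq> {}" using P(3,4) False unfolding N'_def by fastforce
  then obtain z0 where z0: "z0 \<in> N'" "\<And>z. z \<in> N' \<Longrightarrow> S z0 \<le> S z"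
    using continuous_attains_inf[OF cN' _ contS] by blast
  define m where "m = S z0"
  have m: "m > 0" using S_pos[OF z0(1)] unfolding m_def .
  define A where "A = (\<lambda>z. flat_exp 0 (S z / m))"
  define B where "B = (\<lambda>z. flat_exp 0 (1 - S z / m))"
  have cSm: "C_k_on k UNIV (\<lambda>z. complex_of_real (S z / m))" for k
    using C_k_on_mult[OF open_UNIV cS[of k] C_k_on_const[OF open_UNIV, of k "complex_of_real (1/m)"]] by simp
  have cA: "C_k_on k UNIV (\<lambda>z. complex_of_real (A z))" for k
    using C_k_on_compose[OF open_UNIV open_UNIV cSm[of k] C_k_on_flat_exp[of k 0]] unfolding A_def by simp
  have "C_k_on k UNIV (\<lambda>z. 1 + (-1) * complex_of_real (S z / m))" for k
    by (intro C_k_on_add C_k_on_mult C_k_on_const open_UNIV cSm)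
  from C_k_on_compose[OF open_UNIV open_UNIV this C_k_on_flat_exp[of _ 0]]
  have cB: "C_k_on k UNIV (\<lambda>z. complex_of_real (B z))" for k unfolding B_def by simp
  have A_nn: "A z \<ge> 0" "B z \<ge> 0" for z unfolding A_def B_def by (rule h_nn)+
  have AB: "A z + B z > 0" for z
  proof (cases "S z > 0")
    case True then have "A z > 0" unfolding A_def using h_pos m by simp
    then show ?thesis using A_nn[of z] by simp
  next
    case False then have "S z = 0" using S_nn[of z] by simp
    then have "B z > 0" unfolding B_def using h_pos by simp
    then show ?thesis using A_nn[of z] by simp
  qed
  define bump where "bump = (\<lambda>z. complex_of_real (A z) * inverse (complex_of_real (A z) + complex_of_real (B z)))"
  have bump_real: "bump z = complex_of_real (A z / (A z + B z))" for z unfolding bump_def by (simp add: divide_inverse)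
  show ?thesis
  proof (rule exI[of _ bump], rule exI[of _ L], rule exI[of _ N], intro conjI allI ballI impI)
    show "C_k_on k UNIV bump" for k unfolding bump_def
    proof (intro C_k_on_mult C_k_on_inverse C_k_on_add open_UNIV cA cB)
      show "complex_of_real (A z) + complex_of_real (B z) \<noteq> 0" for z
        using AB[of z] by (metis less_irrefl of_real_add of_real_eq_0_iff)
    qed
    show "compact L" unfolding L_def using P(1) by (intro compact_UN) auto
    show "L \<subseteq> U" unfolding L_def using P(5) by blast
    show "open N" unfolding N_def by auto
    show "K \<subseteq> N" unfolding N_def using P by blast
    show "N \<subseteq> L" unfolding N_def L_def using P(3) by force
    show "bump z = 1" if "z \<in> N" for z
    proof -
      have "z \<in> N'" using that unfolding N_def N'_def by force
      then have "S z / m \<ge> 1" using z0(2) m unfolding m_def by simp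
      then have "B z = 0" unfolding B_def flat_exp_def by simp
      then show ?thesis unfolding bump_real using AB[of z] by simp
    qed
    show "bump z = 0" if "z \<notin> L" for z
      unfolding bump_real A_def S_zero[OF that] by (simp add: flat_exp_def)
    show "norm (bump z) \<le> 1" for z
      unfolding bump_real norm_of_real using A_nn[of z] AB[of z] by simp
  qed
qed

section \<open>Diffeomorphisms near the identity\<close>

lemma compact_support_Lipschitz:
  assumes "C_k_on 1 UNIV bump" "compact L" "\<And>z. z \<notin> L \<Longrightarrow> bump z = 0"
  shows "\<exists>B>0. \<forall>z w. norm (bump z - bump w) \<le> B * norm (z - w)"
proof -
  define D where "D = (\<lambda>z. frechet_derivative bump (at z))"
  have D: "(bump has_derivative D z) (at z)" for z
    unfolding D_def using C_k_on_has_derivative[of 0 UNIV bump z] assms(1) by simp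
  have "continuous_on UNIV (\<lambda>z. D z v)" for v using assms(1) unfolding D_def by simp
  then have c: "continuous_on L (\<lambda>z. norm (D z 1) + norm (D z \<i>))"
    by (intro continuous_intros) (meson continuous_on_subset subset_UNIV)+
  obtain B where B: "\<And>z. z \<in> L \<Longrightarrow> norm (D z 1) + norm (D z \<i>) \<le> B"
    using compact_imp_bounded[OF compact_continuous_image[OF c assms(2)]] unfolding bounded_iff by auto
  define B' where "B' = max B 1"
  have "norm (D z 1) + norm (D z \<i>) \<le> B'" for z
  proof (cases "z \<in> L")
    case True then show ?thesis using B[OF True] B'_def by simp
  next
    case False
    have "(bump has_derivative (\<lambda>v. 0)) (at z)"
      by (rule has_derivative_transform_within_open[of "\<lambda>z. 0" "\<lambda>v. 0" z UNIV "-L"])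
        (use False assms compact_imp_closed in \<open>auto simp: open_Compl\<close>)
    then have "D z = (\<lambda>v. 0)" using D has_derivative_unique by blast
    then show ?thesis unfolding B'_def by simp
  qed
  note bnd = this
  have "norm (D z v) \<le> B' * norm v" for z v
  proof -
    have "D z v = Re v * D z 1 + Im v * D z \<i>"
      by (rule linear_complex_decomp[OF has_derivative_bounded_linear[OF D]])
    also have "norm \<dots> \<le> norm v * norm (D z 1) + norm v * norm (D z \<i>)"
      by (rule norm_triangle_mono; simp only: norm_mult norm_of_real; intro mult_right_mono abs_Re_le_cmod abs_Im_le_cmod norm_ge_zero)
    also have "\<dots> = norm v * (norm (D z 1) + norm (D z \<i>))" by (simp add: algebra_simps)
    also have "\<dots> \<le> norm v * B'" using bnd[of z] by (intro mult_left_mono) auto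
    finally show ?thesis by (simp add: mult.commute)
  qed
  then have "onorm (D z) \<le> B'" for z by (intro onorm_le)
  then have "norm (bump z - bump w) \<le> B' * norm (z - w)" for z w
    using differentiable_bound[OF convex_UNIV, of bump D B' z w] D by simp
  moreover have "B' > 0" unfolding B'_def by simp
  ultimately show ?thesis by (intro exI[of _ B'] conjI allI)
qed

text \<open>For nearby points, Cauchy's estimate on discs of radius \<open>d / 4\<close> bounds the
  derivative; for points at least \<open>d / 2\<close> apart, the bound \<delta> on the values
  suffices. The estimate thus holds across the whole of \<open>S\<close>, whatever its
  shape.\<close>

lemma holomorphic_small_Lipschitz:
  assumes "v holomorphic_on P" "open P" "\<delta> > 0" "\<And>z. z \<in> P \<Longrightarrow> norm (v z) \<le> \<delta>"
    "d > 0" "\<And>z. z \<in> S \<Longrightarrow> ball z d \<subseteq> P" "z \<in> S" "w \<in> S"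
  shows "norm (v z - v w) \<le> (8 * \<delta> / d) * norm (z - w)"
proof (cases "norm (z - w) < d / 2")
  case True
  have der: "norm (deriv v x) \<le> 8 * \<delta> / d" if x: "x \<in> ball z (d/2)" for x
  proof -
    have sub: "cball x (d/4) \<subseteq> P"
    proof -
      have "cball x (d/4) \<subseteq> ball z d"
      proof
        fix y assume "y \<in> cball x (d/4)"
        then have "dist z y \<le> dist z x + d/4" using dist_triangle[of z y x] by auto
        then show "y \<in> ball z d" using x assms(5) by auto
      qed
      then show ?thesis using assms(6)[OF assms(7)] by blast
    qed
    \<comment> \<open>The factor 2 turns the bound \<delta> into the strict one required for values
      in an open ball.\<close>
    have "norm ((deriv ^^ 1) v x) \<le> fact 1 * (2 * \<delta>) / (d/4) ^ 1"
    proof (rule Cauchy_higher_deriv_bound[where y=0])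
      show "v holomorphic_on ball x (d/4)" "continuous_on (cball x (d/4)) v"
        using sub assms(1) holomorphic_on_subset holomorphic_on_imp_continuous_on ball_subset_cball
        by (meson order_trans, meson)
      show "v w \<in> ball 0 (2 * \<delta>)" if "w \<in> ball x (d/4)" for w
        using assms(4)[of w] sub that assms(3) by (force simp: ball_subset_cball)
    qed (use assms in auto)
    then show ?thesis by simp
  qed
  have "norm (v z - v w) \<le> (8 * \<delta> / d) * norm (z - w)"
  proof (rule field_differentiable_bound[of "ball z (d/2)"])
    fix x assume "x \<in> ball z (d/2)"
    then have "x \<in> P" using assms(6)[OF assms(7)] assms(5) by auto
    then show "(v has_field_derivative deriv v x) (at x within ball z (d/2))"
      using holomorphic_derivI[OF assms(1,2)] has_field_derivative_at_within by blast
  qed (use der True assms(5) in \<open>auto simp: dist_norm\<close>)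
  then show ?thesis .
next
  case False
  have "z \<in> P" "w \<in> P" using assms(6)[OF assms(7)] assms(6)[OF assms(8)] assms(5) by auto
  then have "norm (v z - v w) \<le> \<delta> + \<delta>" using assms(4)[OF \<open>z \<in> P\<close>] assms(4)[OF \<open>w \<in> P\<close>] norm_triangle_ineq4[of "v z" "v w"] by linarith
  also have "\<dots> \<le> (8 * \<delta> / d) * (d / 2)" using assms(3,5) by simp
  also have "\<dots> \<le> (8 * \<delta> / d) * norm (z - w)" using False assms(3,5) by (intro mult_left_mono) auto
  finally show ?thesis .
qed

text \<open>The displacement is a contraction. This gives the lower bound \<open>low\<close> and
  with it injectivity; surjectivity is Banach's fixed point theorem; and \<open>low\<close> passes
  to the derivative, which is therefore invertible everywhere.\<close>

lemma near_identity_diffeomorphism: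
  assumes sm: "\<And>k. C_k_on k UNIV \<theta>" and lip: "\<And>z w. norm ((\<theta> z - z) - (\<theta> w - w)) \<le> norm (z - w) / 2"
  shows "smooth_diffeomorphism \<theta>"
proof -
  have low: "norm (z - w) / 2 \<le> norm (\<theta> z - \<theta> w)" for z w
  proof -
    have "norm (z - w) \<le> norm (\<theta> z - \<theta> w) + norm ((\<theta> z - z) - (\<theta> w - w))"
      using norm_triangle_ineq4[of "\<theta> z - \<theta> w" "(\<theta> z - z) - (\<theta> w - w)"] by simp
    then show ?thesis using lip[of z w] by simp
  qed
  have inj: "inj \<theta>"
  proof (rule injI)
    fix z w assume "\<theta> z = \<theta> w" then show "z = w" using low[of z w] by simp
  qed
  have surj: "surj \<theta>"
    unfolding surj_def
  proof
    fix w
    have "\<exists>!z\<in>UNIV. w - (\<theta> z - z) = z"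
    proof (rule Banach_fix[where c="1/2"])
      show "dist (w - (\<theta> x - x)) (w - (\<theta> y - y)) \<le> (1/2) * dist x y" for x y
        using lip[of y x] by (simp add: dist_norm norm_minus_commute algebra_simps)
    qed (auto simp: complete_UNIV)
    then show "\<exists>z. w = \<theta> z" by (metis add_diff_cancel_left' add_diff_cancel_right' diff_add_cancel diff_diff_eq2)
  qed
  have bij: "bij \<theta>" using inj surj by (simp add: bij_def)
  define g where "g = inv \<theta>"
  have g: "\<theta> (g w) = w" "g (\<theta> z) = z" for w z
    unfolding g_def using inj surj by (auto simp: surj_f_inv_f)
  have g_lip: "norm (g z - g w) \<le> 2 * norm (z - w)" for z w using low[of "g z" "g w"] g by simp
  define D where "D = (\<lambda>z. frechet_derivative \<theta> (at z))"
  have D: "(\<theta> has_derivative D z) (at z)" for z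
    unfolding D_def using C_k_on_has_derivative[of 0 UNIV \<theta> z] sm[of 1] by simp
  have D_low: "norm v / 2 \<le> norm (D z v)" for z v
  proof -
    have "((\<lambda>t. (\<theta> (z + t *\<^sub>R v) - \<theta> z) /\<^sub>R t) \<longlongrightarrow> D z v) (at (0::real))"
    proof -
      have "((\<lambda>t::real. \<theta> (z + t *\<^sub>R v)) has_derivative (\<lambda>t. D z (t *\<^sub>R v))) (at 0)"
      proof -
        have "((\<lambda>t::real. z + t *\<^sub>R v) has_derivative (\<lambda>t. t *\<^sub>R v)) (at 0)"
          by (auto intro!: derivative_eq_intros)
        from has_derivative_compose[OF this, of \<theta> "D z"] show ?thesis using D[of z] by simp
      qed
      then have "((\<lambda>t::real. norm (\<theta> (z + t *\<^sub>R v) - \<theta> z - D z (t *\<^sub>R v)) / norm t) \<longlongrightarrow> 0) (at 0)"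
        by (simp add: has_derivative_at)
      moreover have "\<forall>\<^sub>F t in at (0::real). norm (\<theta> (z + t *\<^sub>R v) - \<theta> z - D z (t *\<^sub>R v)) / norm t =
          norm ((\<theta> (z + t *\<^sub>R v) - \<theta> z) /\<^sub>R t - D z v)"
        unfolding eventually_at
      proof (intro exI[of _ 1] conjI ballI impI)
        fix t :: real assume "t \<noteq> 0 \<and> dist t 0 < 1"
        then have "(\<theta> (z + t *\<^sub>R v) - \<theta> z) /\<^sub>R t - D z v = (\<theta> (z + t *\<^sub>R v) - \<theta> z - D z (t *\<^sub>R v)) /\<^sub>R t"
          by (simp add: linear_scale[OF bounded_linear.linear[OF has_derivative_bounded_linear[OF D]]] scaleR_diff_right)
        then show "norm (\<theta> (z + t *\<^sub>R v) - \<theta> z - D z (t *\<^sub>R v)) / norm t =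
          norm ((\<theta> (z + t *\<^sub>R v) - \<theta> z) /\<^sub>R t - D z v)" by (simp add: divide_inverse mult.commute)
      qed simp
      ultimately have "((\<lambda>t::real. norm ((\<theta> (z + t *\<^sub>R v) - \<theta> z) /\<^sub>R t - D z v)) \<longlongrightarrow> 0) (at 0)"
        by (rule Lim_transform_eventually)
      then show ?thesis by (rule LIM_zero_cancel[OF tendsto_norm_zero_cancel])
    qed
    then have "((\<lambda>t. norm ((\<theta> (z + t *\<^sub>R v) - \<theta> z) /\<^sub>R t)) \<longlongrightarrow> norm (D z v)) (at (0::real))" by (rule tendsto_norm)
    then show ?thesis
    proof (rule tendsto_lowerbound)
      show "\<forall>\<^sub>F t in at (0::real). norm v / 2 \<le> norm ((\<theta> (z + t *\<^sub>R v) - \<theta> z) /\<^sub>R t)"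
        unfolding eventually_at
      proof (intro exI[of _ 1] conjI ballI impI)
        fix t :: real assume "t \<noteq> 0 \<and> dist t 0 < 1"
        then show "norm v / 2 \<le> norm ((\<theta> (z + t *\<^sub>R v) - \<theta> z) /\<^sub>R t)"
          using low[of "z + t *\<^sub>R v" z] by (simp only: norm_scaleR) (simp add: field_simps)
      qed simp
    qed simp
  qed
  define X where "X = (\<lambda>z. D z 1)"
  define Y where "Y = (\<lambda>z. D z \<i>)"
  have dec: "D z v = Re v * X z + Im v * Y z" for z v
    unfolding X_def Y_def by (rule linear_complex_decomp[OF has_derivative_bounded_linear[OF D]])
  define det where "det = (\<lambda>z. Re (X z) * Im (Y z) - Im (X z) * Re (Y z))"
  have det: "det z \<noteq> 0" for z
  proof
    assume 0: "det z = 0"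
    have "D z (Complex (Re (Y z)) (- Re (X z))) = 0" "D z (Complex (Im (Y z)) (- Im (X z))) = 0"
      unfolding dec using 0 by (auto simp: complex_eq_iff det_def mult.commute)
    then have "Complex (Re (Y z)) (- Re (X z)) = 0" "Complex (Im (Y z)) (- Im (X z)) = 0"
      using D_low[of "Complex (Re (Y z)) (- Re (X z))" z] D_low[of "Complex (Im (Y z)) (- Im (X z))" z] by auto
    then have "Y z = 0" "X z = 0" by (auto simp: complex_eq_iff)
    then show False using D_low[of 1 z] unfolding X_def by simp
  qed
  \<comment> \<open>Cramer's rule: the inverse of the derivative becomes an explicit rational
    expression in the partial derivatives, so its smoothness is a matter of products and
    reciprocals.\<close>
  define I where "I = (\<lambda>z w. inverse (det z) *\<^sub>R Complex (Re w * Im (Y z) - Im w * Re (Y z)) (Im w * Re (X z) - Re w * Im (X z)))"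
  have DI: "D z (I z w) = w" for z w
  proof -
    have "D z (I z w) = inverse (det z) *\<^sub>R D z (Complex (Re w * Im (Y z) - Im w * Re (Y z)) (Im w * Re (X z) - Re w * Im (X z)))"
      unfolding I_def by (rule linear_scale[OF bounded_linear.linear[OF has_derivative_bounded_linear[OF D]]])
    also have "D z (Complex (Re w * Im (Y z) - Im w * Re (Y z)) (Im w * Re (X z) - Re w * Im (X z))) = det z *\<^sub>R w"
      unfolding dec by (auto simp: complex_eq_iff det_def algebra_simps)
    finally have "D z (I z w) = inverse (det z) *\<^sub>R (det z *\<^sub>R w)" .
    then show ?thesis using det[of z] by simp
  qed
  have ID: "I z (D z v) = v" for z v
  proof -
    have "D z (I z (D z v) - v) = 0"
      using linear_diff[OF bounded_linear.linear[OF has_derivative_bounded_linear[OF D]]] DI by simp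
    then show ?thesis using D_low[of "I z (D z v) - v" z] by simp
  qed
  have blI: "bounded_linear (I z)" for z
  proof (rule bounded_linear_intro[where K=2])
    have lin: "linear (D z)" using bounded_linear.linear[OF has_derivative_bounded_linear[OF D]] .
    show "I z (x + y) = I z x + I z y" for x y
      using ID[of z "I z x + I z y"] DI linear_add[OF lin] by simp
    show "I z (r *\<^sub>R x) = r *\<^sub>R I z x" for r x
      using ID[of z "r *\<^sub>R I z x"] DI linear_scale[OF lin] by simp
    show "norm (I z x) \<le> norm x * 2" for x using D_low[of "I z x" z] DI by simp
  qed
  have g_cont: "continuous_on UNIV g"
    unfolding continuous_on_iff
  proof (intro ballI allI impI)
    fix x :: complex and e :: real assume "e > 0"
    show "\<exists>d>0. \<forall>x'\<in>UNIV. dist x' x < d \<longrightarrow> dist (g x') (g x) < e"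
    proof (intro exI[of _ "e/2"] conjI ballI impI)
      fix x' assume "dist x' x < e/2"
      then show "dist (g x') (g x) < e" using g_lip[of x' x] by (simp add: dist_norm)
    qed (use \<open>e > 0\<close> in simp)
  qed
  have g_der: "(g has_derivative I (g w)) (at w)" for w
  proof (rule has_derivative_inverse_basic[where f=\<theta> and T=UNIV])
    show "(\<theta> has_derivative D (g w)) (at (g w))" by (rule D)
    show "bounded_linear (I (g w))" by (rule blI)
    show "I (g w) \<circ> D (g w) = id" using ID by auto
    show "continuous (at w) g" using g_cont by (simp add: continuous_on_eq_continuous_at)
  qed (use g in auto)
  have smD: "C_k_on k UNIV (\<lambda>z. D z v)" for k v using sm[of "Suc k"] unfolding D_def by simp
  have smX: "C_k_on k UNIV X" "C_k_on k UNIV Y" for k unfolding X_def Y_def by (rule smD)+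
  \<comment> \<open>The derivative of \<open>g\<close> at w is \<open>I (g w)\<close>, made of
    derivatives of \<theta> composed with \<open>g\<close> itself, so each order of smoothness of
    \<open>g\<close> yields the next.\<close>
  have "C_k_on k UNIV g" for k
  proof (induction k)
    case 0 then show ?case using g_cont by simp
  next
    case (Suc k)
    have Xg: "C_k_on k UNIV (\<lambda>w. X (g w))" "C_k_on k UNIV (\<lambda>w. Y (g w))"
      using C_k_on_compose[OF open_UNIV open_UNIV Suc smX(1)] C_k_on_compose[OF open_UNIV open_UNIV Suc smX(2)] by auto
    note ri = C_k_on_linear[OF open_UNIV bounded_linear_Re] C_k_on_linear[OF open_UNIV bounded_linear_Im]
    have sdet: "C_k_on k UNIV (\<lambda>w. complex_of_real (Re (X (g w))) * complex_of_real (Im (Y (g w))) +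
      (-1) * (complex_of_real (Im (X (g w))) * complex_of_real (Re (Y (g w)))))"
      by (intro C_k_on_add C_k_on_mult C_k_on_const open_UNIV ri Xg)
    then have sdet: "C_k_on k UNIV (\<lambda>w. complex_of_real (det (g w)))" unfolding det_def by simp
    show ?case
    proof (rule C_k_on_SucI[OF open_UNIV g_der])
      fix v
      have "C_k_on k UNIV (\<lambda>w. inverse (complex_of_real (det (g w))) *
        ((complex_of_real (Re v) * complex_of_real (Im (Y (g w))) + (- complex_of_real (Im v)) * complex_of_real (Re (Y (g w)))) +
         \<i> * (complex_of_real (Im v) * complex_of_real (Re (X (g w))) + (- complex_of_real (Re v)) * complex_of_real (Im (X (g w))))))"
        by (intro C_k_on_mult C_k_on_inverse sdet C_k_on_add C_k_on_const open_UNIV ri Xg) (use det in auto)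
      moreover have "inverse (complex_of_real (det (g w))) *
        ((complex_of_real (Re v) * complex_of_real (Im (Y (g w))) + (- complex_of_real (Im v)) * complex_of_real (Re (Y (g w)))) +
         \<i> * (complex_of_real (Im v) * complex_of_real (Re (X (g w))) + (- complex_of_real (Re v)) * complex_of_real (Im (X (g w)))))
         = I (g w) v" for w
        unfolding I_def scaleR_conv_of_real of_real_inverse
        by (rule arg_cong2[where f="(*)"], simp, simp add: complex_eq_iff)
      ultimately show "C_k_on k UNIV (\<lambda>w. I (g w) v)" by simp
    qed
  qed
  then show ?thesis using bij sm
    unfolding smooth_diffeomorphism_def C_infinity_def C_k_eq_C_k_on_UNIV g_def by simp
qed

text \<open>The displacements \<open>u n\<close> are cut off by functions \<open>\<psi> n\<close>
  that are 1 near \<open>X n\<close>. The tolerances depend on the sets and cutoffs only, because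
  they have to be known before the function that produces \<open>u\<close> is constructed.\<close>

lemma glued_near_identity:
  fixes X P :: "nat \<Rightarrow> complex set"
  assumes X: "\<And>n. compact (X n)" and P: "\<And>n. open (P n)" "\<And>n. X n \<subseteq> P n" "disjoint_family P"
    and lf: "\<And>R. finite {n. P n \<inter> cball 0 R \<noteq> {}}"
  shows "\<exists>\<delta>. (\<forall>n. \<delta> n > 0) \<and>
    (\<forall>u. (\<forall>n. u n holomorphic_on P n \<and> (\<forall>z\<in>P n. norm (u n z) \<le> \<delta> n)) \<longrightarrow>
      (\<exists>\<theta>. smooth_diffeomorphism \<theta> \<and> (\<forall>n. \<exists>N. open N \<and> X n \<subseteq> N \<and> N \<subseteq> P n \<and> (\<forall>z\<in>N. \<theta> z = z + u n z))))"
proof -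
  define Q where "Q = (\<lambda>n \<psi> L N. (\<forall>k. C_k_on k UNIV \<psi>) \<and> compact L \<and> L \<subseteq> P n \<and> open N \<and> X n \<subseteq> N \<and> N \<subseteq> L \<and>
    (\<forall>z\<in>N. \<psi> z = 1) \<and> (\<forall>z. z \<notin> L \<longrightarrow> \<psi> z = 0) \<and> (\<forall>z. norm (\<psi> z) \<le> 1))"
  have "\<exists>\<psi> L N. Q n \<psi> L N" for n
    unfolding Q_def by (rule smooth_cutoff[OF X[of n] P(1)[of n] P(2)[of n]])
  then obtain \<psi> L N where "\<And>n. Q n (\<psi> n) (L n) (N n)" by metis
  then have Q: "C_k_on k UNIV (\<psi> n)" "compact (L n)" "L n \<subseteq> P n" "open (N n)" "X n \<subseteq> N n" "N n \<subseteq> L n"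
    "z \<in> N n \<Longrightarrow> \<psi> n z = 1" "z \<notin> L n \<Longrightarrow> \<psi> n z = 0" "norm (\<psi> n z) \<le> 1" for k n z
    unfolding Q_def by blast+
  have "\<exists>B>0. \<forall>z w. norm (\<psi> n z - \<psi> n w) \<le> B * norm (z - w)" for n
    by (rule compact_support_Lipschitz[OF Q(1)[of 1 n] Q(2)[of n] Q(8)])
  then obtain B where B: "\<And>n. B n > 0" "\<And>n z w. norm (\<psi> n z - \<psi> n w) \<le> B n * norm (z - w)" by metis
  have "\<exists>d>0. (\<Union>z\<in>L n. ball z d) \<subseteq> P n" for n
    using compact_subset_open_imp_ball_epsilon_subset[OF Q(2) P(1) Q(3)] by metis
  then obtain d where d: "\<And>n. d n > 0" "\<And>n. (\<Union>z\<in>L n. ball z (d n)) \<subseteq> P n" by metis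
  \<comment> \<open>\<open>B n * \<delta> n\<close> is the Lipschitz constant due to the cutoff,
    \<open>8 * \<delta> n / d n\<close> the one due to \<open>u n\<close>. Their sum is made 1/4,
    because two pieces may contribute to one difference and 1/2 is the total allowed.\<close>
  define \<delta> where "\<delta> = (\<lambda>n. 1 / (4 * (B n + 8 / d n)))"
  have pos: "B n + 8 / d n > 0" for n using B(1)[of n] d(1)[of n] by (simp add: add_pos_pos)
  have \<delta>: "\<delta> n > 0" "B n * \<delta> n + 8 * \<delta> n / d n = 1/4" for n
  proof -
    show "\<delta> n > 0" unfolding \<delta>_def using pos[of n] by simp
    have "B n * \<delta> n + 8 * \<delta> n / d n = \<delta> n * (B n + 8 / d n)" by (simp add: algebra_simps)
    also have "\<dots> = 1/4" unfolding \<delta>_def using pos[of n] by (simp add: divide_simps)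
    finally show "B n * \<delta> n + 8 * \<delta> n / d n = 1/4" .
  qed
  have B\<delta>: "B n * \<delta> n \<le> 1/4" for n
  proof -
    have "8 * \<delta> n / d n > 0" using \<delta>(1)[of n] d(1)[of n] by simp
    then show ?thesis using \<delta>(2)[of n] by linarith
  qed
  show ?thesis
  proof (intro exI[of _ \<delta>] conjI allI impI)
    show "\<delta> n > 0" for n by (rule \<delta>(1))
    fix u :: "nat \<Rightarrow> complex \<Rightarrow> complex"
    assume u: "\<forall>n. u n holomorphic_on P n \<and> (\<forall>z\<in>P n. norm (u n z) \<le> \<delta> n)"
    define V where "V = (\<lambda>n z. if z \<in> L n then \<psi> n z * u n z else 0)"
    have VP: "V n z = \<psi> n z * u n z" if "z \<in> P n" for n z using Q(8) unfolding V_def by auto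
    have ub: "norm (u n z) \<le> \<delta> n" if "z \<in> L n" for n z using u that Q(3) by blast
    have one: "norm (V n z - V n w) \<le> 1/4 * norm (z - w)" if zw: "z \<in> L n" "w \<notin> L n" for n z w
    proof -
      have "V n z - V n w = (\<psi> n z - \<psi> n w) * u n z" using zw Q(8)[of w n] unfolding V_def by simp
      also have "norm \<dots> \<le> (B n * norm (z - w)) * \<delta> n"
        unfolding norm_mult by (intro mult_mono B(2) ub zw) (use B(1)[of n] in auto)
      also have "\<dots> = (B n * \<delta> n) * norm (z - w)" by simp
      also have "\<dots> \<le> 1/4 * norm (z - w)" by (rule mult_right_mono[OF B\<delta>]) simp
      finally show ?thesis .
    qed
    have V_lip: "norm (V n z - V n w) \<le> 1/4 * norm (z - w)" for n z w
    proof -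
      consider "z \<in> L n" "w \<in> L n" | "z \<in> L n" "w \<notin> L n" | "z \<notin> L n" "w \<in> L n" | "z \<notin> L n" "w \<notin> L n" by blast
      then show ?thesis
      proof cases
        case 1
        have "norm (u n z - u n w) \<le> (8 * \<delta> n / d n) * norm (z - w)"
        proof (rule holomorphic_small_Lipschitz[where P="P n" and S="L n"])
          show "u n holomorphic_on P n" using u by blast
          show "\<And>z. z \<in> P n \<Longrightarrow> norm (u n z) \<le> \<delta> n" using u by blast
          show "\<And>z. z \<in> L n \<Longrightarrow> ball z (d n) \<subseteq> P n" using d(2) by blast
        qed (use P \<delta> d 1 in auto)
        moreover have "V n z - V n w = (\<psi> n z - \<psi> n w) * u n z + \<psi> n w * (u n z - u n w)"
          using 1 unfolding V_def by (simp add: algebra_simps)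
        ultimately have "norm (V n z - V n w) \<le> (B n * norm (z - w)) * \<delta> n + 1 * ((8 * \<delta> n / d n) * norm (z - w))"
          by (simp only:, intro norm_triangle_mono; unfold norm_mult; intro mult_mono B(2) ub 1 Q(9))
            (use B(1)[of n] in auto)
        also have "\<dots> = (B n * \<delta> n + 8 * \<delta> n / d n) * norm (z - w)" by (simp add: algebra_simps)
        finally show ?thesis unfolding \<delta>(2) .
      next
        case 2 then show ?thesis by (rule one)
      next
        case 3 then show ?thesis using one[of w n z] by (simp add: norm_minus_commute)
      next
        case 4 then show ?thesis unfolding V_def by simp
      qed
    qed
    define v where "v = (\<lambda>z. if \<exists>n. z \<in> L n then V (SOME n. z \<in> L n) z else 0)"
    have disj: "n = m" if "z \<in> P n" "z \<in> P m" for n m z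
      using P(3) that unfolding disjoint_family_on_def by blast
    have vP: "v z = V n z" if z: "z \<in> P n" for n z
    proof (cases "\<exists>m. z \<in> L m")
      case True
      then have "z \<in> L (SOME n. z \<in> L n)" by (rule someI_ex)
      then have "(SOME n. z \<in> L n) = n" using disj[OF _ z] Q(3) by blast
      then show ?thesis unfolding v_def using True by simp
    qed (simp add: v_def V_def)
    have vL: "v z = V n z" if "z \<in> L n" for n z using vP that Q(3) by blast
    have v0: "v z = 0" if "z \<notin> (\<Union>n. L n)" for z using that unfolding v_def by auto
    have V0: "V n z = 0" if "z \<in> L m" "m \<noteq> n" for m n z
      using that disj[of z m n] Q(3) unfolding V_def by auto
    have v_lip: "norm (v z - v w) \<le> norm (z - w) / 2" for z w
    proof -
      consider n m where "z \<in> L n" "w \<in> L m" "n \<noteq> m" | n where "v z = V n z" "v w = V n w"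
      proof (cases "\<exists>n. z \<in> L n")
        case True
        then obtain n where n: "z \<in> L n" by blast
        show thesis
        proof (cases "\<exists>m. w \<in> L m")
          case True
          then obtain m where "w \<in> L m" by blast
          then show thesis using that n vL by metis
        next
          case False
          then have "v w = V n w" unfolding v_def V_def by auto
          then show thesis using that(2) vL[OF n] by blast
        qed
      next
        case False
        show thesis
        proof (cases "\<exists>m. w \<in> L m")
          case True
          then obtain m where m: "w \<in> L m" by blast
          have "v z = V m z" using False unfolding v_def V_def by auto
          then show thesis using that(2) vL[OF m] by blast
        next
          case nw: False
          have "v z = V 0 z" "v w = V 0 w" using False nw unfolding v_def V_def by auto
          then show thesis using that(2) by blast
        qed
      qed
      then show ?thesis
      proof cases
        case 1
        \<comment> \<open>\<open>V n\<close> vanishes at \<open>w\<close> and \<open>V m\<close> at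
          \<open>z\<close>, which reduces the difference to differences of single pieces.\<close>
        have "v z - v w = (V n z - V n w) + (V m z - V m w)"
          using vL[OF 1(1)] vL[OF 1(2)] V0[OF 1(1,3)] V0[OF 1(2)] 1(3) by simp
        also have "norm \<dots> \<le> 1/4 * norm (z - w) + 1/4 * norm (z - w)"
          by (rule norm_triangle_mono[OF V_lip V_lip])
        finally show ?thesis by simp
      next
        case 2
        then have "norm (v z - v w) \<le> 1/4 * norm (z - w)" using V_lip by simp
        also have "\<dots> \<le> norm (z - w) / 2" by simp
        finally show ?thesis .
      qed
    qed
    have "closed (\<Union>n. L n)"
    proof (rule closed_UN_compact_locally_finite[OF Q(2)])
      fix R show "finite {n. L n \<inter> cball 0 R \<noteq> {}}"
        by (rule finite_subset[OF _ lf[of R]]) (use Q(3) in blast)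
    qed
    then have open0: "open (- (\<Union>n. L n))" by (rule open_Compl)
    have sm: "C_k_on k UNIV (\<lambda>z. z + v z)" for k
    proof (rule C_k_on_add[OF open_UNIV C_k_on_id[OF open_UNIV]], rule C_k_on_local[OF open_UNIV])
      fix z :: complex
      show "\<exists>T. open T \<and> z \<in> T \<and> C_k_on k T v"
      proof (cases "\<exists>n. z \<in> L n")
        case True
        then obtain n where n: "z \<in> L n" by blast
        have "C_k_on k (P n) (\<lambda>z. \<psi> n z * u n z)"
          by (intro C_k_on_mult[OF P(1)] C_k_on_subset[OF Q(1)] C_k_on_holomorphic[OF P(1)]) (use u in auto)
        then have "C_k_on k (P n) v"
          by (rule C_k_on_cong[OF P(1), rotated]) (simp add: vP VP)
        then show ?thesis using P(1) n Q(3) by blast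
      next
        case False
        have "C_k_on k (- (\<Union>n. L n)) v"
          by (rule C_k_on_cong[OF open0 _ C_k_on_const[OF open0, of k 0]]) (simp add: v0)
        then show ?thesis using open0 False by blast
      qed
    qed
    show "\<exists>\<theta>. smooth_diffeomorphism \<theta> \<and> (\<forall>n. \<exists>N. open N \<and> X n \<subseteq> N \<and> N \<subseteq> P n \<and> (\<forall>z\<in>N. \<theta> z = z + u n z))"
    proof (intro exI[of _ "\<lambda>z. z + v z"] conjI allI)
      show "smooth_diffeomorphism (\<lambda>z. z + v z)"
        by (rule near_identity_diffeomorphism[OF sm]) (use v_lip in simp)
      fix n
      have "z + v z = z + u n z" if "z \<in> N n" for z
        using vL[of z n] Q(6)[of n] Q(7)[OF that] that unfolding V_def by auto
      then show "\<exists>N. open N \<and> X n \<subseteq> N \<and> N \<subseteq> P n \<and> (\<forall>z\<in>N. z + v z = z + u n z)"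
        using Q(3)[of n] Q(4)[of n] Q(5)[of n] Q(6)[of n] by (intro exI[of _ "N n"]) auto
    qed
  qed
qed

section \<open>A criterion for membership in the Julia set\<close>

lemma iterate_eq_funpow:
  "(\<And>j. j < n \<Longrightarrow> \<not> is_pole f ((f ^^ j) z)) \<Longrightarrow> iterate f n z = Some ((f ^^ n) z)"
  by (induction n) (auto simp: to_sphere_def)

text \<open>\<open>None\<close> is absorbing, so a defined orbit never meets a pole and the total
  function \<open>f ^^ n\<close> uses no dummy value along it.\<close>

lemma iterates_definedD:
  assumes "iterates_defined f z"
  shows "\<not> is_pole f ((f ^^ n) z)" "iterate f n z = Some ((f ^^ n) z)"
proof -
  have "iterate f n z = Some ((f ^^ n) z) \<and> \<not> is_pole f ((f ^^ n) z)" for n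
  proof (induction n)
    case 0
    have "iterate f (Suc 0) z \<noteq> None" using assms unfolding iterates_defined_def by blast
    then show ?case by (auto simp: to_sphere_def split: if_splits)
  next
    case (Suc n)
    have "iterate f (Suc (Suc n)) z \<noteq> None" using assms unfolding iterates_defined_def by blast
    then show ?case using Suc by (auto simp: to_sphere_def split: if_splits)
  qed
  then show "\<not> is_pole f ((f ^^ n) z)" "iterate f n z = Some ((f ^^ n) z)" by auto
qed

lemma iterates_definedI: "(\<And>n. \<not> is_pole f ((f ^^ n) z)) \<Longrightarrow> iterates_defined f z"
  unfolding iterates_defined_def using iterate_eq_funpow by (metis option.distinct(1))

lemma analytic_not_pole: "f analytic_on {z} \<Longrightarrow> \<not> is_pole f z"
  using analytic_at_imp_no_pole by blast

lemma funpow_analytic: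
  assumes "\<And>j. j < n \<Longrightarrow> f analytic_on {(f ^^ j) z}"
  shows "(f ^^ n) analytic_on {z}"
  using assms
proof (induction n)
  case 0 show ?case by (simp add: id_def)
next
  case (Suc n)
  have "(f \<circ> (f ^^ n)) analytic_on {z}"
    by (rule analytic_on_compose) (use Suc in auto)
  then show ?case by (simp add: comp_def)
qed

lemma iterates_defined_analytic:
  assumes "f nicely_meromorphic_on UNIV" "iterates_defined f z"
  shows "(f ^^ n) analytic_on {z}"
  by (rule funpow_analytic)
    (use assms iterates_definedD(1) nicely_meromorphic_on_imp_analytic_at in blast)

section \<open>The sphere near infinity\<close>

lemma stereographic_Some_bounds:
  "norm (fst (stereographic (Some z))) \<le> 1" "snd (stereographic (Some z)) < 1" "-1 \<le> snd (stereographic (Some z))"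
proof -
  have p: "(norm z)\<^sup>2 + 1 > 0" by (simp add: add_nonneg_pos)
  have "0 \<le> (norm z - 1)\<^sup>2" by simp
  then have "2 * norm z \<le> (norm z)\<^sup>2 + 1" by (simp add: power2_diff)
  then show "norm (fst (stereographic (Some z))) \<le> 1" using p by simp
  show "snd (stereographic (Some z)) < 1" "-1 \<le> snd (stereographic (Some z))" using p by (simp_all add: pos_le_divide_eq)
qed

text \<open>The reciprocal is a continuous function of the point on the sphere, away from the south
  pole. This turns spherical convergence near infinity into uniform convergence of holomorphic
  functions.\<close>

lemma stereographic_inverse:
  assumes "snd (stereographic (Some z)) > 0"
  shows "inverse z = cnj (fst (stereographic (Some z))) / (1 + complex_of_real (snd (stereographic (Some z))))"
    "norm z > 1"
proof -
  have p: "(norm z)\<^sup>2 + 1 > 0" by (simp add: add_nonneg_pos)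
  then have "(norm z)\<^sup>2 > 1" using assms by (simp add: zero_less_divide_iff)
  then show n: "norm z > 1" using power_le_one_iff[of "norm z" 2] by (metis linorder_not_le norm_ge_zero power_le_one)
  have "1 + (((norm z)\<^sup>2 - 1) / ((norm z)\<^sup>2 + 1)) = 2 * (norm z)\<^sup>2 / ((norm z)\<^sup>2 + 1)"
    using p by (simp add: field_simps)
  then have e: "1 + complex_of_real (snd (stereographic (Some z))) = complex_of_real (2 * (norm z)\<^sup>2 / ((norm z)\<^sup>2 + 1))"
    by (metis of_real_1 of_real_add stereographic.simps(2) snd_conv)
  have "cnj (fst (stereographic (Some z))) / (1 + complex_of_real (snd (stereographic (Some z)))) = cnj z / (norm z)\<^sup>2"
  proof -
    define c where "c = complex_of_real (2 / ((norm z)\<^sup>2 + 1))"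
    have "2 / ((norm z)\<^sup>2 + 1) \<noteq> 0" using p by simp
    then have "c \<noteq> 0" unfolding c_def by (metis of_real_eq_0_iff)
    moreover have "complex_of_real (2 * (norm z)\<^sup>2 / ((norm z)\<^sup>2 + 1)) = c * (norm z)\<^sup>2"
      unfolding c_def by (simp only: of_real_mult[symmetric] times_divide_eq_left)
    moreover have "cnj (fst (stereographic (Some z))) = c * cnj z"
      unfolding c_def by (simp add: scaleR_conv_of_real)
    ultimately show ?thesis unfolding e by simp
  qed
  also have "\<dots> = inverse z"
  proof -
    have "z \<noteq> 0" using n by auto
    then show ?thesis unfolding complex_norm_square by (simp add: inverse_eq_divide)
  qed
  finally show "inverse z = cnj (fst (stereographic (Some z))) / (1 + complex_of_real (snd (stereographic (Some z))))" by simp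
qed

lemma stereographic_tendsto_infinity:
  assumes "filterlim (\<lambda>k. norm (F k)) at_top sequentially"
  shows "(\<lambda>k. snd (stereographic (Some (F k)))) \<longlonglongrightarrow> 1"
proof -
  have e: "snd (stereographic (Some w)) = 1 - 2 * inverse ((norm w)\<^sup>2 + 1)" for w
  proof -
    have "(norm w)\<^sup>2 + 1 > 0" by (simp add: add_nonneg_pos)
    then show ?thesis by (simp add: field_simps)
  qed
  have "filterlim (\<lambda>k. (norm (F k))\<^sup>2 + 1) at_top sequentially"
    by (rule filterlim_at_top_mono[OF filterlim_pow_at_top[OF _ assms, of 2]]) auto
  then have "(\<lambda>k. inverse ((norm (F k))\<^sup>2 + 1)) \<longlonglongrightarrow> 0"
    by (rule filterlim_compose[OF tendsto_inverse_0_at_top[OF filterlim_ident]])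
  then have "(\<lambda>k. 1 - 2 * inverse ((norm (F k))\<^sup>2 + 1)) \<longlonglongrightarrow> 1 - 2 * 0"
    by (intro tendsto_intros)
  then show ?thesis unfolding e by simp
qed

text \<open>
  If \<open>z\<close> had a neighbourhood on which the iterates are normal, some iterates would converge to
  \<open>\<infinity>\<close> at \<open>z\<close>.  Their reciprocals are zero-free, so by Hurwitz' theorem the limit is \<open>\<infinity>\<close> on a
  whole neighbourhood.
\<close>

theorem limit_of_bounded_orbits_in_Julia_set:
  assumes f: "f nicely_meromorphic_on UNIV"
    and unb: "\<And>B. \<exists>n. norm ((f ^^ n) z) > B"
    and bdd: "\<And>e. e > 0 \<Longrightarrow> \<exists>w. dist z w < e \<and> bounded (range (\<lambda>n. (f ^^ n) w))"
  shows "z \<in> Julia_set f"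
proof (rule ccontr)
  assume "z \<notin> Julia_set f"
  then obtain U where U: "open U" "z \<in> U" "\<And>w. w \<in> U \<Longrightarrow> iterates_defined f w" "normal_family U (range (iterate f))"
    unfolding Julia_set_def Fatou_set_def by auto
  have "\<forall>k::nat. \<exists>n. norm ((f ^^ n) z) > real k" using unb by blast
  from choice[OF this] obtain s :: "nat \<Rightarrow> nat" where s: "\<And>k. norm ((f ^^ (s k)) z) > real k" by blast
  have "range (\<lambda>k. iterate f (s k)) \<subseteq> range (iterate f)" by auto
  with U(4) obtain r g where r: "strict_mono (r :: nat \<Rightarrow> nat)"
    and ul: "\<And>K. compact K \<and> K \<subseteq> U \<Longrightarrow> uniform_limit K (\<lambda>n z. stereographic (iterate f (s (r n)) z)) (\<lambda>z. stereographic (g z)) sequentially"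
    unfolding normal_family_def by blast
  define F where "F = (\<lambda>k w. (f ^^ (s (r k))) w)"
  define \<zeta> where "\<zeta> = (\<lambda>k w. stereographic (Some (F k w)))"
  define G where "G = (\<lambda>w. stereographic (g w))"
  have it: "stereographic (iterate f (s (r k)) w) = \<zeta> k w" if "w \<in> U" for k w
    unfolding \<zeta>_def F_def using iterates_definedD(2)[OF U(3)[OF that]] by simp
  have Fan: "F k analytic_on {w}" if "w \<in> U" for k w
    unfolding F_def using iterates_defined_analytic[OF f U(3)[OF that]] by simp
  have Fhol: "F k holomorphic_on U" for k
    using Fan analytic_on_analytic_at[of "F k" U] analytic_imp_holomorphic by blast
  obtain \<epsilon> where \<epsilon>: "\<epsilon> > 0" "cball z \<epsilon> \<subseteq> U" using U(1,2) open_contains_cball by blast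
  have ul\<zeta>: "uniform_limit K \<zeta> G sequentially" if "compact K" "K \<subseteq> U" for K
  proof -
    have "uniform_limit K (\<lambda>n z. stereographic (iterate f (s (r n)) z)) G sequentially"
      unfolding G_def using ul that by blast
    then show ?thesis by (rule uniform_limit_cong'[THEN iffD1, rotated -1]) (use it that in auto)
  qed
  have contG: "continuous_on (cball z \<epsilon>) G"
  proof (rule uniform_limit_theorem[OF _ ul\<zeta>[OF compact_cball \<epsilon>(2)]])
    have "continuous_on (cball z \<epsilon>) (\<zeta> k)" for k
    proof -
      have c: "continuous_on (cball z \<epsilon>) (F k)"
        using holomorphic_on_imp_continuous_on[OF Fhol] \<epsilon>(2) continuous_on_subset by blast
      have nz: "(norm w)\<^sup>2 + 1 \<noteq> 0" for w :: complex
        by (metis add_nonneg_pos less_irrefl zero_less_one zero_le_power2)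
      show ?thesis unfolding \<zeta>_def stereographic.simps
        by (intro continuous_intros c) (use nz in auto)
    qed
    then show "\<forall>\<^sub>F n in sequentially. continuous_on (cball z \<epsilon>) (\<zeta> n)" by simp
  qed auto
  have "(\<lambda>k. \<zeta> k z) \<longlonglongrightarrow> G z"
    using ul\<zeta>[of "{z}"] U(2) by simp
  then have lim1: "(\<lambda>k. snd (\<zeta> k z)) \<longlonglongrightarrow> snd (G z)" by (rule tendsto_snd)
  have "filterlim (\<lambda>k. norm (F k z)) at_top sequentially"
  proof (rule filterlim_at_top_mono[OF filterlim_real_sequentially])
    show "\<forall>\<^sub>F k in sequentially. real k \<le> norm (F k z)"
    proof (rule always_eventually, rule allI)
      fix k
      have "k \<le> r k" using r by (rule strict_mono_imp_increasing)
      then show "real k \<le> norm (F k z)" using s[of "r k"] unfolding F_def by linarith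
    qed
  qed
  from stereographic_tendsto_infinity[OF this] have "(\<lambda>k. snd (\<zeta> k z)) \<longlonglongrightarrow> 1" unfolding \<zeta>_def .
  then have snd1: "snd (G z) = 1" using lim1 LIMSEQ_unique by blast
  have gz: "g z = None"
  proof (cases "g z")
    case (Some w)
    then show ?thesis using snd1 stereographic_Some_bounds(2)[of w] unfolding G_def by simp
  qed simp
  \<comment> \<open>On a small disc around \<open>z\<close> the limit stays above height 1/2, so
    late iterates stay above height 1/4; there their moduli exceed 1 and reciprocals make
    sense.\<close>
  have "continuous_on (cball z \<epsilon>) (\<lambda>w. snd (G w))" using contG by (intro continuous_intros)
  then obtain d where d: "d > 0" "\<And>w. w \<in> cball z \<epsilon> \<Longrightarrow> dist w z < d \<Longrightarrow> dist (snd (G w)) (snd (G z)) < 1/2"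
    unfolding continuous_on_iff using \<epsilon>(1) by (metis centre_in_cball half_gt_zero less_eq_real_def zero_less_one)
  define \<eta> where "\<eta> = min \<epsilon> d / 2"
  have \<eta>: "\<eta> > 0" "\<eta> < d" "\<eta> \<le> \<epsilon>" unfolding \<eta>_def using \<epsilon>(1) d(1) by auto
  have \<eta>U: "cball z \<eta> \<subseteq> U" using \<epsilon>(2) \<eta>(3) by (meson order_trans subset_cball)
  have Ghalf: "snd (G w) > 1/2" if "w \<in> cball z \<eta>" for w
  proof -
    have "dist (snd (G w)) (snd (G z)) < 1/2" using that \<eta> by (intro d(2)) (auto simp: dist_commute)
    then show ?thesis using snd1 unfolding dist_real_def by linarith
  qed
  have "\<forall>\<^sub>F k in sequentially. \<forall>w\<in>cball z \<eta>. dist (\<zeta> k w) (G w) < 1/4"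
    by (rule uniform_limitD[OF ul\<zeta>[OF compact_cball \<eta>U]]) simp
  then obtain k0 where k0: "\<And>k w. k \<ge> k0 \<Longrightarrow> w \<in> cball z \<eta> \<Longrightarrow> dist (\<zeta> k w) (G w) < 1/4"
    unfolding eventually_sequentially by blast
  have \<zeta>4: "snd (\<zeta> k w) > 1/4" if "k \<ge> k0" "w \<in> cball z \<eta>" for k w
  proof -
    have "dist (snd (\<zeta> k w)) (snd (G w)) < 1/4" using k0[OF that] dist_snd_le le_less_trans by blast
    then show ?thesis using Ghalf[OF that(2)] unfolding dist_real_def by linarith
  qed
  define q where "q = (\<lambda>x::complex \<times> real. cnj (fst x) / (1 + complex_of_real (snd x)))"
  \<comment> \<open>On this compact set the coordinate change \<open>q\<close> is uniformly
    continuous and so preserves uniform limits.\<close>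
  define B where "B = cball (0::complex) 1 \<times> {1/4..1::real}"
  have cB: "compact B" unfolding B_def by (intro compact_Times) auto
  have "continuous_on B q" unfolding q_def
  proof (intro continuous_intros ballI)
    fix x assume "x \<in> B"
    then have "1 + snd x \<noteq> 0" unfolding B_def by auto
    then show "1 + complex_of_real (snd x) \<noteq> 0" by (metis of_real_1 of_real_add of_real_eq_0_iff)
  qed
  then have uq: "uniformly_continuous_on B q" using cB compact_uniformly_continuous by blast
  have "uniform_limit (cball z \<eta>) (\<lambda>k w. q (\<zeta> k w)) (\<lambda>w. q (G w)) sequentially"
  proof (rule uniform_limit_compose_uniformly_continuous_on[OF ul\<zeta>[OF compact_cball \<eta>U] uq _ compact_imp_closed[OF cB]])
    show "\<forall>\<^sub>F k in sequentially. \<forall>w\<in>cball z \<eta>. \<zeta> k w \<in> B"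
      unfolding eventually_sequentially
    proof (intro exI[of _ k0] allI impI ballI)
      fix k w assume "k0 \<le> k" "w \<in> cball z \<eta>"
      then have "snd (\<zeta> k w) > 1/4" using \<zeta>4 by blast
      moreover have "norm (fst (\<zeta> k w)) \<le> 1" "snd (\<zeta> k w) < 1"
        unfolding \<zeta>_def using stereographic_Some_bounds by blast+
      ultimately show "\<zeta> k w \<in> B" unfolding B_def by (simp add: mem_Times_iff)
    qed
  qed
  then have ulq: "uniform_limit (cball z \<eta>) (\<lambda>k w. q (\<zeta> (k + k0) w)) (\<lambda>w. q (G w)) sequentially"
    unfolding uniform_limit_sequentially_iff by (meson trans_le_add1)
  define h where "h = (\<lambda>k w. inverse (F (k + k0) w))"
  have hq: "q (\<zeta> (k + k0) w) = h k w" "norm (F (k + k0) w) > 1" if "w \<in> cball z \<eta>" for k w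
  proof -
    have "snd (\<zeta> (k + k0) w) > 1/4" using \<zeta>4 that by (meson le_add2)
    then have p: "snd (stereographic (Some (F (k + k0) w))) > 0" unfolding \<zeta>_def by linarith
    show "q (\<zeta> (k + k0) w) = h k w" unfolding h_def q_def \<zeta>_def by (rule stereographic_inverse(1)[OF p, symmetric])
    show "norm (F (k + k0) w) > 1" by (rule stereographic_inverse(2)[OF p])
  qed
  define H where "H = (\<lambda>w. q (G w))"
  have ulh: "uniform_limit (cball z \<eta>) h H sequentially"
    unfolding H_def by (rule uniform_limit_cong'[THEN iffD1, OF _ _ ulq]) (use hq in auto)
  have hhol: "h k holomorphic_on ball z \<eta>" for k unfolding h_def
  proof (intro holomorphic_intros)
    show "F (k + k0) holomorphic_on ball z \<eta>"
      using Fhol \<eta>U holomorphic_on_subset ball_subset_cball by (metis order_trans)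
    show "F (k + k0) w \<noteq> 0" if "w \<in> ball z \<eta>" for w using hq(2)[of w k] that by auto
  qed
  have ulK: "uniform_limit K h H sequentially" if "K \<subseteq> ball z \<eta>" for K
    using uniform_limit_on_subset[OF ulh] that ball_subset_cball by (metis order_trans)
  have Hhol: "H holomorphic_on ball z \<eta>"
  proof (rule holomorphic_uniform_sequence[OF open_ball hhol])
    fix x assume "x \<in> ball z \<eta>"
    then obtain e where "e > 0" "cball x e \<subseteq> ball z \<eta>" using open_contains_cball by (metis open_ball)
    then show "\<exists>d>0. cball x d \<subseteq> ball z \<eta> \<and> uniform_limit (cball x d) h H sequentially" using ulK by blast
  qed
  have Hz: "H z = 0" unfolding H_def G_def gz q_def by simp
  have "H constant_on ball z \<eta>"
  proof (rule ccontr)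
    assume nc: "\<not> H constant_on ball z \<eta>"
    have "H z \<noteq> 0"
    proof (rule Hurwitz_no_zeros[OF open_ball _ hhol Hhol _ nc])
      show "uniform_limit K h H sequentially" if "K \<subseteq> ball z \<eta>" for K using that by (rule ulK)
      show "h n w \<noteq> 0" if "w \<in> ball z \<eta>" for n w using hq(2)[of w n] that unfolding h_def by auto
    qed (use \<eta> in auto)
    then show False using Hz by simp
  qed
  then have H0: "H w = 0" if "w \<in> ball z \<eta>" for w
    using Hz that \<eta>(1) unfolding constant_on_def by (metis centre_in_ball)
  \<comment> \<open>A bounded orbit keeps the reciprocals away from 0, contradicting their
    limit.\<close>
  obtain w where w: "dist z w < \<eta>" "bounded (range (\<lambda>n. (f ^^ n) w))" using bdd[OF \<eta>(1)] by blast
  obtain M where M: "M > 0" "\<And>n. norm ((f ^^ n) w) \<le> M" using w(2) unfolding bounded_pos by auto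
  have "(\<lambda>k. h k w) \<longlonglongrightarrow> H w" using ulK[of "{w}"] w(1) by simp
  then have "(\<lambda>k. norm (h k w)) \<longlonglongrightarrow> norm (H w)" by (rule tendsto_norm)
  moreover have "inverse M \<le> norm (h k w)" for k
  proof -
    have "norm (F (k + k0) w) > 1" "norm (F (k + k0) w) \<le> M" using hq(2)[of w k] w(1) M(2) unfolding F_def by auto
    then show ?thesis unfolding h_def norm_inverse by (intro le_imp_inverse_le) auto
  qed
  ultimately have "inverse M \<le> norm (H w)" by (intro LIMSEQ_le_const) auto
  then show False using H0[of w] w(1) M(1) by simp
qed

section \<open>Inductive construction of the function\<close>

text \<open>The bound is uniform in \<open>g\<close> and \<open>x\<close>, but only for orbits of
  both maps that stay in \<open>L\<close> for n steps. In the construction, \<open>Inv_orbit\<close>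
  supplies this for the old function and for every admissible perturbation of it.\<close>

lemma funpow_perturbation:
  fixes f :: "complex \<Rightarrow> complex"
  assumes "compact L" "continuous_on L f" "\<gamma> > 0"
  shows "\<exists>\<eta>>0. \<forall>g x. (\<forall>z\<in>L. norm (g z - f z) \<le> \<eta>) \<and> (\<forall>j<n. (f ^^ j) x \<in> L \<and> (g ^^ j) x \<in> L) \<longrightarrow>
     norm ((g ^^ n) x - (f ^^ n) x) \<le> \<gamma>"
  using assms(3)
proof (induction n arbitrary: \<gamma>)
  case 0
  then show ?case by (intro exI[of _ 1]) auto
next
  case (Suc n)
  have "uniformly_continuous_on L f" using assms(1,2) compact_uniformly_continuous by blast
  moreover have "\<gamma> / 2 > 0" using Suc.prems by simp
  ultimately obtain d where d: "d > 0" "\<forall>x\<in>L. \<forall>x'\<in>L. dist x' x < d \<longrightarrow> dist (f x') (f x) < \<gamma> / 2"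
    unfolding uniformly_continuous_on_def by blast
  have "d / 2 > 0" using d by simp
  from Suc.IH[OF this] obtain \<eta> where \<eta>: "\<eta> > 0"
    "\<forall>g x. (\<forall>z\<in>L. norm (g z - f z) \<le> \<eta>) \<and> (\<forall>j<n. (f ^^ j) x \<in> L \<and> (g ^^ j) x \<in> L) \<longrightarrow>
     norm ((g ^^ n) x - (f ^^ n) x) \<le> d / 2" by (elim exE conjE) (rule that)
  show ?case
  proof (rule exI[of _ "min \<eta> (\<gamma>/2)"], intro conjI allI impI)
    show "min \<eta> (\<gamma>/2) > 0" using \<eta> Suc.prems by simp
    fix g :: "complex \<Rightarrow> complex" and x :: complex
    assume a: "(\<forall>z\<in>L. norm (g z - f z) \<le> min \<eta> (\<gamma>/2)) \<and> (\<forall>j<Suc n. (f ^^ j) x \<in> L \<and> (g ^^ j) x \<in> L)"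
    then have "norm ((g ^^ n) x - (f ^^ n) x) \<le> d / 2" using \<eta>(2)[rule_format, of g x] by auto
    then have "dist ((g ^^ n) x) ((f ^^ n) x) < d" using d(1) by (simp add: dist_norm)
    then have "norm (f ((g ^^ n) x) - f ((f ^^ n) x)) < \<gamma> / 2" using d(2) a by (simp add: dist_norm)
    moreover have "norm (g ((g ^^ n) x) - f ((g ^^ n) x)) \<le> \<gamma> / 2" using a by auto
    ultimately show "norm ((g ^^ Suc n) x - (f ^^ Suc n) x) \<le> \<gamma>"
      using norm_triangle_ineq[of "g ((g ^^ n) x) - f ((g ^^ n) x)" "f ((g ^^ n) x) - f ((f ^^ n) x)"] by simp
  qed
qed

lemma analytic_on_locally_eq:
  assumes "h analytic_on S" "open T" "S \<subseteq> T" "\<And>z. z \<in> T \<Longrightarrow> g z = h z"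
  shows "g analytic_on S"
proof -
  have "g analytic_on {z}" if "z \<in> S" for z
  proof -
    have "\<forall>\<^sub>F w in nhds z. h w = g w"
      using assms that by (auto simp: eventually_nhds intro!: exI[of _ T])
    moreover have "h analytic_on {z}" using analytic_on_subset[OF assms(1)] that by auto
    ultimately show ?thesis using analytic_at_cong by blast
  qed
  then show ?thesis using analytic_on_analytic_at by blast
qed

lemma finite_separated:
  fixes S :: "complex set"
  assumes "finite S"
  shows "\<exists>d>0. \<forall>x\<in>S. \<forall>y\<in>S. x \<noteq> y \<longrightarrow> d \<le> dist x y"
  using assms
proof (induction S rule: finite_induct)
  case empty then show ?case by (intro exI[of _ 1]) auto
next
  case (insert a S)
  obtain d where d: "d > 0" "\<forall>x\<in>S. \<forall>y\<in>S. x \<noteq> y \<longrightarrow> d \<le> dist x y" using insert.IH by blast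
  obtain d' where d': "d' > 0" "\<forall>x\<in>S. x \<noteq> a \<longrightarrow> d' \<le> dist a x" using finite_set_avoid[OF insert.hyps(1)] by blast
  show ?case
    by (rule exI[of _ "min d d'"]) (use d d' in \<open>auto simp: dist_commute min.coboundedI1 min.coboundedI2\<close>)
qed

text \<open>
  \<open>ent\<close> selects the entire case and \<open>cball p \<rho>\<close> is the disc that \<open>f\<close> is to map into itself.  The
  sets \<open>N k\<close> are shrinking neighbourhoods of \<open>X\<^sub>0\<close>.  At time \<open>t s\<close> the set \<open>N (3 s)\<close> is in \<open>W s\<close>, outside the set \<open>E s\<close> on
  which \<open>f\<close> has already been fixed up to small errors; at time \<open>t s + 1\<close> it is to be at
  \<open>\<Psi> s (N (3 s))\<close> up to the error \<open>\<delta> s\<close> (exactly, for the points of \<open>A s\<close>), whereas the points of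
  \<open>Y s\<close> are to be in the trap.  It then takes \<open>pp s\<close> steps through the sets \<open>\<Delta> r\<close>, where \<open>f\<close> is
  close to \<open>\<tau> r\<close>, to reach \<open>W (s + 1)\<close>.
\<close>

locale orbit_scheme =
  fixes ent :: bool and p :: complex and \<rho> :: real
    and E W \<Delta> \<sigma> N Y A Vt :: "nat \<Rightarrow> complex set"
    and \<tau> \<Psi> :: "nat \<Rightarrow> complex \<Rightarrow> complex" and e \<delta> :: "nat \<Rightarrow> real" and pp t :: "nat \<Rightarrow> nat"
  assumes \<rho>: "\<rho> > 0"
    and E: "\<And>s. compact (E s)" "\<And>s. ent \<Longrightarrow> full (E s)" "\<And>s. E s \<subseteq> E (Suc s)" "\<And>R. \<exists>s. cball 0 R \<subseteq> E s"
    and W: "\<And>s. open (W s)" "disjoint_family W" "\<And>s. W s \<inter> E s = {}" "\<And>s. W s \<inter> cball p \<rho> = {}"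
      "\<And>r s. ent \<Longrightarrow> W r \<subseteq> E s \<or> W r \<inter> E s = {}"
      "\<And>s. ent \<Longrightarrow> cball p \<rho> \<subseteq> E s \<or> cball p \<rho> \<inter> E s = {}"
    and \<Delta>: "\<And>s. compact (\<Delta> s)" "\<And>s. \<Delta> s \<subseteq> W s" "\<And>s. ent \<Longrightarrow> full (\<Delta> s)" "\<And>s. \<tau> s analytic_on \<Delta> s"
      "\<And>s. finite (\<sigma> s)" "\<And>s. \<sigma> s \<subseteq> \<Delta> s" "\<And>s. e s > 0"
    and N: "\<And>k. compact (N k)" "\<And>k. ent \<Longrightarrow> full (N k)" "\<And>k. N (Suc k) \<subseteq> interior (N k)"
    and Y: "\<And>s. finite (Y s)" "\<And>s. Y s \<subseteq> interior (N (3 * s)) - N (3 * s + 1)"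
    and A: "\<And>s. finite (A s)" "\<And>s k. A s \<subseteq> N k"
    and \<Psi>: "\<And>s. \<Psi> s holomorphic_on interior (N (3 * s))"
    and \<delta>: "\<And>s. \<delta> s > 0"
    and stab: "\<And>s h. h analytic_on N (3 * s + 2) \<Longrightarrow> (\<And>x. x \<in> N (3 * s + 2) \<Longrightarrow> norm (h x - \<Psi> s x) < \<delta> s) \<Longrightarrow>
      inj_on h (N (3 * s + 3)) \<and> h ` N (3 * s + 3) \<subseteq> Vt s"
    and transit: "\<And>s g. (\<And>r. r \<le> s \<Longrightarrow> g analytic_on \<Delta> r \<and> (\<forall>z\<in>\<Delta> r. norm (g z - \<tau> r z) \<le> e r) \<and> (\<forall>z\<in>\<sigma> r. g z = \<tau> r z)) \<Longrightarrow>
      (\<forall>z\<in>Vt s. \<forall>j<pp s. (g ^^ j) z \<in> (\<Union>r\<le>s. \<Delta> r)) \<and> inj_on (g ^^ pp s) (Vt s) \<and> (g ^^ pp s) ` Vt s \<subseteq> W (Suc s) - \<Delta> (Suc s)"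
    and init: "N 0 \<subseteq> W 0 - \<Delta> 0"
    and t: "t 0 = 0" "\<And>s. t (Suc s) = t s + 1 + pp s"
begin

text \<open>Every requirement is controlled by the values of \<open>g\<close> on \<open>L\<close>,
  since the limit function is known to be near the approximants on such sets. The conditions
  \<open>(g ^^ j) x \<in> L\<close> bring iterates under the same control.\<close>

definition Inv :: "complex set \<Rightarrow> nat \<Rightarrow> (complex \<Rightarrow> complex) \<Rightarrow> bool" where
  "Inv L s g \<longleftrightarrow> cball p \<rho> \<subseteq> L \<and> g analytic_on L \<and> (\<forall>z\<in>cball p \<rho>. norm (g z - p) \<le> \<rho>) \<and>
   (\<forall>r<s. \<Delta> r \<subseteq> L \<and> (\<forall>z\<in>\<Delta> r. norm (g z - \<tau> r z) \<le> e r) \<and> (\<forall>z\<in>\<sigma> r. g z = \<tau> r z) \<and>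
     (\<forall>x\<in>N (3 * r+2). (\<forall>j\<le>t r. (g ^^ j) x \<in> L) \<and> norm ((g ^^ Suc (t r)) x - \<Psi> r x) < \<delta> r) \<and>
     (\<forall>a\<in>A r. (g ^^ Suc (t r)) a = \<Psi> r a) \<and>
     (\<forall>y\<in>Y r. (\<forall>j\<le>t r. (g ^^ j) y \<in> L) \<and> norm ((g ^^ Suc (t r)) y - p) \<le> \<rho>))"

lemma Inv_D: "Inv L s g \<Longrightarrow> r < s \<Longrightarrow> \<Delta> r \<subseteq> L" "Inv L s g \<Longrightarrow> r < s \<Longrightarrow> z \<in> \<Delta> r \<Longrightarrow> norm (g z - \<tau> r z) \<le> e r"
  "Inv L s g \<Longrightarrow> r < s \<Longrightarrow> z \<in> \<sigma> r \<Longrightarrow> g z = \<tau> r z"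
  "Inv L s g \<Longrightarrow> r < s \<Longrightarrow> x \<in> N (3 * r+2) \<Longrightarrow> j \<le> t r \<Longrightarrow> (g ^^ j) x \<in> L"
  "Inv L s g \<Longrightarrow> r < s \<Longrightarrow> x \<in> N (3 * r+2) \<Longrightarrow> norm ((g ^^ Suc (t r)) x - \<Psi> r x) < \<delta> r"
  "Inv L s g \<Longrightarrow> g analytic_on L" "Inv L s g \<Longrightarrow> z \<in> cball p \<rho> \<Longrightarrow> norm (g z - p) \<le> \<rho>" "Inv L s g \<Longrightarrow> cball p \<rho> \<subseteq> L"
  "Inv L s g \<Longrightarrow> r < s \<Longrightarrow> a \<in> A r \<Longrightarrow> (g ^^ Suc (t r)) a = \<Psi> r a"
  "Inv L s g \<Longrightarrow> r < s \<Longrightarrow> y \<in> Y r \<Longrightarrow> j \<le> t r \<Longrightarrow> (g ^^ j) y \<in> L"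
  "Inv L s g \<Longrightarrow> r < s \<Longrightarrow> y \<in> Y r \<Longrightarrow> norm ((g ^^ Suc (t r)) y - p) \<le> \<rho>"
  by (simp_all add: Inv_def)

lemma N_antimono: "j \<le> k \<Longrightarrow> N k \<subseteq> N j"
  by (rule lift_Suc_antimono_le[of N, OF order_trans[OF N(3) interior_subset]])

lemma N_interior: "j < k \<Longrightarrow> N k \<subseteq> interior (N j)"
  using N_antimono[of "Suc j" k] N(3)[of j] by simp

text \<open>After the last completed stage \<open>r\<close>, the iterate at time
  \<open>Suc (t r)\<close> is near \<open>\<Psi> r\<close> on \<open>N (3 * r + 2)\<close>. By
  stability it is injective on the next neighbourhood \<open>N (3 * r + 3)\<close>, which is
  \<open>N (3 * s)\<close>, with image in \<open>Vt r\<close>; the transit carries this image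
  injectively into \<open>W s\<close>, off \<open>\<Delta> s\<close>.\<close>

lemma Inv_orbit:
  assumes "Inv L s g"
  shows "x \<in> N (3 * s) \<Longrightarrow> j < t s \<Longrightarrow> (g ^^ j) x \<in> L"
    "x \<in> N (3 * s) \<Longrightarrow> (g ^^ t s) x \<in> W s - \<Delta> s"
    "inj_on (g ^^ t s) (N (3 * s))" "(g ^^ t s) analytic_on N (3 * s)"
proof -
  have "(\<forall>x\<in>N (3 * s). (\<forall>j<t s. (g ^^ j) x \<in> L) \<and> (g ^^ t s) x \<in> W s - \<Delta> s) \<and> inj_on (g ^^ t s) (N (3 * s))"
  proof (cases s)
    case 0
    then show ?thesis using init t(1) by (auto simp: inj_on_def)
  next
    case (Suc r)
    have r: "r < s" using Suc by simp
    define h where "h = g ^^ Suc (t r)"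
    have "h analytic_on {x}" if "x \<in> N (3 * r+2)" for x
      unfolding h_def
    proof (rule funpow_analytic)
      fix j assume "j < Suc (t r)"
      then have "(g ^^ j) x \<in> L" using Inv_D(4)[OF assms r that] by simp
      then show "g analytic_on {(g ^^ j) x}" using Inv_D(6)[OF assms] analytic_on_subset by blast
    qed
    then have "h analytic_on N (3 * r+2)" using analytic_on_analytic_at by blast
    then have h: "inj_on h (N (3 * r+3))" "h ` N (3 * r+3) \<subseteq> Vt r"
      using stab[of h r] Inv_D(5)[OF assms r] unfolding h_def by blast+
    have pas: "(\<forall>z\<in>Vt r. \<forall>j<pp r. (g ^^ j) z \<in> (\<Union>r'\<le>r. \<Delta> r')) \<and> inj_on (g ^^ pp r) (Vt r) \<and> (g ^^ pp r) ` Vt r \<subseteq> W (Suc r) - \<Delta> (Suc r)"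
    proof (rule transit)
      fix r' assume "r' \<le> r"
      then have r': "r' < s" using r by simp
      show "g analytic_on \<Delta> r' \<and> (\<forall>z\<in>\<Delta> r'. norm (g z - \<tau> r' z) \<le> e r') \<and> (\<forall>z\<in>\<sigma> r'. g z = \<tau> r' z)"
        using Inv_D(1)[OF assms r'] Inv_D(2)[OF assms r'] Inv_D(3)[OF assms r'] Inv_D(6)[OF assms] analytic_on_subset by blast
    qed
    have ts: "t s = pp r + Suc (t r)" "3 * s = 3 * r + 3" using t(2)[of r] Suc by simp_all
    have gt: "g ^^ t s = (g ^^ pp r) \<circ> h" unfolding ts h_def by (rule funpow_add)
    show ?thesis
    proof (intro conjI ballI allI impI)
      fix x assume "x \<in> N (3 * s)"
      then have x: "x \<in> N (3 * r+3)" "x \<in> N (3 * r+2)" using ts N_antimono[of "3 * r+2" "3 * r+3"] by auto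
      then have hx: "h x \<in> Vt r" using h(2) by blast
      show "(g ^^ t s) x \<in> W s - \<Delta> s" using pas hx Suc unfolding gt by auto
      fix j assume j: "j < t s"
      show "(g ^^ j) x \<in> L"
      proof (cases "j \<le> t r")
        case True then show ?thesis using Inv_D(4)[OF assms r x(2)] by blast
      next
        case False
        define i where "i = j - Suc (t r)"
        have ji: "j = i + Suc (t r)" "i < pp r" using False j ts unfolding i_def by auto
        have "(g ^^ j) x = (g ^^ i) (h x)" unfolding ji(1) h_def funpow_add by simp
        then have "(g ^^ j) x \<in> (\<Union>r'\<le>r. \<Delta> r')" using pas hx ji(2) by simp
        then obtain r' where "r' \<le> r" "(g ^^ j) x \<in> \<Delta> r'" by blast
        then show ?thesis using Inv_D(1)[OF assms, of r'] r by auto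
      qed
    next
      show "inj_on (g ^^ t s) (N (3 * s))" unfolding gt ts(2)
        by (rule comp_inj_on[OF h(1)]) (use pas h(2) inj_on_subset in blast)
    qed
  qed
  then show orb: "x \<in> N (3 * s) \<Longrightarrow> j < t s \<Longrightarrow> (g ^^ j) x \<in> L"
    "x \<in> N (3 * s) \<Longrightarrow> (g ^^ t s) x \<in> W s - \<Delta> s"
    "inj_on (g ^^ t s) (N (3 * s))" for x j by blast+
  have "(g ^^ t s) analytic_on {x}" if "x \<in> N (3 * s)" for x
    by (rule funpow_analytic) (use orb(1)[OF that] Inv_D(6)[OF assms] analytic_on_subset in blast)
  then show "(g ^^ t s) analytic_on N (3 * s)" using analytic_on_analytic_at by blast
qed

text \<open>Only the clauses for index s are new; the earlier ones are inherited because they become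
  weaker as \<open>L\<close> grows.\<close>

lemma Inv_mono:
  assumes "Inv L s g" "L \<subseteq> L'" "g analytic_on L'"
    and "\<Delta> s \<subseteq> L'" "\<And>z. z \<in> \<Delta> s \<Longrightarrow> norm (g z - \<tau> s z) \<le> e s" "\<And>z. z \<in> \<sigma> s \<Longrightarrow> g z = \<tau> s z"
    and "\<And>x j. x \<in> N (3 * s+2) \<Longrightarrow> j \<le> t s \<Longrightarrow> (g ^^ j) x \<in> L'"
    and "\<And>x. x \<in> N (3 * s+2) \<Longrightarrow> norm ((g ^^ Suc (t s)) x - \<Psi> s x) < \<delta> s"
    and "\<And>a. a \<in> A s \<Longrightarrow> (g ^^ Suc (t s)) a = \<Psi> s a"
    and "\<And>y j. y \<in> Y s \<Longrightarrow> j \<le> t s \<Longrightarrow> (g ^^ j) y \<in> L'"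
    and "\<And>y. y \<in> Y s \<Longrightarrow> norm ((g ^^ Suc (t s)) y - p) \<le> \<rho>"
  shows "Inv L' (Suc s) g"
  unfolding Inv_def
proof (intro conjI allI impI)
  show "cball p \<rho> \<subseteq> L'" using Inv_D(8)[OF assms(1)] assms(2) by blast
  show "g analytic_on L'" by fact
  show "\<forall>z\<in>cball p \<rho>. norm (g z - p) \<le> \<rho>" using Inv_D(7)[OF assms(1)] by blast
  fix r assume "r < Suc s"
  then consider "r < s" | "r = s" by linarith
  then have "\<Delta> r \<subseteq> L' \<and> (\<forall>z\<in>\<Delta> r. norm (g z - \<tau> r z) \<le> e r) \<and> (\<forall>z\<in>\<sigma> r. g z = \<tau> r z) \<and>
     (\<forall>x\<in>N (3 * r+2). (\<forall>j\<le>t r. (g ^^ j) x \<in> L') \<and> norm ((g ^^ Suc (t r)) x - \<Psi> r x) < \<delta> r) \<and>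
     (\<forall>a\<in>A r. (g ^^ Suc (t r)) a = \<Psi> r a) \<and>
     (\<forall>y\<in>Y r. (\<forall>j\<le>t r. (g ^^ j) y \<in> L') \<and> norm ((g ^^ Suc (t r)) y - p) \<le> \<rho>)"
  proof cases
    case 1 then show ?thesis using assms(1,2) unfolding Inv_def by blast
  next
    case 2 then show ?thesis using assms(4-11) by blast
  qed
  then show "\<Delta> r \<subseteq> L'" "\<forall>z\<in>\<Delta> r. norm (g z - \<tau> r z) \<le> e r" "\<forall>z\<in>\<sigma> r. g z = \<tau> r z"
     "\<forall>x\<in>N (3 * r+2). (\<forall>j\<le>t r. (g ^^ j) x \<in> L') \<and> norm ((g ^^ Suc (t r)) x - \<Psi> r x) < \<delta> r"
     "\<forall>a\<in>A r. (g ^^ Suc (t r)) a = \<Psi> r a"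
     "\<forall>y\<in>Y r. (\<forall>j\<le>t r. (g ^^ j) y \<in> L') \<and> norm ((g ^^ Suc (t r)) y - p) \<le> \<rho>" by blast+
qed

text \<open>The shape of the controlled set, with one compact block in each earlier
  \<open>W r\<close>, is recorded because in the entire case \<open>E s \<union> L\<close> must have
  connected complement, which is decided block by block.\<close>

definition block_union :: "nat \<Rightarrow> complex set \<Rightarrow> bool" where
  "block_union s L \<longleftrightarrow> (\<exists>m. L = cball p \<rho> \<union> (\<Union>r<s. m r) \<and>
     (\<forall>r<s. compact (m r) \<and> m r \<subseteq> W r \<and> (ent \<longrightarrow> full (m r))))"

lemma block_union_Suc:
  assumes "block_union s L" "compact M" "M \<subseteq> W s" "ent \<Longrightarrow> full M"
  shows "block_union (Suc s) (L \<union> M)"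
proof -
  obtain m where m: "L = cball p \<rho> \<union> (\<Union>r<s. m r)" "\<forall>r<s. compact (m r) \<and> m r \<subseteq> W r \<and> (ent \<longrightarrow> full (m r))"
    using assms(1) unfolding block_union_def by (elim exE conjE) (rule that)
  have "(\<Union>r<Suc s. (m(s := M)) r) = (\<Union>r<s. m r) \<union> M"
    unfolding lessThan_Suc by auto
  then show ?thesis unfolding block_union_def
    by (intro exI[of _ "m(s := M)"]) (use m assms in \<open>auto simp: less_Suc_eq\<close>)
qed

lemma block_union_compact: "block_union s L \<Longrightarrow> compact L"
  unfolding block_union_def by (auto intro!: compact_Un compact_UN)

lemma block_union_disjoint: "block_union s L \<Longrightarrow> L \<inter> W s = {}"
proof -
  assume "block_union s L"
  then obtain m where m: "L = cball p \<rho> \<union> (\<Union>r<s. m r)" "\<forall>r<s. m r \<subseteq> W r"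
    unfolding block_union_def by blast
  have "W r \<inter> W s = {}" if "r < s" for r using W(2) that unfolding disjoint_family_on_def by auto
  then have "m r \<inter> W s = {}" if "r < s" for r using m(2) that by blast
  moreover have "cball p \<rho> \<inter> W s = {}" using W(4) by blast
  ultimately show "L \<inter> W s = {}" unfolding m(1) by blast
qed

text \<open>Each block is swallowed by \<open>E s\<close> or disjoint from it, as its
  \<open>W r\<close> is, and the same alternative holds for the trap. What is left is a disjoint
  union of compact sets with connected complements.\<close>

lemma block_union_full:
  assumes ent "block_union (Suc s) L"
  shows "full (E s \<union> L)"
proof -
  obtain m where m: "L = cball p \<rho> \<union> (\<Union>r<Suc s. m r)" "\<forall>r<Suc s. compact (m r) \<and> m r \<subseteq> W r \<and> full (m r)"
    using assms unfolding block_union_def by blast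
  define R where "R = {r. r < Suc s \<and> W r \<inter> E s = {}}"
  define U where "U = (\<Union>r\<in>R. m r)"
  have finR: "finite R" unfolding R_def by simp
  have Wdisj: "W i \<inter> W j = {}" if "i \<noteq> j" for i j using W(2) that unfolding disjoint_family_on_def by blast
  have cU: "compact U" unfolding U_def using finR m(2) by (intro compact_UN) (auto simp: R_def)
  have fU: "full U" unfolding U_def
  proof (rule full_UN[OF finR])
    fix i j assume "i \<in> R" "j \<in> R" "i \<noteq> j"
    then have "m i \<subseteq> W i" "m j \<subseteq> W j" using m(2) unfolding R_def by auto
    then show "m i \<inter> m j = {}" using Wdisj[OF \<open>i \<noteq> j\<close>] by blast
  qed (use m(2) in \<open>auto simp: R_def\<close>)
  have UE: "U \<inter> E s = {}" unfolding U_def R_def using m(2) by blast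
  have UD: "U \<inter> cball p \<rho> = {}" unfolding U_def R_def using m(2) W(4) by blast
  have 1: "full (E s \<union> U)" by (rule full_Un[OF E(1) compact_imp_closed[OF cU] _ E(2)[OF assms(1)] fU]) (use UE in blast)
  have abs: "m r \<subseteq> E s" if "r < Suc s" "r \<notin> R" for r
    using that W(5)[OF assms(1), of r s] m(2) unfolding R_def by blast
  have "m r \<subseteq> E s \<union> U" if "r < Suc s" for r
    using abs[OF that] unfolding U_def by (cases "r \<in> R") auto
  then have sub: "(\<Union>r<Suc s. m r) \<subseteq> E s \<union> U" by blast
  have sub': "U \<subseteq> (\<Union>r<Suc s. m r)" unfolding U_def R_def by blast
  show ?thesis
  proof (cases "cball p \<rho> \<subseteq> E s")
    case True
    have "E s \<union> L = E s \<union> U" unfolding m(1) using sub sub' True by blast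
    then show ?thesis using 1 by simp
  next
    case False
    then have DE: "cball p \<rho> \<inter> E s = {}" using W(6)[OF assms(1)] by blast
    have "full (cball p \<rho> \<union> (E s \<union> U))"
      by (rule full_Un[OF compact_cball compact_imp_closed[OF compact_Un[OF E(1) cU]] _ full_cball 1]) (use DE UD in blast)
    moreover have "E s \<union> L = cball p \<rho> \<union> (E s \<union> U)" unfolding m(1) using sub sub' by blast
    ultimately show ?thesis by simp
  qed
qed

text \<open>A function with its safety margin: whatever stays within \<eta> of it on
  \<open>L\<close> and agrees with it at the nodes \<open>F\<close> satisfies \<open>Inv\<close>. So
  does the limit, provided that all later changes add up to at most \<eta>.\<close>

definition stage :: "nat \<Rightarrow> (complex \<Rightarrow> complex) \<Rightarrow> complex set \<Rightarrow> complex set \<Rightarrow> real \<Rightarrow> bool" where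
  "stage s f L F \<eta> \<longleftrightarrow> ratfun (if ent then {} else UNIV) f \<and> block_union s L \<and> f analytic_on L \<and>
     finite F \<and> F \<subseteq> L \<and> \<eta> > 0 \<and>
     (\<forall>g. g analytic_on L \<and> (\<forall>z\<in>L. norm (g z - f z) \<le> \<eta>) \<and> (\<forall>z\<in>F. g z = f z) \<longrightarrow> Inv L s g)"

text \<open>The new function comes from \<open>ratfun_extend\<close>, with a target
  \<open>g0\<close> on a compact set \<open>M\<close> in \<open>W s\<close>. The work lies in its
  margin: a perturbation g has its own orbit, which must still arrive in the right part of
  \<open>M\<close>. That this orbit stays in \<open>L\<close> before time \<open>t s\<close> follows
  from the old margin, applied to g itself.\<close>

lemma stage_step:
  assumes "stage s f L F \<eta>"
  shows "\<exists>f' L' F' \<eta>'. stage (Suc s) f' L' F' \<eta>' \<and> L \<subseteq> L' \<and> F \<subseteq> F' \<and> \<eta>' \<le> \<eta> / 2 \<and>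
     (\<lambda>z. f' z - f z) analytic_on E s \<union> L \<and> (\<forall>z\<in>E s \<union> L. norm (f' z - f z) \<le> \<eta> / 2) \<and> (\<forall>z\<in>F. f' z = f z)"
proof -
  have st: "ratfun (if ent then {} else UNIV) f" "block_union s L" "f analytic_on L" "finite F" "F \<subseteq> L" "\<eta> > 0"
    using assms unfolding stage_def by blast+
  have stI: "Inv L s g" if "g analytic_on L" "\<And>z. z \<in> L \<Longrightarrow> norm (g z - f z) \<le> \<eta>" "\<And>z. z \<in> F \<Longrightarrow> g z = f z" for g
    using assms that unfolding stage_def by blast
  have cL: "compact L" using block_union_compact st(2) .
  have Invf: "Inv L s f" by (rule stI) (use st in auto)
  \<comment> \<open>The actual position of \<open>N (3 * s)\<close> at time \<open>t s\<close>. As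
    \<Phi> is univalent, its inverse \<open>G\<close> recovers the starting point, and the new piece
    can be prescribed as \<open>\<Psi> s\<close> after \<open>G\<close>, whatever errors were made
    before.\<close>
  define \<Phi> where "\<Phi> = f ^^ t s"
  note orbf = Inv_orbit[OF Invf, folded \<Phi>_def]
  define O0 where "O0 = interior (N (3 * s))"
  have O0: "open O0" "O0 \<subseteq> N (3 * s)" unfolding O0_def using interior_subset by auto
  have \<Phi>hol: "\<Phi> holomorphic_on O0"
    using analytic_imp_holomorphic[OF orbf(4)] holomorphic_on_subset O0(2) by blast
  have \<Phi>inj: "inj_on \<Phi> O0" using orbf(3) inj_on_subset O0(2) by blast
  have op: "open (\<Phi> ` V)" if "open V" "V \<subseteq> O0" for V
    using open_mapping_thm3[OF holomorphic_on_subset[OF \<Phi>hol that(2)] that(1) inj_on_subset[OF \<Phi>inj that(2)]] .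
  obtain G where G: "G holomorphic_on (\<Phi> ` O0)" "\<And>z. z \<in> O0 \<Longrightarrow> G (\<Phi> z) = z"
    using holomorphic_has_inverse[OF \<Phi>hol O0(1) \<Phi>inj] by metis
  have N1: "N (3 * s + 1) \<subseteq> O0" unfolding O0_def by (rule N_interior) simp
  define Q where "Q = \<Phi> ` N (3 * s + 1)"
  have \<Phi>cont: "continuous_on O0 \<Phi>" using \<Phi>hol holomorphic_on_imp_continuous_on by blast
  have cQ: "compact Q" unfolding Q_def
    using compact_continuous_image[OF continuous_on_subset[OF \<Phi>cont N1] N(1)] .
  have fQ: "full Q" if ent unfolding Q_def
    by (rule full_image[OF N(1) N(2)[OF that] continuous_on_subset[OF \<Phi>cont N1] inj_on_subset[OF \<Phi>inj N1]])
  have QO: "Q \<subseteq> \<Phi> ` O0" unfolding Q_def using N1 by blast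
  have QW: "Q \<subseteq> W s - \<Delta> s" unfolding Q_def using orbf(2) N1 O0(2) by blast
  have YO: "Y s \<subseteq> O0" "Y s \<inter> N (3 * s + 1) = {}" using Y(2)[of s] unfolding O0_def by auto
  \<comment> \<open>The points to be trapped lie outside \<open>N (3 * s + 1)\<close>, hence their
    images lie outside \<open>Q\<close>. Small discs around them can carry the constant target
    \<open>p\<close> while \<open>Q\<close> carries the steering map.\<close>
  define Wo where "Wo = W s - (\<Delta> s \<union> Q)"
  have oWo: "open Wo" unfolding Wo_def using W(1) \<Delta>(1) cQ by (intro open_Diff closed_Un compact_imp_closed)
  have \<Phi>Y: "\<Phi> ` Y s \<subseteq> Wo"
  proof
    fix w assume "w \<in> \<Phi> ` Y s"
    then obtain y where y: "y \<in> Y s" "w = \<Phi> y" by blast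
    have "w \<notin> Q"
    proof
      assume "w \<in> Q"
      then obtain x where "x \<in> N (3 * s + 1)" "\<Phi> x = \<Phi> y" unfolding Q_def using y(2) by auto
      then show False using \<Phi>inj y(1) YO N1 unfolding inj_on_def by blast
    qed
    moreover have "w \<in> W s - \<Delta> s" unfolding y(2) using orbf(2) y(1) YO(1) O0(2) by blast
    ultimately show "w \<in> Wo" unfolding Wo_def by blast
  qed
  have fin\<Phi>Y: "finite (\<Phi> ` Y s)" using Y(1) by blast
  obtain \<kappa>1 where \<kappa>1: "\<kappa>1 > 0" "(\<Union>w\<in>\<Phi> ` Y s. ball w \<kappa>1) \<subseteq> Wo"
    using compact_subset_open_imp_ball_epsilon_subset[OF finite_imp_compact[OF fin\<Phi>Y] oWo \<Phi>Y] by blast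
  obtain \<kappa>2 where \<kappa>2: "\<kappa>2 > 0" "\<forall>x\<in>\<Phi> ` Y s. \<forall>y\<in>\<Phi> ` Y s. x \<noteq> y \<longrightarrow> \<kappa>2 \<le> dist x y"
    using finite_separated[OF fin\<Phi>Y] by blast
  \<comment> \<open>A third of the smaller distance: the closed discs of radius \<kappa> stay in
    \<open>Wo\<close> and are pairwise disjoint.\<close>
  define \<kappa> where "\<kappa> = min \<kappa>1 \<kappa>2 / 3"
  have \<kappa>: "\<kappa> > 0" "\<kappa> < \<kappa>1" "2 * \<kappa> < \<kappa>2" unfolding \<kappa>_def using \<kappa>1(1) \<kappa>2(1) by auto
  define T where "T = (\<Union>w\<in>\<Phi> ` Y s. cball w \<kappa>)"
  have cT: "compact T" unfolding T_def using fin\<Phi>Y by (intro compact_UN) auto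
  have fT: "full T" unfolding T_def
  proof (rule full_UN[OF fin\<Phi>Y compact_cball full_cball])
    fix i j assume ij: "i \<in> \<Phi> ` Y s" "j \<in> \<Phi> ` Y s" "i \<noteq> j"
    show "cball i \<kappa> \<inter> cball j \<kappa> = {}"
    proof (rule ccontr)
      assume "cball i \<kappa> \<inter> cball j \<kappa> \<noteq> {}"
      then obtain z where "dist i z \<le> \<kappa>" "dist j z \<le> \<kappa>" by auto
      then have "dist i j \<le> 2 * \<kappa>" using dist_triangle2[of i j z] by simp
      then show False using \<kappa>2(2) ij \<kappa>(3) by fastforce
    qed
  qed
  have TW: "T \<subseteq> Wo"
  proof -
    have "cball w \<kappa> \<subseteq> ball w \<kappa>1" for w using \<kappa>(2) by auto
    then show ?thesis unfolding T_def using \<kappa>1(2) by blast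
  qed
  define M where "M = Q \<union> (T \<union> \<Delta> s)"
  have cM: "compact M" unfolding M_def using cQ cT \<Delta>(1) by (intro compact_Un)
  have MW: "M \<subseteq> W s" unfolding M_def using QW TW \<Delta>(2)[of s] unfolding Wo_def by blast
  have QT: "Q \<inter> (T \<union> \<Delta> s) = {}" "T \<inter> \<Delta> s = {}" using QW TW unfolding Wo_def by blast+
  have fM: "full M" if ent
    unfolding M_def
    by (intro full_Un cQ cT fT fQ[OF that] \<Delta>(3)[OF that] QT compact_imp_closed compact_Un \<Delta>(1))
  obtain O1 O1' where O1: "open O1" "open O1'" "Q \<subseteq> O1" "T \<union> \<Delta> s \<subseteq> O1'" "O1 \<inter> O1' = {}"
    using separation_normal[OF compact_imp_closed[OF cQ] compact_imp_closed[OF compact_Un[OF cT \<Delta>(1)[of s]]] QT(1)] by blast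
  obtain O2 O2' where O2: "open O2" "open O2'" "T \<subseteq> O2" "\<Delta> s \<subseteq> O2'" "O2 \<inter> O2' = {}"
    using separation_normal[OF compact_imp_closed[OF cT] compact_imp_closed[OF \<Delta>(1)[of s]] QT(2)] by blast
  \<comment> \<open>Three targets glued along disjoint open sets: steering on \<open>Q\<close>,
    trapping on \<open>T\<close>, and the transit map on \<open>\<Delta> s\<close>.\<close>
  define g0 where "g0 = (\<lambda>z. if z \<in> O1 then \<Psi> s (G z) else if z \<in> O2 then p else \<tau> s z)"
  have GO: "G ` (\<Phi> ` O0) \<subseteq> O0" using G(2) by auto
  have holQ: "(\<lambda>z. \<Psi> s (G z)) holomorphic_on \<Phi> ` O0"
    using holomorphic_on_compose_gen[OF G(1) \<Psi>[of s, folded O0_def] GO] by (simp add: comp_def)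
  have g0Q: "g0 z = \<Psi> s (G z)" if "z \<in> Q" for z using that O1(3) unfolding g0_def by auto
  have g0T: "g0 z = p" if "z \<in> T" for z using that O1 O2 unfolding g0_def by auto
  have g0\<Delta>: "g0 z = \<tau> s z" if "z \<in> \<Delta> s" for z using that O1 O2 unfolding g0_def by auto
  have an1: "g0 analytic_on Q"
  proof (rule analytic_on_locally_eq[of _ Q "O1 \<inter> \<Phi> ` O0"])
    have "(\<lambda>z. \<Psi> s (G z)) analytic_on \<Phi> ` O0" using holQ op[OF O0(1)] analytic_on_open by blast
    then show "(\<lambda>z. \<Psi> s (G z)) analytic_on Q" using analytic_on_subset QO by blast
  qed (use O1 QO op[OF O0(1)] in \<open>auto simp: g0_def\<close>)
  have an2: "g0 analytic_on T"
    by (rule analytic_on_locally_eq[of "\<lambda>z. p" T "O1' \<inter> O2"]) (use O1 O2 in \<open>auto simp: g0_def\<close>)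
  have an3: "g0 analytic_on \<Delta> s"
    by (rule analytic_on_locally_eq[OF \<Delta>(4)[of s], of "O1' \<inter> O2'"]) (use O1 O2 in \<open>auto simp: g0_def\<close>)
  have g0an: "g0 analytic_on M" unfolding M_def analytic_on_Un using an1 an2 an3 by simp
  have N2: "N (3 * s + 2) \<subseteq> interior (N (3 * s + 1))" "N (3 * s + 2) \<subseteq> N (3 * s)" "N (3 * s + 2) \<subseteq> O0"
    using N_interior[of "3 * s + 1" "3 * s + 2"] N_antimono[of "3 * s" "3 * s + 2"] N_interior[of "3 * s" "3 * s + 2"]
    unfolding O0_def by auto
  define V1 where "V1 = \<Phi> ` interior (N (3 * s + 1))"
  have V1: "open V1" "V1 \<subseteq> Q" "\<Phi> ` N (3 * s + 2) \<subseteq> V1"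
    unfolding V1_def Q_def
    by (rule op[OF open_interior order_trans[OF interior_subset N1]], rule image_mono[OF interior_subset],
        rule image_mono[OF N2(1)])
  have c2: "compact (\<Phi> ` N (3 * s + 2))"
    using compact_continuous_image[OF continuous_on_subset[OF \<Phi>cont N2(3)] N(1)] .
  obtain \<gamma>1 where \<gamma>1: "\<gamma>1 > 0" "(\<Union>w\<in>\<Phi> ` N (3 * s + 2). ball w \<gamma>1) \<subseteq> V1"
    using compact_subset_open_imp_ball_epsilon_subset[OF c2 V1(1,3)] by blast
  have "uniformly_continuous_on Q (\<lambda>z. \<Psi> s (G z))"
    using compact_uniformly_continuous[OF _ cQ] holomorphic_on_imp_continuous_on[OF holQ] QO continuous_on_subset by blast
  moreover have "\<delta> s / 2 > 0" using \<delta> by simp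
  ultimately obtain \<gamma>2 where \<gamma>2: "\<gamma>2 > 0" "\<forall>x\<in>Q. \<forall>x'\<in>Q. dist x' x < \<gamma>2 \<longrightarrow> dist (\<Psi> s (G x')) (\<Psi> s (G x)) < \<delta> s / 2"
    unfolding uniformly_continuous_on_def by blast
  \<comment> \<open>Admissible error of the position at time \<open>t s\<close>:
    \<open>\<kappa>\<close> keeps the points to be trapped in their discs, \<open>\<gamma>1\<close>
    keeps \<open>N (3 * s + 2)\<close> inside \<open>Q\<close>, and \<open>\<gamma>2\<close> changes
    the steering value by less than \<open>\<delta> s / 2\<close>.\<close>
  define \<gamma> where "\<gamma> = min \<kappa> (min \<gamma>1 \<gamma>2 / 2)"
  have \<gamma>: "\<gamma> > 0" "\<gamma> \<le> \<kappa>" "\<gamma> < \<gamma>1" "\<gamma> < \<gamma>2" unfolding \<gamma>_def using \<kappa> \<gamma>1 \<gamma>2 by auto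
  have fcont: "continuous_on L f" using st(3) analytic_imp_holomorphic holomorphic_on_imp_continuous_on by blast
  from funpow_perturbation[OF cL fcont \<gamma>(1), of "t s"] obtain \<eta>1 where \<eta>1: "\<eta>1 > 0"
    "\<forall>g x. (\<forall>z\<in>L. norm (g z - f z) \<le> \<eta>1) \<and> (\<forall>j<t s. (f ^^ j) x \<in> L \<and> (g ^^ j) x \<in> L) \<longrightarrow>
       norm ((g ^^ t s) x - (f ^^ t s) x) \<le> \<gamma>" by (elim exE conjE) (rule that)
  \<comment> \<open>The error is spent twice, between \<open>f'\<close> and its target and between a
    later g and \<open>f'\<close>; hence the bounds are needed for
    \<open>2 * \<eta>'\<close>.\<close>
  define \<eta>' where "\<eta>' = min (\<eta> / 4) (min (\<eta>1 / 2) (min (\<delta> s / 4) (min (\<rho> / 4) (e s / 4))))"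
  have \<eta>': "\<eta>' > 0" "2 * \<eta>' \<le> \<eta> / 2" "2 * \<eta>' \<le> \<eta>1" "2 * \<eta>' \<le> \<delta> s / 2" "2 * \<eta>' \<le> \<rho>" "2 * \<eta>' \<le> e s"
    unfolding \<eta>'_def using st(6) \<eta>1(1) \<delta>[of s] \<rho> \<Delta>(7)[of s] by auto
  \<comment> \<open>The new nodes are the orbits of \<open>A s\<close> up to time
    \<open>t s\<close>, so that these points arrive without any error, and the set
    \<open>\<sigma> s\<close> on which the transit map must be attained exactly.\<close>
  define F' where "F' = F \<union> (\<Union>j<t s. (f ^^ j) ` A s) \<union> \<Phi> ` A s \<union> \<sigma> s"
  have finF': "finite F'" unfolding F'_def using st(4) A(1) \<Delta>(5) by auto
  have A_orb: "(f ^^ j) a \<in> L" if "a \<in> A s" "j < t s" for a j using orbf(1) A(2) that by blast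
  have A_Q: "\<Phi> a \<in> Q" if "a \<in> A s" for a unfolding Q_def using A(2) that by blast
  have F'LM: "F' \<subseteq> L \<union> M" unfolding F'_def M_def using st(5) A_orb A_Q \<Delta>(6)[of s] by blast
  have bu: "block_union (Suc s) (L \<union> M)" by (rule block_union_Suc[OF st(2) cM MW fM])
  \<comment> \<open>\<open>W s\<close> is the open set that separates old from new in
    \<open>ratfun_extend\<close>.\<close>
  have dis: "(E s \<union> L) \<inter> W s = {}" using W(3) block_union_disjoint[OF st(2)] by blast
  have ful: "full (E s \<union> L \<union> M)" if ent using block_union_full[OF that bu] by (simp add: Un_assoc)
  have "\<exists>f'. ratfun (if ent then {} else UNIV) f' \<and> (\<lambda>z. f' z - f z) analytic_on E s \<union> L \<and>
     (\<forall>z\<in>E s \<union> L. norm (f' z - f z) \<le> \<eta>') \<and> (\<forall>z\<in>(E s \<union> L) \<inter> F'. f' z = f z) \<and> f' analytic_on M \<and>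
     (\<forall>z\<in>M. norm (f' z - g0 z) \<le> \<eta>') \<and> (\<forall>z\<in>M \<inter> F'. f' z = g0 z)"
    by (rule ratfun_extend[OF st(1) compact_Un[OF E(1)[of s] cL] cM W(1) MW dis _ g0an finF' \<eta>'(1)]) (rule ful)
  then obtain f' where f'_all: "ratfun (if ent then {} else UNIV) f' \<and> (\<lambda>z. f' z - f z) analytic_on E s \<union> L \<and>
     (\<forall>z\<in>E s \<union> L. norm (f' z - f z) \<le> \<eta>') \<and> (\<forall>z\<in>(E s \<union> L) \<inter> F'. f' z = f z) \<and> f' analytic_on M \<and>
     (\<forall>z\<in>M. norm (f' z - g0 z) \<le> \<eta>') \<and> (\<forall>z\<in>M \<inter> F'. f' z = g0 z)"
    by (elim exE) (rule that)
  have f': "ratfun (if ent then {} else UNIV) f'" "(\<lambda>z. f' z - f z) analytic_on E s \<union> L"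
    "\<And>z. z \<in> E s \<union> L \<Longrightarrow> norm (f' z - f z) \<le> \<eta>'" "\<And>z. z \<in> L \<Longrightarrow> z \<in> F' \<Longrightarrow> f' z = f z" "f' analytic_on M"
    "\<And>z. z \<in> M \<Longrightarrow> norm (f' z - g0 z) \<le> \<eta>'" "\<And>z. z \<in> M \<Longrightarrow> z \<in> F' \<Longrightarrow> f' z = g0 z"
    using f'_all by blast+
  have f'L: "f' analytic_on L"
  proof -
    have "(\<lambda>z. (f' z - f z) + f z) analytic_on L"
      by (intro analytic_intros st(3) analytic_on_subset[OF f'(2)]) auto
    then show ?thesis by simp
  qed
  have "Inv (L \<union> M) (Suc s) g"
    if g: "g analytic_on L \<union> M" "\<And>z. z \<in> L \<union> M \<Longrightarrow> norm (g z - f' z) \<le> \<eta>'" "\<And>z. z \<in> F' \<Longrightarrow> g z = f' z" for g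
  proof -
    have gf: "norm (g z - f z) \<le> 2 * \<eta>'" if "z \<in> L" for z
    proof -
      have "norm (g z - f' z) \<le> \<eta>'" "norm (f' z - f z) \<le> \<eta>'" using g(2) f'(3) that by auto
      then show ?thesis using norm_triangle_mono[of "g z - f' z" \<eta>' "f' z - f z" \<eta>'] by simp
    qed
    have gM: "norm (g z - g0 z) \<le> 2 * \<eta>'" if "z \<in> M" for z
    proof -
      have "norm (g z - f' z) \<le> \<eta>'" "norm (f' z - g0 z) \<le> \<eta>'" using g(2) f'(6) that by auto
      then show ?thesis using norm_triangle_mono[of "g z - f' z" \<eta>' "f' z - g0 z" \<eta>'] by simp
    qed
    have InvL: "Inv L s g"
    proof (rule stI)
      show "g analytic_on L" using g(1) analytic_on_subset by blast
      show "norm (g z - f z) \<le> \<eta>" if "z \<in> L" for z using gf[OF that] \<eta>'(2) st(6) by linarith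
      show "g z = f z" if "z \<in> F" for z
        using g(3)[of z] f'(4)[of z] that st(5) unfolding F'_def by auto
    qed
    note orbg = Inv_orbit[OF InvL]
    have near: "norm ((g ^^ t s) x - \<Phi> x) \<le> \<gamma>" if "x \<in> N (3 * s)" for x
      unfolding \<Phi>_def
    proof (rule \<eta>1(2)[rule_format], intro conjI ballI allI impI)
      show "norm (g z - f z) \<le> \<eta>1" if "z \<in> L" for z using gf[OF that] \<eta>'(3) by linarith
      show "(f ^^ j) x \<in> L" "(g ^^ j) x \<in> L" if "j < t s" for j
        using orbf(1)[OF \<open>x \<in> N (3 * s)\<close> that] orbg(1)[OF \<open>x \<in> N (3 * s)\<close> that] by auto
    qed
    have nQ: "(g ^^ t s) x \<in> Q" if "x \<in> N (3 * s + 2)" for x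
    proof -
      have "norm ((g ^^ t s) x - \<Phi> x) \<le> \<gamma>" using near that N2(2) by blast
      then have "(g ^^ t s) x \<in> ball (\<Phi> x) \<gamma>1" using \<gamma>(3) by (simp add: dist_norm norm_minus_commute)
      then show ?thesis using \<gamma>1(2) V1(2) that by blast
    qed
    have nT: "(g ^^ t s) y \<in> T" if "y \<in> Y s" for y
    proof -
      have "norm ((g ^^ t s) y - \<Phi> y) \<le> \<gamma>" using near that YO(1) O0(2) by blast
      then have "(g ^^ t s) y \<in> cball (\<Phi> y) \<kappa>" using \<gamma>(2) by (simp add: dist_norm norm_minus_commute)
      then show ?thesis unfolding T_def using that by blast
    qed
    have Aeq: "(g ^^ j) a = (f ^^ j) a" if "a \<in> A s" "j \<le> t s" for a j
      using that(2)
    proof (induction j)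
      case (Suc j)
      then have "(f ^^ j) a \<in> L" "(f ^^ j) a \<in> F'" using A_orb[OF that(1)] that(1) unfolding F'_def by auto
      then have "g ((f ^^ j) a) = f ((f ^^ j) a)" using g(3) f'(4) by simp
      then show ?case using Suc by simp
    qed simp
    show ?thesis
    proof (rule Inv_mono[OF InvL _ g(1)])
      show "\<Delta> s \<subseteq> L \<union> M" unfolding M_def by blast
      show "norm (g z - \<tau> s z) \<le> e s" if "z \<in> \<Delta> s" for z
      proof -
        have "z \<in> M" using that unfolding M_def by blast
        then show ?thesis using gM[of z] g0\<Delta>[OF that] \<eta>'(6) by simp
      qed
      show "g z = \<tau> s z" if "z \<in> \<sigma> s" for z
      proof -
        have z: "z \<in> F'" "z \<in> \<Delta> s" "z \<in> M" using that \<Delta>(6)[of s] unfolding F'_def M_def by auto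
        then show ?thesis using g(3)[OF z(1)] f'(7)[OF z(3,1)] g0\<Delta>[OF z(2)] by simp
      qed
      show "(g ^^ j) x \<in> L \<union> M" if "x \<in> N (3 * s + 2)" "j \<le> t s" for x j
      proof (cases "j = t s")
        case True then show ?thesis using nQ[OF that(1)] unfolding M_def by blast
      next
        case False
        then have "j < t s" using that(2) by simp
        then show ?thesis using orbg(1)[of x j] that(1) N2(2) by blast
      qed
      show "norm ((g ^^ Suc (t s)) x - \<Psi> s x) < \<delta> s" if x: "x \<in> N (3 * s + 2)" for x
      proof -
        define w where "w = (g ^^ t s) x"
        have wQ: "w \<in> Q" unfolding w_def by (rule nQ[OF x])
        have xQ: "\<Phi> x \<in> Q" using x V1 by blast
        have "dist w (\<Phi> x) < \<gamma>2" using near[of x] x N2(2) \<gamma>(4) unfolding w_def dist_norm by fastforce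
        then have "dist (\<Psi> s (G w)) (\<Psi> s (G (\<Phi> x))) < \<delta> s / 2" using \<gamma>2(2) wQ xQ by blast
        moreover have "G (\<Phi> x) = x" using G(2) x N2(3) by blast
        ultimately have 1: "norm (\<Psi> s (G w) - \<Psi> s x) < \<delta> s / 2" by (simp add: dist_norm)
        have "w \<in> M" using wQ unfolding M_def by blast
        then have 2: "norm (g w - \<Psi> s (G w)) \<le> \<delta> s / 2" using gM[of w] g0Q[OF wQ] \<eta>'(4) by simp
        have "norm (g w - \<Psi> s x) \<le> norm (g w - \<Psi> s (G w)) + norm (\<Psi> s (G w) - \<Psi> s x)"
          using norm_triangle_ineq[of "g w - \<Psi> s (G w)" "\<Psi> s (G w) - \<Psi> s x"] by simp
        then show ?thesis using 1 2 unfolding w_def by simp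
      qed
      show "(g ^^ Suc (t s)) a = \<Psi> s a" if a: "a \<in> A s" for a
      proof -
        have z: "\<Phi> a \<in> F'" "\<Phi> a \<in> Q" "\<Phi> a \<in> M" using a A_Q[OF a] unfolding F'_def M_def by auto
        have "(g ^^ Suc (t s)) a = g (\<Phi> a)" using Aeq[OF a, of "t s"] unfolding \<Phi>_def by simp
        also have "\<dots> = \<Psi> s (G (\<Phi> a))" using g(3)[OF z(1)] f'(7)[OF z(3,1)] g0Q[OF z(2)] by simp
        also have "G (\<Phi> a) = a" using G(2) a A(2)[of s "3 * s + 2"] N2(3) by blast
        finally show ?thesis .
      qed
      show "(g ^^ j) y \<in> L \<union> M" if "y \<in> Y s" "j \<le> t s" for y j
      proof (cases "j = t s")
        case True then show ?thesis using nT[OF that(1)] unfolding M_def by blast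
      next
        case False
        then have "j < t s" using that(2) by simp
        then show ?thesis using orbg(1)[of y j] that(1) YO(1) O0(2) by blast
      qed
      show "norm ((g ^^ Suc (t s)) y - p) \<le> \<rho>" if y: "y \<in> Y s" for y
      proof -
        have w: "(g ^^ t s) y \<in> T" "(g ^^ t s) y \<in> M" using nT[OF y] unfolding M_def by auto
        show ?thesis using gM[OF w(2)] g0T[OF w(1)] \<eta>'(5) by simp
      qed
    qed auto
  qed
  then have "stage (Suc s) f' (L \<union> M) F' \<eta>'"
    unfolding stage_def using f'(1) bu f'L f'(5) finF' F'LM \<eta>'(1) by (simp add: analytic_on_Un)
  moreover have "\<eta>' \<le> \<eta> / 2" using \<eta>'(1,2) by linarith
  moreover have "norm (f' z - f z) \<le> \<eta> / 2" if "z \<in> E s \<union> L" for z using f'(3)[OF that] \<open>\<eta>' \<le> \<eta> / 2\<close> by linarith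
  moreover have "f' z = f z" if "z \<in> F" for z using f'(4)[of z] that st(5) unfolding F'_def by auto
  moreover have "F \<subseteq> F'" unfolding F'_def by blast
  ultimately show ?thesis using f'(2)
    by (intro exI[of _ f'] exI[of _ "L \<union> M"] exI[of _ F'] exI[of _ \<eta>']) auto
qed

text \<open>Every function within \<rho> of the constant \<open>p\<close> on the trap maps the trap
  into itself.\<close>

lemma stage_0: "stage 0 (\<lambda>z. p) (cball p \<rho>) {} \<rho>"
  unfolding stage_def Inv_def block_union_def using \<rho> by (auto simp: ratfun_const)

text \<open>The margins at least halve, so all changes after stage i sum to at most
  \<open>\<eta> i\<close>, and the limit satisfies \<open>Inv\<close> for every stage. On
  \<open>E s\<close> only the differences of approximants are analytic and small; the approximants
  themselves may have poles there.\<close>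

theorem limit_function:
  "\<exists>f. f nicely_meromorphic_on UNIV \<and> (ent \<longrightarrow> f holomorphic_on UNIV) \<and> (\<forall>s. \<exists>L. Inv L s f)"
proof -
  define P where "P = (\<lambda>s (x :: (complex \<Rightarrow> complex) \<times> complex set \<times> complex set \<times> real).
     stage s (fst x) (fst (snd x)) (fst (snd (snd x))) (snd (snd (snd x))))"
  define R where "R = (\<lambda>s (x :: (complex \<Rightarrow> complex) \<times> complex set \<times> complex set \<times> real)
       (x' :: (complex \<Rightarrow> complex) \<times> complex set \<times> complex set \<times> real).
     fst (snd x) \<subseteq> fst (snd x') \<and> fst (snd (snd x)) \<subseteq> fst (snd (snd x')) \<and> snd (snd (snd x')) \<le> snd (snd (snd x)) / 2 \<and>
     (\<lambda>z. fst x' z - fst x z) analytic_on E s \<union> fst (snd x) \<and>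
     (\<forall>z\<in>E s \<union> fst (snd x). norm (fst x' z - fst x z) \<le> snd (snd (snd x)) / 2) \<and>
     (\<forall>z\<in>fst (snd (snd x)). fst x' z = fst x z))"
  have "\<exists>X. \<forall>s. P s (X s) \<and> R s (X s) (X (Suc s))"
  proof (rule dependent_nat_choice)
    show "\<exists>x. P 0 x" unfolding P_def by (rule exI[of _ "(\<lambda>z. p, cball p \<rho>, {}, \<rho>)"]) (simp add: stage_0)
    fix x s assume "P s x"
    from stage_step[OF this[unfolded P_def]] obtain f' L' F' \<eta>' where "stage (Suc s) f' L' F' \<eta>' \<and> fst (snd x) \<subseteq> L' \<and> fst (snd (snd x)) \<subseteq> F' \<and>
       \<eta>' \<le> snd (snd (snd x)) / 2 \<and> (\<lambda>z. f' z - fst x z) analytic_on E s \<union> fst (snd x) \<and>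
       (\<forall>z\<in>E s \<union> fst (snd x). norm (f' z - fst x z) \<le> snd (snd (snd x)) / 2) \<and> (\<forall>z\<in>fst (snd (snd x)). f' z = fst x z)"
      by (elim exE) (rule that)
    then show "\<exists>y. P (Suc s) y \<and> R s x y"
      unfolding P_def R_def by (intro exI[of _ "(f', L', F', \<eta>')"]) simp
  qed
  then obtain X where X: "\<And>s. P s (X s)" "\<And>s. R s (X s) (X (Suc s))" by blast
  define fs where "fs = (\<lambda>s. fst (X s))"
  define Ls where "Ls = (\<lambda>s. fst (snd (X s)))"
  define Fs where "Fs = (\<lambda>s. fst (snd (snd (X s))))"
  define \<eta> where "\<eta> = (\<lambda>s. snd (snd (snd (X s))))"
  have stage: "stage s (fs s) (Ls s) (Fs s) (\<eta> s)" for s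
    using X(1)[of s] unfolding P_def fs_def Ls_def Fs_def \<eta>_def .
  have step: "Ls s \<subseteq> Ls (Suc s)" "Fs s \<subseteq> Fs (Suc s)" "\<eta> (Suc s) \<le> \<eta> s / 2"
     "(\<lambda>z. fs (Suc s) z - fs s z) analytic_on E s \<union> Ls s"
     "z \<in> E s \<union> Ls s \<Longrightarrow> norm (fs (Suc s) z - fs s z) \<le> \<eta> s / 2"
     "z \<in> Fs s \<Longrightarrow> fs (Suc s) z = fs s z" for s z
    using X(2)[of s] unfolding R_def fs_def Ls_def Fs_def \<eta>_def by blast+
  have \<eta>pos: "\<eta> s > 0" and rat: "ratfun (if ent then {} else UNIV) (fs s)" and fsL: "fs s analytic_on Ls s" for s
    using stage[of s] unfolding stage_def by blast+
  have mono: "E i \<union> Ls i \<subseteq> E (i + k) \<union> Ls (i + k)" "Fs i \<subseteq> Fs (i + k)" for i k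
    by (induction k) (use E(3) step(1,2) in fastforce)+
  have \<eta>dec: "\<eta> (i + k) \<le> \<eta> i / 2 ^ k" for i k
  proof (induction k)
    case (Suc k)
    have "\<eta> (i + Suc k) \<le> \<eta> (i + k) / 2" using step(3)[of "i + k"] by simp
    also have "\<dots> \<le> \<eta> i / 2 ^ k / 2" using Suc by simp
    finally show ?case by simp
  qed simp
  have tel: "norm (fs (i + k) z - fs i z) \<le> \<eta> i * (1 - 1 / 2 ^ k)" if z: "z \<in> E i \<union> Ls i" for i k z
  proof (induction k)
    case (Suc k)
    have "norm (fs (i + Suc k) z - fs (i + k) z) \<le> \<eta> (i + k) / 2" using step(5)[of z "i + k"] mono(1)[of i k] z by auto
    also have "\<dots> \<le> \<eta> i / 2 ^ k / 2" using \<eta>dec[of i k] by simp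
    finally have 1: "norm (fs (i + Suc k) z - fs (i + k) z) \<le> \<eta> i / 2 ^ k / 2" .
    have "norm (fs (i + Suc k) z - fs i z) \<le> \<eta> i / 2 ^ k / 2 + \<eta> i * (1 - 1 / 2 ^ k)"
      using norm_triangle_mono[OF 1 Suc] by simp
    also have "\<dots> = \<eta> i * (1 - 1 / 2 ^ Suc k)" by (simp add: field_simps)
    finally show ?case .
  qed simp
  have tel': "norm (fs n z - fs i z) \<le> \<eta> i" if "z \<in> E i \<union> Ls i" "i \<le> n" for i n z
  proof -
    have "\<eta> i * (1 - 1 / 2 ^ (n - i)) \<le> \<eta> i * 1" using \<eta>pos[of i] by (intro mult_left_mono) auto
    then show ?thesis using tel[OF that(1), of "n - i"] that(2) by simp
  qed
  have Fs_eq: "fs (i + k) z = fs i z" if "z \<in> Fs i" for i k z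
  proof (induction k)
    case (Suc k)
    have "z \<in> Fs (i + k)" using mono(2) that by blast
    then show ?case using step(6)[of z "i + k"] Suc by simp
  qed simp
  have diff_an: "(\<lambda>z. fs (i + k) z - fs i z) analytic_on E i \<union> Ls i" for i k
  proof (induction k)
    case (Suc k)
    have "(\<lambda>z. fs (i + Suc k) z - fs (i + k) z) analytic_on E i \<union> Ls i"
      using analytic_on_subset[OF step(4)[of "i + k"] mono(1)] by simp
    then have "(\<lambda>z. (fs (i + Suc k) z - fs (i + k) z) + (fs (i + k) z - fs i z)) analytic_on E i \<union> Ls i"
      using Suc by (rule analytic_on_add)
    then show ?case by simp
  qed simp
  have \<eta>0: "(\<lambda>k. \<eta> (i + k)) \<longlonglongrightarrow> 0" for i
  proof (rule tendsto_sandwich[of "\<lambda>k. 0" _ _ "\<lambda>k. \<eta> i / 2 ^ k"])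
    have "(\<lambda>k. \<eta> i * (1/2) ^ k) \<longlonglongrightarrow> \<eta> i * 0" by (intro tendsto_intros LIMSEQ_power_zero) auto
    then show "(\<lambda>k. \<eta> i / 2 ^ k) \<longlonglongrightarrow> 0" by (simp add: power_one_over)
  qed (auto intro!: always_eventually \<eta>dec less_imp_le[OF \<eta>pos])
  have conv: "\<exists>l. (\<lambda>s. fs s z) \<longlonglongrightarrow> l" for z
  proof -
    obtain i where i: "cball 0 (norm z) \<subseteq> E i" using E(4) by blast
    have "Cauchy (\<lambda>k. fs (i + k) z)"
    proof (rule CauchyI')
      fix e' :: real assume "e' > 0"
      from LIMSEQ_D[OF \<eta>0[of i] this] obtain M where M: "\<And>k. k \<ge> M \<Longrightarrow> \<eta> (i + k) < e'" using \<eta>pos by fastforce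
      show "\<exists>M. \<forall>m\<ge>M. \<forall>n>m. dist (fs (i + m) z) (fs (i + n) z) < e'"
      proof (intro exI[of _ M] allI impI)
        fix m n assume mn: "M \<le> m" "m < n"
        have "z \<in> E (i + m) \<union> Ls (i + m)" using mono(1)[of i m] i by auto
        then have "norm (fs (i + n) z - fs (i + m) z) \<le> \<eta> (i + m)" using tel' mn by simp
        then show "dist (fs (i + m) z) (fs (i + n) z) < e'" using M[OF mn(1)] by (simp add: dist_norm norm_minus_commute)
      qed
    qed
    then obtain l where "(\<lambda>k. fs (i + k) z) \<longlonglongrightarrow> l" using Cauchy_convergent convergent_def by blast
    then have "(\<lambda>k. fs (k + i) z) \<longlonglongrightarrow> l" by (simp add: add.commute)
    then have "(\<lambda>s. fs s z) \<longlonglongrightarrow> l" by (rule LIMSEQ_offset)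
    then show ?thesis by blast
  qed
  \<comment> \<open>The pointwise limit exists at poles too: there division by zero supplies dummy
    values, which cancel in the differences.\<close>
  define fl where "fl = (\<lambda>z. lim (\<lambda>s. fs s z))"
  have lim: "(\<lambda>s. fs s z) \<longlonglongrightarrow> fl z" for z using conv[of z] unfolding fl_def by (metis convergent_LIMSEQ_iff convergent_def)
  have close: "norm (fl z - fs i z) \<le> \<eta> i" if "z \<in> E i \<union> Ls i" for i z
  proof (rule LIMSEQ_le_const2)
    show "(\<lambda>s. norm (fs s z - fs i z)) \<longlonglongrightarrow> norm (fl z - fs i z)" by (intro tendsto_intros lim)
    show "\<exists>N. \<forall>n\<ge>N. norm (fs n z - fs i z) \<le> \<eta> i" using tel'[OF that] by blast
  qed
  have fl_Fs: "fl z = fs i z" if "z \<in> Fs i" for i z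
  proof (rule LIMSEQ_unique[OF lim])
    have "(\<lambda>k. fs (k + i) z) \<longlonglongrightarrow> fs i z" using Fs_eq[OF that] by (simp add: add.commute)
    then show "(\<lambda>s. fs s z) \<longlonglongrightarrow> fs i z" by (rule LIMSEQ_offset)
  qed
  have hol: "(\<lambda>z. fl z - fs i z) holomorphic_on interior (E i)" for i
  proof (rule holomorphic_uniform_sequence[OF open_interior])
    show "(\<lambda>z. fs (i + k) z - fs i z) holomorphic_on interior (E i)" for k
      by (rule analytic_imp_holomorphic[OF analytic_on_subset[OF diff_an]]) (use interior_subset in blast)
    fix x assume "x \<in> interior (E i)"
    then obtain d where d: "d > 0" "cball x d \<subseteq> interior (E i)" using open_contains_cball by (metis open_interior)
    have "uniform_limit (cball x d) (\<lambda>k z. fs (i + k) z - fs i z) (\<lambda>z. fl z - fs i z) sequentially"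
    proof (rule uniform_limitI)
      fix e' :: real assume "e' > 0"
      from LIMSEQ_D[OF \<eta>0[of i] this] obtain M where M: "\<And>k. k \<ge> M \<Longrightarrow> \<eta> (i + k) < e'" using \<eta>pos by fastforce
      show "\<forall>\<^sub>F k in sequentially. \<forall>z\<in>cball x d. dist (fs (i + k) z - fs i z) (fl z - fs i z) < e'"
        unfolding eventually_sequentially
      proof (intro exI[of _ M] allI impI ballI)
        fix k z assume k: "M \<le> k" and z: "z \<in> cball x d"
        have "z \<in> E (i + k) \<union> Ls (i + k)" using z d(2) interior_subset mono(1)[of i k] by blast
        then have "norm (fl z - fs (i + k) z) \<le> \<eta> (i + k)" by (rule close)
        then show "dist (fs (i + k) z - fs i z) (fl z - fs i z) < e'" using M[OF k] by (simp add: dist_norm norm_minus_commute)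
      qed
    qed
    then show "\<exists>d>0. cball x d \<subseteq> interior (E i) \<and> uniform_limit (cball x d) (\<lambda>k z. fs (i + k) z - fs i z) (\<lambda>z. fl z - fs i z) sequentially"
      using d by blast
  qed
  have inner: "\<exists>k. z \<in> interior (E (i + k))" for z i
  proof -
    obtain n where n: "cball 0 (norm z + 1) \<subseteq> E n" using E(4) by blast
    have "E n \<subseteq> E (i + n)" using lift_Suc_mono_le[of E n "i + n"] E(3) by simp
    then have "ball 0 (norm z + 1) \<subseteq> E (i + n)" using n ball_subset_cball by blast
    then have "ball 0 (norm z + 1) \<subseteq> interior (E (i + n))" by (rule interior_maximal) simp
    moreover have "z \<in> ball 0 (norm z + 1)" by simp
    ultimately show ?thesis by blast
  qed
  have han: "(\<lambda>w. fl w - fs n w) analytic_on {z}" if "z \<in> interior (E n)" for n z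
    using hol[of n] that analytic_at open_interior by blast
  have mero: "fl meromorphic_on UNIV"
    unfolding meromorphic_on_meromorphic_at[of fl UNIV]
  proof
    fix z
    obtain n where n: "z \<in> interior (E n)" using inner[of z 0] by auto
    have "(\<lambda>w. (fl w - fs n w) + fs n w) meromorphic_on {z}"
      by (intro meromorphic_on_add analytic_on_imp_meromorphic_on[OF han[OF n]] ratfun_meromorphic[OF rat])
    then show "fl meromorphic_on {z}" by simp
  qed
  have anL: "fl analytic_on {z}" if z: "fs i analytic_on {z}" "z \<in> E i \<union> Ls i" for i z
  proof -
    obtain k where k: "z \<in> interior (E (i + k))" using inner by blast
    have "(\<lambda>w. fs (i + k) w - fs i w) analytic_on {z}" by (rule analytic_on_subset[OF diff_an]) (use z in blast)
    then have "(\<lambda>w. (fl w - fs (i + k) w) + ((fs (i + k) w - fs i w) + fs i w)) analytic_on {z}"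
      by (intro analytic_on_add han[OF k] z)
    then show ?thesis by simp
  qed
  \<comment> \<open>This normalises the values at the poles and changes nothing at points of
    analyticity, in particular on all \<open>Ls i\<close>.\<close>
  define f where "f = remove_sings fl"
  have f_eq: "f z = fl z" "f analytic_on {z}" if "fl analytic_on {z}" for z
    unfolding f_def using that remove_sings_analytic_on by auto
  have fL: "fl analytic_on {z}" if "z \<in> Ls i" for i z
    by (rule anL[of i]) (use that fsL[of i] analytic_on_subset in blast)+
  have "Inv (Ls i) i f" for i
  proof -
    have "f analytic_on Ls i" using f_eq(2) fL analytic_on_analytic_at by blast
    moreover have "norm (f z - fs i z) \<le> \<eta> i" if "z \<in> Ls i" for z using f_eq(1)[OF fL[OF that]] close that by simp
    moreover have "f z = fs i z" if "z \<in> Fs i" for z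
      using f_eq(1)[OF fL[of z i]] fl_Fs[OF that] that stage[of i] unfolding stage_def by auto
    ultimately show ?thesis using stage[of i] unfolding stage_def by blast
  qed
  moreover have "f nicely_meromorphic_on UNIV" unfolding f_def by (rule remove_sings_nicely_meromorphic[OF mero])
  moreover have "f holomorphic_on UNIV" if ent
  proof -
    have "f analytic_on {z}" for z
    proof (rule f_eq(2))
      obtain n where "z \<in> interior (E n)" using inner[of z 0] by auto
      then have "z \<in> E n \<union> Ls n" using interior_subset by blast
      moreover have "fs n analytic_on {z}" using rat[of n] that by (intro ratfun_analytic[of "{}"]) auto
      ultimately show "fl analytic_on {z}" using anL by blast
    qed
    then show ?thesis using analytic_on_analytic_at analytic_imp_holomorphic by blast
  qed
  ultimately show ?thesis by blast
qed

end

section \<open>Orbits of compact sets\<close>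

lemma compact_nbhd:
  assumes "compact K" "ent \<Longrightarrow> full K" "open U" "K \<subseteq> U"
  shows "\<exists>K'. compact K' \<and> (ent \<longrightarrow> full K') \<and> K \<subseteq> interior K' \<and> K' \<subseteq> U"
proof (cases ent)
  case True
  then show ?thesis using full_compact_nbhd[OF assms(1) assms(2)[OF True] assms(3,4)] by metis
next
  case False
  obtain P r where P: "finite P" "P \<subseteq> K" "r > 0" "K \<subseteq> (\<Union>p\<in>P. ball p r)" "\<And>p. p \<in> P \<Longrightarrow> cball p (2 * r) \<subseteq> U"
    using open_UN_ball_cover[OF assms(1,3,4)] by blast
  define K' where "K' = (\<Union>p\<in>P. cball p (2 * r))"
  have "compact K'" unfolding K'_def using P(1) by (intro compact_UN) auto
  moreover have "K' \<subseteq> U" unfolding K'_def using P(5) by blast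
  moreover have "ball p r \<subseteq> cball p (2 * r)" for p using P(3) by auto
  then have "(\<Union>p\<in>P. ball p r) \<subseteq> K'" unfolding K'_def by blast
  then have "(\<Union>p\<in>P. ball p r) \<subseteq> interior K'" by (rule interior_maximal) auto
  then have "K \<subseteq> interior K'" using P(4) by blast
  ultimately show ?thesis using False by blast
qed

text \<open>A boundary point of a compact set is a limit of points outside it, and compactness of
  the boundary reduces the approximation at scale \<open>r\<close> to finitely many of them. These
  are the points to be sent into the trap.\<close>

lemma frontier_finite_approx:
  fixes X :: "complex set"
  assumes "compact X" "open U" "X \<subseteq> U" "r > 0"
  shows "\<exists>Y. finite Y \<and> Y \<subseteq> U - X \<and> (\<forall>x\<in>frontier X. \<exists>y\<in>Y. dist x y < r)"
proof -
  have cF: "compact (frontier X)" using assms(1) compact_frontier by blast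
  have FX: "frontier X \<subseteq> X" using assms(1) by (simp add: compact_imp_closed frontier_subset_closed)
  have "\<exists>y. y \<in> U - X \<and> dist x y < r / 2" if x: "x \<in> frontier X" for x
  proof -
    have "open (ball x (r/2) \<inter> U)" using assms(2) by blast
    moreover have "x \<in> ball x (r/2) \<inter> U" using x FX assms(3,4) by auto
    ultimately obtain e where e: "e > 0" "ball x e \<subseteq> ball x (r/2) \<inter> U" using open_contains_ball by blast
    have "ball x e - X \<noteq> {}" using x e(1) unfolding frontier_straddle by fastforce
    then obtain y where "y \<in> ball x e" "y \<notin> X" by blast
    then have "y \<in> U - X" "y \<in> ball x (r/2)" using e(2) by blast+
    then show ?thesis by auto
  qed
  then obtain y where y: "\<And>x. x \<in> frontier X \<Longrightarrow> y x \<in> U - X \<and> dist x (y x) < r / 2" by metis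
  have "frontier X \<subseteq> (\<Union>x\<in>frontier X. ball x (r/2))" using assms(4) by auto
  from compactE_image[OF cF _ this] obtain P where P: "P \<subseteq> frontier X" "finite P" "frontier X \<subseteq> (\<Union>x\<in>P. ball x (r/2))"
    by auto
  show ?thesis
  proof (intro exI[of _ "y ` P"] conjI ballI)
    show "finite (y ` P)" using P(2) by blast
    show "y ` P \<subseteq> U - X" using y P(1) by blast
    fix x assume "x \<in> frontier X"
    then obtain p where p: "p \<in> P" "dist p x < r / 2" using P(3) by auto
    have "dist p (y p) < r / 2" using y p(1) P(1) by blast
    then have "dist x (y p) < r" using p(2) dist_triangle_half_r[of p x r "y p"] by blast
    then show "\<exists>y\<in>y ` P. dist x y < r" using p(1) by blast
  qed
qed

text \<open>\<open>Y k\<close> is chosen in the interior of \<open>N k\<close> off \<open>X\<close>,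
  and \<open>N (Suc k)\<close> is then taken small enough to avoid it: these points follow the orbit
  of \<open>X\<close> for as long as \<open>N k\<close> is controlled and may leave it
  afterwards.\<close>

lemma nested_neighborhoods:
  fixes X :: "complex set"
  assumes "compact X" "ent \<Longrightarrow> full X" "\<And>k. open (H k)" "\<And>k::nat. X \<subseteq> H k"
  shows "\<exists>N Y. \<forall>k. compact (N k) \<and> (ent \<longrightarrow> full (N k)) \<and> X \<subseteq> interior (N k) \<and> N k \<subseteq> H k \<and>
     N (Suc k) \<subseteq> interior (N k) \<and> finite (Y k) \<and> Y k \<subseteq> interior (N k) - N (Suc k) \<and>
     (\<forall>x\<in>frontier X. \<exists>y\<in>Y k. dist x y < 1 / real (Suc k))"
proof -
  define P where "P = (\<lambda>k N. compact N \<and> (ent \<longrightarrow> full N) \<and> X \<subseteq> interior N \<and> N \<subseteq> H k)"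
  define Q where "Q = (\<lambda>k N N' Y. N' \<subseteq> interior N \<and> finite Y \<and> Y \<subseteq> interior N - N' \<and>
     (\<forall>x\<in>frontier X. \<exists>y\<in>Y. dist x y < 1 / real (Suc k)))"
  have "\<exists>N. \<forall>k. P k (N k) \<and> (\<exists>Y. Q k (N k) (N (Suc k)) Y)"
  proof (rule dependent_nat_choice)
    show "\<exists>N. P 0 N" unfolding P_def by (rule compact_nbhd[OF assms(1,2,3,4)])
    fix N k assume PN: "P k N"
    obtain Y where Y: "finite Y" "Y \<subseteq> interior N - X" "\<forall>x\<in>frontier X. \<exists>y\<in>Y. dist x y < 1 / real (Suc k)"
      using frontier_finite_approx[OF assms(1) open_interior, of N "1 / real (Suc k)"] PN unfolding P_def by auto
    have op: "open (H (Suc k) \<inter> interior N - Y)" using assms(3) Y(1) by (intro open_Diff open_Int finite_imp_closed) auto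
    have sub: "X \<subseteq> H (Suc k) \<inter> interior N - Y" using assms(4) PN Y(2) unfolding P_def by blast
    have "\<exists>N'. compact N' \<and> (ent \<longrightarrow> full N') \<and> X \<subseteq> interior N' \<and> N' \<subseteq> H (Suc k) \<inter> interior N - Y"
      by (rule compact_nbhd[OF assms(1,2) op sub])
    then obtain N' where N': "compact N' \<and> (ent \<longrightarrow> full N') \<and> X \<subseteq> interior N' \<and> N' \<subseteq> H (Suc k) \<inter> interior N - Y" by blast
    then have "P (Suc k) N'" unfolding P_def by blast
    moreover have "Q k N N' Y" unfolding Q_def using Y N' by blast
    ultimately show "\<exists>N'. P (Suc k) N' \<and> (\<exists>Y. Q k N N' Y)" by blast
  qed
  then obtain N where N: "\<And>k. P k (N k)" "\<And>k. \<exists>Y. Q k (N k) (N (Suc k)) Y" by blast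
  then obtain Y where Y: "\<And>k. Q k (N k) (N (Suc k)) (Y k)" by metis
  show ?thesis
    by (intro exI[of _ N] exI[of _ Y] allI) (use N(1) Y in \<open>auto simp: P_def Q_def\<close>)
qed

text \<open>\<open>h\<close> composed with the inverse of \<open>\<Psi>\<close> is the identity plus
  a small holomorphic \<open>v\<close>, defined on a \<open>d\<close>-neighbourhood of the compact
  image. With \<open>8 * \<delta> / d \<le> 1 / 2\<close>, \<open>v\<close> is a contraction and
  cannot destroy injectivity.\<close>

lemma stable_injective:
  assumes "\<Psi> holomorphic_on U" "open U" "inj_on \<Psi> U" "B \<subseteq> U" "compact B'" "B' \<subseteq> interior B"
    "open T" "\<Psi> ` B' \<subseteq> T"
  shows "\<exists>\<delta>>0. \<forall>h. h analytic_on B \<and> (\<forall>x\<in>B. norm (h x - \<Psi> x) < \<delta>) \<longrightarrow> inj_on h B' \<and> h ` B' \<subseteq> T"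
proof -
  define V where "V = interior B"
  have V: "open V" "V \<subseteq> B" "V \<subseteq> U" "B' \<subseteq> V" unfolding V_def using assms(4,6) interior_subset by blast+
  have hV: "\<Psi> holomorphic_on V" "inj_on \<Psi> V" using assms(1,3) V(3) holomorphic_on_subset inj_on_subset by blast+
  obtain G where G: "G holomorphic_on \<Psi> ` V" "\<And>z. z \<in> V \<Longrightarrow> G (\<Psi> z) = z"
    using holomorphic_has_inverse[OF hV(1) V(1) hV(2)] by metis
  have oP: "open (\<Psi> ` V)" using open_mapping_thm3[OF hV(1) V(1) hV(2)] .
  have "continuous_on B' \<Psi>" using hV(1) holomorphic_on_imp_continuous_on V(4) continuous_on_subset by blast
  then have cS: "compact (\<Psi> ` B')" using assms(5) by (rule compact_continuous_image)
  obtain d where d: "d > 0" "(\<Union>w\<in>\<Psi> ` B'. ball w d) \<subseteq> \<Psi> ` V"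
    using compact_subset_open_imp_ball_epsilon_subset[OF cS oP image_mono[OF V(4)]] by blast
  obtain d' where d': "d' > 0" "(\<Union>w\<in>\<Psi> ` B'. ball w d') \<subseteq> T"
    using compact_subset_open_imp_ball_epsilon_subset[OF cS assms(7,8)] by blast
  define \<delta> where "\<delta> = min (d / 16) d'"
  have \<delta>: "\<delta> > 0" "\<delta> \<le> d'" "8 * \<delta> / d \<le> 1 / 2" unfolding \<delta>_def using d(1) d'(1) by (auto simp: field_simps)
  show ?thesis
  proof (intro exI[of _ \<delta>] conjI allI impI)
    fix h assume h: "h analytic_on B \<and> (\<forall>x\<in>B. norm (h x - \<Psi> x) < \<delta>)"
    define v where "v = (\<lambda>w. h (G w) - w)"
    have "h holomorphic_on V" using h analytic_imp_holomorphic holomorphic_on_subset V(2) by blast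
    moreover have "G ` (\<Psi> ` V) \<subseteq> V" using G(2) by auto
    ultimately have "(h \<circ> G) holomorphic_on \<Psi> ` V" using holomorphic_on_compose_gen[OF G(1)] by blast
    then have vhol: "v holomorphic_on \<Psi> ` V" unfolding v_def by (intro holomorphic_intros) (simp add: comp_def)
    have vb: "norm (v w) \<le> \<delta>" if "w \<in> \<Psi> ` V" for w
      using that h V(2) G(2) unfolding v_def by (auto intro!: less_imp_le)
    have v\<Psi>: "v (\<Psi> x) = h x - \<Psi> x" if "x \<in> B'" for x using G(2) V(4) that unfolding v_def by auto
    show "inj_on h B'"
    proof (rule inj_onI)
      fix x y assume xy: "x \<in> B'" "y \<in> B'" "h x = h y"
      have "norm (v (\<Psi> x) - v (\<Psi> y)) \<le> (8 * \<delta> / d) * norm (\<Psi> x - \<Psi> y)"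
        by (rule holomorphic_small_Lipschitz[OF vhol oP \<delta>(1) vb d(1), of "\<Psi> ` B'"]) (use xy d(2) in auto)
      also have "\<dots> \<le> (1/2) * norm (\<Psi> x - \<Psi> y)" by (rule mult_right_mono[OF \<delta>(3)]) simp
      finally have "norm (\<Psi> y - \<Psi> x) \<le> (1/2) * norm (\<Psi> x - \<Psi> y)" using v\<Psi> xy by simp
      then have "\<Psi> x = \<Psi> y" by (simp add: norm_minus_commute)
      then show "x = y" using hV(2) xy V(4) unfolding inj_on_def by blast
    qed
    show "h ` B' \<subseteq> T"
    proof
      fix w assume "w \<in> h ` B'"
      then obtain x where x: "x \<in> B'" "w = h x" by blast
      have "norm (h x - \<Psi> x) < \<delta>" using h x V by blast
      then have "h x \<in> ball (\<Psi> x) d'" using \<delta>(2) by (simp add: dist_norm norm_minus_commute)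
      then show "w \<in> T" using d'(2) x by blast
    qed
  qed (use \<delta> in auto)
qed

text \<open>The sequence \<open>a\<close> excludes a finite limit and \<open>b\<close> excludes a
  pole. The argument by sequences applies equally when poles accumulate at infinity.\<close>

lemma essential_at_infinityI:
  assumes "filterlim a at_infinity sequentially" "filterlim (\<lambda>k. f (a k)) at_infinity sequentially"
    and "filterlim b at_infinity sequentially" "\<And>k. norm (f (b k)) \<le> B"
  shows "essential_at_infinity f"
  unfolding essential_at_infinity_def not_essential_def
proof
  assume "\<exists>x. ((\<lambda>z. f (1 / z)) \<longlongrightarrow> x) (at 0) \<or> is_pole (\<lambda>z. f (1 / z)) 0"
  then consider x where "((\<lambda>z. f (1 / z)) \<longlongrightarrow> x) (at 0)" | "is_pole (\<lambda>z. f (1 / z)) 0" by blast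
  then show False
  proof cases
    case 1
    have "filterlim (\<lambda>k. inverse (a k)) (at 0) sequentially"
      using assms(1) by (simp add: filterlim_inverse_at_iff)
    from filterlim_compose[OF 1 this] have "(\<lambda>k. f (a k)) \<longlonglongrightarrow> x" by (simp add: inverse_eq_divide)
    then show False using not_tendsto_and_filterlim_at_infinity[OF sequentially_bot _ assms(2)] by blast
  next
    case 2
    have "filterlim (\<lambda>k. inverse (b k)) (at 0) sequentially"
      using assms(3) by (simp add: filterlim_inverse_at_iff)
    from filterlim_compose[OF 2[unfolded is_pole_def] this]
    have "filterlim (\<lambda>k. f (b k)) at_infinity sequentially" by (simp add: inverse_eq_divide)
    from filterlim_at_infinity[of 0, THEN iffD1, rule_format, OF order_refl this, of "\<bar>B\<bar> + 1"]
    have "\<forall>\<^sub>F k in sequentially. \<bar>B\<bar> + 1 \<le> norm (f (b k))" by simp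
    then obtain k where "\<bar>B\<bar> + 1 \<le> norm (f (b k))" unfolding eventually_sequentially by blast
    then show False using assms(4)[of k] by simp
  qed
qed

section \<open>Diffeomorphic images and the orbit of \<open>X 0\<close>\<close>

lemma smooth_diffeomorphism_continuous:
  assumes "smooth_diffeomorphism \<theta>"
  shows "continuous_on S \<theta>" "continuous_on S (inv \<theta>)" "bij \<theta>"
proof -
  have "C_k 0 \<theta>" "C_k 0 (inv \<theta>)" using assms unfolding smooth_diffeomorphism_def C_infinity_def by blast+
  then show "continuous_on S \<theta>" "continuous_on S (inv \<theta>)" by (metis C_k.simps(1) continuous_on_subset subset_UNIV)+
  show "bij \<theta>" using assms unfolding smooth_diffeomorphism_def by blast
qed

lemma frontier_diffeomorphic_image:
  assumes "smooth_diffeomorphism \<theta>" "closed S" "w \<in> frontier (\<theta> ` S)"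
  shows "\<exists>z\<in>S. z \<notin> interior S \<and> w = \<theta> z"
proof -
  note c = smooth_diffeomorphism_continuous[OF assms(1)]
  have im: "\<theta> ` T = inv \<theta> -` T" for T
    using bij_vimage_eq_inv_image[OF bij_imp_bij_inv[OF c(3)], of T] inv_inv_eq[OF c(3)] by simp
  have "closed (\<theta> ` S)" unfolding im using closed_vimage[OF assms(2)] c(2)[of UNIV] by blast
  then have "w \<in> \<theta> ` S" using assms(3) frontier_subset_closed by blast
  then obtain z where z: "z \<in> S" "w = \<theta> z" by blast
  have "open (\<theta> ` interior S)" unfolding im using open_vimage[OF open_interior] c(2)[of UNIV] by blast
  then have "\<theta> ` interior S \<subseteq> interior (\<theta> ` S)" using interior_subset by (intro interior_maximal image_mono)
  then have "z \<notin> interior S" using z assms(3) unfolding frontier_def by blast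
  then show ?thesis using z by blast
qed

text \<open>The data in working form: the divergence of the sets to infinity is stated as local
  finiteness, and \<open>V\<close> is a domain of univalence. The condition \<open>ne\<close> sets
  aside the case of empty sets, where there is no orbit to follow.\<close>

locale compact_orbit =
  fixes X C :: "nat \<Rightarrow> complex set" and \<phi> :: "complex \<Rightarrow> complex" and V :: "complex set" and \<epsilon> :: "nat \<Rightarrow> real"
  assumes X: "\<And>n. compact (X n)" "disjoint_family X" "\<And>R. finite {n. X n \<inter> cball 0 R \<noteq> {}}"
    and C: "\<And>n. finite (C n)" "\<And>n. C n \<subseteq> X n"
    and V: "open V" "(\<Union>n. X n) \<subseteq> V" "\<phi> holomorphic_on V" "inj_on \<phi> V"
    and img: "\<And>n. \<phi> ` X n = X (Suc n)"
    and \<epsilon>: "\<And>n. \<epsilon> n > 0"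
    and ne: "X 0 \<noteq> {}"
begin

text \<open>The natural domain of \<open>\<phi> ^^ n\<close>: the first n points of the orbit lie in
  \<open>V\<close>, outside which \<phi> has only arbitrary values.\<close>

primrec G :: "nat \<Rightarrow> complex set" where
  "G 0 = UNIV"
| "G (Suc n) = {z \<in> G n. (\<phi> ^^ n) z \<in> V}"

lemma X_image: "(\<phi> ^^ n) ` X 0 = X n"
proof (induction n)
  case (Suc n)
  have "(\<phi> ^^ Suc n) ` X 0 = \<phi> ` ((\<phi> ^^ n) ` X 0)" by (simp add: image_comp)
  then show ?case using Suc img by simp
qed simp

lemma X_in_G: "X 0 \<subseteq> G n"
proof (induction n)
  case (Suc n)
  have "(\<phi> ^^ n) ` X 0 \<subseteq> V" unfolding X_image using V(2) by blast
  then show ?case using Suc by auto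
qed simp

lemma G_regular: "open (G n) \<and> (\<phi> ^^ n) holomorphic_on G n \<and> inj_on (\<phi> ^^ n) (G n)"
proof (induction n)
  case 0 then show ?case by (simp add: id_def)
next
  case (Suc n)
  have eq: "G (Suc n) = G n \<inter> (\<phi> ^^ n) -` V" by auto
  have op: "open (G (Suc n))" unfolding eq
    using Suc V(1) continuous_open_preimage holomorphic_on_imp_continuous_on by blast
  have sub: "G (Suc n) \<subseteq> G n" "(\<phi> ^^ n) ` G (Suc n) \<subseteq> V" by auto
  have "(\<phi> \<circ> (\<phi> ^^ n)) holomorphic_on G (Suc n)"
    by (rule holomorphic_on_compose_gen[OF _ V(3) sub(2)]) (use Suc sub(1) holomorphic_on_subset in blast)
  moreover have "inj_on (\<phi> \<circ> (\<phi> ^^ n)) (G (Suc n))"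
    by (rule comp_inj_on) (use Suc sub V(4) inj_on_subset in blast)+
  ultimately show ?case using op by (simp add: comp_def)
qed

lemma G_antimono: "m \<le> n \<Longrightarrow> G n \<subseteq> G m"
  by (rule lift_Suc_antimono_le[of G]) auto

lemma X_eventually_far: "\<exists>n\<ge>m. X n \<inter> cball 0 R = {}"
proof -
  have "finite ({n. X n \<inter> cball 0 R \<noteq> {}} \<union> {..m})" using X(3) by simp
  then obtain n where "n \<notin> {n. X n \<inter> cball 0 R \<noteq> {}} \<union> {..m}" using infinite_UNIV_nat ex_new_if_finite by blast
  then show ?thesis by (intro exI[of _ n]) auto
qed

text \<open>Being univalent, \<open>\<phi> ^^ n\<close> is open on the interior of
  \<open>X 0\<close> and sends interior points to interior points.\<close>

lemma interior_pullback:
  assumes "x \<in> X 0" "(\<phi> ^^ n) x \<notin> interior (X n)"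
  shows "x \<in> frontier (X 0)"
proof -
  have "x \<notin> interior (X 0)"
  proof
    assume x: "x \<in> interior (X 0)"
    have sub: "interior (X 0) \<subseteq> G n" using X_in_G interior_subset by blast
    have "open ((\<phi> ^^ n) ` interior (X 0))"
      using G_regular[of n] sub by (intro open_mapping_thm3) (auto intro: holomorphic_on_subset inj_on_subset)
    moreover have "(\<phi> ^^ n) ` interior (X 0) \<subseteq> X n" using X_image[of n] interior_subset by blast
    ultimately have "(\<phi> ^^ n) ` interior (X 0) \<subseteq> interior (X n)" by (rule interior_maximal[rotated])
    then show False using x assms(2) by blast
  qed
  then show ?thesis using assms(1) closure_subset unfolding frontier_def by blast
qed

end

text \<open>\<open>T n\<close> is the time at which the orbit of \<open>X\<^sub>0\<close> reaches \<open>\<theta>(X\<^sub>n)\<close>.\<close>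

locale realized_orbit = compact_orbit +
  fixes f \<theta> :: "complex \<Rightarrow> complex" and T :: "nat \<Rightarrow> nat" and W :: "nat \<Rightarrow> complex set"
  assumes f: "f nicely_meromorphic_on UNIV"
    and \<theta>: "smooth_diffeomorphism \<theta>"
    and T: "\<And>n. n \<le> T n"
    and f\<theta>: "\<And>n x. x \<in> X 0 \<Longrightarrow> (f ^^ T n) x = \<theta> ((\<phi> ^^ n) x)"
    and \<theta>1: "\<And>n z. z \<in> X n \<Longrightarrow> norm (\<theta> z - z) \<le> 1"
    and orb: "\<And>x m. x \<in> X 0 \<Longrightarrow> f analytic_on {(f ^^ m) x}"
    and bdd: "\<And>x e. x \<in> frontier (X 0) \<Longrightarrow> e > 0 \<Longrightarrow> \<exists>y. dist x y < e \<and> bounded (range (\<lambda>m. (f ^^ m) y))"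
    and W: "\<And>x n. x \<in> X 0 \<Longrightarrow> (f ^^ T n) x \<in> W n" "\<And>x m n. x \<in> X 0 \<Longrightarrow> (f ^^ m) x \<in> W n \<Longrightarrow> m = T n"
begin

text \<open>The sets \<open>X n\<close> leave every disc, and \<theta> moves their points by at most
  1.\<close>

lemma orbit_unbounded:
  assumes "x \<in> X 0"
  shows "\<exists>n\<ge>m. norm ((f ^^ T n) x) > B"
proof -
  obtain n where n: "n \<ge> m" "X n \<inter> cball 0 (B + 1) = {}" using X_eventually_far by blast
  have z: "(\<phi> ^^ n) x \<in> X n" using X_image assms by blast
  then have "norm ((\<phi> ^^ n) x) > B + 1" using n(2) by fastforce
  moreover have "norm (\<theta> ((\<phi> ^^ n) x) - (\<phi> ^^ n) x) \<le> 1" using \<theta>1 z by blast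
  ultimately have "norm (\<theta> ((\<phi> ^^ n) x)) > B"
    using norm_triangle_ineq2[of "(\<phi> ^^ n) x" "\<theta> ((\<phi> ^^ n) x)"] by (simp add: norm_minus_commute)
  then show ?thesis using n(1) f\<theta>[OF assms] by auto
qed

lemma Xn_preimage: "z \<in> X n \<Longrightarrow> \<exists>x\<in>X 0. (\<phi> ^^ n) x = z \<and> \<theta> z = (f ^^ T n) x"
proof -
  assume "z \<in> X n"
  then obtain x where "x \<in> X 0" "z = (\<phi> ^^ n) x" using X_image[of n] by blast
  then show ?thesis using f\<theta>[of x n] by auto
qed

lemma iterates_defined_X: "z \<in> X n \<Longrightarrow> iterates_defined f (\<theta> z)"
proof (rule iterates_definedI)
  fix m assume "z \<in> X n"
  then obtain x where x: "x \<in> X 0" "\<theta> z = (f ^^ T n) x" using Xn_preimage by blast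
  have "(f ^^ m) (\<theta> z) = (f ^^ (m + T n)) x" unfolding x(2) funpow_add by simp
  then show "\<not> is_pole f ((f ^^ m) (\<theta> z))" using orb[OF x(1)] analytic_not_pole by simp
qed

text \<open>The point is the image at time \<open>T n\<close> of a boundary point of
  \<open>X 0\<close>. The continuous map \<open>f ^^ T n\<close> carries the bounded orbits near the
  latter to bounded orbits near the former, and an unbounded orbit has unbounded tails.\<close>

lemma boundary_point_in_Julia:
  assumes "z \<in> X n" "z \<notin> interior (X n)"
  shows "\<theta> z \<in> Julia_set f"
proof -
  obtain x where x: "x \<in> X 0" "(\<phi> ^^ n) x = z" "\<theta> z = (f ^^ T n) x" using Xn_preimage[OF assms(1)] by blast
  have xf: "x \<in> frontier (X 0)" using interior_pullback x assms(2) by blast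
  have "(f ^^ T n) analytic_on {x}" by (rule funpow_analytic) (use orb[OF x(1)] in blast)
  then have cont: "isCont (f ^^ T n) x" by (rule analytic_at_imp_isCont)
  show ?thesis
  proof (rule limit_of_bounded_orbits_in_Julia_set[OF f])
    fix B
    obtain n' where n': "n' \<ge> T n" "norm ((f ^^ T n') x) > B" using orbit_unbounded[OF x(1)] by blast
    have "T n \<le> T n'" using n'(1) T[of n'] by simp
    then have "(f ^^ (T n' - T n)) (\<theta> z) = (f ^^ T n') x"
      unfolding x(3) using funpow_add[of "T n' - T n" "T n" f] by simp
    then show "\<exists>m. norm ((f ^^ m) (\<theta> z)) > B" using n'(2) by metis
  next
    fix e :: real assume "e > 0"
    then obtain d where d: "d > 0" "\<And>y. dist y x < d \<Longrightarrow> dist ((f ^^ T n) y) ((f ^^ T n) x) < e"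
      using cont unfolding continuous_at_eps_delta by blast
    obtain y where y: "dist x y < d" "bounded (range (\<lambda>m. (f ^^ m) y))" using bdd[OF xf d(1)] by blast
    have "range (\<lambda>m. (f ^^ m) ((f ^^ T n) y)) \<subseteq> range (\<lambda>m. (f ^^ m) y)"
    proof
      fix w assume "w \<in> range (\<lambda>m. (f ^^ m) ((f ^^ T n) y))"
      then obtain m where "w = (f ^^ (m + T n)) y" by (auto simp: funpow_add)
      then show "w \<in> range (\<lambda>m. (f ^^ m) y)" by blast
    qed
    then have "bounded (range (\<lambda>m. (f ^^ m) ((f ^^ T n) y)))" using y(2) bounded_subset by blast
    then show "\<exists>w. dist (\<theta> z) w < e \<and> bounded (range (\<lambda>m. (f ^^ m) w))"
      using d(2)[of y] y(1) unfolding x(3) by (metis dist_commute)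
  qed
qed

lemma frontier_union_in_Julia: "frontier (\<theta> ` (\<Union>n. X n)) \<subseteq> Julia_set f"
proof
  fix w assume "w \<in> frontier (\<theta> ` (\<Union>n. X n))"
  moreover have "closed (\<Union>n. X n)" by (rule closed_UN_compact_locally_finite[OF X(1,3)])
  ultimately obtain z n where z: "z \<in> X n" "z \<notin> interior (\<Union>n. X n)" "w = \<theta> z"
    using frontier_diffeomorphic_image[OF \<theta>] by blast
  have "interior (X n) \<subseteq> interior (\<Union>n. X n)" by (intro interior_mono) blast
  then show "w \<in> Julia_set f" using boundary_point_in_Julia[OF z(1)] z by blast
qed

text \<open>If two images met, two orbits starting in \<open>X 0\<close> would coincide from then
  on, with a time shift \<open>j - i\<close>, and would enter some \<open>W N\<close> at different
  times. But \<open>W N\<close> is visited at time \<open>T N\<close> only.\<close>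

lemma wandering: "wandering_compact_set f (\<theta> ` X n)"
  unfolding wandering_compact_set_def
proof (intro conjI allI impI)
  show "compact (\<theta> ` X n)" using compact_continuous_image smooth_diffeomorphism_continuous(1)[OF \<theta>] X(1) by blast
  show "frontier (\<theta> ` X n) \<subseteq> Julia_set f"
    using frontier_diffeomorphic_image[OF \<theta> compact_imp_closed[OF X(1)]] boundary_point_in_Julia by blast
  show "\<forall>z\<in>\<theta> ` X n. iterates_defined f z" using iterates_defined_X by blast
  have *: "iterate f i ` (\<theta> ` X n) \<inter> iterate f j ` (\<theta> ` X n) = {}" if "i < j" for i j
  proof (rule ccontr)
    assume "iterate f i ` (\<theta> ` X n) \<inter> iterate f j ` (\<theta> ` X n) \<noteq> {}"
    then obtain z z' where z: "z \<in> X n" "z' \<in> X n" "iterate f i (\<theta> z) = iterate f j (\<theta> z')" by auto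
    obtain x x' where x: "x \<in> X 0" "\<theta> z = (f ^^ T n) x" "x' \<in> X 0" "\<theta> z' = (f ^^ T n) x'"
      using Xn_preimage[OF z(1)] Xn_preimage[OF z(2)] by blast
    have eq: "(f ^^ (i + T n)) x = (f ^^ (j + T n)) x'"
      using z(3) iterates_definedD(2)[OF iterates_defined_X[OF z(1)], of i]
        iterates_definedD(2)[OF iterates_defined_X[OF z(2)], of j] x by (simp add: funpow_add)
    \<comment> \<open>An index whose visit is still to come: \<open>T N\<close> is at least
      \<open>N\<close>, which is the time of the collision.\<close>
    define N where "N = i + T n"
    define k where "k = T N - N"
    have TN: "T N = k + N" using T[of N] unfolding k_def by simp
    have "(f ^^ T N) x = (f ^^ k) ((f ^^ N) x)" by (subst TN) (simp add: funpow_add)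
    also have "\<dots> = (f ^^ k) ((f ^^ (i + T n)) x)" unfolding N_def ..
    also have "\<dots> = (f ^^ (k + (j + T n))) x'" unfolding eq by (simp add: funpow_add)
    finally have "(f ^^ (k + (j + T n))) x' \<in> W N" using W(1)[OF x(1), of N] by simp
    then have "k + (j + T n) = T N" using W(2)[OF x(3)] by blast
    then show False using TN that unfolding N_def by simp
  qed
  fix i j :: nat assume "j \<noteq> i"
  then consider "i < j" | "j < i" by linarith
  then show "iterate f i ` (\<theta> ` X n) \<inter> iterate f j ` (\<theta> ` X n) = {}"
    by cases (use * in blast)+
qed

lemma conjugacy:
  assumes "z \<in> X n" "T n < T (Suc n)"
  shows "iterate f (T (Suc n) - T n) (\<theta> z) = Some (\<theta> (\<phi> z))"
proof -
  obtain x where x: "x \<in> X 0" "(\<phi> ^^ n) x = z" "\<theta> z = (f ^^ T n) x" using Xn_preimage[OF assms(1)] by blast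
  have "(f ^^ (T (Suc n) - T n)) (\<theta> z) = (f ^^ T (Suc n)) x"
    unfolding x(3) using funpow_add[of "T (Suc n) - T n" "T n" f] assms(2) by simp
  also have "\<dots> = \<theta> (\<phi> z)" using f\<theta>[OF x(1), of "Suc n"] x(2) by simp
  finally show ?thesis using iterates_definedD(2)[OF iterates_defined_X[OF assms(1)]] by simp
qed

end

section \<open>Realising the prescribed orbit\<close>

lemma Cauchy_Riemann_atI:
  assumes "\<theta> analytic_on {z}"
  shows "Cauchy_Riemann_at \<theta> z"
proof -
  have "(\<theta> has_field_derivative deriv \<theta> z) (at z)"
    using assms analytic_on_imp_differentiable_at by (simp add: DERIV_deriv_iff_field_differentiable)
  then have d: "(\<theta> has_derivative (\<lambda>v. deriv \<theta> z * v)) (at z)" by (simp add: has_field_derivative_def)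
  then have "frechet_derivative \<theta> (at z) = (\<lambda>v. deriv \<theta> z * v)" using frechet_derivative_at by metis
  then show ?thesis using d unfolding Cauchy_Riemann_at_def differentiable_def by auto
qed

text \<open>
  The parameters of \<^locale>\<open>orbit_scheme\<close> that are specific to the escaping and oscillating case.
  The visit to \<open>X\<^sub>n\<close> takes place at stage \<open>\<iota> n\<close>.
\<close>

locale orbit_mode = compact_orbit +
  fixes ent :: bool and p :: complex and \<rho> :: real
    and E W \<Delta> \<sigma> Vt :: "nat \<Rightarrow> complex set"
    and \<tau> \<Psi> :: "nat \<Rightarrow> complex \<Rightarrow> complex" and e :: "nat \<Rightarrow> real" and pp t \<iota> :: "nat \<Rightarrow> nat"
  assumes \<rho>: "\<rho> > 0"
    and E: "\<And>s. compact (E s)" "\<And>s. ent \<Longrightarrow> full (E s)" "\<And>s. E s \<subseteq> E (Suc s)" "\<And>R. \<exists>s. cball 0 R \<subseteq> E s"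
    and W: "\<And>s. open (W s)" "disjoint_family W" "\<And>s. W s \<inter> E s = {}" "\<And>s. W s \<inter> cball p \<rho> = {}"
      "\<And>r s. ent \<Longrightarrow> W r \<subseteq> E s \<or> W r \<inter> E s = {}"
      "\<And>s. ent \<Longrightarrow> cball p \<rho> \<subseteq> E s \<or> cball p \<rho> \<inter> E s = {}"
    and \<Delta>: "\<And>s. compact (\<Delta> s)" "\<And>s. \<Delta> s \<subseteq> W s" "\<And>s. ent \<Longrightarrow> full (\<Delta> s)" "\<And>s. \<tau> s analytic_on \<Delta> s"
      "\<And>s. finite (\<sigma> s)" "\<And>s. \<sigma> s \<subseteq> \<Delta> s" "\<And>s. e s > 0"
    and transit: "\<And>s g. (\<And>r. r \<le> s \<Longrightarrow> g analytic_on \<Delta> r \<and> (\<forall>z\<in>\<Delta> r. norm (g z - \<tau> r z) \<le> e r) \<and> (\<forall>z\<in>\<sigma> r. g z = \<tau> r z)) \<Longrightarrow>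
      (\<forall>z\<in>Vt s. \<forall>j<pp s. (g ^^ j) z \<in> (\<Union>r\<le>s. \<Delta> r)) \<and> inj_on (g ^^ pp s) (Vt s) \<and> (g ^^ pp s) ` Vt s \<subseteq> W (Suc s) - \<Delta> (Suc s)"
    and t: "t 0 = 0" "\<And>s. t (Suc s) = t s + 1 + pp s"
    and X0: "ent \<Longrightarrow> full (X 0)"
    and Vt: "\<And>s. open (Vt s)" "\<And>s. \<Psi> s ` X 0 \<subseteq> Vt s"
    and \<Psi>: "\<And>s. \<Psi> s holomorphic_on G (Suc s)" "\<And>s. inj_on (\<Psi> s) (G (Suc s))"
    and \<iota>: "\<iota> 0 = 0" "strict_mono \<iota>"
    and XW: "\<And>n. X n \<subseteq> W (\<iota> n)" "\<And>n. \<Delta> (\<iota> n) = {}"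
    and key: "\<And>n s. \<iota> (Suc n) = Suc s \<Longrightarrow> \<Psi> s = \<phi> ^^ Suc n \<and> pp s = 0"
begin

lemma \<iota>_ge: "n \<le> \<iota> n"
  using \<iota>(2) by (rule strict_mono_imp_increasing)

lemma t_ge: "s \<le> t s"
  by (induction s) (use t in auto)

lemma E_mono: "r \<le> s \<Longrightarrow> E r \<subseteq> E s"
  using lift_Suc_mono_le[of E, OF E(3)] by blast

lemma W_disjoint: "z \<in> W r \<Longrightarrow> z \<in> W s \<Longrightarrow> r = s"
  using W(2) unfolding disjoint_family_on_def by blast

lemma W_far: "\<exists>s0. \<forall>s\<ge>s0. W s \<inter> cball 0 R = {}"
proof -
  obtain s0 where "cball 0 R \<subseteq> E s0" using E(4) by blast
  then have "W s \<inter> cball 0 R = {}" if "s \<ge> s0" for s using W(3)[of s] E_mono[OF that] by blast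
  then show ?thesis by blast
qed

text \<open>\<open>W s\<close> misses \<open>E s\<close>, and the increasing sets \<open>E s\<close>
  exhaust the plane.\<close>

lemma W_tendsto_infinity:
  assumes "\<And>k. a k \<in> W (r k)" "\<And>k. k \<le> r k"
  shows "filterlim a at_infinity sequentially"
  unfolding filterlim_at_infinity[OF order_refl]
proof (intro allI impI)
  fix R :: real assume "R > 0"
  obtain s0 where "\<forall>s\<ge>s0. W s \<inter> cball 0 R = {}" using W_far by blast
  then have "R \<le> norm (a k)" if "k \<ge> s0" for k
    using assms(1)[of k] order_trans[OF that assms(2)] by fastforce
  then show "\<forall>\<^sub>F k in sequentially. R \<le> norm (a k)" unfolding eventually_sequentially by blast
qed

text \<open>The points whose ideal itinerary, given by the iterates of \<phi> and by the maps
  \<Psi>, is respected up to index k. The neighbourhoods \<open>N k\<close> of \<open>X 0\<close>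
  are chosen inside.\<close>

definition H :: "nat \<Rightarrow> complex set" where
  "H k = {z \<in> G (Suc k). (\<forall>n\<le>k. (\<phi> ^^ n) z \<in> W (\<iota> n)) \<and> (\<forall>s\<le>k. \<Psi> s z \<in> Vt s)}"

lemma H_open: "open (H k)"
proof -
  have "open (G (Suc k) \<inter> (\<phi> ^^ n) -` W (\<iota> n))" if "n \<le> k" for n
  proof (rule continuous_open_preimage)
    show "continuous_on (G (Suc k)) (\<phi> ^^ n)"
      using G_regular[of n] G_antimono[of n "Suc k"] that holomorphic_on_imp_continuous_on continuous_on_subset
      by (meson le_SucI)
  qed (use G_regular W(1) in blast)+
  then have 1: "open (\<Inter>n\<in>{..k}. G (Suc k) \<inter> (\<phi> ^^ n) -` W (\<iota> n))" by (intro open_INT) auto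
  have "open (G (Suc k) \<inter> \<Psi> s -` Vt s)" if "s \<le> k" for s
  proof (rule continuous_open_preimage)
    show "continuous_on (G (Suc k)) (\<Psi> s)"
      using \<Psi>(1)[of s] G_antimono[of "Suc s" "Suc k"] that holomorphic_on_imp_continuous_on continuous_on_subset
      by (meson Suc_le_mono)
  qed (use G_regular Vt(1) in blast)+
  then have 2: "open (\<Inter>s\<in>{..k}. G (Suc k) \<inter> \<Psi> s -` Vt s)" by (intro open_INT) auto
  have "H k = (\<Inter>n\<in>{..k}. G (Suc k) \<inter> (\<phi> ^^ n) -` W (\<iota> n)) \<inter> (\<Inter>s\<in>{..k}. G (Suc k) \<inter> \<Psi> s -` Vt s)"
    unfolding H_def by auto
  then show ?thesis using 1 2 by (simp only: open_Int)
qed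

lemma X_in_H: "X 0 \<subseteq> H k"
proof
  fix x assume x: "x \<in> X 0"
  have "(\<phi> ^^ n) x \<in> W (\<iota> n)" for n using X_image[of n] x XW(1)[of n] by blast
  then show "x \<in> H k" unfolding H_def using x X_in_G[of "Suc k"] Vt(2) by blast
qed

text \<open>\<theta> is forced: being the identity on \<open>X 0\<close>, it must be
  \<open>f ^^ T n\<close> after the inverse of \<open>\<phi> ^^ n\<close> on \<open>X n\<close>.
  That map is holomorphic and close to the identity on a neighbourhood \<open>P n\<close>, so the
  gluing lemma extends it to the plane. The tolerances of that lemma are built into the construction
  of \<open>f\<close> beforehand.\<close>

theorem realization:
  "\<exists>f \<theta>. realized_orbit X C \<phi> V \<epsilon> f \<theta> (\<lambda>n. t (\<iota> n)) (\<lambda>n. W (\<iota> n)) \<and> admissible_conjugacy X C \<epsilon> f \<theta> \<and>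
     essential_at_infinity f \<and> (ent \<longrightarrow> f holomorphic_on UNIV) \<and> (\<forall>s. \<forall>x\<in>X 0. (f ^^ Suc (t s)) x \<in> Vt s)"
proof -
  have "\<exists>N Y. \<forall>k. compact (N k) \<and> (ent \<longrightarrow> full (N k)) \<and> X 0 \<subseteq> interior (N k) \<and> N k \<subseteq> H k \<and>
     N (Suc k) \<subseteq> interior (N k) \<and> finite (Y k) \<and> Y k \<subseteq> interior (N k) - N (Suc k) \<and>
     (\<forall>x\<in>frontier (X 0). \<exists>y\<in>Y k. dist x y < 1 / real (Suc k))"
    by (rule nested_neighborhoods[OF X(1) _ H_open X_in_H]) (rule X0)
  then obtain N Y where NY: "\<forall>k. compact (N k) \<and> (ent \<longrightarrow> full (N k)) \<and> X 0 \<subseteq> interior (N k) \<and> N k \<subseteq> H k \<and>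
     N (Suc k) \<subseteq> interior (N k) \<and> finite (Y k) \<and> Y k \<subseteq> interior (N k) - N (Suc k) \<and>
     (\<forall>x\<in>frontier (X 0). \<exists>y\<in>Y k. dist x y < 1 / real (Suc k))"
    by (elim exE) (rule that)
  have N: "compact (N k)" "ent \<Longrightarrow> full (N k)" "X 0 \<subseteq> interior (N k)" "N k \<subseteq> H k" "N (Suc k) \<subseteq> interior (N k)"
    and Y: "finite (Y k)" "Y k \<subseteq> interior (N k) - N (Suc k)"
     "x \<in> frontier (X 0) \<Longrightarrow> \<exists>y\<in>Y k. dist x y < 1 / real (Suc k)" for k x
    using NY by auto
  have XN: "X 0 \<subseteq> N k" for k using N(3) interior_subset by blast
  have NG: "N k \<subseteq> G m" if "m \<le> Suc k" for k m
    using N(4)[of k] G_antimono[OF that] unfolding H_def by blast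
  have NW: "(\<phi> ^^ n) ` N k \<subseteq> W (\<iota> n)" if "n \<le> k" for n k using N(4)[of k] that unfolding H_def by blast
  have NVt: "\<Psi> s ` N k \<subseteq> Vt s" if "s \<le> k" for s k using N(4)[of k] that unfolding H_def by blast
  have "\<exists>\<delta>>0. \<forall>h. h analytic_on N (3 * s + 2) \<and> (\<forall>x\<in>N (3 * s + 2). norm (h x - \<Psi> s x) < \<delta>) \<longrightarrow>
      inj_on h (N (3 * s + 3)) \<and> h ` N (3 * s + 3) \<subseteq> Vt s" for s
  proof (rule stable_injective[OF \<Psi>(1) _ \<Psi>(2)])
    show "open (G (Suc s))" using G_regular by blast
    show "N (3 * s + 2) \<subseteq> G (Suc s)" by (rule NG) simp
    show "N (3 * s + 3) \<subseteq> interior (N (3 * s + 2))" using N(5)[of "3 * s + 2"] by (simp add: eval_nat_numeral)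
    show "\<Psi> s ` N (3 * s + 3) \<subseteq> Vt s" by (rule NVt) simp
  qed (use N Vt in auto)
  then obtain \<delta>1 where \<delta>1: "\<And>s. \<delta>1 s > 0" "\<And>s h. h analytic_on N (3 * s + 2) \<Longrightarrow>
      (\<And>x. x \<in> N (3 * s + 2) \<Longrightarrow> norm (h x - \<Psi> s x) < \<delta>1 s) \<Longrightarrow>
      inj_on h (N (3 * s + 3)) \<and> h ` N (3 * s + 3) \<subseteq> Vt s" by metis
  \<comment> \<open>For n > 0 the visit to \<open>X n\<close> is prepared at stage
    \<open>\<iota> n - 1\<close>, whose estimates hold on
    \<open>N (3 * (\<iota> n - 1) + 2)\<close>, that is, on \<open>N (3 * \<iota> n - 1)\<close>.
    For n = 0 truncated subtraction gives the index 0.\<close>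
  define \<kappa> where "\<kappa> = (\<lambda>n. 3 * \<iota> n - 1)"
  have \<kappa>_ge: "n \<le> \<kappa> n" for n using \<iota>_ge[of n] \<iota>(1) unfolding \<kappa>_def by (cases n) auto
  define P where "P = (\<lambda>n. (\<phi> ^^ n) ` interior (N (\<kappa> n)))"
  have intG: "interior (N (\<kappa> n)) \<subseteq> G n" for n
    using NG[of n "\<kappa> n"] \<kappa>_ge[of n] interior_subset by (meson le_SucI order_trans)
  have reg: "(\<phi> ^^ n) holomorphic_on interior (N (\<kappa> n))" "inj_on (\<phi> ^^ n) (interior (N (\<kappa> n)))" for n
    using G_regular[of n] intG holomorphic_on_subset inj_on_subset by blast+
  have P: "open (P n)" "X n \<subseteq> P n" "P n \<subseteq> W (\<iota> n)" for n
  proof -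
    show "open (P n)" unfolding P_def by (rule open_mapping_thm3[OF reg(1) open_interior reg(2)])
    have "(\<phi> ^^ n) ` X 0 \<subseteq> P n" unfolding P_def by (rule image_mono[OF N(3)])
    then show "X n \<subseteq> P n" by (simp only: X_image)
    show "P n \<subseteq> W (\<iota> n)" unfolding P_def using NW[OF \<kappa>_ge] interior_subset by blast
  qed
  have \<iota>inj: "\<iota> m = \<iota> n \<Longrightarrow> m = n" for m n using strict_mono_eq[OF \<iota>(2)] by blast
  have Pdisj: "disjoint_family P"
    unfolding disjoint_family_on_def using P(3) W_disjoint \<iota>inj by blast
  have Plf: "finite {n. P n \<inter> cball 0 R \<noteq> {}}" for R
  proof -
    obtain s0 where s0: "\<forall>s\<ge>s0. W s \<inter> cball 0 R = {}" using W_far by blast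
    have "n < s0" if "P n \<inter> cball 0 R \<noteq> {}" for n
    proof (rule ccontr)
      assume "\<not> n < s0"
      then have "W (\<iota> n) \<inter> cball 0 R = {}" using s0 \<iota>_ge[of n] by simp
      then show False using that P(3) by blast
    qed
    then have "{n. P n \<inter> cball 0 R \<noteq> {}} \<subseteq> {..<s0}" by blast
    then show ?thesis using finite_subset by blast
  qed
  from glued_near_identity[OF X(1) P(1,2) Pdisj Plf]
  obtain \<delta>2 where \<delta>2: "(\<forall>n. \<delta>2 n > 0) \<and>
    (\<forall>u. (\<forall>n. u n holomorphic_on P n \<and> (\<forall>z\<in>P n. norm (u n z) \<le> \<delta>2 n)) \<longrightarrow>
      (\<exists>\<theta>. smooth_diffeomorphism \<theta> \<and> (\<forall>n. \<exists>N. open N \<and> X n \<subseteq> N \<and> N \<subseteq> P n \<and> (\<forall>z\<in>N. \<theta> z = z + u n z))))"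
    by (elim exE) (rule that)
  \<comment> \<open>Stage s may prepare the visit to \<open>X n\<close> only if
    \<open>\<iota> n = Suc s\<close>, hence \<open>n \<le> Suc s\<close>; the minimum covers all
    these n.\<close>
  define \<delta>3 where "\<delta>3 = (\<lambda>s. Min ((\<lambda>n. min (\<delta>2 n) (\<epsilon> n)) ` {..Suc s}))"
  define \<delta> where "\<delta> = (\<lambda>s. min (\<delta>1 s) (min 1 (\<delta>3 s)))"
  have \<delta>3: "\<delta>3 s > 0" "n \<le> Suc s \<Longrightarrow> \<delta>3 s \<le> min (\<delta>2 n) (\<epsilon> n)" for s n
  proof -
    show "\<delta>3 s > 0" unfolding \<delta>3_def using \<delta>2 \<epsilon> by (subst Min_gr_iff) auto
    show "n \<le> Suc s \<Longrightarrow> \<delta>3 s \<le> min (\<delta>2 n) (\<epsilon> n)" unfolding \<delta>3_def by (rule Min_le) auto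
  qed
  have \<delta>: "\<delta> s > 0" "\<delta> s \<le> \<delta>1 s" "\<delta> s \<le> 1" "n \<le> Suc s \<Longrightarrow> \<delta> s \<le> \<delta>2 n" "n \<le> Suc s \<Longrightarrow> \<delta> s \<le> \<epsilon> n" for s n
    unfolding \<delta>_def using \<delta>1(1)[of s] \<delta>3(1)[of s] \<delta>3(2)[of n s] by auto
  \<comment> \<open>The starting points whose ideal orbits pass through some \<open>C n\<close> with
    \<open>n \<le> Suc s\<close>. Injectivity of \<open>\<phi> ^^ n\<close> keeps the set
    finite.\<close>
  define A where "A = (\<lambda>s. {a \<in> X 0. \<exists>n\<le>Suc s. (\<phi> ^^ n) a \<in> C n})"
  have finA: "finite (A s)" for s
  proof (rule finite_subset)
    show "A s \<subseteq> (\<Union>n\<le>Suc s. (\<phi> ^^ n) -` C n \<inter> G n)" unfolding A_def using X_in_G by blast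
    show "finite (\<Union>n\<le>Suc s. (\<phi> ^^ n) -` C n \<inter> G n)"
      using C(1) G_regular by (intro finite_UN_I finite_vimage_IntI) auto
  qed
  interpret os: orbit_scheme ent p \<rho> E W \<Delta> \<sigma> N "\<lambda>s. Y (3 * s)" A Vt \<tau> \<Psi> e \<delta> pp t
  proof (rule orbit_scheme.intro)
    show "\<Psi> s holomorphic_on interior (N (3 * s))" for s
      using \<Psi>(1)[of s] NG[of "Suc s" "3 * s"] interior_subset[of "N (3 * s)"] holomorphic_on_subset by (metis Suc_le_mono order_trans mult_le_mono1 mult_1 one_le_numeral)
    show "inj_on h (N (3 * s + 3)) \<and> h ` N (3 * s + 3) \<subseteq> Vt s"
      if "h analytic_on N (3 * s + 2)" "\<And>x. x \<in> N (3 * s + 2) \<Longrightarrow> norm (h x - \<Psi> s x) < \<delta> s" for s h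
      using \<delta>1(2)[OF that(1)] that(2) \<delta>(2)[of s] less_le_trans by blast
    show "N 0 \<subseteq> W 0 - \<Delta> 0" using NW[of 0 0] \<iota>(1) XW(2)[of 0] by simp
    show "A s \<subseteq> N k" for s k unfolding A_def using XN by blast
    show "Y (3 * s) \<subseteq> interior (N (3 * s)) - N (3 * s + 1)" for s using Y(2)[of "3 * s"] by simp
  qed (fact \<rho> E W \<Delta> t transit N Y(1) finA \<delta>(1))+
  obtain f where f: "f nicely_meromorphic_on UNIV" "ent \<longrightarrow> f holomorphic_on UNIV" "\<forall>s. \<exists>L. os.Inv L s f"
    using os.limit_function by blast
  have Inv_ex: "\<exists>L. os.Inv L s f" for s using f(3) by blast
  have orbN: "f analytic_on {(f ^^ j) x}" if x: "x \<in> N (3 * s + 2)" and j: "j \<le> t s" for x s j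
  proof -
    obtain L where L: "os.Inv L (Suc s) f" using Inv_ex by blast
    have "(f ^^ j) x \<in> L" by (rule os.Inv_D(4)[OF L _ x j]) simp
    then show ?thesis using os.Inv_D(6)[OF L] analytic_on_subset by blast
  qed
  have f\<Psi>: "norm ((f ^^ Suc (t s)) x - \<Psi> s x) < \<delta> s" if x: "x \<in> N (3 * s + 2)" for x s
  proof -
    obtain L where L: "os.Inv L (Suc s) f" using Inv_ex by blast
    show ?thesis by (rule os.Inv_D(5)[OF L _ x]) simp
  qed
  have fan: "(f ^^ Suc (t s)) analytic_on N (3 * s + 2)" for s
  proof -
    have "(f ^^ Suc (t s)) analytic_on {x}" if "x \<in> N (3 * s + 2)" for x
      by (rule funpow_analytic) (use orbN[OF that] in simp)
    then show ?thesis using analytic_on_analytic_at by blast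
  qed
  have fVt: "(f ^^ Suc (t s)) x \<in> Vt s" if x: "x \<in> N (3 * s + 3)" for x s
    using os.stab[OF fan f\<Psi>] x by blast
  have stage_W: "(f ^^ t s) x \<in> W s" if "x \<in> N (3 * s)" for x s
    using Inv_ex[of s] os.Inv_orbit(2) that by blast
  have fA: "(f ^^ Suc (t s)) a = \<Psi> s a" if "a \<in> A s" for a s
    using Inv_ex[of "Suc s"] os.Inv_D(9) that by blast
  have fY: "(f ^^ Suc (t s)) y \<in> cball p \<rho>" if "y \<in> Y (3 * s)" for y s
    using Inv_ex[of "Suc s"] os.Inv_D(11)[of _ "Suc s" f s y] that by (auto simp: dist_norm norm_minus_commute)
  have trap: "f z \<in> cball p \<rho>" if "z \<in> cball p \<rho>" for z
    using Inv_ex[of 0] os.Inv_D(7)[OF _ that] by (auto simp: dist_norm norm_minus_commute)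
  have trap_n: "(f ^^ m) z \<in> cball p \<rho>" if "z \<in> cball p \<rho>" for z m
    by (induction m) (use that trap in auto)
  define T where "T = (\<lambda>n. t (\<iota> n))"
  have T0: "T 0 = 0" unfolding T_def using \<iota>(1) t(1) by simp
  have pred: "\<exists>s. \<iota> (Suc n) = Suc s \<and> \<Psi> s = \<phi> ^^ Suc n \<and> T (Suc n) = Suc (t s) \<and> \<kappa> (Suc n) = 3 * s + 2 \<and> Suc n \<le> Suc s" for n
  proof -
    obtain s where s: "\<iota> (Suc n) = Suc s" using \<iota>_ge[of "Suc n"] by (cases "\<iota> (Suc n)") auto
    then have "\<Psi> s = \<phi> ^^ Suc n" "pp s = 0" using key by blast+
    then show ?thesis using s \<iota>_ge[of "Suc n"] unfolding T_def \<kappa>_def by (intro exI[of _ s]) (simp add: t(2))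
  qed
  have near: "norm ((f ^^ T n) x - (\<phi> ^^ n) x) \<le> min (\<delta>2 n) 1" "n > 0 \<Longrightarrow> norm ((f ^^ T n) x - (\<phi> ^^ n) x) \<le> \<epsilon> n"
    and fTan: "(f ^^ T n) analytic_on {x}" if x: "x \<in> N (\<kappa> n)" for x n
  proof -
    have "norm ((f ^^ T n) x - (\<phi> ^^ n) x) \<le> min (\<delta>2 n) 1 \<and> (n > 0 \<longrightarrow> norm ((f ^^ T n) x - (\<phi> ^^ n) x) \<le> \<epsilon> n) \<and> (f ^^ T n) analytic_on {x}"
    proof (cases n)
      case 0
      then show ?thesis using T0 \<delta>2 by (simp add: id_def less_imp_le)
    next
      case (Suc m)
      obtain s where s: "\<Psi> s = \<phi> ^^ Suc m" "T (Suc m) = Suc (t s)" "\<kappa> (Suc m) = 3 * s + 2" "Suc m \<le> Suc s" using pred by blast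
      have x': "x \<in> N (3 * s + 2)" using x s(3) Suc by simp
      have "norm ((f ^^ T n) x - (\<phi> ^^ n) x) < \<delta> s" using f\<Psi>[OF x'] s(1,2) Suc by simp
      moreover have "(f ^^ T n) analytic_on {x}" using fan[of s] x' s(2) Suc analytic_on_subset by simp
      ultimately show ?thesis using \<delta>(3)[of s] \<delta>(4,5)[of n s] s(4) Suc by auto
    qed
    then show "norm ((f ^^ T n) x - (\<phi> ^^ n) x) \<le> min (\<delta>2 n) 1" "n > 0 \<Longrightarrow> norm ((f ^^ T n) x - (\<phi> ^^ n) x) \<le> \<epsilon> n"
      "(f ^^ T n) analytic_on {x}" by blast+
  qed
  have "\<exists>g. g holomorphic_on P n \<and> (\<forall>z\<in>interior (N (\<kappa> n)). g ((\<phi> ^^ n) z) = z)" for n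
    using holomorphic_has_inverse[OF reg(1) open_interior reg(2)] unfolding P_def by metis
  then obtain g where g: "\<And>n. g n holomorphic_on P n" "\<And>n z. z \<in> interior (N (\<kappa> n)) \<Longrightarrow> g n ((\<phi> ^^ n) z) = z" by metis
  \<comment> \<open>The displacement of the actual visit from the ideal one, transported to
    \<open>P n\<close>, where \<open>g n\<close> inverts \<open>\<phi> ^^ n\<close>.\<close>
  define u where "u = (\<lambda>n w. (f ^^ T n) (g n w) - w)"
  have u_eq: "u n ((\<phi> ^^ n) x) = (f ^^ T n) x - (\<phi> ^^ n) x" if "x \<in> interior (N (\<kappa> n))" for n x
    unfolding u_def using g(2)[OF that] by simp
  have u: "u n holomorphic_on P n" "z \<in> P n \<Longrightarrow> norm (u n z) \<le> min (\<delta>2 n) 1" "z \<in> P n \<Longrightarrow> n > 0 \<Longrightarrow> norm (u n z) \<le> \<epsilon> n" for n z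
  proof -
    have sub: "g n ` P n \<subseteq> interior (N (\<kappa> n))" unfolding P_def using g(2) by auto
    have "(f ^^ T n) analytic_on interior (N (\<kappa> n))"
      using fTan interior_subset analytic_on_analytic_at by blast
    then have "((f ^^ T n) \<circ> g n) holomorphic_on P n"
      using holomorphic_on_compose_gen[OF g(1) analytic_imp_holomorphic sub] by blast
    then show "u n holomorphic_on P n" unfolding u_def by (intro holomorphic_intros) (simp add: comp_def)
    have "\<exists>x\<in>interior (N (\<kappa> n)). z = (\<phi> ^^ n) x" if "z \<in> P n" using that unfolding P_def by blast
    then show "z \<in> P n \<Longrightarrow> norm (u n z) \<le> min (\<delta>2 n) 1" "z \<in> P n \<Longrightarrow> n > 0 \<Longrightarrow> norm (u n z) \<le> \<epsilon> n"
      using near[of _ n] u_eq[of _ n] interior_subset by fastforce+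
  qed
  have "\<forall>n. u n holomorphic_on P n \<and> (\<forall>z\<in>P n. norm (u n z) \<le> \<delta>2 n)" using u(1,2) by simp
  with \<delta>2 obtain \<theta> where \<theta>: "smooth_diffeomorphism \<theta>" "\<forall>n. \<exists>N. open N \<and> X n \<subseteq> N \<and> N \<subseteq> P n \<and> (\<forall>z\<in>N. \<theta> z = z + u n z)" by blast
  then obtain O' where O': "\<And>n. open (O' n)" "\<And>n. X n \<subseteq> O' n" "\<And>n. O' n \<subseteq> P n" "\<And>n z. z \<in> O' n \<Longrightarrow> \<theta> z = z + u n z" by metis
  have \<theta>X: "\<theta> z = z + u n z" if "z \<in> X n" for z n using O'(2,4) that by blast
  have f\<theta>: "(f ^^ T n) x = \<theta> ((\<phi> ^^ n) x)" if "x \<in> X 0" for x n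
  proof -
    have "(\<phi> ^^ n) x \<in> X n" using that X_image[of n] by blast
    then show ?thesis using \<theta>X u_eq[of x n] N(3) that by fastforce
  qed
  \<comment> \<open>Every time is the start of a stage or belongs to a transit through the sets
    \<open>\<Delta> r\<close>. As \<open>\<Delta> (\<iota> n)\<close> is empty and the sets
    \<open>W s\<close> are disjoint, \<open>W (\<iota> n)\<close> can be visited at time
    \<open>T n\<close> only.\<close>
  have stage_or_transit: "\<exists>s. (m = t s \<and> (f ^^ m) x \<in> W s) \<or> (f ^^ m) x \<in> (\<Union>r. \<Delta> r)" if x: "x \<in> X 0" for x m
  proof -
    have "\<exists>s. t s \<le> m \<and> m < t (Suc s)"
    proof -
      define s where "s = (GREATEST s. t s \<le> m)"
      have b: "\<And>s. t s \<le> m \<Longrightarrow> s \<le> m" using t_ge order_trans by blast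
      have "t s \<le> m" unfolding s_def by (rule GreatestI_nat[of _ 0 m]) (use t b in auto)
      moreover have "\<not> t (Suc s) \<le> m"
        using Greatest_le_nat[of "\<lambda>s. t s \<le> m" "Suc s" m] b unfolding s_def by fastforce
      ultimately show ?thesis by (intro exI[of _ s]) simp
    qed
    then obtain s where s: "t s \<le> m" "m < t (Suc s)" by blast
    show ?thesis
    proof (cases "m = t s")
      case True then show ?thesis using stage_W[of x s] x XN by blast
    next
      case False
      define j where "j = m - Suc (t s)"
      have j: "m = j + Suc (t s)" "j < pp s" using s False unfolding j_def by (auto simp: t(2))
      obtain L where L: "os.Inv L (Suc s) f" using Inv_ex by blast
      have "(\<forall>z\<in>Vt s. \<forall>j<pp s. (f ^^ j) z \<in> (\<Union>r\<le>s. \<Delta> r)) \<and> inj_on (f ^^ pp s) (Vt s) \<and> (f ^^ pp s) ` Vt s \<subseteq> W (Suc s) - \<Delta> (Suc s)"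
      proof (rule transit)
        fix r assume "r \<le> s"
        then have r: "r < Suc s" by simp
        show "f analytic_on \<Delta> r \<and> (\<forall>z\<in>\<Delta> r. norm (f z - \<tau> r z) \<le> e r) \<and> (\<forall>z\<in>\<sigma> r. f z = \<tau> r z)"
          using os.Inv_D(1)[OF L r] os.Inv_D(2)[OF L r] os.Inv_D(3)[OF L r] os.Inv_D(6)[OF L] analytic_on_subset by blast
      qed
      moreover have "(f ^^ Suc (t s)) x \<in> Vt s" by (rule fVt) (use x XN in blast)
      ultimately have "(f ^^ j) ((f ^^ Suc (t s)) x) \<in> (\<Union>r\<le>s. \<Delta> r)" using j(2) by blast
      then show ?thesis unfolding j(1) funpow_add by auto
    qed
  qed
  interpret ro: realized_orbit X C \<phi> V \<epsilon> f \<theta> T "\<lambda>n. W (\<iota> n)"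
  proof unfold_locales
    show "n \<le> T n" for n unfolding T_def using \<iota>_ge[of n] t_ge[of "\<iota> n"] by simp
    show "norm (\<theta> z - z) \<le> 1" if "z \<in> X n" for n z using \<theta>X[OF that] u(2)[of z n] P(2) that by auto
    show "f analytic_on {(f ^^ m) x}" if "x \<in> X 0" for x m
      using orbN[of x m m] XN that t_ge by blast
    show "(f ^^ T n) x \<in> W (\<iota> n)" if "x \<in> X 0" for x n unfolding T_def using stage_W XN that by blast
    show "m = T n" if xm: "x \<in> X 0" "(f ^^ m) x \<in> W (\<iota> n)" for x m n
    proof -
      obtain s where "(m = t s \<and> (f ^^ m) x \<in> W s) \<or> (f ^^ m) x \<in> (\<Union>r. \<Delta> r)" using stage_or_transit[OF xm(1)] by blast
      then show ?thesis
      proof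
        assume "m = t s \<and> (f ^^ m) x \<in> W s"
        then show ?thesis using W_disjoint xm(2) unfolding T_def by blast
      next
        assume "(f ^^ m) x \<in> (\<Union>r. \<Delta> r)"
        then obtain r where r: "(f ^^ m) x \<in> \<Delta> r" by blast
        then have "r = \<iota> n" using \<Delta>(2) W_disjoint xm(2) by blast
        then show ?thesis using r XW(2) by blast
      qed
    qed
    show "\<exists>y. dist x y < e' \<and> bounded (range (\<lambda>m. (f ^^ m) y))" if x: "x \<in> frontier (X 0)" and "e' > 0" for x and e' :: real
    proof -
      obtain s where s: "1 / real (Suc s) < e'" using \<open>e' > 0\<close> nat_approx_posE by blast
      obtain y where y: "y \<in> Y (3 * s)" "dist x y < 1 / real (Suc (3 * s))" using Y(3)[OF x] by blast
      have "1 / real (Suc (3 * s)) \<le> 1 / real (Suc s)" by (simp add: frac_le)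
      then have d: "dist x y < e'" using y(2) s by linarith
      \<comment> \<open>Finitely many points before the trap is entered, and the trap ever
        after.\<close>
      have "range (\<lambda>m. (f ^^ m) y) \<subseteq> (\<lambda>m. (f ^^ m) y) ` {..t s} \<union> cball p \<rho>"
      proof
        fix w assume "w \<in> range (\<lambda>m. (f ^^ m) y)"
        then obtain m where m: "w = (f ^^ m) y" by blast
        show "w \<in> (\<lambda>m. (f ^^ m) y) ` {..t s} \<union> cball p \<rho>"
        proof (cases "m \<le> t s")
          case False
          then have "w = (f ^^ (m - Suc (t s))) ((f ^^ Suc (t s)) y)"
            unfolding m using funpow_add[of "m - Suc (t s)" "Suc (t s)" f] by simp
          then show ?thesis using trap_n[OF fY[OF y(1)]] by simp
        qed (use m in blast)
      qed
      moreover have "bounded ((\<lambda>m. (f ^^ m) y) ` {..t s} \<union> cball p \<rho>)" by (simp add: finite_imp_bounded)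
      ultimately show ?thesis using d bounded_subset by blast
    qed
  qed (use f(1) \<theta>(1) f\<theta> in auto)
  have \<theta>an: "\<theta> analytic_on O' n" for n
  proof -
    have "(\<lambda>z. z + u n z) holomorphic_on O' n"
      by (intro holomorphic_intros holomorphic_on_subset[OF u(1) O'(3)])
    then have "\<theta> holomorphic_on O' n" by (rule holomorphic_transform) (use O'(4) in simp)
    then show ?thesis using O'(1) analytic_on_open by blast
  qed
  have \<theta>anX: "\<theta> analytic_on {z}" if "z \<in> (\<Union>n. X n)" for z
    using that O'(2) \<theta>an analytic_on_subset by blast
  have adm: "admissible_conjugacy X C \<epsilon> f \<theta>"
    unfolding admissible_conjugacy_def
  proof (intro conjI ballI allI)
    show "smooth_diffeomorphism \<theta>" by (rule \<theta>(1))
    show \<theta>0: "\<theta> z = z" if "z \<in> X 0" for z using f\<theta>[OF that, of 0] T0 by simp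
    show "norm (\<theta> z - z) \<le> \<epsilon> n" if "z \<in> X n" for n z
    proof (cases "n = 0")
      case True then show ?thesis using \<theta>0 that \<epsilon>[of 0] by simp
    next
      case False then show ?thesis using \<theta>X[OF that] u(3)[of z n] P(2) that by auto
    qed
    show "frontier (\<theta> ` (\<Union>n. X n)) \<subseteq> Julia_set f" by (rule ro.frontier_union_in_Julia)
    show "Cauchy_Riemann_at \<theta> z" if "z \<in> (\<Union>n. X n)" for z by (rule Cauchy_Riemann_atI[OF \<theta>anX[OF that]])
    show "conformal_on \<theta> (interior (\<Union>n. X n))"
      unfolding conformal_on_def
    proof
      have "\<theta> analytic_on (\<Union>n. X n)" by (rule analytic_on_analytic_at[THEN iffD2]) (intro ballI \<theta>anX)
      then have "\<theta> analytic_on interior (\<Union>n. X n)" by (rule analytic_on_subset[OF _ interior_subset])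
      then show h: "\<theta> holomorphic_on interior (\<Union>n. X n)" by (rule analytic_imp_holomorphic)
      have "inj_on \<theta> (interior (\<Union>n. X n))"
        using smooth_diffeomorphism_continuous(3)[OF \<theta>(1)] bij_is_inj inj_on_subset by blast
      then show "\<forall>z\<in>interior (\<Union>n. X n). deriv \<theta> z \<noteq> 0" using holomorphic_injective_imp_regular[OF h] by blast
    qed
    show "\<theta> c = c" if c: "c \<in> (\<Union>n. C n)" for c
    proof -
      obtain n where n: "c \<in> C n" using c by blast
      then have "c \<in> (\<phi> ^^ n) ` X 0" unfolding X_image using C(2) by blast
      then obtain a where a: "a \<in> X 0" "(\<phi> ^^ n) a = c" by (elim imageE) (use that in simp)
      show ?thesis
      proof (cases n)
        case 0 then show ?thesis using a \<theta>0 by simp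
      next
        case (Suc m)
        obtain s where s: "\<Psi> s = \<phi> ^^ Suc m" "T (Suc m) = Suc (t s)" "Suc m \<le> Suc s" using pred by blast
        have "a \<in> A s" unfolding A_def using a n Suc s(3) by auto
        then have "(f ^^ T n) a = c" using fA s(1,2) a(2) Suc by simp
        then show ?thesis using f\<theta>[OF a(1), of n] a(2) by simp
      qed
    qed
  qed
  obtain x0 where x0: "x0 \<in> X 0" using ne by blast
  have ess: "essential_at_infinity f"
  proof -
    \<comment> \<open>The points one step before the visits to \<open>X (Suc n)\<close> tend to
      infinity and so do their images; the points about to be trapped tend to infinity with bounded
      images.\<close>
    have "\<forall>n. \<exists>s. T (Suc n) = Suc (t s) \<and> n \<le> s" using pred by (meson Suc_le_mono)
    from choice[OF this] obtain r where r: "\<And>n. T (Suc n) = Suc (t (r n))" "\<And>n. n \<le> r n" by blast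
    have a: "filterlim (\<lambda>n. (f ^^ t (r n)) x0) at_infinity sequentially"
      by (rule W_tendsto_infinity[of _ r]) (use stage_W x0 XN r(2) in blast)+
    have "f ((f ^^ t (r n)) x0) \<in> W (\<iota> (Suc n))" for n
      using ro.W(1)[OF x0, of "Suc n"] r(1)[of n] by simp
    then have fa: "filterlim (\<lambda>n. f ((f ^^ t (r n)) x0)) at_infinity sequentially"
      by (rule W_tendsto_infinity[of _ "\<lambda>n. \<iota> (Suc n)"]) (use \<iota>_ge Suc_leD in blast)
    have "frontier (X 0) \<noteq> {}"
    proof -
      have "X 0 \<noteq> UNIV" using X(1)[of 0] not_compact_UNIV by metis
      then show ?thesis using ne frontier_eq_empty by blast
    qed
    then obtain x1 where "x1 \<in> frontier (X 0)" by blast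
    then have "\<forall>k. \<exists>y. y \<in> Y (3 * k)" using Y(3) by blast
    from choice[OF this] obtain y where y: "\<And>k. y k \<in> Y (3 * k)" by blast
    have "y k \<in> N (3 * k)" for k using y Y(2) interior_subset by blast
    then have b: "filterlim (\<lambda>k. (f ^^ t k) (y k)) at_infinity sequentially"
      by (intro W_tendsto_infinity[of _ "\<lambda>k. k"] stage_W) auto
    have "norm (f ((f ^^ t k) (y k))) \<le> norm p + \<rho>" for k
    proof -
      have "dist p (f ((f ^^ t k) (y k))) \<le> \<rho>" using fY[OF y[of k]] by simp
      then show ?thesis using norm_triangle_sub[of "f ((f ^^ t k) (y k))" p] by (simp add: dist_norm norm_minus_commute)
    qed    then show ?thesis by (rule essential_at_infinityI[OF a fa b])
  qed
  have "\<forall>s. \<forall>x\<in>X 0. (f ^^ Suc (t s)) x \<in> Vt s" using fVt XN by blast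
  then show ?thesis using ro.realized_orbit_axioms adm ess f(2) unfolding T_def by blast
qed

end

section \<open>Escaping and oscillating orbits\<close>

text \<open>The trap is treated as a zeroth member of the family, so that it, too, is swallowed or
  missed by every \<open>E s\<close>; the indices are then shifted back by one.\<close>

lemma trapped_exhaustion:
  fixes Z :: "nat \<Rightarrow> complex set"
  assumes Z: "\<And>n. compact (Z n)" "disjoint_family Z" "\<And>R. finite {n. Z n \<inter> cball 0 R \<noteq> {}}"
    and Zfull: "\<And>n. ent \<Longrightarrow> full (Z n)" and trap: "\<And>n. Z n \<inter> cball p \<rho> = {}"
  shows "\<exists>E W. (\<forall>s::nat. compact (E s) \<and> (ent \<longrightarrow> full (E s)) \<and> E s \<subseteq> E (Suc s)) \<and> (\<forall>R. \<exists>s. cball 0 R \<subseteq> E s) \<and>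
    (\<forall>s::nat. open (W s) \<and> Z s \<subseteq> W s \<and> W s \<inter> E s = {} \<and> W s \<inter> cball p \<rho> = {}) \<and> disjoint_family W \<and>
    (ent \<longrightarrow> (\<forall>s. (\<forall>r. W r \<subseteq> E s \<or> W r \<inter> E s = {}) \<and> (cball p \<rho> \<subseteq> E s \<or> cball p \<rho> \<inter> E s = {})))"
proof -
  define Z' where "Z' = case_nat (cball p \<rho>) Z"
  have 1: "compact (Z' n)" "Z' n \<inter> {} = {}" for n unfolding Z'_def using Z(1) by (auto split: nat.split)
  have 2: "disjoint_family Z'" unfolding Z'_def disjoint_family_on_def using Z(2) trap
    by (auto simp: disjoint_family_on_def split: nat.splits)
  have 3: "finite {n. Z' n \<inter> cball 0 R \<noteq> {}}" for R
  proof (rule finite_subset)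
    show "{n. Z' n \<inter> cball 0 R \<noteq> {}} \<subseteq> insert 0 (Suc ` {n. Z n \<inter> cball 0 R \<noteq> {}})"
    proof
      fix n assume "n \<in> {n. Z' n \<inter> cball 0 R \<noteq> {}}"
      then show "n \<in> insert 0 (Suc ` {n. Z n \<inter> cball 0 R \<noteq> {}})" unfolding Z'_def by (cases n) auto
    qed
  qed (use Z(3) in simp)
  have 4: "full (Z' n)" if ent for n unfolding Z'_def using Zfull[OF that] full_cball by (auto split: nat.split)
  obtain E W where E: "\<And>s::nat. compact (E s)" "\<And>s. ent \<Longrightarrow> full (E s)" "\<And>s. E s \<subseteq> E (Suc s)"
    "\<And>R. \<exists>s. cball 0 R \<subseteq> E s" and W: "\<And>s::nat. open (W s)" "\<And>s. Z' s \<subseteq> W s" "disjoint_family W"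
    "\<And>s. W s \<inter> E s = {}" "\<And>s. W s \<inter> {} = {}" "\<And>r s. ent \<Longrightarrow> W r \<subseteq> E s \<or> W r \<inter> E s = {}"
    using locally_finite_exhaustion[OF 1(1) 2 3 4 compact_empty 1(2)] by blast
  have trapW: "cball p \<rho> \<subseteq> W 0" using W(2)[of 0] unfolding Z'_def by simp
  have disj: "W r \<inter> W s = {}" if "r \<noteq> s" for r s using W(3) that unfolding disjoint_family_on_def by blast
  show ?thesis
  proof (rule exI[of _ "\<lambda>s. E (Suc s)"], rule exI[of _ "\<lambda>s. W (Suc s)"], intro conjI allI impI)
    show "\<exists>s. cball 0 R \<subseteq> E (Suc s)" for R using E(3,4) by (meson order_trans)
    show "Z s \<subseteq> W (Suc s)" for s using W(2)[of "Suc s"] unfolding Z'_def by simp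
    show "W (Suc s) \<inter> cball p \<rho> = {}" for s using trapW disj[of 0 "Suc s"] by blast
    show "disjoint_family (\<lambda>s. W (Suc s))" unfolding disjoint_family_on_def using disj by simp
    show "cball p \<rho> \<subseteq> E (Suc s) \<or> cball p \<rho> \<inter> E (Suc s) = {}" if ent for s
      using W(6)[OF that, of 0 "Suc s"] trapW by blast
  qed (use E W in blast)+
qed

lemma cball_in_complement:
  fixes Z :: "nat \<Rightarrow> complex set"
  assumes "\<And>n. compact (Z n)" "\<And>R. finite {n. Z n \<inter> cball 0 R \<noteq> {}}" "p \<notin> (\<Union>n. Z n)"
  shows "\<exists>\<rho>. 0 < \<rho> \<and> \<rho> \<le> 1 \<and> (\<forall>n. Z n \<inter> cball p \<rho> = {})"
proof -
  have "open (- (\<Union>n. Z n))" using closed_UN_compact_locally_finite[OF assms(1,2)] by blast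
  then obtain \<rho> where \<rho>: "\<rho> > 0" "cball p \<rho> \<subseteq> - (\<Union>n. Z n)" using assms(3) open_contains_cball by (metis ComplI)
  have "cball p (min \<rho> 1) \<subseteq> cball p \<rho>" by auto
  then have "\<forall>n. Z n \<inter> cball p (min \<rho> 1) = {}" using \<rho>(2) by blast
  then show ?thesis using \<rho>(1) by (intro exI[of _ "min \<rho> 1"]) auto
qed

context compact_orbit
begin

theorem escaping_case:
  assumes full: "ent \<Longrightarrow> full (\<Union>n. X n)"
  shows "\<exists>f \<theta>. f nicely_meromorphic_on UNIV \<and> essential_at_infinity f \<and> (ent \<longrightarrow> f holomorphic_on UNIV) \<and>
    escaping_realization X C \<phi> \<epsilon> f \<theta>"
proof -
  have Xfull: "full (X n)" if ent for n by (rule full_member[OF X full[OF that]])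
  obtain p where p: "p \<notin> (\<Union>n. X n)" using locally_finite_compl_unbounded[OF X] by blast
  obtain \<rho> where \<rho>: "0 < \<rho>" "\<And>n. X n \<inter> cball p \<rho> = {}" using cball_in_complement[OF X(1,3) p] by blast
  have "\<exists>E W. (\<forall>s::nat. compact (E s) \<and> (ent \<longrightarrow> full (E s)) \<and> E s \<subseteq> E (Suc s)) \<and> (\<forall>R. \<exists>s. cball 0 R \<subseteq> E s) \<and>
    (\<forall>s::nat. open (W s) \<and> X s \<subseteq> W s \<and> W s \<inter> E s = {} \<and> W s \<inter> cball p \<rho> = {}) \<and> disjoint_family W \<and>
    (ent \<longrightarrow> (\<forall>s. (\<forall>r. W r \<subseteq> E s \<or> W r \<inter> E s = {}) \<and> (cball p \<rho> \<subseteq> E s \<or> cball p \<rho> \<inter> E s = {})))"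
    by (rule trapped_exhaustion[OF X _ \<rho>(2)]) (rule Xfull)
  then obtain E W where EW: "(\<forall>s::nat. compact (E s) \<and> (ent \<longrightarrow> full (E s)) \<and> E s \<subseteq> E (Suc s)) \<and> (\<forall>R. \<exists>s. cball 0 R \<subseteq> E s) \<and>
    (\<forall>s::nat. open (W s) \<and> X s \<subseteq> W s \<and> W s \<inter> E s = {} \<and> W s \<inter> cball p \<rho> = {}) \<and> disjoint_family W \<and>
    (ent \<longrightarrow> (\<forall>s. (\<forall>r. W r \<subseteq> E s \<or> W r \<inter> E s = {}) \<and> (cball p \<rho> \<subseteq> E s \<or> cball p \<rho> \<inter> E s = {})))"
    by (elim exE) (rule that)
  \<comment> \<open>There are no transits: every stage is a visit, so \<iota> is the identity and
    time equals the stage number.\<close>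
  interpret om: orbit_mode X C \<phi> V \<epsilon> ent p \<rho> E W "\<lambda>_. {}" "\<lambda>_. {}" "\<lambda>s. W (Suc s)" "\<lambda>_ z. z" "\<lambda>s. \<phi> ^^ Suc s"
    "\<lambda>_. 1" "\<lambda>_. 0" "\<lambda>s. s" "\<lambda>n. n"
  proof
    show "(\<phi> ^^ Suc s) ` X 0 \<subseteq> W (Suc s)" for s unfolding X_image using EW by blast
    show "(\<phi> ^^ Suc s) holomorphic_on G (Suc s)" "inj_on (\<phi> ^^ Suc s) (G (Suc s))" for s using G_regular by blast+
    show "strict_mono (\<lambda>n::nat. n)" by (simp add: strict_mono_def)
    show "full (X 0)" if ent using Xfull[OF that] .
  qed (use EW \<rho>(1) in \<open>simp_all add: connected_UNIV\<close>)
  from om.realization obtain f \<theta> where f: "realized_orbit X C \<phi> V \<epsilon> f \<theta> (\<lambda>n. n) W \<and> admissible_conjugacy X C \<epsilon> f \<theta> \<and>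
     essential_at_infinity f \<and> (ent \<longrightarrow> f holomorphic_on UNIV)" by blast
  then interpret ro: realized_orbit X C \<phi> V \<epsilon> f \<theta> "\<lambda>n. n" W by blast
  have "to_sphere f (\<theta> z) = Some (\<theta> (\<phi> z))" if "z \<in> X n" for z n
    using ro.conjugacy[OF that] by simp
  moreover have "\<theta> z \<in> escaping_set f" if z: "z \<in> X n" for z n
  proof -
    obtain x where x: "x \<in> X 0" "\<theta> z = (f ^^ n) x" using ro.Xn_preimage[OF z] by blast
    have "the (iterate f m (\<theta> z)) \<in> W (m + n)" for m
      using iterates_definedD(2)[OF ro.iterates_defined_X[OF z], of m] ro.W(1)[OF x(1), of "m + n"]
      unfolding x(2) by (simp add: funpow_add)
    then have "filterlim (\<lambda>m. the (iterate f m (\<theta> z))) at_infinity sequentially"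
      by (rule om.W_tendsto_infinity) simp
    then show ?thesis unfolding escaping_set_def using ro.iterates_defined_X[OF z] by simp
  qed
  ultimately have "escaping_realization X C \<phi> \<epsilon> f \<theta>"
    unfolding escaping_realization_def using f ro.wandering by blast
  then show ?thesis using f ro.f by blast
qed

end

text \<open>On the half-size disc the deviation from the translation has Lipschitz constant
  \<open>8 * (\<rho> / 32) / (\<rho> / 2) = 1 / 2\<close>, which explains the 32; distances change
  by factors between 1/2 and 3/2.\<close>

lemma near_translation:
  fixes g :: "complex \<Rightarrow> complex"
  assumes g: "g analytic_on cball b \<rho>" "\<And>z. z \<in> cball b \<rho> \<Longrightarrow> norm (g z - (z - b + c)) \<le> \<rho> / 32" and "\<rho> > 0"
    and z: "z \<in> ball b (\<rho> / 2)" "w \<in> ball b (\<rho> / 2)"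
  shows "norm (z - w) / 2 \<le> norm (g z - g w)" "norm (g z - g w) \<le> 2 * norm (z - w)"
proof -
  define v where "v = (\<lambda>z. g z - (z - b + c))"
  have "norm (v z - v w) \<le> (8 * (\<rho> / 32) / (\<rho> / 2)) * norm (z - w)"
  proof (rule holomorphic_small_Lipschitz[where P="ball b \<rho>" and S="ball b (\<rho> / 2)"])
    show "v holomorphic_on ball b \<rho>" unfolding v_def
      by (intro holomorphic_intros holomorphic_on_subset[OF analytic_imp_holomorphic[OF g(1)] ball_subset_cball])
    show "ball x (\<rho> / 2) \<subseteq> ball b \<rho>" if "x \<in> ball b (\<rho> / 2)" for x
    proof
      fix y assume "y \<in> ball x (\<rho> / 2)"
      then show "y \<in> ball b \<rho>" using that dist_triangle[of b y x] by simp
    qed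
    show "norm (v x) \<le> \<rho> / 32" if "x \<in> ball b \<rho>" for x using g(2)[of x] that unfolding v_def by simp
  qed (use assms in auto)
  also have "8 * (\<rho> / 32) / (\<rho> / 2) = 1 / 2" using \<open>\<rho> > 0\<close> by simp
  finally have v: "norm (v z - v w) \<le> norm (z - w) / 2" by simp
  have "g z - g w = (z - w) + (v z - v w)" unfolding v_def by simp
  then show "norm (z - w) / 2 \<le> norm (g z - g w)" "norm (g z - g w) \<le> 2 * norm (z - w)"
    using v norm_triangle_ineq[of "z - w" "v z - v w"] norm_diff_ineq[of "z - w" "v z - v w"] norm_ge_zero[of "z - w"] by auto
qed

text \<open>As centres go exactly to centres, the distance from the centre at most doubles and at
  most halves in each step. The bound \<open>2 ^ j * r \<le> \<rho> j / 2\<close> keeps the orbit in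
  the half-size discs, where the estimate applies.\<close>

lemma chain_of_near_translations:
  fixes b :: "nat \<Rightarrow> complex"
  assumes \<rho>: "\<And>j. j < n \<Longrightarrow> \<rho> j > 0" "\<And>j. j < n \<Longrightarrow> 2 ^ j * r \<le> \<rho> j / 2"
    and g: "\<And>j. j < n \<Longrightarrow> g analytic_on cball (b j) (\<rho> j)"
      "\<And>j z. j < n \<Longrightarrow> z \<in> cball (b j) (\<rho> j) \<Longrightarrow> norm (g z - (z - b j + b (Suc j))) \<le> \<rho> j / 32"
      "\<And>j. j < n \<Longrightarrow> g (b j) = b (Suc j)"
    and j: "j \<le> n"
  shows "(\<forall>z\<in>ball (b 0) r. dist (b 0) z / 2 ^ j \<le> dist (b j) ((g ^^ j) z) \<and> dist (b j) ((g ^^ j) z) \<le> 2 ^ j * dist (b 0) z) \<and>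
    inj_on (g ^^ j) (ball (b 0) r)"
  using j
proof (induction j)
  case 0 then show ?case by simp
next
  case (Suc j)
  then have jn: "j < n" and IH: "\<And>z. z \<in> ball (b 0) r \<Longrightarrow> dist (b 0) z / 2 ^ j \<le> dist (b j) ((g ^^ j) z)"
     "\<And>z. z \<in> ball (b 0) r \<Longrightarrow> dist (b j) ((g ^^ j) z) \<le> 2 ^ j * dist (b 0) z"
     "inj_on (g ^^ j) (ball (b 0) r)" by auto
  have inb: "(g ^^ j) z \<in> ball (b j) (\<rho> j / 2)" if "z \<in> ball (b 0) r" for z
  proof -
    have "2 ^ j * dist (b 0) z < 2 ^ j * r" using that by simp
    then show ?thesis using IH(2)[OF that] \<rho>(2)[OF jn] unfolding mem_ball by linarith
  qed
  have st: "norm (z - w) / 2 \<le> norm (g z - g w)" "norm (g z - g w) \<le> 2 * norm (z - w)"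
    if "z \<in> ball (b j) (\<rho> j / 2)" "w \<in> ball (b j) (\<rho> j / 2)" for z w
    by (rule near_translation[of g "b j" "\<rho> j" "b (Suc j)"]; use g(1,2)[OF jn] \<rho>(1)[OF jn] that in blast)+
  have cen: "b j \<in> ball (b j) (\<rho> j / 2)" using \<rho>(1)[OF jn] by simp
  have "dist (b 0) z / 2 ^ Suc j \<le> dist (b (Suc j)) ((g ^^ Suc j) z) \<and> dist (b (Suc j)) ((g ^^ Suc j) z) \<le> 2 ^ Suc j * dist (b 0) z"
    if z: "z \<in> ball (b 0) r" for z
    using st[OF cen inb[OF z]] IH(1,2)[OF z] unfolding g(3)[OF jn] by (simp add: dist_norm)
  moreover have "inj_on (g \<circ> (g ^^ j)) (ball (b 0) r)"
  proof (rule comp_inj_on[OF IH(3)], rule inj_onI)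
    fix x y assume "x \<in> (g ^^ j) ` ball (b 0) r" "y \<in> (g ^^ j) ` ball (b 0) r" "g x = g y"
    then show "x = y" using st(1)[of x y] inb by auto
  qed
  ultimately show ?case by (simp add: comp_def)
qed

text \<open>
  A nearly translating passage through \<open>n\<close> discs distorts distances from the centres by a factor of at most \<open>2\<^sup>n\<close>
  in either direction.  \<open>core_radius R j\<close> is the radius of the \<open>j\<close>-th of these discs.  An annulus of
  radii \<open>entry_radius R n / 4\<close> and \<open>entry_radius R n\<close> therefore passes through the first \<open>n\<close>
  discs and then lands between the circles of radii \<open>core_radius R n\<close> and \<open>R n\<close>.
\<close>

primrec entry_radius :: "(nat \<Rightarrow> real) \<Rightarrow> nat \<Rightarrow> real" where
  "entry_radius R 0 = R 0 / 2"
| "entry_radius R (Suc n) = min (R (Suc n)) (entry_radius R n / 2 ^ n / 8) / 2 ^ (n + 2)"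

definition core_radius :: "(nat \<Rightarrow> real) \<Rightarrow> nat \<Rightarrow> real" where
  "core_radius R n = entry_radius R n / 2 ^ n / 8"

text \<open>The factor \<open>2 ^ (n + 2)\<close> in \<open>entry_radius R (Suc n)\<close> leaves
  room for the doublings, both in the final disc and in all earlier cores, whose radii do not
  increase. The 8 in the core radius exceeds 4, so \<open>entry_radius R n / 4\<close>, halved n
  times, is still outside the core.\<close>

lemma entry_radius:
  assumes "\<And>n. R n > 0"
  shows "entry_radius R n > 0" "core_radius R n > 0" "core_radius R n < R n"
    "2 ^ n * entry_radius R n < R n" "core_radius R n < entry_radius R n / 4 / 2 ^ n"
    "j < n \<Longrightarrow> 2 ^ j * entry_radius R n \<le> core_radius R j / 2"
proof -
  have pos: "entry_radius R n > 0" for n by (induction n) (use assms in auto)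
  then show p: "entry_radius R n > 0" "core_radius R n > 0" for n unfolding core_radius_def by simp_all
  have step: "entry_radius R (Suc n) \<le> core_radius R n / 2 ^ (n + 2)" for n
    unfolding core_radius_def entry_radius.simps by (intro divide_right_mono) auto
  show big: "2 ^ n * entry_radius R n < R n" for n
  proof (cases n)
    case (Suc m)
    have "entry_radius R (Suc m) \<le> R (Suc m) / 2 ^ (m + 2)"
      unfolding entry_radius.simps by (intro divide_right_mono) auto
    then have "2 ^ (m + 2) * entry_radius R (Suc m) \<le> R (Suc m)" by (simp add: field_simps)
    then show ?thesis using pos[of "Suc m"] assms[of "Suc m"] Suc by simp
  qed (use assms[of 0] in simp)
  have le: "core_radius R n \<le> entry_radius R n" for n
  proof -
    have "1 \<le> (2::real) ^ n * 8" using one_le_power[of "2::real" n] by linarith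
    then show ?thesis unfolding core_radius_def using pos[of n] by (simp add: divide_le_eq)
  qed
  have "1 * entry_radius R n \<le> 2 ^ n * entry_radius R n" using pos[of n] by (intro mult_right_mono) auto
  then show "core_radius R n < R n" using le[of n] big[of n] by linarith
  show "core_radius R n < entry_radius R n / 4 / 2 ^ n" unfolding core_radius_def using pos[of n] by (simp add: field_simps)
  have anti: "core_radius R (Suc n) \<le> core_radius R n" for n
  proof -
    have "core_radius R n / 2 ^ (n + 2) \<le> core_radius R n / 1" using p(2)[of n] one_le_power[of "2::real" "n + 2"] by (intro divide_left_mono) auto
    then show ?thesis using le[of "Suc n"] step[of n] by linarith
  qed
  show "2 ^ j * entry_radius R n \<le> core_radius R j / 2" if jn: "j < n"
  proof -
    obtain m where m: "n = Suc m" using jn by (cases n) auto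
    have jm: "j \<le> m" using jn m by simp
    have "core_radius R m \<le> core_radius R j" by (rule lift_Suc_antimono_le[of "core_radius R", OF anti jm])
    then have "core_radius R m / 2 ^ (m + 2) \<le> core_radius R j / 2 ^ (m + 2)" by (intro divide_right_mono) auto
    then have "entry_radius R n \<le> core_radius R j / 2 ^ (m + 2)" using step[of m] m by simp
    then have "2 ^ j * entry_radius R n \<le> 2 ^ j * (core_radius R j / 2 ^ (m + 2))" by (intro mult_left_mono) auto
    also have "\<dots> \<le> 2 ^ m * (core_radius R j / 2 ^ (m + 2))"
      using p(2)[of j] jm by (intro mult_right_mono power_increasing) auto
    also have "\<dots> = core_radius R j / 4" by (simp add: power_add)
    also have "\<dots> \<le> core_radius R j / 2" using p(2)[of j] by simp
    finally show ?thesis .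
  qed
qed

section \<open>Oscillating orbits\<close>

lemma bungee_setI:
  assumes "iterates_defined f w"
    and "\<And>m. \<exists>n\<ge>m. norm ((f ^^ n) w) \<le> B" "\<And>m B. \<exists>n\<ge>m. norm ((f ^^ n) w) > B"
  shows "w \<in> bungee_set f"
proof -
  define s where "s = (\<lambda>n. ereal (norm (the (iterate f n w))))"
  have s: "s n = ereal (norm ((f ^^ n) w))" for n unfolding s_def using iterates_definedD(2)[OF assms(1)] by simp
  have "liminf s < \<infinity>"
  proof (rule ccontr)
    assume "\<not> liminf s < \<infinity>"
    then have "ereal B < liminf s" by simp
    then have "\<forall>\<^sub>F n in sequentially. ereal B < s n" by (rule less_LiminfD)
    then obtain m where "\<forall>n\<ge>m. ereal B < s n" unfolding eventually_sequentially by blast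
    then show False using assms(2)[of m] s by fastforce
  qed
  moreover have "limsup s = \<infinity>"
  proof (rule ccontr)
    assume "limsup s \<noteq> \<infinity>"
    then obtain B where "limsup s < ereal (real B)" using less_PInf_Ex_of_nat by auto
    then have "\<forall>\<^sub>F n in sequentially. s n < ereal (real B)" by (rule Limsup_lessD)
    then obtain m where "\<forall>n\<ge>m. s n < ereal (real B)" unfolding eventually_sequentially by blast
    then show False using assms(3)[of m "real B"] s by fastforce
  qed
  ultimately show ?thesis unfolding bungee_set_def s_def using assms(1) by simp
qed

text \<open>The moduli of the centres grow by more than 3 while the radii are at most 1, which makes
  the discs disjoint and locally finite.\<close>

lemma sparse_sequence_in_complement:
  fixes Z :: "nat \<Rightarrow> complex set"
  assumes Z: "\<And>n. compact (Z n)" "disjoint_family Z" "\<And>R. finite {n. Z n \<inter> cball 0 R \<noteq> {}}"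
  shows "\<exists>q R. (\<forall>k::nat. 0 < R k \<and> R k \<le> 1 \<and> (\<forall>n. Z n \<inter> cball (q k) (R k) = {})) \<and>
    disjoint_family (\<lambda>k. cball (q k) (R k)) \<and> (\<forall>M. finite {k. cball (q k) (R k) \<inter> cball 0 M \<noteq> {}})"
proof -
  have "\<exists>q. \<forall>k. q k \<notin> (\<Union>n. Z n) \<and> norm (q (Suc k)) > norm (q k) + 3"
  proof (rule dependent_nat_choice)
    show "\<exists>z. z \<notin> (\<Union>n. Z n)" using locally_finite_compl_unbounded[OF Z] by blast
    show "\<exists>w. w \<notin> (\<Union>n. Z n) \<and> norm w > norm z + 3" for z :: complex
      using locally_finite_compl_unbounded[OF Z, of "norm z + 3"] by blast
  qed
  then obtain q where q: "\<And>k. q k \<notin> (\<Union>n. Z n)" "\<And>k. norm (q (Suc k)) > norm (q k) + 3" by blast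
  have "\<forall>k. \<exists>\<rho>. 0 < \<rho> \<and> \<rho> \<le> 1 \<and> (\<forall>n. Z n \<inter> cball (q k) \<rho> = {})"
    using cball_in_complement[OF Z(1,3) q(1)] by blast
  from choice[OF this] obtain R where R: "\<And>k. 0 < R k" "\<And>k. R k \<le> 1" "\<And>k n. Z n \<inter> cball (q k) (R k) = {}" by blast
  have far: "norm (q i) + 3 \<le> norm (q j)" if "i < j" for i j
  proof -
    have "norm (q (Suc i)) \<le> norm (q j)"
    proof (rule lift_Suc_mono_le[of "\<lambda>k. norm (q k)"])
      show "norm (q n) \<le> norm (q (Suc n))" for n using q(2)[of n] by linarith
    qed (use that in simp)
    then show ?thesis using q(2)[of i] by simp
  qed
  have near: "\<bar>norm z - norm (q k)\<bar> \<le> 1" if "z \<in> cball (q k) (R k)" for z k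
    using that R(2)[of k] norm_triangle_ineq3[of z "q k"] by (simp add: dist_norm norm_minus_commute)
  have disj: "cball (q i) (R i) \<inter> cball (q j) (R j) = {}" if "i < j" for i j
    using near[of _ i] near[of _ j] far[OF that] by fastforce
  have "3 * real k \<le> norm (q k)" for k
  proof (induction k)
    case (Suc k) then show ?case using q(2)[of k] by simp
  qed simp
  then have grow: "real k \<le> norm z + 1" if "z \<in> cball (q k) (R k)" for z k
    using near[OF that] by (smt (verit) of_nat_0_le_iff)
  have "finite {k. cball (q k) (R k) \<inter> cball 0 M \<noteq> {}}" for M
  proof (rule finite_subset)
    show "{k. cball (q k) (R k) \<inter> cball 0 M \<noteq> {}} \<subseteq> {..nat \<lceil>M + 1\<rceil>}"
    proof
      fix k assume "k \<in> {k. cball (q k) (R k) \<inter> cball 0 M \<noteq> {}}"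
      then obtain z where "z \<in> cball (q k) (R k)" "norm z \<le> M" by auto
      then have "real k \<le> M + 1" using grow[of z k] by simp
      then show "k \<in> {..nat \<lceil>M + 1\<rceil>}" by (simp add: le_nat_iff) linarith
    qed
  qed simp
  moreover have "disjoint_family (\<lambda>k. cball (q k) (R k))"
    unfolding disjoint_family_on_def using disj by (metis Int_commute linorder_neqE_nat)
  ultimately show ?thesis using R by blast
qed

context compact_orbit
begin

text \<open>Stages alternate. Stage \<open>2 * n\<close> leaves \<open>X n\<close> for a
  neighbourhood of \<open>b 0\<close> and passes by n translations to the disc around
  \<open>b n\<close>; stage \<open>Suc (2 * n)\<close> goes from there to \<open>X (Suc n)\<close>
  in one step and also fixes the translation from \<open>b n\<close> to \<open>b (Suc n)\<close>,
  just before the first passage that uses it. That every passage begins near \<open>b 0\<close>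
  makes f(\<theta>(X)) bounded.\<close>

theorem oscillating_case:
  assumes full: "ent \<Longrightarrow> full (\<Union>n. X n)"
  shows "\<exists>f \<theta> k. f nicely_meromorphic_on UNIV \<and> essential_at_infinity f \<and> (ent \<longrightarrow> f holomorphic_on UNIV) \<and>
    oscillating_realization X C \<phi> \<epsilon> f \<theta> k"
proof -
  have Xfull: "full (X n)" if ent for n by (rule full_member[OF X full[OF that]])
  obtain q R' where qR: "\<And>k::nat. 0 < R' k" "\<And>k. R' k \<le> 1" "\<And>k n. X n \<inter> cball (q k) (R' k) = {}"
    "disjoint_family (\<lambda>k. cball (q k) (R' k))" "\<And>M. finite {k. cball (q k) (R' k) \<inter> cball 0 M \<noteq> {}}"
    using sparse_sequence_in_complement[OF X] by blast
  have qdisj: "cball (q i) (R' i) \<inter> cball (q j) (R' j) = {}" if "i \<noteq> j" for i j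
    using qR(4) that unfolding disjoint_family_on_def by blast
  \<comment> \<open>The disc around \<open>q 0\<close> is reserved for the trap.\<close>
  define b where "b = (\<lambda>n. q (Suc n))"
  define R where "R = (\<lambda>n. R' (Suc n))"
  define r where "r = entry_radius R"
  define c where "c = core_radius R"
  have R: "R n > 0" "R n \<le> 1" for n unfolding R_def using qR by auto
  note rc = entry_radius[of R, OF R(1), folded r_def c_def]
  define Z where "Z = (\<lambda>s. if even s then X (s div 2) else cball (b (s div 2)) (R (s div 2)))"
  have Zs: "Z (2 * n) = X n" "Z (Suc (2 * n)) = cball (b n) (R n)" for n unfolding Z_def by simp_all
  have parity: "\<exists>n. s = 2 * n \<or> s = Suc (2 * n)" for s :: nat by presburger
  have Z1: "compact (Z s)" for s unfolding Z_def using X(1) by simp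
  have XX: "X m \<inter> X n = {}" if "m \<noteq> n" for m n using X(2) that unfolding disjoint_family_on_def by blast
  have Z2: "disjoint_family Z"
    unfolding disjoint_family_on_def
  proof (intro ballI impI)
    fix i j :: nat assume "i \<noteq> j"
    moreover obtain m n where "i = 2 * m \<or> i = Suc (2 * m)" "j = 2 * n \<or> j = Suc (2 * n)" using parity by metis
    ultimately show "Z i \<inter> Z j = {}"
      using XX[of m n] qR(3)[of m "Suc n"] qR(3)[of n "Suc m"] qdisj[of "Suc m" "Suc n"] unfolding b_def R_def
      by (elim disjE) (simp_all add: Zs b_def R_def Int_commute)
  qed
  have Z3: "finite {s. Z s \<inter> cball 0 M \<noteq> {}}" for M
  proof (rule finite_subset)
    show "{s. Z s \<inter> cball 0 M \<noteq> {}} \<subseteq> (\<lambda>n. 2 * n) ` {n. X n \<inter> cball 0 M \<noteq> {}} \<union>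
        (\<lambda>k. Suc (2 * (k - 1))) ` {k. cball (q k) (R' k) \<inter> cball 0 M \<noteq> {}}"
    proof
      fix s assume s: "s \<in> {s. Z s \<inter> cball 0 M \<noteq> {}}"
      obtain n where "s = 2 * n \<or> s = Suc (2 * n)" using parity by blast
      then show "s \<in> (\<lambda>n. 2 * n) ` {n. X n \<inter> cball 0 M \<noteq> {}} \<union>
        (\<lambda>k. Suc (2 * (k - 1))) ` {k. cball (q k) (R' k) \<inter> cball 0 M \<noteq> {}}"
      proof
        assume "s = 2 * n" then show ?thesis using s by (auto simp: Zs)
      next
        assume "s = Suc (2 * n)"
        then show ?thesis using s by (intro UnI2 image_eqI[of _ _ "Suc n"]) (simp_all add: Zs b_def R_def)
      qed
    qed
  qed (use X(3) qR(5) in blast)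
  have Z4: "full (Z s)" if ent for s unfolding Z_def using Xfull[OF that] full_cball by simp
  have Z5: "Z s \<inter> cball (q 0) (R' 0) = {}" for s
    unfolding Z_def b_def R_def using qR(3) qdisj[of "Suc (s div 2)" 0] by simp
  have "\<exists>E W. (\<forall>s::nat. compact (E s) \<and> (ent \<longrightarrow> full (E s)) \<and> E s \<subseteq> E (Suc s)) \<and> (\<forall>R. \<exists>s. cball 0 R \<subseteq> E s) \<and>
    (\<forall>s::nat. open (W s) \<and> Z s \<subseteq> W s \<and> W s \<inter> E s = {} \<and> W s \<inter> cball (q 0) (R' 0) = {}) \<and> disjoint_family W \<and>
    (ent \<longrightarrow> (\<forall>s. (\<forall>r. W r \<subseteq> E s \<or> W r \<inter> E s = {}) \<and> (cball (q 0) (R' 0) \<subseteq> E s \<or> cball (q 0) (R' 0) \<inter> E s = {})))"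
    by (rule trapped_exhaustion[OF Z1 Z2 Z3 _ Z5]) (rule Z4)
  then obtain E W where EW: "(\<forall>s::nat. compact (E s) \<and> (ent \<longrightarrow> full (E s)) \<and> E s \<subseteq> E (Suc s)) \<and> (\<forall>R. \<exists>s. cball 0 R \<subseteq> E s) \<and>
    (\<forall>s::nat. open (W s) \<and> Z s \<subseteq> W s \<and> W s \<inter> E s = {} \<and> W s \<inter> cball (q 0) (R' 0) = {}) \<and> disjoint_family W \<and>
    (ent \<longrightarrow> (\<forall>s. (\<forall>r. W r \<subseteq> E s \<or> W r \<inter> E s = {}) \<and> (cball (q 0) (R' 0) \<subseteq> E s \<or> cball (q 0) (R' 0) \<inter> E s = {})))"
    by (elim exE) (rule that)
  have XW: "X n \<subseteq> W (2 * n)" "cball (b n) (R n) \<subseteq> W (Suc (2 * n))" for n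
    using EW Zs[of n] by metis+
  have "\<forall>n. \<exists>B>0. \<forall>z\<in>X (Suc n). norm z \<le> B"
    using X(1) compact_imp_bounded bounded_pos by metis
  from choice[OF this] obtain B where B: "\<And>n. B n > 0" "\<And>n z. z \<in> X (Suc n) \<Longrightarrow> norm z \<le> B n" by blast
  \<comment> \<open>\<open>X (Suc n)\<close> lies in the disc of radius \<open>B n\<close> around 0;
    its image lies within \<open>r n / 8\<close> of a point at distance \<open>r n / 2\<close> from
    \<open>b 0\<close>, well inside the annulus.\<close>
  define aff where "aff = (\<lambda>n w. b 0 + of_real (r n / 2) + of_real (r n / (8 * B n)) * w)"
  \<comment> \<open>An annulus rather than a disc: after the passage the image must avoid the core
    around \<open>b n\<close>, where the next translation is about to be prescribed.\<close>
  define annulus where "annulus = (\<lambda>n. {z. r n / 4 < dist (b 0) z} \<inter> ball (b 0) (r n))"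
  define \<Delta> where "\<Delta> = (\<lambda>s. if even s then {} else cball (b (s div 2)) (c (s div 2)))"
  define \<sigma> where "\<sigma> = (\<lambda>s. if even s then {} else {b (s div 2)})"
  define Vt where "Vt = (\<lambda>s. if even s then annulus (s div 2) else W (Suc s))"
  define \<tau> where "\<tau> = (\<lambda>s z. z - b (s div 2) + b (Suc (s div 2)))"
  define \<Psi> where "\<Psi> = (\<lambda>s. if even s then (\<lambda>z. aff (s div 2) ((\<phi> ^^ Suc (s div 2)) z)) else \<phi> ^^ Suc (s div 2))"
  define e where "e = (\<lambda>s. c (s div 2) / 32)"
  define pp where "pp = (\<lambda>s. if even s then s div 2 else (0::nat))"
  define t where "t = (\<lambda>s. \<Sum>i<s. 1 + pp i)"
  have annulus_unit: "annulus n \<subseteq> ball (b 0) 1" for n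
  proof -
    have "1 * r n \<le> 2 ^ n * r n" using rc(1)[of n] by (intro mult_right_mono) auto
    then have "r n \<le> 1" using rc(4)[of n] R(2)[of n] by linarith
    then show ?thesis unfolding annulus_def by auto
  qed
  have annulus_open: "open (annulus n)" for n
    unfolding annulus_def by (intro open_Int open_Collect_less continuous_intros open_ball)
  have aff_in: "aff n z \<in> annulus n" if "z \<in> X (Suc n)" for n z
  proof -
    have "norm (of_real (r n / (8 * B n)) * z) = r n / (8 * B n) * norm z"
      using rc(1)[of n] B(1)[of n] by (simp add: norm_mult norm_divide)
    also have "\<dots> \<le> r n / (8 * B n) * B n" using rc(1)[of n] B(1)[of n] B(2)[OF that] by (intro mult_left_mono) auto
    also have "\<dots> = r n / 8" using B(1)[of n] by simp
    finally have s: "norm (of_real (r n / (8 * B n)) * z) \<le> r n / 8" .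
    have m: "norm (of_real (r n / 2) :: complex) = r n / 2" using rc(1)[of n] by simp
    have "dist (b 0) (aff n z) = norm (of_real (r n / 2) + of_real (r n / (8 * B n)) * z)"
      by (subst dist_commute) (simp add: aff_def dist_norm)
    then show ?thesis unfolding annulus_def
      using norm_triangle_ineq[of "of_real (r n / 2)" "of_real (r n / (8 * B n)) * z"]
        norm_diff_ineq[of "of_real (r n / 2)" "of_real (r n / (8 * B n)) * z"] s m rc(1)[of n] by simp
  qed
  interpret om: orbit_mode X C \<phi> V \<epsilon> ent "q 0" "R' 0" E W \<Delta> \<sigma> Vt \<tau> \<Psi> e pp t "\<lambda>n. 2 * n"
  proof
    show "R' 0 > 0" by (rule qR(1))
    show "full (X 0)" if ent by (rule Xfull[OF that])
    show "compact (\<Delta> s)" for s unfolding \<Delta>_def by simp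
    show "\<Delta> s \<subseteq> W s" for s
    proof -
      obtain n where "s = 2 * n \<or> s = Suc (2 * n)" using parity by blast
      moreover have "cball (b n) (c n) \<subseteq> cball (b n) (R n)" using rc(3)[of n] by auto
      ultimately show ?thesis using XW(2)[of n] unfolding \<Delta>_def by auto
    qed
    show "full (\<Delta> s)" for s unfolding \<Delta>_def using full_cball by (simp add: connected_UNIV)
    show "\<tau> s analytic_on \<Delta> s" for s unfolding \<tau>_def by (intro analytic_intros)
    show "finite (\<sigma> s)" for s unfolding \<sigma>_def by simp
    show "\<sigma> s \<subseteq> \<Delta> s" for s unfolding \<sigma>_def \<Delta>_def using rc(2)[of "s div 2"] by (auto simp: less_imp_le)
    show "e s > 0" for s unfolding e_def using rc(2)[of "s div 2"] by simp
    show "t 0 = 0" "t (Suc s) = t s + 1 + pp s" for s unfolding t_def by simp_all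
    show "open (Vt s)" for s unfolding Vt_def using annulus_open EW by simp
    show "\<Psi> s ` X 0 \<subseteq> Vt s" for s
    proof -
      obtain n where n: "s = 2 * n \<or> s = Suc (2 * n)" using parity by blast
      have "(\<phi> ^^ Suc n) x \<in> X (Suc n)" if "x \<in> X 0" for x using X_image[of "Suc n"] that by blast
      then show ?thesis using n aff_in[of _ n] XW(1)[of "Suc n"] unfolding \<Psi>_def Vt_def by fastforce
    qed
    show "\<Psi> s holomorphic_on G (Suc s)" "inj_on (\<Psi> s) (G (Suc s))" for s
    proof -
      obtain n where n: "s = 2 * n \<or> s = Suc (2 * n)" using parity by blast
      then have sub: "G (Suc s) \<subseteq> G (Suc n)" by (intro G_antimono) auto
      have reg: "(\<phi> ^^ Suc n) holomorphic_on G (Suc s)" "inj_on (\<phi> ^^ Suc n) (G (Suc s))"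
        using G_regular[of "Suc n"] sub holomorphic_on_subset inj_on_subset by blast+
      have "(\<lambda>z. aff n ((\<phi> ^^ Suc n) z)) holomorphic_on G (Suc s)"
        unfolding aff_def by (intro holomorphic_intros reg(1))
      then show "\<Psi> s holomorphic_on G (Suc s)" using n reg(1) unfolding \<Psi>_def by auto
      have "inj (aff n)" unfolding aff_def by (rule injI) (use rc(1)[of n] B(1)[of n] in auto)
      then have "inj_on (\<lambda>z. aff n ((\<phi> ^^ Suc n) z)) (G (Suc s))" using reg(2) unfolding inj_on_def by blast
      then show "inj_on (\<Psi> s) (G (Suc s))" using n reg(2) unfolding \<Psi>_def by auto
    qed
    show "strict_mono (\<lambda>n::nat. 2 * n)" by (simp add: strict_mono_def)
    show "X n \<subseteq> W (2 * n)" for n by (rule XW)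
    show "\<Delta> (2 * n) = {}" for n unfolding \<Delta>_def by simp
    show "\<Psi> s = \<phi> ^^ Suc n \<and> pp s = 0" if "2 * Suc n = Suc s" for n s
    proof -
      have "s = Suc (2 * n)" using that by simp
      then show ?thesis unfolding \<Psi>_def pp_def by simp
    qed
    show "(\<forall>z\<in>Vt s. \<forall>j<pp s. (g ^^ j) z \<in> (\<Union>r\<le>s. \<Delta> r)) \<and> inj_on (g ^^ pp s) (Vt s) \<and> (g ^^ pp s) ` Vt s \<subseteq> W (Suc s) - \<Delta> (Suc s)"
      if g: "\<And>r. r \<le> s \<Longrightarrow> g analytic_on \<Delta> r \<and> (\<forall>z\<in>\<Delta> r. norm (g z - \<tau> r z) \<le> e r) \<and> (\<forall>z\<in>\<sigma> r. g z = \<tau> r z)" for s g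
    proof -
      obtain n where "s = 2 * n \<or> s = Suc (2 * n)" using parity by blast
      then show ?thesis
      proof
        assume "s = Suc (2 * n)"
        then show ?thesis unfolding pp_def Vt_def \<Delta>_def by simp
      next
        assume s: "s = 2 * n"
        \<comment> \<open>The translations on the cores with index \<open>j < n\<close> were fixed
          at the odd stages \<open>Suc (2 * j)\<close>, all of them before stage
          \<open>2 * n\<close>.\<close>
        have gj: "g analytic_on cball (b j) (c j)"
          "z \<in> cball (b j) (c j) \<Longrightarrow> norm (g z - (z - b j + b (Suc j))) \<le> c j / 32" "g (b j) = b (Suc j)" if "j < n" for j z
          using g[of "Suc (2 * j)"] that s unfolding \<Delta>_def \<tau>_def \<sigma>_def e_def by auto
        have ch: "(\<forall>z\<in>ball (b 0) (r n). dist (b 0) z / 2 ^ j \<le> dist (b j) ((g ^^ j) z) \<and> dist (b j) ((g ^^ j) z) \<le> 2 ^ j * dist (b 0) z) \<and>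
          inj_on (g ^^ j) (ball (b 0) (r n))" if "j \<le> n" for j
          by (rule chain_of_near_translations[where n = n and \<rho> = c]) (use gj rc(2,6) that in blast)+
        have ann: "annulus n \<subseteq> ball (b 0) (r n)" unfolding annulus_def by blast
        have "(g ^^ j) z \<in> \<Delta> (Suc (2 * j))" if z: "z \<in> annulus n" and j: "j < n" for z j
        proof -
          have "dist (b j) ((g ^^ j) z) \<le> 2 ^ j * dist (b 0) z" using ch[of j] j z ann by auto
          also have "\<dots> \<le> 2 ^ j * r n" using z unfolding annulus_def by simp
          also have "\<dots> \<le> c j" using rc(6)[OF j] rc(2)[of j] by linarith
          finally show ?thesis unfolding \<Delta>_def by simp
        qed
        then have 1: "\<forall>z\<in>annulus n. \<forall>j<n. (g ^^ j) z \<in> (\<Union>r\<le>s. \<Delta> r)" using s by fastforce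
        have 2: "inj_on (g ^^ n) (annulus n)" using ch[of n] ann inj_on_subset by blast
        have 3: "(g ^^ n) z \<in> W (Suc s) - \<Delta> (Suc s)" if z: "z \<in> annulus n" for z
        proof -
          have d: "r n / 4 < dist (b 0) z" "dist (b 0) z < r n" using z unfolding annulus_def by auto
          have h: "dist (b 0) z / 2 ^ n \<le> dist (b n) ((g ^^ n) z)" "dist (b n) ((g ^^ n) z) \<le> 2 ^ n * dist (b 0) z"
            using ch[of n] z ann by auto
          have "r n / 4 / 2 ^ n < dist (b 0) z / 2 ^ n" using d(1) by (intro divide_strict_right_mono) auto
          then have "c n < dist (b n) ((g ^^ n) z)" using h(1) rc(5)[of n] by linarith
          moreover have "2 ^ n * dist (b 0) z < 2 ^ n * r n" using d(2) by simp
          then have "dist (b n) ((g ^^ n) z) \<le> R n" using h(2) rc(4)[of n] by linarith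
          then have "(g ^^ n) z \<in> W (Suc s)" using XW(2)[of n] s by auto
          ultimately show ?thesis unfolding \<Delta>_def s by simp
        qed
        show ?thesis using 1 2 3 s unfolding pp_def Vt_def by auto
      qed
    qed
  qed (use EW in simp_all)
  define T where "T = (\<lambda>n. t (2 * n))"
  \<comment> \<open>Stage \<open>2 * n\<close> takes n + 1 steps and stage
    \<open>Suc (2 * n)\<close> takes one, whence the exponents \<open>n + 2\<close>.\<close>
  have T_Suc: "T (Suc n) = T n + (n + 2)" for n unfolding T_def t_def pp_def by simp
  from om.realization[folded T_def] obtain f \<theta> where f: "realized_orbit X C \<phi> V \<epsilon> f \<theta> T (\<lambda>n. W (2 * n)) \<and> admissible_conjugacy X C \<epsilon> f \<theta> \<and>
     essential_at_infinity f \<and> (ent \<longrightarrow> f holomorphic_on UNIV) \<and> (\<forall>s. \<forall>x\<in>X 0. (f ^^ Suc (t s)) x \<in> Vt s)"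
    by (elim exE) (rule that)
  then interpret ro: realized_orbit X C \<phi> V \<epsilon> f \<theta> T "\<lambda>n. W (2 * n)" by blast
  have near_b0: "(f ^^ Suc (T n)) x \<in> ball (b 0) 1" if "x \<in> X 0" for x n
  proof -
    have "(f ^^ Suc (T n)) x \<in> Vt (2 * n)" using f that unfolding T_def by blast
    then show ?thesis unfolding Vt_def using annulus_unit[of n] by auto
  qed
  have conj: "iterate f (n + 2) (\<theta> z) = Some (\<theta> (\<phi> z))" if "z \<in> X n" for z n
    using ro.conjugacy[OF that] by (simp add: T_Suc)
  have bdd: "to_sphere f (\<theta> z) \<in> Some ` ball (b 0) 1" if z: "z \<in> X n" for z n
  proof -
    obtain x where x: "x \<in> X 0" "\<theta> z = (f ^^ T n) x" using ro.Xn_preimage[OF z] by blast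
    have "\<not> is_pole f (\<theta> z)" using iterates_definedD(1)[OF ro.iterates_defined_X[OF z], of 0] by simp
    then show ?thesis unfolding to_sphere_def using near_b0[OF x(1), of n] x(2) by simp
  qed
  have bungee: "\<theta> z \<in> bungee_set f" if z: "z \<in> X n" for z n
  proof (rule bungee_setI)
    show "iterates_defined f (\<theta> z)" by (rule ro.iterates_defined_X[OF z])
    obtain x where x: "x \<in> X 0" "\<theta> z = (f ^^ T n) x" using ro.Xn_preimage[OF z] by blast
    have shift: "(f ^^ (k - T n)) (\<theta> z) = (f ^^ k) x" if "T n \<le> k" for k
      unfolding x(2) using funpow_add[of "k - T n" "T n" f] that by simp
    fix m :: nat
    show "\<exists>k\<ge>m. norm ((f ^^ k) (\<theta> z)) > M" for M
    proof -
      obtain n' where n': "n' \<ge> m + T n" "norm ((f ^^ T n') x) > M" using ro.orbit_unbounded[OF x(1)] by blast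
      then have "m + T n \<le> T n'" using ro.T[of n'] by simp
      then show ?thesis using n'(2) shift[of "T n'"] by (intro exI[of _ "T n' - T n"]) auto
    qed
    show "\<exists>k\<ge>m. norm ((f ^^ k) (\<theta> z)) \<le> norm (b 0) + 1"
    proof -
      define k where "k = Suc (T (m + T n))"
      have k: "m + T n \<le> k" unfolding k_def using ro.T[of "m + T n"] by simp
      have "dist (b 0) ((f ^^ k) x) < 1" using near_b0[OF x(1), of "m + T n"] unfolding k_def by simp
      then have "norm ((f ^^ k) x) \<le> norm (b 0) + 1"
        using norm_triangle_ineq2[of "(f ^^ k) x" "b 0"] by (simp add: dist_norm norm_minus_commute)
      then show ?thesis using k shift[of k] by (intro exI[of _ "k - T n"]) auto
    qed
  qed
  have "oscillating_realization X C \<phi> \<epsilon> f \<theta> (\<lambda>n. n + 2)"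
    unfolding oscillating_realization_def
  proof (intro conjI allI)
    show "\<exists>B. bounded B \<and> to_sphere f ` \<theta> ` (\<Union>n. X n) \<subseteq> Some ` B"
      using bdd by (intro exI[of _ "ball (b 0) 1"]) auto
  qed (use f conj bungee ro.wandering in auto)
  then show ?thesis using f ro.f by blast
qed

end

section \<open>The empty case and the conclusion\<close>

lemma exp_essential_at_infinity: "essential_at_infinity exp"
proof (rule essential_at_infinityI)
  have inf: "filterlim (\<lambda>k::nat. a * of_nat k) at_infinity sequentially" if "a \<noteq> 0" for a :: complex
  proof -
    have "filterlim (\<lambda>k. norm a * real k) at_top sequentially" 
      using that by (intro filterlim_tendsto_pos_mult_at_top[OF tendsto_const _ filterlim_real_sequentially]) simp
    then show ?thesis by (subst filterlim_at_infinity_conv_norm_at_top) (simp add: norm_mult)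
  qed
  show "filterlim (\<lambda>k::nat. 1 * of_nat k :: complex) at_infinity sequentially" by (rule inf) simp
  show "filterlim (\<lambda>k::nat. 2 * of_real pi * \<i> * of_nat k) at_infinity sequentially" by (rule inf) simp
  show "norm (exp (2 * of_real pi * \<i> * of_nat k)) \<le> 1" for k by (simp add: norm_exp_eq_Re)
  have "filterlim (\<lambda>k. exp (real k)) at_top sequentially" by (rule filterlim_compose[OF exp_at_top filterlim_real_sequentially])
  then show "filterlim (\<lambda>k::nat. exp (1 * of_nat k :: complex)) at_infinity sequentially"
    by (subst filterlim_at_infinity_conv_norm_at_top) (simp add: norm_exp_eq_Re)
qed

text \<open>Without points only the conditions on \<theta> alone remain, and the identity meets them
  for every \<open>f\<close>.\<close>

lemma empty_realizations:
  assumes "\<And>n. X n = {}" "\<And>n. C n \<subseteq> X n"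
  shows "escaping_realization X C \<phi> \<epsilon> f (\<lambda>z. z)" "oscillating_realization X C \<phi> \<epsilon> f (\<lambda>z. z) (\<lambda>_. 1)"
proof -
  have "smooth_diffeomorphism (\<lambda>z. z)"
    unfolding smooth_diffeomorphism_def C_infinity_def C_k_eq_C_k_on_UNIV
    using C_k_on_id[OF open_UNIV] inv_id by (auto simp: bij_id[unfolded id_def] id_def)
  then have "admissible_conjugacy X C \<epsilon> f (\<lambda>z. z)"
    unfolding admissible_conjugacy_def conformal_on_def using assms by simp
  then show "escaping_realization X C \<phi> \<epsilon> f (\<lambda>z. z)" "oscillating_realization X C \<phi> \<epsilon> f (\<lambda>z. z) (\<lambda>_. 1)"
    unfolding escaping_realization_def oscillating_realization_def wandering_compact_set_def
    using assms by auto
qed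

theorem theorem1p8:
  fixes X C :: "nat \<Rightarrow> complex set"
    and \<phi> :: "complex \<Rightarrow> complex"
    and U :: "complex set"
    and \<epsilon> :: "nat \<Rightarrow> real"
  assumes "\<And>n. compact (X n)"
    and "disjoint_family X"
    and "(\<lambda>n. INF z\<in>X n. ereal (norm z)) \<longlonglongrightarrow> \<infinity>"
    and "\<And>n. finite (C n)"
    and "\<And>n. C n \<subseteq> X n"
    and "open U" and "(\<Union>n. X n) \<subseteq> U" and "\<phi> holomorphic_on U"
    and "\<And>n. n \<ge> 1 \<Longrightarrow> \<phi> ` X (n - 1) \<subseteq> X n"
    and "\<And>n. n \<ge> 1 \<Longrightarrow> \<phi> ` frontier (X (n - 1)) \<subseteq> frontier (X n)"
    and "\<And>n. \<epsilon> n > 0"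
    and "\<exists>V. open V \<and> (\<Union>n. X n) \<subseteq> V \<and> V \<subseteq> U \<and> \<phi> holomorphic_on V \<and> inj_on \<phi> V"
    and "\<And>n. \<phi> ` X n = X (Suc n)"
  shows
    "(\<exists>f \<theta>. transcendental_meromorphic f \<and> escaping_realization X C \<phi> \<epsilon> f \<theta>) \<and>
     (\<exists>f \<theta> k. transcendental_meromorphic f \<and> oscillating_realization X C \<phi> \<epsilon> f \<theta> k) \<and>
     (connected (- (\<Union>n. X n)) \<longrightarrow>
        (\<exists>f \<theta>. transcendental_entire f \<and> escaping_realization X C \<phi> \<epsilon> f \<theta>) \<and>
        (\<exists>f \<theta> k. transcendental_entire f \<and> oscillating_realization X C \<phi> \<epsilon> f \<theta> k))"
proof -
  have lf: "finite {n. X n \<inter> cball 0 R \<noteq> {}}" for R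
  proof -
    have "\<forall>\<^sub>F n in sequentially. ereal R < (INF z\<in>X n. ereal (norm z))"
      using assms(3) unfolding tendsto_PInfty by blast
    then obtain m where m: "\<And>n. n \<ge> m \<Longrightarrow> ereal R < (INF z\<in>X n. ereal (norm z))"
      unfolding eventually_sequentially by blast
    have "n < m" if meets: "X n \<inter> cball 0 R \<noteq> {}" for n
    proof (rule ccontr)
      assume "\<not> n < m"
      obtain z where z: "z \<in> X n" "norm z \<le> R" using meets by auto
      have "ereal R < ereal (norm z)" 
        using \<open>\<not> n < m\<close> by (intro less_le_trans[OF m INF_lower[OF z(1)]]) simp
      then show False using z(2) by simp
    qed
    then have "{n. X n \<inter> cball 0 R \<noteq> {}} \<subseteq> {..<m}" by blast
    then show ?thesis using finite_subset by blast
  qed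
  obtain V where V: "open V" "(\<Union>n. X n) \<subseteq> V" "\<phi> holomorphic_on V" "inj_on \<phi> V" using assms(12) by blast
  show ?thesis
  proof (cases "X 0 = {}")
    \<comment> \<open>All sets are empty together, each being the image of the one before; any
      transcendental entire function will do.\<close>
    case True
    have "X n = {}" for n by (induction n) (use True assms(13) in \<open>simp, metis image_empty\<close>)
    note r = empty_realizations[OF this assms(5), where \<phi> = \<phi> and \<epsilon> = \<epsilon> and f = exp]
    have "exp holomorphic_on (UNIV :: complex set)" by (intro holomorphic_intros)
    moreover from this have "exp nicely_meromorphic_on (UNIV :: complex set)"
      by (simp add: analytic_on_open analytic_on_imp_nicely_meromorphic_on)
    ultimately have "transcendental_meromorphic exp" "transcendental_entire exp"
      unfolding transcendental_meromorphic_def transcendental_entire_def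
      using exp_essential_at_infinity by simp_all
    then show ?thesis using r by (intro conjI impI exI)
  next
    case False
    interpret compact_orbit X C \<phi> V \<epsilon>
      by unfold_locales (use assms(1,2,4,5,11,13) lf V False in auto)
    \<comment> \<open>With \<open>ent\<close> taken to be the connectedness of the complement, the
      premise of both cases becomes a tautology and the entire case is covered by the same
      theorems.\<close>
    show ?thesis
      using escaping_case[of False] oscillating_case[of False]
        escaping_case[of "connected (- (\<Union>n. X n))"] oscillating_case[of "connected (- (\<Union>n. X n))"]
      unfolding transcendental_meromorphic_def transcendental_entire_def by blast
  qed
qed

end
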